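(* Let $0<p<1$ and $q=1-p$. Let $\mathcal{M}=\{M_n\}_{n\ge 0}$ be a sequence of real numbers with $M_n\ge 1$ for all $n$, and suppose that $\mu_{\mathcal{M}}=\prod_{n=0}^{\infty}M_n^{q^n}=\infty$ and that $\mathcal{M}$ is $p$-regular. Then there exists an isomorphism of topological vector spaces $$W^p_{\mathcal{M}}\cong L^p\oplus W^p_{\mathcal{M}_1},$$ where $\mathcal{M}_1=\{M_{n+1}\}_{n\ge 0}$ is the shifted sequence.
   Context: $L^p=L^p(\mathbb{R})$ is the space of (classes of) Lebesgue measurable functions with $\|u\|_p=\left(\int_{\mathbb{R}}|u|^p\,dx\right)^{1/p}<\infty$, a complete quasi-normed space; direct sums carry the product topology. For a weight sequence $\mathcal{M}$ and $u\in C^\infty(\mathbb{R})$ put $\|u\|_{\mathcal{M}}=\sup_{n\ge 0}\frac{\|u^{(n)}\|_p}{M_n}$. The test class $\mathcal{S}_{\mathcal{M}}$ is the set of $u\in C^\infty(\mathbb{R})$ with $\|u\|_{\mathcal{M}}<\infty$ and $\limsup_{n\to\infty}\|u^{(n)}\|_\infty^{q^n}\le 1$. The Carleman-Sobolev class $W^p_{\mathcal{M}}$ is the abstract completion of $\mathcal{S}_{\mathcal{M}}$ with respect to the quasi-norm $\|\cdot\|_{\mathcal{M}}$; $W^p_{\mathcal{M}_1}$ is defined in the same way from the sequence $\mathcal{M}_1$. A sequence $\mathcal{M}$ is $p$-regular if either $\liminf_{n\to\infty}q^n\log M_n>0$, or all of the following hold: (i) $\mathcal{M}$ is logarithmically convex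 (i.e. $n\mapsto\log M_n$ is convex); (ii) the limit $\lim_{n\to\infty}q^n\log M_n$ exists; (iii) $\liminf_{n\to\infty}\frac{\log M_n}{n^2}=\infty$. *)

theory Defs
  imports "HOL-Analysis.Analysis"
begin

text \<open>
  The scalar field is an arbitrary type \<open>'a :: {real_normed_field, euclidean_space}\<close>; its two
  library instances are \<open>real\<close> and \<open>complex\<close>. The parameter \<open>q\<close> is always written
  \<open>1 - p\<close>. Quasi-norms take values in the extended nonnegative reals.
\<close>

section \<open>Quasi-normed spaces and topological vector spaces\<close>

record ('k, 'v) qn_space =
  qcarrier :: "'v set"
  qadd :: "'v \<Rightarrow> 'v \<Rightarrow> 'v"
  qscale :: "'k \<Rightarrow> 'v \<Rightarrow> 'v"
  qnorm :: "'v \<Rightarrow> ennreal"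

record ('k, 'v) tvs =
  vadd :: "'v \<Rightarrow> 'v \<Rightarrow> 'v"
  vscale :: "'k \<Rightarrow> 'v \<Rightarrow> 'v"
  vtop :: "'v topology"

definition qdist :: "('k::ring_1, 'v) qn_space \<Rightarrow> 'v \<Rightarrow> 'v \<Rightarrow> ennreal" where
  "qdist V x y = qnorm V (qadd V x (qscale V (-1) y))"

definition qtopology :: "('k::ring_1, 'v) qn_space \<Rightarrow> 'v topology" where
  "qtopology V = topology (\<lambda>U. U \<subseteq> qcarrier V \<and>
     (\<forall>x\<in>U. \<exists>\<epsilon>>0. \<forall>y\<in>qcarrier V. qdist V y x < \<epsilon> \<longrightarrow> y \<in> U))"

lemma openin_qtopology:
  "openin (qtopology V) U \<longleftrightarrow> U \<subseteq> qcarrier V \<and>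
     (\<forall>x\<in>U. \<exists>\<epsilon>>0. \<forall>y\<in>qcarrier V. qdist V y x < \<epsilon> \<longrightarrow> y \<in> U)"
proof -
  let ?P = "\<lambda>U. U \<subseteq> qcarrier V \<and> (\<forall>x\<in>U. \<exists>\<epsilon>>0. \<forall>y\<in>qcarrier V. qdist V y x < \<epsilon> \<longrightarrow> y \<in> U)"
  have "?P (S \<inter> T)" if S: "?P S" and T: "?P T" for S T
  proof (intro conjI ballI)
    show "S \<inter> T \<subseteq> qcarrier V" using S by blast
    fix x assume x: "x \<in> S \<inter> T"
    obtain a where a: "a > 0" "\<forall>y\<in>qcarrier V. qdist V y x < a \<longrightarrow> y \<in> S" using S x by blast
    obtain b where b: "b > 0" "\<forall>y\<in>qcarrier V. qdist V y x < b \<longrightarrow> y \<in> T" using T x by blast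
    show "\<exists>\<epsilon>>0. \<forall>y\<in>qcarrier V. qdist V y x < \<epsilon> \<longrightarrow> y \<in> S \<inter> T"
      by (rule exI[of _ "min a b"]) (use a b in auto)
  qed
  moreover have "?P (\<Union>K)" if K: "\<forall>S\<in>K. ?P S" for K
  proof (intro conjI ballI)
    show "\<Union>K \<subseteq> qcarrier V" using K by blast
    fix x assume "x \<in> \<Union>K"
    then obtain S where S: "S \<in> K" "x \<in> S" by blast
    with K obtain a where "a > 0" "\<forall>y\<in>qcarrier V. qdist V y x < a \<longrightarrow> y \<in> S" by blast
    with S show "\<exists>\<epsilon>>0. \<forall>y\<in>qcarrier V. qdist V y x < \<epsilon> \<longrightarrow> y \<in> \<Union>K" by blast
  qed
  ultimately have "istopology ?P" unfolding istopology_def by blast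
  then show ?thesis unfolding qtopology_def by (simp add: topology_inverse')
qed

definition tvs_of :: "('k::ring_1, 'v) qn_space \<Rightarrow> ('k, 'v) tvs" where
  "tvs_of V = \<lparr>vadd = qadd V, vscale = qscale V, vtop = qtopology V\<rparr>"

definition tvs_sum :: "('k, 'v) tvs \<Rightarrow> ('k, 'w) tvs \<Rightarrow> ('k, 'v \<times> 'w) tvs" where
  "tvs_sum V W =
     \<lparr>vadd = (\<lambda>x y. (vadd V (fst x) (fst y), vadd W (snd x) (snd y))),
      vscale = (\<lambda>c x. (vscale V c (fst x), vscale W c (snd x))),
      vtop = prod_topology (vtop V) (vtop W)\<rparr>"

definition tvs_isomorphic :: "('k, 'v) tvs \<Rightarrow> ('k, 'w) tvs \<Rightarrow> bool" where
  "tvs_isomorphic V W \<longleftrightarrow>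
     (\<exists>T. homeomorphic_map (vtop V) (vtop W) T \<and>
          (\<forall>x\<in>topspace (vtop V). \<forall>y\<in>topspace (vtop V). T (vadd V x y) = vadd W (T x) (T y)) \<and>
          (\<forall>c. \<forall>x\<in>topspace (vtop V). T (vscale V c x) = vscale W c (T x)))"

section \<open>Abstract completion\<close>

definition cauchy_seqs :: "('k::ring_1, 'v) qn_space \<Rightarrow> (nat \<Rightarrow> 'v) set" where
  "cauchy_seqs V = {u. (\<forall>n. u n \<in> qcarrier V) \<and>
     (\<forall>\<epsilon>>0. \<exists>N. \<forall>m\<ge>N. \<forall>n\<ge>N. qdist V (u m) (u n) < \<epsilon>)}"

definition cauchy_rel :: "('k::ring_1, 'v) qn_space \<Rightarrow> ((nat \<Rightarrow> 'v) \<times> (nat \<Rightarrow> 'v)) set" where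
  "cauchy_rel V = {(u, v). u \<in> cauchy_seqs V \<and> v \<in> cauchy_seqs V \<and>
     (\<lambda>n. qdist V (u n) (v n)) \<longlonglongrightarrow> 0}"

text \<open>
  The limit defining the quasi-norm of a class exists and does not depend on the representative
  whenever some power of the quasi-norm is subadditive, which is the case for the spaces below
  (with exponent \<open>p\<close>).
\<close>

definition completion :: "('k::ring_1, 'v) qn_space \<Rightarrow> ('k, (nat \<Rightarrow> 'v) set) qn_space" where
  "completion V =
     \<lparr>qcarrier = cauchy_seqs V // cauchy_rel V,
      qadd = (\<lambda>A B. \<Union>u\<in>A. \<Union>v\<in>B. cauchy_rel V `` {\<lambda>n. qadd V (u n) (v n)}),
      qscale = (\<lambda>c A. \<Union>u\<in>A. cauchy_rel V `` {\<lambda>n. qscale V c (u n)}),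
      qnorm = (\<lambda>A. THE l. \<forall>u\<in>A. (\<lambda>n. qnorm V (u n)) \<longlonglongrightarrow> l)\<rparr>"

section \<open>The space $L^p$\<close>

text \<open>Intended for exponents \<open>a > 0\<close>, with \<open>\<infinity>\<close> raised to \<open>a\<close> equal to \<open>\<infinity>\<close>.\<close>

definition ennpowr :: "ennreal \<Rightarrow> real \<Rightarrow> ennreal" where
  "ennpowr x a = (if x = \<infinity> then \<infinity> else ennreal (enn2real x powr a))"

definition lp_norm :: "real \<Rightarrow> (real \<Rightarrow> 'a::real_normed_vector) \<Rightarrow> ennreal" where
  "lp_norm p f = ennpowr (\<integral>\<^sup>+ x. ennreal (norm (f x) powr p) \<partial>lebesgue) (1 / p)"

definition lp_funs :: "real \<Rightarrow> (real \<Rightarrow> 'a::real_normed_vector) set" where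
  "lp_funs p = {f \<in> borel_measurable lebesgue. lp_norm p f < \<infinity>}"

definition ae_rel :: "real \<Rightarrow> ((real \<Rightarrow> 'a::real_normed_vector) \<times> (real \<Rightarrow> 'a)) set" where
  "ae_rel p = {(f, g). f \<in> lp_funs p \<and> g \<in> lp_funs p \<and> (AE x in lebesgue. f x = g x)}"

definition lp_space ::
  "real \<Rightarrow> ('a::{real_normed_field, euclidean_space}, (real \<Rightarrow> 'a) set) qn_space" where
  "lp_space p =
     \<lparr>qcarrier = lp_funs p // ae_rel p,
      qadd = (\<lambda>A B. \<Union>f\<in>A. \<Union>g\<in>B. ae_rel p `` {\<lambda>x. f x + g x}),
      qscale = (\<lambda>c A. \<Union>f\<in>A. ae_rel p `` {\<lambda>x. c * f x}),
      qnorm = (\<lambda>A. THE r. \<forall>f\<in>A. lp_norm p f = r)\<rparr>"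

section \<open>Carleman-Sobolev classes\<close>

definition nderiv :: "nat \<Rightarrow> (real \<Rightarrow> 'a::real_normed_vector) \<Rightarrow> real \<Rightarrow> 'a" where
  "nderiv n = (\<lambda>f x. vector_derivative f (at x)) ^^ n"

definition smooth :: "(real \<Rightarrow> 'a::real_normed_vector) \<Rightarrow> bool" where
  "smooth u \<longleftrightarrow> (\<forall>n x. nderiv n u differentiable (at x))"

definition sup_norm :: "(real \<Rightarrow> 'a::real_normed_vector) \<Rightarrow> ennreal" where
  "sup_norm f = (SUP x. ennreal (norm (f x)))"

definition carleman_norm ::
  "real \<Rightarrow> (nat \<Rightarrow> real) \<Rightarrow> (real \<Rightarrow> 'a::real_normed_vector) \<Rightarrow> ennreal" where
  "carleman_norm p M u = (SUP n. lp_norm p (nderiv n u) / ennreal (M n))"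

definition test_class :: "real \<Rightarrow> (nat \<Rightarrow> real) \<Rightarrow> (real \<Rightarrow> 'a::real_normed_vector) set" where
  "test_class p M = {u. smooth u \<and> carleman_norm p M u < \<infinity> \<and>
     limsup (\<lambda>n. ennpowr (sup_norm (nderiv n u)) ((1 - p) ^ n)) \<le> 1}"

definition test_space ::
  "real \<Rightarrow> (nat \<Rightarrow> real) \<Rightarrow> ('a::{real_normed_field, euclidean_space}, real \<Rightarrow> 'a) qn_space" where
  "test_space p M =
     \<lparr>qcarrier = test_class p M,
      qadd = (\<lambda>u v x. u x + v x),
      qscale = (\<lambda>c u x. c * u x),
      qnorm = carleman_norm p M\<rparr>"

definition carleman_sobolev ::
  "real \<Rightarrow> (nat \<Rightarrow> real) \<Rightarrow>
    ('a::{real_normed_field, euclidean_space}, (nat \<Rightarrow> real \<Rightarrow> 'a) set) qn_space" where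
  "carleman_sobolev p M = completion (test_space p M)"

section \<open>Weight sequences\<close>

definition carleman_mu :: "real \<Rightarrow> (nat \<Rightarrow> real) \<Rightarrow> ennreal" where
  "carleman_mu p M = lim (\<lambda>N. \<Prod>n<N. ennreal (M n powr ((1 - p) ^ n)))"

definition log_convex :: "(nat \<Rightarrow> real) \<Rightarrow> bool" where
  "log_convex M \<longleftrightarrow> (\<forall>n. 2 * ln (M (Suc n)) \<le> ln (M n) + ln (M (Suc (Suc n))))"

text \<open>
  An infinite limit of \<open>(1 - p) ^ n * ln (M n)\<close> falls under the first alternative, so the limit
  in the second one may be taken to be finite.
\<close>

definition p_regular :: "real \<Rightarrow> (nat \<Rightarrow> real) \<Rightarrow> bool" where
  "p_regular p M \<longleftrightarrow>
     liminf (\<lambda>n. ereal ((1 - p) ^ n * ln (M n))) > 0 \<or>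
     (log_convex M \<and>
      convergent (\<lambda>n. (1 - p) ^ n * ln (M n)) \<and>
      liminf (\<lambda>n. ereal (ln (M n) / (real n)\<^sup>2)) = \<infinity>)"

end

theory Submission
  imports Defs
begin

text \<open>
  Since \<open>\<parallel>u\<parallel>\<^sub>M\<close> is the maximum of \<open>\<parallel>u\<parallel>\<^sub>p / M\<^sub>0\<close> and the norm of \<open>u'\<close> for the shifted sequence, \<open>u \<mapsto> (u, u')\<close>
  extends to an embedding of the completion into \<open>L\<^sup>p \<oplus> W\<^sup>p\<close>, and everything reduces to the density of its image.
  Let \<open>g\<close> be a test function for the shifted sequence \<open>N\<close>. For \<open>p < 1\<close> a steep increment costs little: a bump whose
  derivative is an infinite convolution of uniform densities of shrinking widths \<open>r\<^sub>0, r\<^sub>1, \<dots>\<close> has derivatives with arbitrarily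
  small norms, and choosing each width greedily keeps the suprema \<open>exp (o((1-p)\<^sup>-\<^sup>n))\<close> as soon as
  \<open>\<Sum> (1-p)\<^sup>n ln N\<^sub>n\<close> diverges. So step functions are approximated in \<open>L\<^sup>p\<close> by smooth functions with small derivatives, and the first
  component is arbitrary.
  It remains to find one \<open>u\<close> with \<open>u'\<close> near \<open>g\<close> and \<open>u\<close> in \<open>L\<^sup>p\<close>. The line is cut into intervals on which the primitive of \<open>g\<close> is
  replaced by a bump with the same increment; \<open>u\<close> is the difference. The cuts come from a dyadic stopping rule balancing length and
  increment against a finite measure that controls all \<open>|g\<^sup>(\<^sup>n\<^sup>)|\<^sup>p / N\<^sub>n\<^sup>p\<close>. To bound the suprema uniformly over the
  intervals, the greedy exponents are compared with the logarithms of the maxima of the derivatives of \<open>g\<close> up to the first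
  derivative of small oscillation; from there on the interval itself is large enough for the measure to take over.
\<close>

section \<open>Spaces with a subadditive power of the norm\<close>

text \<open>The difficulty is uniformity. Infinitely many bumps are needed at a small total price,
  and yet the suprema of their derivatives of order n must be at most exp (e / (1-p)^n) from an
  order on that does not depend on the bump. For a single bump the divergence of the series gives
  this, at an uncontrolled rate. Uniformity is bought with a factor \<beta>: an interval of weight w
  may spend \<beta>^2 w, where \<beta> tends to infinity along the line so slowly that the total
  stays small. The surplus ln \<beta> enters every step of the recursion for the exponents and wipes
  out its starting value in a bounded number of steps. The starting values are bounded on a unit
  interval whose increment is small relative to \<beta> w. On a shorter interval the inverse width
  is large from the outset. There the derivatives of g on the interval one generation earlier serve
  as a yardstick: as long as they oscillate, their maxima have to grow at least as fast as the
  greedy exponents do. Cutting at the good halves of bad intervals meets both demands: goodness of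
  the half bounds the L^p error, badness of the parent makes the comparison with g possible.\<close>

lemma powr_less_powr_iff: "0 < a \<Longrightarrow> 0 \<le> x \<Longrightarrow> 0 \<le> y \<Longrightarrow> x powr a < y powr a \<longleftrightarrow> x < (y::real)"
  using powr_less_mono2[of a x y] powr_mono2[of a y x] by (auto simp: not_less[symmetric] less_imp_le)

lemma squeeze_0:
  fixes f h :: "nat \<Rightarrow> real"
  assumes "\<And>n. 0 \<le> f n" "\<And>n. f n \<le> h n" "h \<longlonglongrightarrow> 0" shows "f \<longlonglongrightarrow> 0"
  by (rule Lim_null_comparison[OF always_eventually assms(3)]) (use assms(1,2) in simp)

text \<open>\<open>D\<close> plays the role of the p-th power of the quasi-distance, the quantity
  that satisfies a triangle inequality for \<open>p < 1\<close>. All topological arguments are run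
  with it.\<close>

definition power_dist :: "real \<Rightarrow> ('k::ring_1, 'v) qn_space \<Rightarrow> ('v \<Rightarrow> 'v \<Rightarrow> real) \<Rightarrow> bool" where
  "power_dist p V D \<longleftrightarrow> 0 < p \<and>
     (\<forall>x\<in>qcarrier V. \<forall>y\<in>qcarrier V. 0 \<le> D x y \<and> qdist V x y = ennreal (D x y powr (1 / p)))"

lemma power_dist_less:
  assumes "power_dist p V D" "x \<in> qcarrier V" "y \<in> qcarrier V" "0 \<le> e"
  shows "qdist V x y < ennreal (e powr (1 / p)) \<longleftrightarrow> D x y < e"
  using assms by (auto simp: power_dist_def ennreal_less_iff powr_less_powr_iff)

lemma ennreal_pos_powr:
  assumes "0 < (\<epsilon>::ennreal)" "0 < p" obtains e where "0 < e" "ennreal (e powr (1 / p)) \<le> \<epsilon>"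
proof (cases \<epsilon>)
  case (real r)
  then have r: "0 < r" using assms by (auto simp: zero_less_iff_neq_zero)
  then have "(r powr p) powr (1 / p) = r" using assms by (simp add: powr_powr)
  then show thesis using real r by (intro that[of "r powr p"]) auto
next
  case top
  then show thesis by (intro that[of 1]) auto
qed

lemma openin_power_dist:
  assumes V: "power_dist p V D"
  shows "openin (qtopology V) U \<longleftrightarrow> U \<subseteq> qcarrier V \<and> (\<forall>x\<in>U. \<exists>e>0. \<forall>y\<in>qcarrier V. D y x < e \<longrightarrow> y \<in> U)"
proof -
  have p: "0 < p" using V by (simp add: power_dist_def)
  have "(\<exists>\<epsilon>>0. \<forall>y\<in>qcarrier V. qdist V y x < \<epsilon> \<longrightarrow> y \<in> U) \<longleftrightarrow> (\<exists>e>0. \<forall>y\<in>qcarrier V. D y x < e \<longrightarrow> y \<in> U)"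
    if x: "x \<in> qcarrier V" for x
  proof
    assume "\<exists>\<epsilon>>0. \<forall>y\<in>qcarrier V. qdist V y x < \<epsilon> \<longrightarrow> y \<in> U"
    then obtain \<epsilon> where \<epsilon>: "0 < \<epsilon>" "\<And>y. y \<in> qcarrier V \<Longrightarrow> qdist V y x < \<epsilon> \<Longrightarrow> y \<in> U" by blast
    obtain e where e: "0 < e" "ennreal (e powr (1 / p)) \<le> \<epsilon>" using ennreal_pos_powr[OF \<epsilon>(1) p] .
    have "y \<in> U" if "y \<in> qcarrier V" "D y x < e" for y
      using power_dist_less[OF V that(1) x, of e] that e \<epsilon>(2)[OF that(1)] by (auto intro: less_le_trans)
    then show "\<exists>e>0. \<forall>y\<in>qcarrier V. D y x < e \<longrightarrow> y \<in> U" using e(1) by blast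
  next
    assume "\<exists>e>0. \<forall>y\<in>qcarrier V. D y x < e \<longrightarrow> y \<in> U"
    then obtain e where e: "0 < e" "\<And>y. y \<in> qcarrier V \<Longrightarrow> D y x < e \<Longrightarrow> y \<in> U" by blast
    then show "\<exists>\<epsilon>>0. \<forall>y\<in>qcarrier V. qdist V y x < \<epsilon> \<longrightarrow> y \<in> U"
      using power_dist_less[OF V _ x, of _ e] by (intro exI[of _ "ennreal (e powr (1 / p))"]) auto
  qed
  then show ?thesis unfolding openin_qtopology by blast
qed

lemma topspace_qtopology: "power_dist p V D \<Longrightarrow> topspace (qtopology V) = qcarrier V"
  unfolding topspace_def using openin_power_dist[of p V D "qcarrier V"] openin_power_dist[of p V D]
  by (auto intro: exI[of _ "1::real"] zero_less_one)

lemma openin_power_ball: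
  assumes V: "power_dist p V D"
    and tri: "\<And>x y z. x \<in> qcarrier V \<Longrightarrow> y \<in> qcarrier V \<Longrightarrow> z \<in> qcarrier V \<Longrightarrow> D x z \<le> D x y + D y z"
    and x: "x \<in> qcarrier V"
  shows "openin (qtopology V) {y \<in> qcarrier V. D y x < e}"
  unfolding openin_power_dist[OF V]
proof (intro conjI ballI)
  fix y assume y: "y \<in> {y \<in> qcarrier V. D y x < e}"
  have "z \<in> {y \<in> qcarrier V. D y x < e}" if "z \<in> qcarrier V" "D z y < e - D y x" for z
    using tri[of z y x] that y x by auto
  then show "\<exists>d>0. \<forall>z\<in>qcarrier V. D z y < d \<longrightarrow> z \<in> {y \<in> qcarrier V. D y x < e}"
    using y by (intro exI[of _ "e - D y x"]) auto
qed auto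

text \<open>\<open>T\<close> is an isometry onto the product with the distance
  \<open>max (D1 / c) D2\<close>, which induces the product topology. In the application
  \<open>c\<close> is \<open>M 0 powr p\<close>, the weight of order 0.\<close>

lemma homeomorphic_map_max:
  assumes V: "power_dist p V D" and V1: "power_dist p V1 D1" and V2: "power_dist p V2 D2"
    and tri1: "\<And>x y z. x \<in> qcarrier V1 \<Longrightarrow> y \<in> qcarrier V1 \<Longrightarrow> z \<in> qcarrier V1 \<Longrightarrow> D1 x z \<le> D1 x y + D1 y z"
    and tri2: "\<And>x y z. x \<in> qcarrier V2 \<Longrightarrow> y \<in> qcarrier V2 \<Longrightarrow> z \<in> qcarrier V2 \<Longrightarrow> D2 x z \<le> D2 x y + D2 y z"
    and refl1: "\<And>x. x \<in> qcarrier V1 \<Longrightarrow> D1 x x = 0" and refl2: "\<And>x. x \<in> qcarrier V2 \<Longrightarrow> D2 x x = 0"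
    and T: "bij_betw T (qcarrier V) (qcarrier V1 \<times> qcarrier V2)" and c: "0 < c"
    and D: "\<And>x y. x \<in> qcarrier V \<Longrightarrow> y \<in> qcarrier V \<Longrightarrow>
      D x y = max (D1 (fst (T x)) (fst (T y)) / c) (D2 (snd (T x)) (snd (T y)))"
  shows "homeomorphic_map (qtopology V) (prod_topology (qtopology V1) (qtopology V2)) T"
proof (rule bijective_open_imp_homeomorphic_map)
  note top = topspace_qtopology[OF V] topspace_qtopology[OF V1] topspace_qtopology[OF V2]
  have TC: "fst (T x) \<in> qcarrier V1" "snd (T x) \<in> qcarrier V2" if "x \<in> qcarrier V" for x
    using bij_betwE[OF T] that by auto
  show "continuous_map (qtopology V) (prod_topology (qtopology V1) (qtopology V2)) T"
    unfolding continuous_map_pairwise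
  proof
    show "continuous_map (qtopology V) (qtopology V1) (fst \<circ> T)"
      unfolding continuous_map_def top
    proof (intro conjI allI impI)
      show "fst \<circ> T \<in> qcarrier V \<rightarrow> qcarrier V1" using TC by auto
      fix U assume U: "openin (qtopology V1) U"
      show "openin (qtopology V) {x \<in> qcarrier V. (fst \<circ> T) x \<in> U}"
        unfolding openin_power_dist[OF V]
      proof (intro conjI ballI)
        fix x assume x: "x \<in> {x \<in> qcarrier V. (fst \<circ> T) x \<in> U}"
        then obtain e where e: "0 < e" "\<And>y. y \<in> qcarrier V1 \<Longrightarrow> D1 y (fst (T x)) < e \<Longrightarrow> y \<in> U"
          using U unfolding openin_power_dist[OF V1] by auto
        have "y \<in> {x \<in> qcarrier V. (fst \<circ> T) x \<in> U}" if "y \<in> qcarrier V" "D y x < e / c" for y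
        proof -
          have xV: "x \<in> qcarrier V" using x by simp
          have "D1 (fst (T y)) (fst (T x)) / c \<le> D y x" unfolding D[OF that(1) xV] by (rule max.cobounded1)
          then have "D1 (fst (T y)) (fst (T x)) / c < e / c" using that(2) by linarith
          then have "D1 (fst (T y)) (fst (T x)) < e" using c by (simp add: divide_less_cancel)
          then show ?thesis using e(2)[OF TC(1)[OF that(1)]] that(1) by simp
        qed
        then show "\<exists>e>0. \<forall>y\<in>qcarrier V. D y x < e \<longrightarrow> y \<in> {x \<in> qcarrier V. (fst \<circ> T) x \<in> U}"
          using e(1) c by (intro exI[of _ "e / c"]) auto
      qed auto
    qed
    show "continuous_map (qtopology V) (qtopology V2) (snd \<circ> T)"
      unfolding continuous_map_def top
    proof (intro conjI allI impI)
      show "snd \<circ> T \<in> qcarrier V \<rightarrow> qcarrier V2" using TC by auto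
      fix U assume U: "openin (qtopology V2) U"
      show "openin (qtopology V) {x \<in> qcarrier V. (snd \<circ> T) x \<in> U}"
        unfolding openin_power_dist[OF V]
      proof (intro conjI ballI)
        fix x assume x: "x \<in> {x \<in> qcarrier V. (snd \<circ> T) x \<in> U}"
        then obtain e where e: "0 < e" "\<And>y. y \<in> qcarrier V2 \<Longrightarrow> D2 y (snd (T x)) < e \<Longrightarrow> y \<in> U"
          using U unfolding openin_power_dist[OF V2] by auto
        have "y \<in> {x \<in> qcarrier V. (snd \<circ> T) x \<in> U}" if "y \<in> qcarrier V" "D y x < e" for y
        proof -
          have xV: "x \<in> qcarrier V" using x by simp
          have "D2 (snd (T y)) (snd (T x)) \<le> D y x" unfolding D[OF that(1) xV] by (rule max.cobounded2)
          then have "D2 (snd (T y)) (snd (T x)) < e" using that(2) by linarith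
          then show ?thesis using e(2)[OF TC(2)[OF that(1)]] that(1) by simp
        qed
        then show "\<exists>e>0. \<forall>y\<in>qcarrier V. D y x < e \<longrightarrow> y \<in> {x \<in> qcarrier V. (snd \<circ> T) x \<in> U}"
          using e(1) by blast
      qed auto
    qed
  qed
  show "open_map (qtopology V) (prod_topology (qtopology V1) (qtopology V2)) T"
    unfolding open_map_def
  proof (intro allI impI)
    fix U assume U: "openin (qtopology V) U"
    have UV: "U \<subseteq> qcarrier V" using U unfolding openin_power_dist[OF V] by blast
    show "openin (prod_topology (qtopology V1) (qtopology V2)) (T ` U)"
      unfolding openin_prod_topology_alt
    proof (intro allI impI)
      fix a b assume "(a, b) \<in> T ` U"
      then obtain x where x: "x \<in> U" "T x = (a, b)" by auto
      have xV: "x \<in> qcarrier V" using x UV by auto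
      have ab: "a \<in> qcarrier V1" "b \<in> qcarrier V2" using TC[OF xV] x by auto
      obtain e where e: "0 < e" "\<And>y. y \<in> qcarrier V \<Longrightarrow> D y x < e \<Longrightarrow> y \<in> U"
        using U x unfolding openin_power_dist[OF V] by blast
      let ?A = "{y \<in> qcarrier V1. D1 y a < c * e}" and ?B = "{y \<in> qcarrier V2. D2 y b < e}"
      have "?A \<times> ?B \<subseteq> T ` U"
      proof
        fix z assume z: "z \<in> ?A \<times> ?B"
        then have "z \<in> T ` qcarrier V" using bij_betw_imp_surj_on[OF T] by auto
        then obtain y where y: "y \<in> qcarrier V" "z = T y" by auto
        have "D1 (fst (T y)) (fst (T x)) < c * e" "D2 (snd (T y)) (snd (T x)) < e" using z y(2) x(2) by auto
        then have "D y x < e" unfolding D[OF y(1) xV] using c by (simp add: pos_divide_less_eq mult.commute)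
        then show "z \<in> T ` U" using e(2) y by auto
      qed
      moreover have "openin (qtopology V1) ?A" "openin (qtopology V2) ?B"
        by (rule openin_power_ball[OF V1 tri1 ab(1)], assumption+, rule openin_power_ball[OF V2 tri2 ab(2)], assumption+)
      moreover have "a \<in> ?A" "b \<in> ?B" using ab refl1 refl2 e c by auto
      ultimately show "\<exists>U' V'. openin (qtopology V1) U' \<and> openin (qtopology V2) V' \<and> a \<in> U' \<and> b \<in> V' \<and> U' \<times> V' \<subseteq> T ` U"
        by blast
    qed
  qed
  show "T ` topspace (qtopology V) = topspace (prod_topology (qtopology V1) (qtopology V2))"
    using bij_betw_imp_surj_on[OF T] by (simp add: top)
  show "inj_on T (topspace (qtopology V))" using bij_betw_imp_inj_on[OF T] by (simp add: top)
qed

text \<open>Spaces whose norm has a subadditive \<open>p\<close>-th power \<open>mu\<close>.\<close>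

locale pnormed =
  fixes V :: "('k::ring_1, 'v) qn_space" and p :: real and mu :: "'v \<Rightarrow> real" and sc :: "'k \<Rightarrow> real"
  assumes p: "0 < p"
    and add: "\<And>x y. x \<in> qcarrier V \<Longrightarrow> y \<in> qcarrier V \<Longrightarrow> qadd V x y \<in> qcarrier V"
    and scale: "\<And>c x. x \<in> qcarrier V \<Longrightarrow> qscale V c x \<in> qcarrier V"
    and mu: "\<And>x. x \<in> qcarrier V \<Longrightarrow> 0 \<le> mu x"
    and norm: "\<And>x. x \<in> qcarrier V \<Longrightarrow> qnorm V x = ennreal (mu x powr (1 / p))"
    and D_refl: "\<And>x. x \<in> qcarrier V \<Longrightarrow> mu (qadd V x (qscale V (-1) x)) = 0"
    and D_sym: "\<And>x y. x \<in> qcarrier V \<Longrightarrow> y \<in> qcarrier V \<Longrightarrow>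
      mu (qadd V x (qscale V (-1) y)) = mu (qadd V y (qscale V (-1) x))"
    and D_tri: "\<And>x y z. x \<in> qcarrier V \<Longrightarrow> y \<in> qcarrier V \<Longrightarrow> z \<in> qcarrier V \<Longrightarrow>
      mu (qadd V x (qscale V (-1) z)) \<le> mu (qadd V x (qscale V (-1) y)) + mu (qadd V y (qscale V (-1) z))"
    and D_add: "\<And>x y x' y'. x \<in> qcarrier V \<Longrightarrow> y \<in> qcarrier V \<Longrightarrow> x' \<in> qcarrier V \<Longrightarrow> y' \<in> qcarrier V \<Longrightarrow>
      mu (qadd V (qadd V x y) (qscale V (-1) (qadd V x' y'))) \<le>
      mu (qadd V x (qscale V (-1) x')) + mu (qadd V y (qscale V (-1) y'))"
    and sc: "\<And>c. 0 \<le> sc c"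
    and D_scale: "\<And>c x y. x \<in> qcarrier V \<Longrightarrow> y \<in> qcarrier V \<Longrightarrow>
      mu (qadd V (qscale V c x) (qscale V (-1) (qscale V c y))) \<le> sc c * mu (qadd V x (qscale V (-1) y))"
    and mu_diff: "\<And>x y. x \<in> qcarrier V \<Longrightarrow> y \<in> qcarrier V \<Longrightarrow> mu x \<le> mu y + mu (qadd V x (qscale V (-1) y))"
begin

definition D :: "'v \<Rightarrow> 'v \<Rightarrow> real" where "D x y = mu (qadd V x (qscale V (-1) y))"

lemma D_nonneg: "x \<in> qcarrier V \<Longrightarrow> y \<in> qcarrier V \<Longrightarrow> 0 \<le> D x y"
  by (simp add: D_def mu add scale)

lemma D_power_dist: "power_dist p V D"
  unfolding power_dist_def using D_nonneg p by (auto simp: D_def qdist_def norm add scale)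

lemma D_triangle: "x \<in> qcarrier V \<Longrightarrow> y \<in> qcarrier V \<Longrightarrow> z \<in> qcarrier V \<Longrightarrow> D x z \<le> D x y + D y z"
  by (simp add: D_def D_tri)

lemma D_qadd: "x \<in> qcarrier V \<Longrightarrow> y \<in> qcarrier V \<Longrightarrow> x' \<in> qcarrier V \<Longrightarrow> y' \<in> qcarrier V \<Longrightarrow>
    D (qadd V x y) (qadd V x' y') \<le> D x x' + D y y'"
  unfolding D_def by (rule D_add)

lemma D_qscale: "x \<in> qcarrier V \<Longrightarrow> y \<in> qcarrier V \<Longrightarrow> D (qscale V c x) (qscale V c y) \<le> sc c * D x y"
  unfolding D_def by (rule D_scale)

lemma D_commute: "x \<in> qcarrier V \<Longrightarrow> y \<in> qcarrier V \<Longrightarrow> D x y = D y x"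
  unfolding D_def by (rule D_sym)

section \<open>Cauchy sequences and the completion of a space with a subadditive power of the
  norm\<close>

lemma cauchy_seqs_iff:
  "u \<in> cauchy_seqs V \<longleftrightarrow> (\<forall>n. u n \<in> qcarrier V) \<and> (\<forall>e>0. \<exists>N. \<forall>m\<ge>N. \<forall>n\<ge>N. D (u m) (u n) < e)"
proof -
  have "(\<forall>\<epsilon>>0. \<exists>N. \<forall>m\<ge>N. \<forall>n\<ge>N. qdist V (u m) (u n) < \<epsilon>) \<longleftrightarrow> (\<forall>e>0. \<exists>N. \<forall>m\<ge>N. \<forall>n\<ge>N. D (u m) (u n) < e)"
    if u: "\<forall>n. u n \<in> qcarrier V"
  proof (intro iffI allI impI)
    fix e :: real assume h: "\<forall>\<epsilon>>0. \<exists>N. \<forall>m\<ge>N. \<forall>n\<ge>N. qdist V (u m) (u n) < \<epsilon>" and e: "0 < e"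
    have "0 < ennreal (e powr (1 / p))" using e by simp
    then obtain N where "\<forall>m\<ge>N. \<forall>n\<ge>N. qdist V (u m) (u n) < ennreal (e powr (1 / p))" using h by blast
    then show "\<exists>N. \<forall>m\<ge>N. \<forall>n\<ge>N. D (u m) (u n) < e"
      using power_dist_less[OF D_power_dist, of "u _" "u _" e] u e by auto
  next
    fix \<epsilon> :: ennreal assume h: "\<forall>e>0. \<exists>N. \<forall>m\<ge>N. \<forall>n\<ge>N. D (u m) (u n) < e" and \<epsilon>: "0 < \<epsilon>"
    obtain e where e: "0 < e" "ennreal (e powr (1 / p)) \<le> \<epsilon>" using ennreal_pos_powr[OF \<epsilon> p] .
    obtain N where N: "\<And>m n. m \<ge> N \<Longrightarrow> n \<ge> N \<Longrightarrow> D (u m) (u n) < e" using h e(1) by blast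
    have "qdist V (u m) (u n) < \<epsilon>" if "m \<ge> N" "n \<ge> N" for m n
      using power_dist_less[OF D_power_dist, of "u m" "u n" e] u e N[OF that] by (auto intro: less_le_trans)
    then show "\<exists>N. \<forall>m\<ge>N. \<forall>n\<ge>N. qdist V (u m) (u n) < \<epsilon>" by blast
  qed
  then show ?thesis unfolding cauchy_seqs_def by blast
qed

lemma cauchy_carrier: "u \<in> cauchy_seqs V \<Longrightarrow> u n \<in> qcarrier V"
  by (simp add: cauchy_seqs_iff)

lemma tendsto_powr_ennreal_0_iff:
  assumes "\<And>n. 0 \<le> f n" shows "(\<lambda>n. ennreal (f n powr (1 / p))) \<longlonglongrightarrow> 0 \<longleftrightarrow> f \<longlonglongrightarrow> 0"
proof
  assume "(\<lambda>n. ennreal (f n powr (1 / p))) \<longlonglongrightarrow> 0"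
  then have "(\<lambda>n. f n powr (1 / p)) \<longlonglongrightarrow> 0"
    using tendsto_ennreal_iff[of "\<lambda>n. f n powr (1 / p)" sequentially 0] by simp
  then have "(\<lambda>n. (f n powr (1 / p)) powr p) \<longlonglongrightarrow> 0 powr p"
    using p by (intro tendsto_powr') (auto intro: always_eventually)
  then show "f \<longlonglongrightarrow> 0" using p assms by (simp add: powr_powr)
next
  assume "f \<longlonglongrightarrow> 0"
  then have "(\<lambda>n. f n powr (1 / p)) \<longlonglongrightarrow> 0 powr (1 / p)"
    using p assms by (intro tendsto_powr') (auto intro: always_eventually)
  then show "(\<lambda>n. ennreal (f n powr (1 / p))) \<longlonglongrightarrow> 0"
    using tendsto_ennreal_iff[of "\<lambda>n. f n powr (1 / p)" sequentially 0] p by simp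
qed

lemma cauchy_rel_iff:
  "(u, v) \<in> cauchy_rel V \<longleftrightarrow> u \<in> cauchy_seqs V \<and> v \<in> cauchy_seqs V \<and> (\<lambda>n. D (u n) (v n)) \<longlonglongrightarrow> 0"
proof -
  have "(\<lambda>n. qdist V (u n) (v n)) \<longlonglongrightarrow> 0 \<longleftrightarrow> (\<lambda>n. D (u n) (v n)) \<longlonglongrightarrow> 0"
    if "u \<in> cauchy_seqs V" "v \<in> cauchy_seqs V"
  proof -
    have "(\<lambda>n. qdist V (u n) (v n)) = (\<lambda>n. ennreal (D (u n) (v n) powr (1 / p)))"
      using D_power_dist cauchy_carrier that unfolding power_dist_def by auto
    then show ?thesis
      using tendsto_powr_ennreal_0_iff[of "\<lambda>n. D (u n) (v n)"] D_nonneg cauchy_carrier that by simp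
  qed
  then show ?thesis unfolding cauchy_rel_def by auto
qed

lemma D_seq_abs: 
  assumes "x \<in> qcarrier V" "y \<in> qcarrier V" "x' \<in> qcarrier V" "y' \<in> qcarrier V"
  shows "\<bar>D x y - D x' y'\<bar> \<le> D x x' + D y y'"
  using D_triangle[of x x' y] D_triangle[of x' y' y] D_triangle[of x' x y'] D_triangle[of x y y']
    D_commute[of x x'] D_commute[of y y'] assms by linarith

lemma convergent_D:
  assumes u: "u \<in> cauchy_seqs V" and v: "v \<in> cauchy_seqs V"
  shows "convergent (\<lambda>n. D (u n) (v n))"
proof (rule Cauchy_convergent, rule metric_CauchyI)
  fix e :: real assume e: "0 < e"
  obtain N1 where N1: "\<And>m n. m \<ge> N1 \<Longrightarrow> n \<ge> N1 \<Longrightarrow> D (u m) (u n) < e / 2"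
    using u e unfolding cauchy_seqs_iff by (meson half_gt_zero)
  obtain N2 where N2: "\<And>m n. m \<ge> N2 \<Longrightarrow> n \<ge> N2 \<Longrightarrow> D (v m) (v n) < e / 2"
    using v e unfolding cauchy_seqs_iff by (meson half_gt_zero)
  show "\<exists>M. \<forall>m\<ge>M. \<forall>n\<ge>M. dist (D (u m) (v m)) (D (u n) (v n)) < e"
  proof (intro exI allI impI)
    fix m n assume mn: "max N1 N2 \<le> m" "max N1 N2 \<le> n"
    have "\<bar>D (u m) (v m) - D (u n) (v n)\<bar> \<le> D (u m) (u n) + D (v m) (v n)"
      by (intro D_seq_abs cauchy_carrier u v)
    then show "dist (D (u m) (v m)) (D (u n) (v n)) < e" using N1[of m n] N2[of m n] mn by (simp add: dist_real_def)
  qed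
qed

lemma mu_abs: "x \<in> qcarrier V \<Longrightarrow> y \<in> qcarrier V \<Longrightarrow> \<bar>mu x - mu y\<bar> \<le> D x y"
  using mu_diff[of x y] mu_diff[of y x] D_commute[of x y] by (simp add: D_def)

lemma convergent_mu:
  assumes u: "u \<in> cauchy_seqs V" shows "convergent (\<lambda>n. mu (u n))"
proof (rule Cauchy_convergent, rule metric_CauchyI)
  fix e :: real assume e: "0 < e"
  obtain N1 where N1: "\<And>m n. m \<ge> N1 \<Longrightarrow> n \<ge> N1 \<Longrightarrow> D (u m) (u n) < e"
    using u e unfolding cauchy_seqs_iff by blast
  show "\<exists>M. \<forall>m\<ge>M. \<forall>n\<ge>M. dist (mu (u m)) (mu (u n)) < e"
  proof (intro exI allI impI)
    fix m n assume mn: "N1 \<le> m" "N1 \<le> n"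
    show "dist (mu (u m)) (mu (u n)) < e"
      using mu_abs[of "u m" "u n"] cauchy_carrier[OF u] N1[OF mn] by (force simp: dist_real_def)
  qed
qed

lemma equiv_cauchy_rel: "equiv (cauchy_seqs V) (cauchy_rel V)"
proof (rule equivI)
  show "cauchy_rel V \<subseteq> cauchy_seqs V \<times> cauchy_seqs V" unfolding cauchy_rel_def by auto
  show "refl_on (cauchy_seqs V) (cauchy_rel V)"
  proof (rule refl_onI)
    fix u assume u: "u \<in> cauchy_seqs V"
    have "(\<lambda>n. D (u n) (u n)) = (\<lambda>_. 0)" by (rule ext) (simp only: D_def D_refl[OF cauchy_carrier[OF u]])
    then show "(u, u) \<in> cauchy_rel V" using u by (simp add: cauchy_rel_iff)
  qed
  show "sym (cauchy_rel V)"
  proof (rule symI)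
    fix u v assume h: "(u, v) \<in> cauchy_rel V"
    then have c: "u \<in> cauchy_seqs V" "v \<in> cauchy_seqs V" by (auto simp: cauchy_rel_iff)
    have "(\<lambda>n. D (v n) (u n)) = (\<lambda>n. D (u n) (v n))"
      by (rule ext) (rule D_commute[OF cauchy_carrier[OF c(2)] cauchy_carrier[OF c(1)]])
    then show "(v, u) \<in> cauchy_rel V" using h by (simp add: cauchy_rel_iff)
  qed
  show "trans (cauchy_rel V)"
  proof (rule transI)
    fix u v w assume uv: "(u, v) \<in> cauchy_rel V" and vw: "(v, w) \<in> cauchy_rel V"
    have c: "u \<in> cauchy_seqs V" "v \<in> cauchy_seqs V" "w \<in> cauchy_seqs V" using uv vw by (auto simp: cauchy_rel_iff)
    have "(\<lambda>n. D (u n) (v n) + D (v n) (w n)) \<longlonglongrightarrow> 0 + 0"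
      using uv vw by (intro tendsto_add) (auto simp: cauchy_rel_iff)
    then have "(\<lambda>n. D (u n) (w n)) \<longlonglongrightarrow> 0"
      by (intro squeeze_0[of "\<lambda>n. D (u n) (w n)" "\<lambda>n. D (u n) (v n) + D (v n) (w n)"])
         (use c in \<open>auto intro!: D_nonneg D_triangle cauchy_carrier\<close>)
    then show "(u, w) \<in> cauchy_rel V" using c by (simp add: cauchy_rel_iff)
  qed
qed

definition cls :: "(nat \<Rightarrow> 'v) \<Rightarrow> (nat \<Rightarrow> 'v) set" where "cls u = cauchy_rel V `` {u}"

lemma cls_eq_iff:
  assumes "u \<in> cauchy_seqs V" "v \<in> cauchy_seqs V"
  shows "cls u = cls v \<longleftrightarrow> (\<lambda>n. D (u n) (v n)) \<longlonglongrightarrow> 0"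
  unfolding cls_def using eq_equiv_class_iff[OF equiv_cauchy_rel assms] assms by (simp add: cauchy_rel_iff)

lemma in_cls: "v \<in> cls u \<longleftrightarrow> (u, v) \<in> cauchy_rel V" by (simp add: cls_def)

lemma self_in_cls: "u \<in> cauchy_seqs V \<Longrightarrow> u \<in> cls u"
  unfolding cls_def by (rule equiv_class_self[OF equiv_cauchy_rel])

lemma completion_carrier: "qcarrier (completion V) = cls ` cauchy_seqs V"
  by (auto simp: completion_def cls_def quotient_def)

lemma cauchy_add:
  assumes u: "u \<in> cauchy_seqs V" and v: "v \<in> cauchy_seqs V"
  shows "(\<lambda>n. qadd V (u n) (v n)) \<in> cauchy_seqs V"
  unfolding cauchy_seqs_iff
proof (intro conjI allI impI)
  show "qadd V (u n) (v n) \<in> qcarrier V" for n by (intro add cauchy_carrier u v)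
  fix e :: real assume e: "0 < e"
  obtain N1 where N1: "\<And>m n. m \<ge> N1 \<Longrightarrow> n \<ge> N1 \<Longrightarrow> D (u m) (u n) < e / 2"
    using u e unfolding cauchy_seqs_iff by (meson half_gt_zero)
  obtain N2 where N2: "\<And>m n. m \<ge> N2 \<Longrightarrow> n \<ge> N2 \<Longrightarrow> D (v m) (v n) < e / 2"
    using v e unfolding cauchy_seqs_iff by (meson half_gt_zero)
  show "\<exists>N. \<forall>m\<ge>N. \<forall>n\<ge>N. D (qadd V (u m) (v m)) (qadd V (u n) (v n)) < e"
  proof (intro exI allI impI)
    fix m n assume mn: "max N1 N2 \<le> m" "max N1 N2 \<le> n"
    have "D (qadd V (u m) (v m)) (qadd V (u n) (v n)) \<le> D (u m) (u n) + D (v m) (v n)"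
      unfolding D_def by (intro D_add cauchy_carrier u v)
    then show "D (qadd V (u m) (v m)) (qadd V (u n) (v n)) < e" using N1[of m n] N2[of m n] mn by simp
  qed
qed

lemma cauchy_scale:
  assumes u: "u \<in> cauchy_seqs V" shows "(\<lambda>n. qscale V c (u n)) \<in> cauchy_seqs V"
  unfolding cauchy_seqs_iff
proof (intro conjI allI impI)
  show "qscale V c (u n) \<in> qcarrier V" for n by (intro scale cauchy_carrier u)
  fix e :: real assume e: "0 < e"
  have "0 < e / (sc c + 1)" using e sc[of c] by simp
  then obtain N1 where N1: "\<And>m n. m \<ge> N1 \<Longrightarrow> n \<ge> N1 \<Longrightarrow> D (u m) (u n) < e / (sc c + 1)"
    using u unfolding cauchy_seqs_iff by meson
  show "\<exists>N. \<forall>m\<ge>N. \<forall>n\<ge>N. D (qscale V c (u m)) (qscale V c (u n)) < e"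
  proof (intro exI allI impI)
    fix m n assume mn: "N1 \<le> m" "N1 \<le> n"
    have "D (qscale V c (u m)) (qscale V c (u n)) \<le> sc c * D (u m) (u n)"
      unfolding D_def by (intro D_scale cauchy_carrier u)
    also have "\<dots> \<le> sc c * (e / (sc c + 1))" using N1[OF mn] sc[of c] by (intro mult_left_mono) auto
    also have "\<dots> < e" using sc[of c] e by (simp add: field_simps)
    finally show "D (qscale V c (u m)) (qscale V c (u n)) < e" .
  qed
qed

lemma completion_add:
  assumes u: "u \<in> cauchy_seqs V" and v: "v \<in> cauchy_seqs V"
  shows "qadd (completion V) (cls u) (cls v) = cls (\<lambda>n. qadd V (u n) (v n))"
proof -
  have *: "cls (\<lambda>n. qadd V (u' n) (v' n)) = cls (\<lambda>n. qadd V (u n) (v n))" if "u' \<in> cls u" "v' \<in> cls v" for u' v'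
  proof -
    have c: "u' \<in> cauchy_seqs V" "v' \<in> cauchy_seqs V" and l: "(\<lambda>n. D (u n) (u' n)) \<longlonglongrightarrow> 0" "(\<lambda>n. D (v n) (v' n)) \<longlonglongrightarrow> 0"
      using that by (auto simp: in_cls cauchy_rel_iff)
    have "(\<lambda>n. D (u n) (u' n) + D (v n) (v' n)) \<longlonglongrightarrow> 0 + 0" by (intro tendsto_add l)
    then have "(\<lambda>n. D (qadd V (u n) (v n)) (qadd V (u' n) (v' n))) \<longlonglongrightarrow> 0"
    proof (intro squeeze_0[of "\<lambda>n. D (qadd V (u n) (v n)) (qadd V (u' n) (v' n))" "\<lambda>n. D (u n) (u' n) + D (v n) (v' n)"])
      note cc = cauchy_carrier[OF u] cauchy_carrier[OF v] cauchy_carrier[OF c(1)] cauchy_carrier[OF c(2)]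
      show "0 \<le> D (qadd V (u n) (v n)) (qadd V (u' n) (v' n))" for n by (intro D_nonneg add cc)
      show "D (qadd V (u n) (v n)) (qadd V (u' n) (v' n)) \<le> D (u n) (u' n) + D (v n) (v' n)" for n
        by (intro D_qadd cc)
    qed simp
    then show ?thesis by (rule iffD2[OF cls_eq_iff[OF cauchy_add[OF u v] cauchy_add[OF c]], THEN sym])
  qed
  have "qadd (completion V) (cls u) (cls v) = (\<Union>u'\<in>cls u. \<Union>v'\<in>cls v. cls (\<lambda>n. qadd V (u' n) (v' n)))"
    by (simp add: completion_def cls_def)
  also have "\<dots> = (\<Union>u'\<in>cls u. \<Union>v'\<in>cls v. cls (\<lambda>n. qadd V (u n) (v n)))" by (intro SUP_cong refl *)
  also have "\<dots> = cls (\<lambda>n. qadd V (u n) (v n))" using self_in_cls[OF u] self_in_cls[OF v] by auto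
  finally show ?thesis .
qed

lemma completion_scale:
  assumes u: "u \<in> cauchy_seqs V"
  shows "qscale (completion V) k (cls u) = cls (\<lambda>n. qscale V k (u n))"
proof -
  have *: "cls (\<lambda>n. qscale V k (u' n)) = cls (\<lambda>n. qscale V k (u n))" if "u' \<in> cls u" for u'
  proof -
    have c: "u' \<in> cauchy_seqs V" and l: "(\<lambda>n. D (u n) (u' n)) \<longlonglongrightarrow> 0"
      using that by (auto simp: in_cls cauchy_rel_iff)
    have "(\<lambda>n. sc k * D (u n) (u' n)) \<longlonglongrightarrow> sc k * 0" by (intro tendsto_mult tendsto_const l)
    then have "(\<lambda>n. D (qscale V k (u n)) (qscale V k (u' n))) \<longlonglongrightarrow> 0"
    proof (intro squeeze_0[of "\<lambda>n. D (qscale V k (u n)) (qscale V k (u' n))" "\<lambda>n. sc k * D (u n) (u' n)"])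
      note cc = cauchy_carrier[OF u] cauchy_carrier[OF c]
      show "0 \<le> D (qscale V k (u n)) (qscale V k (u' n))" for n by (intro D_nonneg scale cc)
      show "D (qscale V k (u n)) (qscale V k (u' n)) \<le> sc k * D (u n) (u' n)" for n
        by (intro D_qscale cc)
    qed simp
    then show ?thesis by (rule iffD2[OF cls_eq_iff[OF cauchy_scale[OF u, of k] cauchy_scale[OF c, of k]], THEN sym])
  qed
  have "qscale (completion V) k (cls u) = (\<Union>u'\<in>cls u. cls (\<lambda>n. qscale V k (u' n)))"
    by (simp add: completion_def cls_def)
  also have "\<dots> = (\<Union>u'\<in>cls u. cls (\<lambda>n. qscale V k (u n)))" by (intro SUP_cong refl *)
  also have "\<dots> = cls (\<lambda>n. qscale V k (u n))" using self_in_cls[OF u] by auto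
  finally show ?thesis .
qed

text \<open>\<open>mu\<close> is 1-Lipschitz for \<open>D\<close> by \<open>mu_abs\<close>, so the
  limit exists and agrees on equivalent sequences. This gives the \<open>THE\<close> in
  \<open>completion\<close> its unique witness.\<close>

lemma completion_norm:
  assumes u: "u \<in> cauchy_seqs V"
  shows "qnorm (completion V) (cls u) = ennreal (lim (\<lambda>n. mu (u n)) powr (1 / p))"
proof -
  let ?l = "lim (\<lambda>n. mu (u n))"
  have "(\<lambda>n. qnorm V (v n)) \<longlonglongrightarrow> ennreal (?l powr (1 / p))" if "v \<in> cls u" for v
  proof -
    have v: "v \<in> cauchy_seqs V" and l: "(\<lambda>n. D (u n) (v n)) \<longlonglongrightarrow> 0" using that by (auto simp: in_cls cauchy_rel_iff)
    have "(\<lambda>n. mu (u n) - mu (v n)) \<longlonglongrightarrow> 0"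
    proof (rule Lim_null_comparison[OF always_eventually l], intro allI)
      show "norm (mu (u n) - mu (v n)) \<le> D (u n) (v n)" for n
        unfolding real_norm_def by (rule mu_abs[OF cauchy_carrier[OF u] cauchy_carrier[OF v]])
    qed
    moreover have ul: "(\<lambda>n. mu (u n)) \<longlonglongrightarrow> ?l" using convergent_mu[OF u] by (simp add: convergent_LIMSEQ_iff)
    ultimately have "(\<lambda>n. mu (u n) - (mu (u n) - mu (v n))) \<longlonglongrightarrow> ?l - 0" by (intro tendsto_diff)
    then have "(\<lambda>n. mu (v n)) \<longlonglongrightarrow> ?l" by simp
    then have "(\<lambda>n. mu (v n) powr (1 / p)) \<longlonglongrightarrow> ?l powr (1 / p)"
      using p v by (intro tendsto_powr') (auto intro!: always_eventually mu cauchy_carrier)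
    then have "(\<lambda>n. ennreal (mu (v n) powr (1 / p))) \<longlonglongrightarrow> ennreal (?l powr (1 / p))" by (rule tendsto_ennrealI)
    moreover have "(\<lambda>n. qnorm V (v n)) = (\<lambda>n. ennreal (mu (v n) powr (1 / p)))" using norm cauchy_carrier[OF v] by auto
    ultimately show ?thesis by simp
  qed
  moreover have "l = ennreal (?l powr (1 / p))" if "\<forall>v\<in>cls u. (\<lambda>n. qnorm V (v n)) \<longlonglongrightarrow> l" for l
    using that calculation self_in_cls[OF u] LIMSEQ_unique by blast
  ultimately show ?thesis unfolding completion_def by (auto intro!: the_equality)
qed

definition Dl :: "(nat \<Rightarrow> 'v) \<Rightarrow> (nat \<Rightarrow> 'v) \<Rightarrow> real" where "Dl u v = lim (\<lambda>n. D (u n) (v n))"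

lemma Dl_tendsto: "u \<in> cauchy_seqs V \<Longrightarrow> v \<in> cauchy_seqs V \<Longrightarrow> (\<lambda>n. D (u n) (v n)) \<longlonglongrightarrow> Dl u v"
  unfolding Dl_def using convergent_D by (simp add: convergent_LIMSEQ_iff)

lemma completion_qdist:
  assumes u: "u \<in> cauchy_seqs V" and v: "v \<in> cauchy_seqs V"
  shows "qdist (completion V) (cls u) (cls v) = ennreal (Dl u v powr (1 / p))"
  unfolding qdist_def completion_scale[OF v] completion_add[OF u cauchy_scale[OF v]]
    completion_norm[OF cauchy_add[OF u cauchy_scale[OF v]]] Dl_def D_def ..

definition rep :: "(nat \<Rightarrow> 'v) set \<Rightarrow> nat \<Rightarrow> 'v" where "rep A = (SOME u. u \<in> cauchy_seqs V \<and> A = cls u)"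

lemma rep: "A \<in> qcarrier (completion V) \<Longrightarrow> rep A \<in> cauchy_seqs V \<and> cls (rep A) = A"
proof -
  assume "A \<in> qcarrier (completion V)"
  then have "\<exists>u. u \<in> cauchy_seqs V \<and> A = cls u" unfolding completion_carrier by blast
  then have "rep A \<in> cauchy_seqs V \<and> A = cls (rep A)" unfolding rep_def by (rule someI_ex)
  then show ?thesis by simp
qed

text \<open>The distance of classes through chosen representatives; \<open>DC_cls\<close> frees it
  from the choice.\<close>

definition DC :: "(nat \<Rightarrow> 'v) set \<Rightarrow> (nat \<Rightarrow> 'v) set \<Rightarrow> real" where "DC A B = Dl (rep A) (rep B)"

lemma DC_tendsto:
  "A \<in> qcarrier (completion V) \<Longrightarrow> B \<in> qcarrier (completion V) \<Longrightarrow> (\<lambda>n. D (rep A n) (rep B n)) \<longlonglongrightarrow> DC A B"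
  unfolding DC_def by (intro Dl_tendsto) (auto simp: rep)

lemma DC_power_dist: "power_dist p (completion V) DC"
  unfolding power_dist_def
proof (intro conjI ballI p)
  fix A B assume AB: "A \<in> qcarrier (completion V)" "B \<in> qcarrier (completion V)"
  show "0 \<le> DC A B"
  proof (rule LIMSEQ_le_const[OF DC_tendsto[OF AB]], intro exI allI impI)
    show "0 \<le> D (rep A n) (rep B n)" for n
      using rep[OF AB(1)] rep[OF AB(2)] by (intro D_nonneg cauchy_carrier) simp_all
  qed
  show "qdist (completion V) A B = ennreal (DC A B powr (1 / p))"
    using completion_qdist[of "rep A" "rep B"] rep[OF AB(1)] rep[OF AB(2)] by (simp add: DC_def)
qed

lemma DC_triangle:
  assumes "A \<in> qcarrier (completion V)" "B \<in> qcarrier (completion V)" "C \<in> qcarrier (completion V)"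
  shows "DC A C \<le> DC A B + DC B C"
proof (rule LIMSEQ_le[OF DC_tendsto[OF assms(1,3)] tendsto_add[OF DC_tendsto[OF assms(1,2)] DC_tendsto[OF assms(2,3)]]],
    intro exI allI impI)
  show "D (rep A n) (rep C n) \<le> D (rep A n) (rep B n) + D (rep B n) (rep C n)" for n
    using rep[OF assms(1)] rep[OF assms(2)] rep[OF assms(3)] by (intro D_triangle cauchy_carrier) simp_all
qed

lemma DC_refl: "A \<in> qcarrier (completion V) \<Longrightarrow> DC A A = 0"
proof -
  assume A: "A \<in> qcarrier (completion V)"
  have "(\<lambda>n. D (rep A n) (rep A n)) = (\<lambda>_. 0)"
    using rep[OF A] by (intro ext) (simp add: D_def D_refl cauchy_carrier)
  then show ?thesis using DC_tendsto[OF A A] by (simp add: LIMSEQ_const_iff)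
qed

lemma DC_cls:
  assumes u: "u \<in> cauchy_seqs V" and v: "v \<in> cauchy_seqs V" shows "DC (cls u) (cls v) = Dl u v"
proof -
  have c: "cls u \<in> qcarrier (completion V)" "cls v \<in> qcarrier (completion V)" using u v by (auto simp: completion_carrier)
  note ru = rep[OF c(1)] and rv = rep[OF c(2)]
  have z: "(\<lambda>n. D (rep (cls u) n) (u n) + D (rep (cls v) n) (v n)) \<longlonglongrightarrow> 0 + 0"
    using cls_eq_iff[of "rep (cls u)" u] cls_eq_iff[of "rep (cls v)" v] ru rv u v by (intro tendsto_add) auto
  have "(\<lambda>n. D (rep (cls u) n) (rep (cls v) n) - D (u n) (v n)) \<longlonglongrightarrow> 0"
  proof (rule Lim_null_comparison[OF always_eventually], intro allI)
    show "norm (D (rep (cls u) n) (rep (cls v) n) - D (u n) (v n)) \<le> D (rep (cls u) n) (u n) + D (rep (cls v) n) (v n)" for n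
      unfolding real_norm_def using ru rv u v by (intro D_seq_abs cauchy_carrier) simp_all
    show "(\<lambda>n. D (rep (cls u) n) (u n) + D (rep (cls v) n) (v n)) \<longlonglongrightarrow> 0" using z by simp
  qed
  moreover have "(\<lambda>n. D (rep (cls u) n) (rep (cls v) n) - D (u n) (v n)) \<longlonglongrightarrow> DC (cls u) (cls v) - Dl u v"
    by (intro tendsto_diff DC_tendsto c Dl_tendsto u v)
  ultimately show ?thesis using LIMSEQ_unique by fastforce
qed

end

section \<open>A recursion for exponents\<close>

lemma minus_p_min_mono:
  fixes p P m :: real
  assumes "0 < p" "p < 1" "0 \<le> P" "m \<le> p * P" "0 \<le> m"
  shows "p * m \<le> m" "0 \<le> P - p * m" "(1 - p) * P \<le> P - p * m"
proof -
  show 1: "p * m \<le> m" using assms by (simp add: mult_left_le_one_le)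
  have "p * P \<le> P" using assms by (simp add: mult_left_le_one_le)
  then show "0 \<le> P - p * m" using 1 assms by linarith
  have "P - p * P \<le> P - p * m" using 1 assms by linarith
  then show "(1 - p) * P \<le> P - p * m" by (simp only: left_diff_distrib mult_1)
qed

text \<open>Model of the greedy choice of widths. Up to normalisation, \<open>al\<close> is the
  logarithm of a bound for the k-th derivative, \<open>ga\<close> the logarithm of an inverse width,
  and \<open>de\<close> the surplus in the budget for the L^p norm. The first alternative for
  \<open>ga\<close> comes from the halving of the widths, the second from the budget. The recursion
  is required between \<open>J\<close> and \<open>K\<close> only, because a comparison with a
  function g ends at its first flat derivative.\<close>

locale greedy_rec =
  fixes p q c :: real and al ga de :: "nat \<Rightarrow> real" and J K :: nat
  assumes p: "0 < p" "p < 1" and q: "q = 1 - p" and c: "0 \<le> c"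
    and al: "\<And>k. J \<le> k \<Longrightarrow> k < K \<Longrightarrow> al (Suc k) \<le> al k + ga (Suc k)"
    and ga: "\<And>k. J \<le> k \<Longrightarrow> k < K \<Longrightarrow>
      ga (Suc k) \<le> max (ga k + c) ((p * al k + c * (real k + 1) - de k) / q)"
    and de: "\<And>k. 0 \<le> de k"
begin

text \<open>Without noise and surplus, \<open>al = A / q ^ k\<close> and
  \<open>ga = p * A / q ^ k\<close> reproduce themselves under the recursion, since
  \<open>q + p = 1\<close>. The potential is the least nonnegative \<open>A\<close> for which this
  pair dominates the two sequences at \<open>k\<close>.\<close>

definition pot :: "nat \<Rightarrow> real" where
  "pot k = max 0 (max (q ^ k * al k) (q ^ k * ga k / p))"

definition noise :: "nat \<Rightarrow> real" where
  "noise k = c * (real k + 1) * q ^ k / p"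

lemma q01: "0 < q" "q < 1" using p q by auto

lemma pot_nonneg: "0 \<le> pot k" by (simp add: pot_def)

lemma noise_nonneg: "0 \<le> noise k" using p q01 c by (simp add: noise_def)

lemma al_le_pot: "al k \<le> pot k / q ^ k" and ga_le_pot: "ga k \<le> p * pot k / q ^ k"
proof -
  have "q ^ k * al k \<le> pot k" "q ^ k * ga k / p \<le> pot k" by (auto simp: pot_def)
  then show "al k \<le> pot k / q ^ k" "ga k \<le> p * pot k / q ^ k"
    using p q01 by (auto simp: field_simps)
qed

lemma summable_noise: "summable noise"
proof -
  have "summable (\<lambda>k. diffs (\<lambda>n. 1) k * q ^ k)"
    by (rule termdiff_converges[where K = 1])
       (use q01 in \<open>auto intro!: summable_geometric\<close>)
  then have "summable (\<lambda>k. (c / p) * (diffs (\<lambda>n. 1) k * q ^ k))" by (rule summable_mult)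
  also have "(\<lambda>k. (c / p) * (diffs (\<lambda>n. 1) k * q ^ k)) = noise"
    by (auto simp: noise_def diffs_def fun_eq_iff field_simps)
  finally show ?thesis .
qed

lemma step_ga:
  assumes "J \<le> k" "k < K"
  shows "q ^ Suc k * ga (Suc k) / p \<le>
    max (q * pot k) (q ^ k * al k - q ^ k * de k / p) + noise k"
proof -
  have "ga (Suc k) \<le> max (ga k + c) ((p * al k + c * (real k + 1) - de k) / q)"
    using ga assms by blast
  then consider "ga (Suc k) \<le> ga k + c" | "ga (Suc k) \<le> (p * al k + c * (real k + 1) - de k) / q"
    by linarith
  then show ?thesis
  proof cases
    case 1
    have "q ^ Suc k * ga (Suc k) / p \<le> q ^ Suc k * (ga k + c) / p"
      using 1 q01 p by (intro divide_right_mono mult_left_mono) auto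
    also have "\<dots> = q * (q ^ k * ga k / p) + c * q ^ Suc k / p" by (simp add: algebra_simps add_divide_distrib)
    also have "\<dots> \<le> q * pot k + noise k"
    proof (rule add_mono)
      show "q * (q ^ k * ga k / p) \<le> q * pot k"
        using q01 by (intro mult_left_mono) (auto simp: pot_def)
      have "c * q ^ Suc k \<le> c * (real k + 1) * q ^ k"
      proof -
        have "c * q ^ Suc k = c * q * q ^ k" by simp
        also have "\<dots> \<le> c * (real k + 1) * q ^ k"
          using q01 c by (intro mult_right_mono mult_left_mono) auto
        finally show ?thesis .
      qed
      then show "c * q ^ Suc k / p \<le> noise k"
        unfolding noise_def using p by (intro divide_right_mono) auto
    qed
    finally show ?thesis by linarith
  next
    case 2
    have "q ^ Suc k * ga (Suc k) / p \<le> q ^ Suc k * ((p * al k + c * (real k + 1) - de k) / q) / p"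
      using 2 q01 p by (intro divide_right_mono mult_left_mono) auto
    also have "\<dots> = q ^ k * al k - q ^ k * de k / p + noise k"
      using q01 p by (simp add: noise_def field_simps)
    finally show ?thesis by linarith
  qed
qed

lemma step_al:
  assumes "J \<le> k" "k < K"
  shows "q ^ Suc k * al (Suc k) \<le> q * (q ^ k * al k) + p * (q ^ Suc k * ga (Suc k) / p)"
proof -
  have "q ^ Suc k * al (Suc k) \<le> q ^ Suc k * (al k + ga (Suc k))"
    using al assms q01 by (intro mult_left_mono) auto
  then show ?thesis using p by (simp add: algebra_simps)
qed

text \<open>\<open>q * pot k\<close> is \<open>pot k - p * pot k\<close>, and the surplus lowers the
  other alternative by \<open>q ^ k * de k / p\<close>. In either case at least the minimum is
  gained in \<open>ga\<close>, and a share \<open>p\<close> of it reaches \<open>al\<close>.\<close>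

lemma step_al_strict:
  assumes "J \<le> k" "k < K"
  shows "q ^ Suc k * al (Suc k) \<le> pot k - p * min (p * pot k) (q ^ k * de k / p) + noise k"
proof -
  let ?m = "min (p * pot k) (q ^ k * de k / p)"
  have ale: "q ^ k * al k \<le> pot k" by (simp add: pot_def)
  have m: "0 \<le> ?m" using p q01 de pot_nonneg by simp
  have "q * pot k = pot k - p * pot k" unfolding q by algebra
  then have "q * pot k \<le> pot k - ?m" by linarith
  moreover have "q ^ k * al k - q ^ k * de k / p \<le> pot k - ?m" using ale by linarith
  ultimately have "q ^ Suc k * ga (Suc k) / p \<le> pot k - ?m + noise k"
    using step_ga[OF assms] by linarith
  then have "q ^ Suc k * al (Suc k) \<le> q * pot k + p * (pot k - ?m + noise k)"
    using step_al[OF assms] ale q01 p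
      mult_left_mono[of "q ^ k * al k" "pot k" q] mult_left_mono[of "q ^ Suc k * ga (Suc k) / p" "pot k - ?m + noise k" p]
    by linarith
  also have "\<dots> = pot k - p * ?m + p * noise k" unfolding q by algebra
  also have "\<dots> \<le> pot k - p * ?m + noise k"
    using p noise_nonneg[of k] by (simp add: mult_left_le_one_le)
  finally show ?thesis .
qed

lemma pot_Suc: "J \<le> k \<Longrightarrow> k < K \<Longrightarrow> pot (Suc k) \<le> pot k + noise k"
proof -
  assume k: "J \<le> k" "k < K"
  have m: "0 \<le> p * min (p * pot k) (q ^ k * de k / p)" using p q01 de pot_nonneg by simp
  have 1: "q ^ Suc k * al (Suc k) \<le> pot k + noise k" using step_al_strict[OF k] m by linarith
  have "q * pot k \<le> pot k" using q01 pot_nonneg[of k] by (simp add: mult_left_le_one_le)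
  moreover have "q ^ k * al k \<le> pot k" by (simp add: pot_def)
  moreover have "0 \<le> q ^ k * de k / p" using p q01 de by simp
  ultimately have "q ^ Suc k * ga (Suc k) / p \<le> pot k + noise k"
    using step_ga[OF k] by linarith
  with 1 show ?thesis using pot_nonneg[of k] noise_nonneg[of k] by (simp add: pot_def[of "Suc k"])
qed

text \<open>The gain in \<open>al (Suc k)\<close> is handed on to \<open>ga\<close> and
  \<open>al\<close> at the next index, so that both parts of the potential have dropped.\<close>

lemma pot_Suc_Suc:
  assumes "J \<le> k" "Suc k < K"
  shows "pot (Suc (Suc k)) \<le> pot k - p * min (p * pot k) (q ^ k * de k / p) + noise k + noise (Suc k)"
proof -
  let ?m = "min (p * pot k) (q ^ k * de k / p)"
  let ?Z = "pot k - p * ?m + noise k"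
  have k: "J \<le> k" "k < K" and k': "J \<le> Suc k" "Suc k < K" using assms by simp_all
  have m: "0 \<le> ?m" using p q01 de pot_nonneg by simp
  note mm = minus_p_min_mono[OF p pot_nonneg, of ?m k]
  have v1: "q ^ Suc k * al (Suc k) \<le> ?Z" using step_al_strict[OF k] .
  have "q * pot (Suc k) \<le> q * (pot k + noise k)" using pot_Suc[OF k] q01 by (intro mult_left_mono) auto
  also have "\<dots> \<le> q * pot k + noise k"
    using q01 noise_nonneg[of k] by (simp add: algebra_simps mult_left_le_one_le)
  also have "\<dots> \<le> ?Z" using mm(3) m q by simp
  finally have g0: "q * pot (Suc k) \<le> ?Z" .
  have "0 \<le> q ^ Suc k * de (Suc k) / p" using p q01 de by simp
  with step_ga[OF k'] v1 g0 have g2: "q ^ Suc (Suc k) * ga (Suc (Suc k)) / p \<le> ?Z + noise (Suc k)"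
    by linarith
  have "q ^ Suc (Suc k) * al (Suc (Suc k)) \<le> q * ?Z + p * (?Z + noise (Suc k))"
    using step_al[OF k'] mult_left_mono[OF v1, of q] mult_left_mono[OF g2, of p] q01 p by linarith
  also have "\<dots> = ?Z + p * noise (Suc k)" unfolding q by algebra
  also have "\<dots> \<le> ?Z + noise (Suc k)"
    using p noise_nonneg[of "Suc k"] by (simp add: mult_left_le_one_le)
  finally have v2: "q ^ Suc (Suc k) * al (Suc (Suc k)) \<le> ?Z + noise (Suc k)" .
  have "0 \<le> ?Z + noise (Suc k)" using mm(2) m noise_nonneg[of k] noise_nonneg[of "Suc k"] by simp
  with v2 g2 show ?thesis by (simp add: pot_def[of "Suc (Suc k)"])
qed

lemma pot_le_noise_sum: "J \<le> m \<Longrightarrow> m \<le> k \<Longrightarrow> k \<le> K \<Longrightarrow> pot k \<le> pot m + (\<Sum>i=m..<k. noise i)"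
proof (induction k)
  case 0 then show ?case by simp
next
  case (Suc k)
  show ?case
  proof (cases "m = Suc k")
    case False
    then have "pot k \<le> pot m + (\<Sum>i=m..<k. noise i)" using Suc by simp
    moreover have "(\<Sum>i=m..<Suc k. noise i) = (\<Sum>i=m..<k. noise i) + noise k"
      using Suc.prems False by (simp add: sum.atLeastLessThan_Suc)
    ultimately show ?thesis using pot_Suc[of k] Suc.prems False by linarith
  qed simp
qed

end

text \<open>The noise as a function of \<open>p\<close> and \<open>c\<close> alone. Its tails can be
  bounded before \<open>al\<close>, \<open>ga\<close> and \<open>de\<close> are fixed, which the
  uniform statements below rely on.\<close>

definition gnoise :: "real \<Rightarrow> real \<Rightarrow> nat \<Rightarrow> real" where
  "gnoise p c k = c * (real k + 1) * (1 - p) ^ k / p"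

lemma (in greedy_rec) noise_eq: "noise = gnoise p c"
  unfolding gnoise_def q[symmetric] by (simp add: noise_def fun_eq_iff)

lemma gnoise_nonneg: "0 < p \<Longrightarrow> p < 1 \<Longrightarrow> 0 \<le> c \<Longrightarrow> 0 \<le> gnoise p c k"
  by (simp add: gnoise_def)

lemma summable_gnoise:
  assumes "0 < p" "p < 1" "0 \<le> c"
  shows "summable (gnoise p c)"
proof -
  interpret greedy_rec p "1 - p" c "\<lambda>_. 0" "\<lambda>_. 0" "\<lambda>_. 0" 0 0
    by standard (use assms in auto)
  show ?thesis using summable_noise by (simp add: noise_eq)
qed

lemma gnoise_tail:
  assumes "0 < p" "p < 1" "0 \<le> c" "0 < e"
  obtains m where "\<And>a b. m \<le> a \<Longrightarrow> (\<Sum>i=a..<b. gnoise p c i) \<le> e"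
proof -
  obtain N where N: "\<forall>m\<ge>N. \<forall>n. norm (sum (gnoise p c) {m..<n}) < e"
    using summable_gnoise[OF assms(1-3)] assms(4) unfolding summable_Cauchy by blast
  have "(\<Sum>i=a..<b. gnoise p c i) \<le> e" if "N \<le> a" for a b
    using N[rule_format, OF that, of b] by simp
  then show thesis by (rule that[of N])
qed

lemma linear_rec_tendsto_0:
  fixes z b :: "nat \<Rightarrow> real"
  assumes th: "0 \<le> th" "th < 1" and z: "\<And>n. z (Suc n) = th * z n + b n"
    and b: "b \<longlonglongrightarrow> 0" "\<And>n. 0 \<le> b n" and z0: "0 \<le> z 0"
  shows "z \<longlonglongrightarrow> 0"
proof (rule LIMSEQ_I)
  fix e :: real assume e: "0 < e"
  have nn: "0 \<le> z n" for n by (induction n) (use z0 z b th in auto)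
  have "eventually (\<lambda>n. b n < (1 - th) * (e / 2)) sequentially"
    using b(1) th e by (intro order_tendstoD(2)[where a = "(1 - th) * (e / 2)"]) auto
  then obtain m where m: "\<And>n. n \<ge> m \<Longrightarrow> b n < (1 - th) * (e / 2)"
    by (auto simp: eventually_sequentially)
  have bd: "z (m + n) \<le> e / 2 + th ^ n * z m" for n
  proof (induction n)
    case 0 then show ?case using e by simp
  next
    case (Suc n)
    have "z (m + Suc n) = th * z (m + n) + b (m + n)" using z by simp
    also have "\<dots> \<le> th * (e / 2 + th ^ n * z m) + (1 - th) * (e / 2)"
      using Suc th m[of "m + n"] by (intro add_mono mult_left_mono) auto
    also have "\<dots> = e / 2 + th ^ Suc n * z m" by (simp add: field_simps)
    finally show ?case .
  qed
  have "(\<lambda>n. th ^ n * z m) \<longlonglongrightarrow> 0"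
    using th by (intro tendsto_mult_left_zero LIMSEQ_realpow_zero) auto
  then have "eventually (\<lambda>n. th ^ n * z m < e / 2) sequentially"
    using e by (intro order_tendstoD(2)[where a = "e / 2"]) auto
  then obtain k where k: "\<And>n. n \<ge> k \<Longrightarrow> th ^ n * z m < e / 2"
    by (auto simp: eventually_sequentially)
  show "\<exists>no. \<forall>n\<ge>no. norm (z n - 0) < e"
  proof (intro exI allI impI)
    fix n assume "m + k \<le> n"
    then have "z n < e" using bd[of "n - m"] k[of "n - m"] by (simp add: le_diff_conv2)
    then show "norm (z n - 0) < e" using nn[of n] by simp
  qed
qed

text \<open>As long as the surplus is at least \<open>La\<close>, two steps contract the potential
  by the factor \<open>1 - p * p\<close> up to noise, whatever the sequences are. After
  \<open>2 * i0\<close> steps it is at most \<open>e / 2\<close>, and from then on only the tail of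
  the noise can be added.\<close>

lemma greedy_rec_uniform:
  fixes p c C e :: real
  assumes p: "0 < p" "p < 1" and c: "0 \<le> c" and C: "0 \<le> C" and e: "0 < e"
  obtains La :: real and k0 :: nat where "0 \<le> La"
    "\<And>al ga de K k. greedy_rec p (1 - p) c al ga de 0 K \<Longrightarrow> (\<And>k. La \<le> de k) \<Longrightarrow>
      al 0 \<le> C \<Longrightarrow> ga 0 \<le> p * C \<Longrightarrow> k0 \<le> k \<Longrightarrow> k \<le> K \<Longrightarrow>
      al k \<le> e / (1 - p) ^ k \<and> ga k \<le> p * e / (1 - p) ^ k"
proof -
  define q where "q = 1 - p"
  have qq: "0 < q" "q < 1" using p by (auto simp: q_def)
  let ?n = "gnoise p c"
  note sn = summable_gnoise[OF p c] and nn = gnoise_nonneg[OF p c]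
  define H where "H = suminf ?n"
  have H: "(\<Sum>i=a..<b. ?n i) \<le> H" for a b
    unfolding H_def by (rule sum_le_suminf[OF sn]) (use nn in auto)
  \<comment> \<open>Majorant of the potential along even indices; the inhomogeneity is the noise of
    two consecutive steps.\<close>
  define z where "z = rec_nat C (\<lambda>n z. (1 - p * p) * z + (?n (2 * n) + ?n (Suc (2 * n))))"
  have z: "z 0 = C" "z (Suc n) = (1 - p * p) * z n + (?n (2 * n) + ?n (Suc (2 * n)))" for n
    by (auto simp: z_def)
  have pp: "p * p < 1" "0 < p * p" using p mult_strict_mono[of p 1 p 1] by auto
  have "(\<lambda>n. ?n (2 * n) + ?n (Suc (2 * n))) \<longlonglongrightarrow> 0 + 0"
  proof (intro tendsto_add)
    have t: "?n \<longlonglongrightarrow> 0" using sn by (rule summable_LIMSEQ_zero)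
    show "(\<lambda>n. ?n (2 * n)) \<longlonglongrightarrow> 0" "(\<lambda>n. ?n (Suc (2 * n))) \<longlonglongrightarrow> 0"
      using LIMSEQ_subseq_LIMSEQ[OF t, of "\<lambda>n. 2 * n"] LIMSEQ_subseq_LIMSEQ[OF t, of "\<lambda>n. Suc (2 * n)"]
      by (auto simp: o_def strict_mono_def)
  qed
  then have zlim: "z \<longlonglongrightarrow> 0"
    using linear_rec_tendsto_0[of "1 - p * p" z "\<lambda>n. ?n (2 * n) + ?n (Suc (2 * n))"] z pp C nn by auto
  obtain m where m: "\<And>a b. m \<le> a \<Longrightarrow> (\<Sum>i=a..<b. ?n i) \<le> e / 2"
    using gnoise_tail[OF p c, of "e / 2"] e by auto
  have "eventually (\<lambda>n. z n < e / 2) sequentially"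
    using zlim e by (intro order_tendstoD(2)[where a = "e / 2"]) auto
  then obtain i0 where i0: "i0 \<ge> m" "z i0 < e / 2"
    by (metis eventually_sequentially max.cobounded1 max.cobounded2)
  \<comment> \<open>\<open>C + H\<close> bounds the potential at all times. With this surplus the
    minimum in \<open>pot_Suc_Suc\<close> is the term \<open>p * pot\<close> at all even indices up
    to \<open>2 * i0\<close>.\<close>
  define La where "La = p * p * (C + H) / q ^ (2 * i0)"
  have H0: "0 \<le> H" using H[of 0 0] by simp
  have La0: "0 \<le> La" using p qq C H0 by (simp add: La_def)
  show thesis
  proof (rule that[OF La0, of "2 * i0"], goal_cases)
    case (1 al ga de K k)
    interpret greedy_rec p "1 - p" c al ga de 0 K by fact
    have p0: "pot 0 \<le> C" using 1 p C by (auto simp: pot_def field_simps)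
    have all: "pot k \<le> C + H" if "k \<le> K" for k
      using pot_le_noise_sum[of 0 k] that p0 H[of 0 k] by (simp add: noise_eq)
    have *: "pot (2 * i) \<le> z i" if "i \<le> i0" "2 * i \<le> K" for i
      using that
    proof (induction i)
      case 0 then show ?case using p0 z by simp
    next
      case (Suc i)
      have IH: "pot (2 * i) \<le> z i" using Suc by simp
      have "p * p * (C + H) = q ^ (2 * i0) * La" using qq by (simp add: La_def)
      also have "\<dots> \<le> q ^ (2 * i0) * de (2 * i)" using 1(2)[of "2 * i"] qq by (intro mult_left_mono) auto
      finally have "p * p * (C + H) \<le> q ^ (2 * i0) * de (2 * i)" .
      also have "\<dots> \<le> q ^ (2 * i) * de (2 * i)"
        using qq Suc.prems 1(2)[of "2 * i"] La0 by (intro mult_right_mono power_decreasing) auto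
      finally have "p * (C + H) \<le> q ^ (2 * i) * de (2 * i) / p" using p by (simp add: field_simps)
      moreover have "p * pot (2 * i) \<le> p * (C + H)"
        using all[of "2 * i"] Suc.prems p by (intro mult_left_mono) auto
      ultimately have "min (p * pot (2 * i)) (q ^ (2 * i) * de (2 * i) / p) = p * pot (2 * i)" by linarith
      then have "pot (Suc (Suc (2 * i))) \<le> pot (2 * i) - p * (p * pot (2 * i)) + ?n (2 * i) + ?n (Suc (2 * i))"
        using pot_Suc_Suc[of "2 * i"] Suc.prems by (simp add: q_def noise_eq)
      also have "\<dots> \<le> z (Suc i)"
        using z(2)[of i] mult_left_mono[OF IH, of "1 - p * p"] pp by (simp add: algebra_simps)
      finally show ?case by simp
    qed
    have "pot k \<le> pot (2 * i0) + (\<Sum>i=2 * i0..<k. noise i)"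
      by (rule pot_le_noise_sum) (use 1 in auto)
    also have "\<dots> \<le> e / 2 + e / 2"
      using *[of i0] i0 m[of "2 * i0" k] 1 by (intro add_mono) (auto simp: noise_eq)
    finally have "pot k \<le> e" by simp
    then have "pot k / q ^ k \<le> e / q ^ k" "p * pot k / q ^ k \<le> p * e / q ^ k"
      using qq p by (auto intro!: divide_right_mono mult_left_mono)
    then show ?case using al_le_pot[of k] ga_le_pot[of k] by (auto simp: q_def)
  qed
qed

lemma not_summable_min:
  fixes f :: "nat \<Rightarrow> real"
  assumes "\<And>n. 0 \<le> f n" "\<not> summable f" "0 < c"
  shows "\<not> summable (\<lambda>n. min c (f n))"
proof
  assume s: "summable (\<lambda>n. min c (f n))"
  then have "eventually (\<lambda>n. min c (f n) < c) sequentially"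
    using assms(3) by (intro order_tendstoD(2)[where a = c and y = 0] summable_LIMSEQ_zero) auto
  then have "eventually (\<lambda>n. min c (f n) = f n) sequentially" by eventually_elim auto
  then show False using s assms(2) summable_cong[of "\<lambda>n. min c (f n)" f] by simp
qed

text \<open>If the potential stayed above \<open>e / 2\<close>, every pair of steps would lose a
  multiple of a truncation of \<open>(1 - p) ^ k * de k\<close>, and telescoping would bound a
  divergent series. Hence it becomes small at some late index and remains small because the noise
  has small tails.\<close>

lemma greedy_rec_limit:
  fixes p c e :: real
  assumes g: "\<And>K. greedy_rec p (1 - p) c al ga de 0 K" and de: "\<not> summable (\<lambda>k. (1 - p) ^ k * de k)"
    and e: "0 < e"
  shows "eventually (\<lambda>k. al k \<le> e / (1 - p) ^ k) sequentially"
proof -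
  have g': "greedy_rec p (1 - p) c al ga de 0 K" for K by (rule g)
  interpret greedy_rec p "1 - p" c al ga de 0 0 by (rule g)
  have pS: "pot (Suc (Suc k)) \<le> pot k - p * min (p * pot k) ((1 - p) ^ k * de k / p) + noise k + noise (Suc k)" for k
    using greedy_rec.pot_Suc_Suc[OF g', of k "k + 2"]
    unfolding greedy_rec.pot_def[OF g'] greedy_rec.noise_def[OF g'] by simp
  have pn: "pot k \<le> pot m + (\<Sum>i=m..<k. noise i)" if "m \<le> k" for m k
    using greedy_rec.pot_le_noise_sum[OF g', of m k k] that
    unfolding greedy_rec.pot_def[OF g'] greedy_rec.noise_def[OF g'] by simp
  define H where "H = suminf noise"
  have H: "(\<Sum>i=a..<b. noise i) \<le> H" "(\<Sum>i=a..<b. noise (Suc i)) \<le> H" for a b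
  proof -
    show "(\<Sum>i=a..<b. noise i) \<le> H"
      unfolding H_def by (rule sum_le_suminf[OF summable_noise]) (use noise_nonneg in auto)
    have "(\<Sum>i=a..<b. noise (Suc i)) = (\<Sum>i=Suc a..<Suc b. noise i)"
      by (rule sum.shift_bounds_Suc_ivl[symmetric])
    also have "\<dots> \<le> H"
      unfolding H_def by (rule sum_le_suminf[OF summable_noise]) (use noise_nonneg in auto)
    finally show "(\<Sum>i=a..<b. noise (Suc i)) \<le> H" .
  qed
  obtain m where m: "\<And>a b. m \<le> a \<Longrightarrow> (\<Sum>i=a..<b. noise i) \<le> e / 2"
    using gnoise_tail[OF p c, of "e / 2"] e by (auto simp: noise_eq)
  have "\<exists>k\<ge>m. pot k \<le> e / 2"
  proof (rule ccontr)
    assume "\<not> ?thesis"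
    then have big: "pot k > e / 2" if "m \<le> k" for k using that by (meson not_le)
    define f where "f k = min (p * (e / 2)) ((1 - p) ^ k * de k / p)" for k
    have ns: "\<not> summable (\<lambda>k. (1 - p) ^ k * de k / p)"
    proof
      assume "summable (\<lambda>k. (1 - p) ^ k * de k / p)"
      then have "summable (\<lambda>k. p * ((1 - p) ^ k * de k / p))" by (rule summable_mult)
      then show False using assms(2) p by simp
    qed
    have nf: "\<not> summable f" unfolding f_def
      by (rule not_summable_min) (use ns p e greedy_rec.de[OF g'] in auto)
    have f0: "0 \<le> f k" for k using p e greedy_rec.de[OF g'] by (simp add: f_def)
    have st: "p * f k \<le> pot k - pot (Suc (Suc k)) + noise k + noise (Suc k)" if "m \<le> k" for k
    proof -
      have "p * (e / 2) \<le> p * pot k" using big[OF that] p by (intro mult_left_mono) auto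
      then have "f k \<le> min (p * pot k) ((1 - p) ^ k * de k / p)" unfolding f_def by linarith
      then have "p * f k \<le> p * min (p * pot k) ((1 - p) ^ k * de k / p)" using p by (intro mult_left_mono) auto
      then show ?thesis using pS[of k] by linarith
    qed
    have bound: "p * (\<Sum>k=m..<m + n. f k) \<le> pot m + pot (Suc m) + 2 * H" for n
    proof -
      have "p * (\<Sum>k=m..<m + n. f k) = (\<Sum>k=m..<m + n. p * f k)" by (simp add: sum_distrib_left)
      also have "\<dots> \<le> (\<Sum>k=m..<m + n. (pot k - pot (Suc (Suc k))) + noise k + noise (Suc k))"
        by (intro sum_mono st) auto
      also have "\<dots> = (\<Sum>k=m..<m + n. pot k - pot (Suc (Suc k))) + (\<Sum>k=m..<m + n. noise k) + (\<Sum>k=m..<m + n. noise (Suc k))"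
        by (simp add: sum.distrib)
      also have "(\<Sum>k=m..<m + n. pot k - pot (Suc (Suc k))) = pot m + pot (Suc m) - pot (m + n) - pot (Suc (m + n))"
        by (induction n) auto
      finally show ?thesis using H[of m "m + n"] pot_nonneg[of "m + n"] pot_nonneg[of "Suc (m + n)"] by linarith
    qed
    have "summable (\<lambda>k. f (k + m))"
    proof (rule bounded_imp_summable)
      show "0 \<le> f (k + m)" for k by (rule f0)
      show "(\<Sum>k\<le>n. f (k + m)) \<le> (pot m + pot (Suc m) + 2 * H) / p" for n
      proof -
        have "(\<Sum>k\<le>n. f (k + m)) = (\<Sum>k=m..<m + Suc n. f k)"
          using sum.shift_bounds_nat_ivl[of f 0 m "Suc n"]
          by (simp add: atLeast0LessThan lessThan_Suc_atMost add.commute)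
        then show ?thesis using bound[of "Suc n"] p by (simp add: field_simps)
      qed
    qed
    then show False using nf by (simp add: summable_iff_shift)
  qed
  then obtain k1 where k1: "k1 \<ge> m" "pot k1 \<le> e / 2" by blast
  have "al k \<le> e / (1 - p) ^ k" if "k1 \<le> k" for k
  proof -
    have "pot k \<le> e" using pn[OF that] k1 m[OF k1(1), of k] by linarith
    then have "pot k / (1 - p) ^ k \<le> e / (1 - p) ^ k" using p by (intro divide_right_mono) auto
    then show ?thesis using al_le_pot[of k] by linarith
  qed
  then show ?thesis by (auto simp: eventually_sequentially)
qed

text \<open>For restarting the recursion at a late order \<open>j\<close>: even without surplus the
  potential grows by at most the noise beyond \<open>j\<close>, and \<open>m\<close> is chosen so
  that this is at most \<open>e\<close>.\<close>

lemma greedy_rec_persist: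
  fixes p c e :: real
  assumes p: "0 < p" "p < 1" and c: "0 \<le> c" and e: "0 < e"
  obtains m :: nat where
    "\<And>al ga de j K k. greedy_rec p (1 - p) c al ga de j K \<Longrightarrow> j \<ge> m \<Longrightarrow>
      al j \<le> e / (1 - p) ^ j \<Longrightarrow> ga j \<le> p * e / (1 - p) ^ j \<Longrightarrow> j \<le> k \<Longrightarrow> k \<le> K \<Longrightarrow>
      al k \<le> 2 * e / (1 - p) ^ k"
proof -
  obtain m where m: "\<And>a b. m \<le> a \<Longrightarrow> (\<Sum>i=a..<b. gnoise p c i) \<le> e"
    using gnoise_tail[OF p c e] by auto
  show thesis
  proof (rule that[of m], goal_cases)
    case (1 al ga de j K k)
    interpret greedy_rec p "1 - p" c al ga de j K by fact
    have "pot j \<le> e" using 1 p e by (auto simp: pot_def field_simps)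
    then have "pot k \<le> 2 * e"
      using pot_le_noise_sum[of j k] 1 m[of j k] by (simp add: noise_eq)
    then have "pot k / (1 - p) ^ k \<le> 2 * e / (1 - p) ^ k" using p by (intro divide_right_mono) auto
    then show ?case using al_le_pot[of k] by linarith
  qed
qed

section \<open>Bumps as infinite convolutions\<close>

lemma powr_subadd:
  fixes x y p :: real
  assumes "0 < p" "p \<le> 1" "0 \<le> x" "0 \<le> y"
  shows "(x + y) powr p \<le> x powr p + y powr p"
proof (cases "x + y = 0")
  case True then show ?thesis using assms by simp
next
  case False
  then have s: "0 < x + y" using assms by linarith
  have le: "t \<le> t powr p" if "0 \<le> t" "t \<le> 1" for t :: real
  proof (cases "t = 0")
    case False
    then have "t powr 1 \<le> t powr p" using that assms by (intro powr_mono') auto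
    then show ?thesis using that False by simp
  qed simp
  have "1 = x / (x + y) + y / (x + y)" using s by (simp add: add_divide_distrib[symmetric])
  also have "\<dots> \<le> (x / (x + y)) powr p + (y / (x + y)) powr p"
    using s assms by (intro add_mono le) (auto simp: divide_simps)
  also have "\<dots> = (x powr p + y powr p) / (x + y) powr p"
    using s assms by (simp add: powr_divide add_divide_distrib)
  finally show ?thesis using s by (simp add: field_simps)
qed

lemma norm_powr_subadd:
  fixes x y :: "'a::real_normed_vector"
  assumes "0 < p" "p \<le> 1"
  shows "norm (x + y) powr p \<le> norm x powr p + norm y powr p"
proof -
  have "norm (x + y) powr p \<le> (norm x + norm y) powr p"
    using assms by (intro powr_mono2) (auto intro: norm_triangle_ineq)
  also have "\<dots> \<le> norm x powr p + norm y powr p" using assms by (intro powr_subadd) auto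
  finally show ?thesis .
qed

text \<open>Convolution with the uniform probability density on \<open>{0..a}\<close>.\<close>

definition sliding_mean :: "real \<Rightarrow> (real \<Rightarrow> real) \<Rightarrow> real \<Rightarrow> real" where
  "sliding_mean a f x = integral {0..a} (\<lambda>s. f (x - s)) / a"

text \<open>The continuous distribution functions of probability measures on
  \<open>{0..r}\<close>.\<close>

definition ramp_like :: "real \<Rightarrow> (real \<Rightarrow> real) \<Rightarrow> bool" where
  "ramp_like r f \<longleftrightarrow> continuous_on UNIV f \<and> mono f \<and> (\<forall>x\<le>0. f x = 0) \<and> (\<forall>x\<ge>r. f x = 1)"

lemma ramp_like_bounds:
  assumes "ramp_like r f" shows "0 \<le> f x" "f x \<le> 1"
proof -
  have m: "mono f" and z: "f (min x 0) = 0" and o: "f (max x r) = 1"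
    using assms by (simp_all add: ramp_like_def)
  show "0 \<le> f x" using monoD[OF m, of "min x 0" x] z by simp
  show "f x \<le> 1" using monoD[OF m, of x "max x r"] o by simp
qed

lemma shift_integrable:
  fixes f :: "real \<Rightarrow> 'a::euclidean_space"
  assumes "continuous_on UNIV f" shows "(\<lambda>s. f (x - s)) integrable_on {a..b}"
  by (intro integrable_continuous_interval continuous_on_compose2[OF assms] continuous_intros) auto

lemma sliding_mean_mono:
  assumes "0 < a" "continuous_on UNIV f" "continuous_on UNIV g" "\<And>s. f (x - s) \<le> g (y - s)"
  shows "sliding_mean a f x \<le> sliding_mean a g y"
  unfolding sliding_mean_def using assms
  by (intro divide_right_mono integral_le shift_integrable) auto

lemma sliding_mean_has_derivative:
  assumes a: "0 < a" and f: "continuous_on UNIV f"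
  shows "(sliding_mean a f has_real_derivative (f x - f (x - a)) / a) (at x)"
proof -
  \<comment> \<open>The antiderivative is available on compact intervals only; this one contains
    both \<open>y\<close> and \<open>y - a\<close> for all \<open>y\<close> near
    \<open>x\<close>.\<close>
  let ?I = "{x - a - 1..x + 1}"
  obtain F where F: "\<And>y. y \<in> ?I \<Longrightarrow> (F has_vector_derivative f y) (at y within ?I)"
    using antiderivative_continuous[of "x - a - 1" "x + 1" f] continuous_on_subset[OF f] by blast
  have F': "(F has_real_derivative f y) (at y)" if "x - a - 1 < y" "y < x + 1" for y
  proof -
    have "(F has_vector_derivative f y) (at y within {x - a - 1<..<x + 1})"
      using F[of y] that by (auto intro: has_vector_derivative_within_subset)
    then show ?thesis
      using that by (simp add: has_real_derivative_iff_has_vector_derivative at_within_open[of y "{x - a - 1<..<x + 1}"])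
  qed
  have eq: "(F y - F (y - a)) / a = sliding_mean a f y" if "y \<in> {x - 1<..<x + 1}" for y
  proof -
    have "((\<lambda>s. f (y - s)) has_integral (- F (y - a) - (- F (y - 0)))) {0..a}"
    proof (rule fundamental_theorem_of_calculus)
      fix s assume s: "s \<in> {0..a}"
      have "((\<lambda>s. - F (y - s)) has_real_derivative - (f (y - s) * (0 - 1))) (at s within {0..a})"
        using s that by (intro DERIV_minus DERIV_chain2[OF F'] DERIV_diff DERIV_ident DERIV_const) auto
      then show "((\<lambda>s. - F (y - s)) has_vector_derivative f (y - s)) (at s within {0..a})"
        by (simp add: has_real_derivative_iff_has_vector_derivative)
    qed (use a in auto)
    then show ?thesis by (simp add: sliding_mean_def integral_unique)
  qed
  have "((\<lambda>y. (F y - F (y - a)) / a) has_real_derivative (f x - f (x - a) * (1 - 0)) / a) (at x)"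
    using a by (intro DERIV_cdivide DERIV_diff F' DERIV_chain2[OF F'] derivative_eq_intros) auto
  then have "((\<lambda>y. (F y - F (y - a)) / a) has_real_derivative (f x - f (x - a)) / a) (at x)" by simp
  then show ?thesis
    by (rule has_field_derivative_transform_within_open[where S = "{x - 1<..<x + 1}"]) (use eq in auto)
qed

lemma sliding_mean_ramp_like:
  assumes a: "0 < a" and f: "ramp_like r f"
  shows "ramp_like (a + r) (sliding_mean a f)"
proof -
  have c: "continuous_on UNIV f" and m: "mono f" and z: "\<And>x. x \<le> 0 \<Longrightarrow> f x = 0" and o: "\<And>x. x \<ge> r \<Longrightarrow> f x = 1"
    using f by (auto simp: ramp_like_def)
  have "sliding_mean a f x = 0" if "x \<le> 0" for x
  proof -
    have "integral {0..a} (\<lambda>s. f (x - s)) = integral {0..a} (\<lambda>_. 0)"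
      by (rule integral_cong) (use z that in auto)
    then show ?thesis by (simp add: sliding_mean_def)
  qed
  moreover have "sliding_mean a f x = 1" if "x \<ge> a + r" for x
  proof -
    have "integral {0..a} (\<lambda>s. f (x - s)) = integral {0..a} (\<lambda>_. 1)"
      by (rule integral_cong) (use o that in auto)
    then show ?thesis using a by (simp add: sliding_mean_def)
  qed
  moreover have "mono (sliding_mean a f)"
    by (intro monoI sliding_mean_mono a c) (use m in \<open>auto intro: monoD\<close>)
  moreover have "continuous_on UNIV (sliding_mean a f)"
    using sliding_mean_has_derivative[OF a c]
    by (meson DERIV_continuous continuous_at_imp_continuous_on)
  ultimately show ?thesis by (simp add: ramp_like_def)
qed

lemma sliding_mean_lipschitz:
  assumes a: "0 < a" and c: "continuous_on UNIV f" and b: "\<And>x. 0 \<le> f x \<and> f x \<le> 1"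
  shows "\<bar>sliding_mean a f x - sliding_mean a f y\<bar> \<le> \<bar>x - y\<bar> / a"
proof -
  have "norm (sliding_mean a f x - sliding_mean a f y) \<le> (1 / a) * norm (x - y)"
  proof (rule field_differentiable_bound[of UNIV])
    fix z
    show "(sliding_mean a f has_field_derivative (f z - f (z - a)) / a) (at z within UNIV)"
      using sliding_mean_has_derivative[OF a c] by simp
    have "\<bar>f z - f (z - a)\<bar> \<le> 1" using b[of z] b[of "z - a"] by linarith
    then show "norm ((f z - f (z - a)) / a) \<le> 1 / a" using a by (simp add: divide_right_mono)
  qed auto
  then show ?thesis by simp
qed

text \<open>\<open>r n\<close> is the total width of the uniform densities with index at least
  \<open>n\<close>, and a single density has the width \<open>gap n\<close>. Recording tails instead
  of widths keeps the supports exact, and the halving makes \<open>gap n\<close> comparable to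
  \<open>r n\<close>.\<close>

locale shrinking =
  fixes r :: "nat \<Rightarrow> real"
  assumes r_pos: "\<And>n. 0 < r n" and r_half: "\<And>n. r (Suc n) \<le> r n / 2"
begin

definition gap :: "nat \<Rightarrow> real" where "gap n = r n - r (Suc n)"

lemma gap_ge: "r n / 2 \<le> gap n" using r_half[of n] by (simp add: gap_def)

lemma gap_pos: "0 < gap n" using gap_ge[of n] r_pos[of n] by linarith

text \<open>\<open>m\<close> averages of widths \<open>gap n\<close>, \<open>gap (Suc n)\<close>,
  ... applied to a linear ramp of width \<open>r (n + m)\<close>, which stands in for the averages
  still missing. Every approximation is therefore constant outside \<open>{0..r n}\<close>.\<close>

fun approx_cdf :: "nat \<Rightarrow> nat \<Rightarrow> real \<Rightarrow> real" where
  "approx_cdf 0 n = (\<lambda>x. max 0 (min 1 (x / r n)))"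
| "approx_cdf (Suc m) n = sliding_mean (gap n) (approx_cdf m (Suc n))"

lemma approx_cdf_ramp: "ramp_like (r n) (approx_cdf m n)"
proof (induction m arbitrary: n)
  case 0
  have "continuous_on UNIV (\<lambda>x. max 0 (min 1 (x / r n)))"
    using r_pos[of n] by (intro continuous_intros) auto
  moreover have "mono (\<lambda>x. max 0 (min 1 (x / r n)))"
    using r_pos[of n] by (intro monoI max.mono min.mono divide_right_mono) auto
  ultimately show ?case using r_pos[of n] by (auto simp: ramp_like_def divide_nonpos_pos)
next
  case (Suc m)
  show ?case using sliding_mean_ramp_like[OF gap_pos[of n] Suc[of "Suc n"]] by (simp add: gap_def)
qed

lemma approx_cdf_cont: "continuous_on UNIV (approx_cdf m n)"
  using approx_cdf_ramp by (simp add: ramp_like_def)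

text \<open>A distribution function of a measure on \<open>{0..r}\<close> lies between the
  translates by \<open>r\<close>, to either side, of any other one, and averaging preserves this.
  Replacing the inner ramp thus costs a shift by \<open>r (n + m)\<close>.\<close>

lemma approx_cdf_sandwich:
  "approx_cdf (m + k) n x \<le> approx_cdf m n (x + r (n + m))" (is "?P m n x")
  "approx_cdf m n (x - r (n + m)) \<le> approx_cdf (m + k) n x" (is "?Q m n x")
proof -
  have "?P m n x \<and> ?Q m n x"
  proof (induction m arbitrary: n x)
    case 0
    note b = ramp_like_bounds[OF approx_cdf_ramp[of n k], of x]
    have z: "approx_cdf k n x = 0" if "x \<le> 0" using approx_cdf_ramp[of n k] that by (simp add: ramp_like_def)
    have o: "approx_cdf k n x = 1" if "x \<ge> r n" using approx_cdf_ramp[of n k] that by (simp add: ramp_like_def)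
    have "approx_cdf k n x \<le> max 0 (min 1 ((x + r n) / r n))"
    proof (cases "x \<le> 0")
      case False
      then have "1 \<le> (x + r n) / r n" using r_pos[of n] by (simp add: field_simps)
      then show ?thesis using b by simp
    qed (use z in simp)
    moreover have "max 0 (min 1 ((x - r n) / r n)) \<le> approx_cdf k n x"
    proof (cases "x \<ge> r n")
      case False
      then have "(x - r n) / r n \<le> 0" using r_pos[of n] by (simp add: divide_nonpos_pos)
      then show ?thesis using b by simp
    qed (use o in simp)
    ultimately show ?case by simp
  next
    case (Suc m)
    have ih: "?P m (Suc n) y" "?Q m (Suc n) y" for y using Suc[of "Suc n" y] by blast+
    show ?case
      unfolding add_Suc approx_cdf.simps add_Suc_right
    proof (intro conjI sliding_mean_mono gap_pos approx_cdf_cont, goal_cases)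
      case (1 s)
      have "x + r (Suc (n + m)) - s = x - s + r (Suc (n + m))" by simp
      then show ?case using ih(1)[of "x - s"] by (simp only: add_Suc)
    next
      case (2 s)
      have "x - r (Suc (n + m)) - s = x - s - r (Suc (n + m))" by simp
      then show ?case using ih(2)[of "x - s"] by (simp only: add_Suc)
    qed
  qed
  then show "?P m n x" "?Q m n x" by blast+
qed

lemma r_bound: "r (n + m) \<le> r n / 2 ^ m"
proof (induction m)
  case (Suc m)
  then show ?case using r_half[of "n + m"] by simp
qed simp

text \<open>The outermost average has Lipschitz constant \<open>1 / gap n\<close>, which turns the
  shift of the sandwich into a uniform error. For \<open>m = 0\<close> there is no such
  average.\<close>

lemma approx_cdf_close:
  assumes "0 < m"
  shows "\<bar>approx_cdf (m + k) n x - approx_cdf m n x\<bar> \<le> r n / gap n / 2 ^ m"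
proof -
  obtain m' where m: "m = Suc m'" using assms by (cases m) auto
  have L: "\<bar>approx_cdf m n x - approx_cdf m n y\<bar> \<le> \<bar>x - y\<bar> / gap n" for x y
    unfolding m approx_cdf.simps
    by (rule sliding_mean_lipschitz[OF gap_pos approx_cdf_cont])
       (use ramp_like_bounds[OF approx_cdf_ramp] in auto)
  have "\<bar>approx_cdf (m + k) n x - approx_cdf m n x\<bar> \<le> r (n + m) / gap n"
  proof -
    have R: "\<bar>x + r (n + m) - x\<bar> = r (n + m)" "\<bar>x - r (n + m) - x\<bar> = r (n + m)" using r_pos[of "n + m"] by auto
    show ?thesis
      using approx_cdf_sandwich(1)[of m k n x] approx_cdf_sandwich(2)[of m n x k] L[of "x + r (n + m)" x] L[of "x - r (n + m)" x] unfolding R by linarith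
  qed
  also have "\<dots> \<le> (r n / 2 ^ m) / gap n" using r_bound gap_pos by (intro divide_right_mono) (auto intro: less_imp_le)
  finally show ?thesis by (simp only: divide_divide_eq_left mult.commute)
qed

definition cdf :: "nat \<Rightarrow> real \<Rightarrow> real" where "cdf n x = lim (\<lambda>m. approx_cdf m n x)"

lemma approx_cdf_tendsto: "(\<lambda>m. approx_cdf m n x) \<longlonglongrightarrow> cdf n x"
proof -
  have t: "(\<lambda>m. r n / gap n / 2 ^ m) \<longlonglongrightarrow> 0"
    using LIMSEQ_realpow_zero[of "1/2"] tendsto_mult_right_zero[of "\<lambda>m. (1/2::real) ^ m" sequentially "r n / gap n"]
    by (simp add: power_divide)
  have "Cauchy (\<lambda>m. approx_cdf m n x)"
  proof (rule metric_CauchyI)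
    fix e :: real assume e: "0 < e"
    have "eventually (\<lambda>m. r n / gap n / 2 ^ m < e / 2) sequentially"
      using t e by (intro order_tendstoD(2)) auto
    then obtain M0 where M0: "\<And>m. m \<ge> M0 \<Longrightarrow> r n / gap n / 2 ^ m < e / 2"
      by (auto simp: eventually_sequentially)
    define M1 where "M1 = Suc M0"
    have "\<bar>approx_cdf m n x - approx_cdf M1 n x\<bar> < e / 2" if "m \<ge> M1" for m
      using approx_cdf_close[of M1 "m - M1" n x] M0[of M1] that
      unfolding M1_def by (simp del: approx_cdf.simps)
    note h = this
    have "dist (approx_cdf m n x) (approx_cdf k n x) < e" if "m \<ge> M1" "k \<ge> M1" for m k
      using h[OF that(1)] h[OF that(2)] unfolding dist_real_def by linarith
    then show "\<exists>M. \<forall>m\<ge>M. \<forall>k\<ge>M. dist (approx_cdf m n x) (approx_cdf k n x) < e" by blast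
  qed
  then show ?thesis unfolding cdf_def using Cauchy_convergent convergent_LIMSEQ_iff by blast
qed

lemma cdf_close: "0 < m \<Longrightarrow> \<bar>cdf n x - approx_cdf m n x\<bar> \<le> r n / gap n / 2 ^ m"
proof -
  assume m: "0 < m"
  have "(\<lambda>k. \<bar>approx_cdf (m + k) n x - approx_cdf m n x\<bar>) \<longlonglongrightarrow> \<bar>cdf n x - approx_cdf m n x\<bar>"
  proof (intro tendsto_rabs tendsto_diff tendsto_const)
    have "(\<lambda>k. m + k) = (\<lambda>k. k + m)" by (auto simp: fun_eq_iff)
    then show "(\<lambda>k. approx_cdf (m + k) n x) \<longlonglongrightarrow> cdf n x"
      using LIMSEQ_ignore_initial_segment[OF approx_cdf_tendsto[of n x], of m] by metis
  qed
  then show ?thesis by (rule LIMSEQ_le_const2) (intro exI allI impI approx_cdf_close[OF m])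
qed

lemma cdf_cont: "continuous_on UNIV (cdf n)"
proof -
  have t: "(\<lambda>m. r n / gap n / 2 ^ m) \<longlonglongrightarrow> 0"
    using LIMSEQ_realpow_zero[of "1/2"] tendsto_mult_right_zero[of "\<lambda>m. (1/2::real) ^ m" sequentially "r n / gap n"]
    by (simp add: power_divide)
  have u: "uniform_limit UNIV (\<lambda>m. approx_cdf m n) (cdf n) sequentially"
  proof (rule uniform_limitI)
    fix e :: real assume "0 < e"
    then have "eventually (\<lambda>m. r n / gap n / 2 ^ m < e) sequentially"
      using t by (intro order_tendstoD(2)) auto
    with eventually_gt_at_top[of 0]
    show "\<forall>\<^sub>F m in sequentially. \<forall>x\<in>UNIV. dist (approx_cdf m n x) (cdf n x) < e"
    proof eventually_elim
      case (elim m)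
      show ?case
      proof
        fix x
        show "dist (approx_cdf m n x) (cdf n x) < e"
          using cdf_close[OF elim(1), of n x] elim(2) unfolding dist_real_def by linarith
      qed
    qed
  qed
  show ?thesis
    by (rule uniform_limit_theorem[OF always_eventually u])
       (intro allI approx_cdf_cont, rule sequentially_bot)
qed

lemma cdf_ramp: "ramp_like (r n) (cdf n)"
  unfolding ramp_like_def
proof (intro conjI allI impI cdf_cont)
  show "mono (cdf n)"
  proof (rule monoI)
    fix x y :: real assume xy: "x \<le> y"
    show "cdf n x \<le> cdf n y"
      by (rule LIMSEQ_le[OF approx_cdf_tendsto approx_cdf_tendsto])
         (use approx_cdf_ramp xy in \<open>auto simp: ramp_like_def intro: monoD\<close>)
  qed
  fix x :: real
  show "cdf n x = 0" if "x \<le> 0"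
  proof -
    have "(\<lambda>m. approx_cdf m n x) = (\<lambda>_. 0)" using approx_cdf_ramp[of n] that by (auto simp: ramp_like_def fun_eq_iff)
    then show ?thesis using approx_cdf_tendsto[of n x] by (simp add: LIMSEQ_const_iff)
  qed
  show "cdf n x = 1" if "r n \<le> x"
  proof -
    have "(\<lambda>m. approx_cdf m n x) = (\<lambda>_. 1)" using approx_cdf_ramp[of n] that by (auto simp: ramp_like_def fun_eq_iff)
    then show ?thesis using approx_cdf_tendsto[of n x] by (simp add: LIMSEQ_const_iff)
  qed
qed

text \<open>Uniform convergence passes through \<open>sliding_mean\<close>, because an average is
  monotone and commutes with the addition of constants.\<close>

lemma cdf_rec: "cdf n = sliding_mean (gap n) (cdf (Suc n))"
proof
  fix x
  have t: "(\<lambda>m. r (Suc n) / gap (Suc n) / 2 ^ m) \<longlonglongrightarrow> 0"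
    using LIMSEQ_realpow_zero[of "1/2"] tendsto_mult_right_zero[of "\<lambda>m. (1/2::real) ^ m" sequentially "r (Suc n) / gap (Suc n)"]
    by (simp add: power_divide)
  have "(\<lambda>m. approx_cdf (Suc m) n x - sliding_mean (gap n) (cdf (Suc n)) x) \<longlonglongrightarrow> 0"
  proof (rule tendsto_norm_zero_cancel, rule tendsto_sandwich[OF _ _ tendsto_const t])
    show "\<forall>\<^sub>F m in sequentially. norm (approx_cdf (Suc m) n x - sliding_mean (gap n) (cdf (Suc n)) x) \<le> r (Suc n) / gap (Suc n) / 2 ^ m"
      using eventually_gt_at_top[of 0]
    proof eventually_elim
      case (elim m)
      let ?e = "r (Suc n) / gap (Suc n) / 2 ^ m"
      have e: "\<bar>cdf (Suc n) y - approx_cdf m (Suc n) y\<bar> \<le> ?e" for y using cdf_close[OF elim] .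
      have add: "sliding_mean (gap n) (\<lambda>y. f y + ?e) x = sliding_mean (gap n) f x + ?e"
        if "continuous_on UNIV f" for f
      proof -
        have "integral {0..gap n} (\<lambda>s. f (x - s) + ?e) = integral {0..gap n} (\<lambda>s. f (x - s)) + integral {0..gap n} (\<lambda>s. ?e)"
          by (rule integral_add[OF shift_integrable[OF that]]) (rule integrable_const_ivl)
        then show ?thesis using gap_pos[of n] unfolding sliding_mean_def by (simp add: add_divide_distrib)
      qed
      have e1: "cdf (Suc n) y \<le> approx_cdf m (Suc n) y + ?e" "approx_cdf m (Suc n) y \<le> cdf (Suc n) y + ?e" for y
        using e[of y] by linarith+
      have c1: "continuous_on UNIV (\<lambda>y. approx_cdf m (Suc n) y + ?e)" "continuous_on UNIV (\<lambda>y. cdf (Suc n) y + ?e)"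
        by (rule continuous_on_add[OF approx_cdf_cont continuous_on_const], rule continuous_on_add[OF cdf_cont continuous_on_const])
      have "sliding_mean (gap n) (cdf (Suc n)) x \<le> sliding_mean (gap n) (\<lambda>y. approx_cdf m (Suc n) y + ?e) x"
        by (rule sliding_mean_mono[OF gap_pos cdf_cont c1(1) e1(1)])
      moreover have "sliding_mean (gap n) (approx_cdf m (Suc n)) x \<le> sliding_mean (gap n) (\<lambda>y. cdf (Suc n) y + ?e) x"
        by (rule sliding_mean_mono[OF gap_pos approx_cdf_cont c1(2) e1(2)])
      ultimately show ?case
        unfolding add[OF cdf_cont[of "Suc n"]] add[OF approx_cdf_cont[of m "Suc n"]] real_norm_def approx_cdf.simps by linarith
    qed
  qed auto
  then have "(\<lambda>m. approx_cdf (Suc m) n x) \<longlonglongrightarrow> sliding_mean (gap n) (cdf (Suc n)) x"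
    using LIM_zero_iff by blast
  then show "cdf n x = sliding_mean (gap n) (cdf (Suc n)) x"
    using LIMSEQ_Suc[OF approx_cdf_tendsto[of n x]] LIMSEQ_unique by blast
qed

text \<open>Differentiating the average of width \<open>gap n\<close> gives a difference quotient
  with that step, applied to \<open>cdf (Suc n)\<close>, which is again an average. So each order
  uses up one uniform density and all derivatives are explicit.\<close>

fun cdf_deriv :: "nat \<Rightarrow> nat \<Rightarrow> real \<Rightarrow> real" where
  "cdf_deriv 0 n x = cdf n x"
| "cdf_deriv (Suc k) n x = (cdf_deriv k (Suc n) x - cdf_deriv k (Suc n) (x - gap n)) / gap n"

lemma cdf_deriv_derivative: "(cdf_deriv k n has_real_derivative cdf_deriv (Suc k) n x) (at x)"
proof (induction k arbitrary: n x)
  case 0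
  have "cdf_deriv 0 m = cdf m" for m by (auto simp: fun_eq_iff)
  then show ?case using sliding_mean_has_derivative[OF gap_pos cdf_cont, of n "Suc n" x] by (simp add: cdf_rec[of n, symmetric])
next
  case (Suc k)
  have "((\<lambda>x. (cdf_deriv k (Suc n) x - cdf_deriv k (Suc n) (x - gap n)) / gap n) has_real_derivative
    (cdf_deriv (Suc k) (Suc n) x - cdf_deriv (Suc k) (Suc n) (x - gap n) * (1 - 0)) / gap n) (at x)"
    by (intro DERIV_cdivide DERIV_diff Suc DERIV_chain2[OF Suc] DERIV_ident DERIV_const)
  then show ?case by (simp add: cdf_deriv.simps(2)[abs_def] fun_eq_iff)
qed

lemma cdf_deriv_bound: "\<bar>cdf_deriv k n x\<bar> \<le> (\<Prod>i<k. 4 / r (n + i))"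
proof (induction k arbitrary: n x)
  case 0
  then show ?case using ramp_like_bounds[OF cdf_ramp, of n x] by simp
next
  case (Suc k)
  let ?P = "\<Prod>i<k. 4 / r (Suc n + i)"
  have P: "0 \<le> ?P" using r_pos by (intro prod_nonneg) (auto intro: less_imp_le)
  have "\<bar>cdf_deriv (Suc k) n x\<bar> \<le> (?P + ?P) / gap n"
    using Suc[of "Suc n" x] Suc[of "Suc n" "x - gap n"] gap_pos[of n]
    by (auto simp: abs_divide intro!: divide_right_mono)
  also have "\<dots> \<le> (?P + ?P) / (r n / 2)"
    using P gap_ge[of n] r_pos[of n] by (intro divide_left_mono) auto
  also have "\<dots> = (4 / r (n + 0)) * ?P" by simp
  also have "\<dots> = (\<Prod>i<Suc k. 4 / r (n + i))" unfolding prod.lessThan_Suc_shift by simp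
  finally show ?case .
qed

lemma cdf_deriv_support: "x \<le> 0 \<or> r n \<le> x \<Longrightarrow> cdf_deriv (Suc k) n x = 0"
proof (induction k arbitrary: n x)
  case 0
  then show ?case using cdf_ramp[of "Suc n"] gap_pos[of n] by (auto simp: ramp_like_def gap_def)
next
  case (Suc k)
  have "x - gap n \<le> 0 \<or> r (Suc n) \<le> x - gap n" "x \<le> 0 \<or> r (Suc n) \<le> x"
    using Suc.prems gap_pos[of n] by (auto simp: gap_def)
  then show ?case
    unfolding cdf_deriv.simps(2)[of "Suc k"] using Suc.IH[of x "Suc n"] Suc.IH[of "x - gap n" "Suc n"] by (simp only:) simp
qed

lemma cdf_deriv_borel [measurable]: "cdf_deriv k n \<in> borel_measurable borel"
  using cdf_deriv_derivative[of k n]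
  by (intro borel_measurable_continuous_onI) (meson DERIV_continuous continuous_at_imp_continuous_on)

text \<open>Each outer difference quotient costs a factor \<open>2 * gap powr (-p)\<close>, at most
  \<open>4 * r powr (-p)\<close>. The innermost one is at most \<open>2 / r (n + k)\<close> on an
  interval of length \<open>r (n + k)\<close>, which leaves the width with the power
  \<open>1 - p\<close>. This power is positive, so narrow bumps are cheap.\<close>

lemma cdf_deriv_Lp:
  assumes p: "0 < p" "p < 1"
  shows "(\<integral>\<^sup>+x. ennreal (\<bar>cdf_deriv (Suc k) n x\<bar> powr p) \<partial>lborel)
    \<le> ennreal (4 ^ Suc k * (\<Prod>i<k. r (n + i) powr (-p)) * r (n + k) powr (1 - p))"
proof (induction k arbitrary: n)
  case 0
  have b: "\<bar>cdf_deriv (Suc 0) n x\<bar> \<le> 2 / r n" for x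
  proof -
    have "\<bar>cdf (Suc n) x - cdf (Suc n) (x - gap n)\<bar> \<le> 1"
      using ramp_like_bounds[OF cdf_ramp, of "Suc n" x] ramp_like_bounds[OF cdf_ramp, of "Suc n" "x - gap n"] by linarith
    then have "\<bar>cdf_deriv (Suc 0) n x\<bar> \<le> 1 / gap n"
      using gap_pos[of n] by (auto simp: abs_divide intro!: divide_right_mono)
    also have "\<dots> \<le> 1 / (r n / 2)" using gap_ge[of n] r_pos[of n] gap_pos[of n] by (intro divide_left_mono) auto
    finally show ?thesis by simp
  qed
  have "(\<integral>\<^sup>+x. ennreal (\<bar>cdf_deriv (Suc 0) n x\<bar> powr p) \<partial>lborel)
     \<le> (\<integral>\<^sup>+x. ennreal ((2 / r n) powr p) * indicator {0..r n} x \<partial>lborel)"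
  proof (intro nn_integral_mono)
    fix x
    show "ennreal (\<bar>cdf_deriv (Suc 0) n x\<bar> powr p) \<le> ennreal ((2 / r n) powr p) * indicator {0..r n} x"
    proof (cases "x \<in> {0..r n}")
      case True
      then show ?thesis using b[of x] p by (auto intro!: ennreal_leI powr_mono2)
    next
      case False
      then have "cdf_deriv (Suc 0) n x = 0" by (intro cdf_deriv_support) auto
      then show ?thesis by (simp del: cdf_deriv.simps)
    qed
  qed
  also have "\<dots> = ennreal ((2 / r n) powr p * r n)"
    using r_pos[of n] by (simp add: nn_integral_cmult_indicator ennreal_mult)
  also have "(2 / r n) powr p * r n = 2 powr p * r n powr (1 - p)"
    using r_pos[of n] p by (simp add: powr_divide powr_diff)
  also have "ennreal \<dots> \<le> ennreal (4 * r n powr (1 - p))"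
  proof (intro ennreal_leI mult_right_mono)
    have "2 powr p \<le> 2 powr (2::real)" using p by (intro powr_mono) auto
    then show "2 powr p \<le> (4::real)" by simp
  qed auto
  finally show ?case by simp
next
  case (Suc k)
  let ?f = "cdf_deriv (Suc k) (Suc n)"
  let ?B = "4 ^ Suc k * (\<Prod>i<k. r (Suc n + i) powr (-p)) * r (Suc n + k) powr (1 - p)"
  have B: "0 \<le> ?B" by (intro mult_nonneg_nonneg prod_nonneg) auto
  have g: "0 < gap n" by (rule gap_pos)
  have pt: "\<bar>cdf_deriv (Suc (Suc k)) n x\<bar> powr p
    \<le> gap n powr (-p) * (\<bar>?f x\<bar> powr p + \<bar>?f (x - gap n)\<bar> powr p)" for x
  proof -
    have "\<bar>cdf_deriv (Suc (Suc k)) n x\<bar> powr p = \<bar>?f x - ?f (x - gap n)\<bar> powr p * gap n powr (-p)"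
      using g by (simp add: abs_divide powr_divide powr_minus_divide del: cdf_deriv.simps(2) add: cdf_deriv.simps(2)[of "Suc k"])
    also have "\<bar>?f x - ?f (x - gap n)\<bar> powr p \<le> \<bar>?f x\<bar> powr p + \<bar>?f (x - gap n)\<bar> powr p"
      using norm_powr_subadd[of p "?f x" "- ?f (x - gap n)"] p by simp
    finally show ?thesis by (simp add: mult.commute mult_right_mono)
  qed
  have sh: "(\<integral>\<^sup>+x. ennreal (\<bar>?f (x - gap n)\<bar> powr p) \<partial>lborel) = (\<integral>\<^sup>+x. ennreal (\<bar>?f x\<bar> powr p) \<partial>lborel)"
    using nn_integral_real_affine[of "\<lambda>x. ennreal (\<bar>?f (x - gap n)\<bar> powr p)" 1 "gap n"] by (simp del: cdf_deriv.simps)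
  have "(\<integral>\<^sup>+x. ennreal (\<bar>cdf_deriv (Suc (Suc k)) n x\<bar> powr p) \<partial>lborel)
    \<le> (\<integral>\<^sup>+x. ennreal (gap n powr (-p)) * (ennreal (\<bar>?f x\<bar> powr p) + ennreal (\<bar>?f (x - gap n)\<bar> powr p)) \<partial>lborel)"
    by (intro nn_integral_mono) (use pt in \<open>simp add: ennreal_mult[symmetric] ennreal_plus[symmetric] ennreal_leI del: cdf_deriv.simps ennreal_plus\<close>)
  also have "\<dots> = ennreal (gap n powr (-p)) * ((\<integral>\<^sup>+x. ennreal (\<bar>?f x\<bar> powr p) \<partial>lborel) + (\<integral>\<^sup>+x. ennreal (\<bar>?f x\<bar> powr p) \<partial>lborel))"
    by (subst nn_integral_cmult, measurable, subst nn_integral_add) (auto simp: sh simp del: cdf_deriv.simps)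
  also have "\<dots> \<le> ennreal (gap n powr (-p)) * (ennreal ?B + ennreal ?B)"
    by (intro mult_left_mono add_mono Suc) auto
  also have "\<dots> = ennreal (gap n powr (-p) * (?B + ?B))" using B by (simp add: ennreal_mult ennreal_plus[symmetric] del: ennreal_plus)
  also have "\<dots> \<le> ennreal ((2 * r n powr (-p)) * (?B + ?B))"
  proof (intro ennreal_leI mult_right_mono)
    have "gap n powr (-p) \<le> (r n / 2) powr (-p)"
      using gap_ge[of n] r_pos[of n] p by (intro powr_mono2') auto
    also have "\<dots> = 2 powr p * r n powr (-p)" using r_pos[of n] by (simp add: powr_divide powr_minus_divide)
    also have "\<dots> \<le> 2 * r n powr (-p)"
      using p powr_mono[of p 1 "2::real"] by (intro mult_right_mono) auto
    finally show "gap n powr (-p) \<le> 2 * r n powr (-p)" .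
  qed (use B in auto)
  also have "(2 * r n powr (-p)) * (?B + ?B) = 4 ^ Suc (Suc k) * (\<Prod>i<Suc k. r (n + i) powr (-p)) * r (n + Suc k) powr (1 - p)"
    unfolding prod.lessThan_Suc_shift by (simp add: mult_ac)
  finally show ?case .
qed

end

section \<open>Derivatives on an interval\<close>

lemma cont_powr_norm:
  fixes f :: "real \<Rightarrow> 'a::real_normed_vector"
  assumes "continuous_on S f" "0 < p"
  shows "continuous_on S (\<lambda>x. norm (f x) powr p)"
  by (intro continuous_on_powr' continuous_on_norm assms(1) continuous_on_const) (use assms in auto)

text \<open>Change of variables with a factor of modulus at least 1. In the uses below
  \<open>c\<close> is \<open>1\<close> or, up to sign, the index of a node of a finite
  difference.\<close>

lemma integral_affine_le:
  fixes f :: "real \<Rightarrow> real"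
  assumes f: "continuous_on {a..b} f" "\<And>y. y \<in> {a..b} \<Longrightarrow> 0 \<le> f y"
    and c: "1 \<le> \<bar>c\<bar>" and T: "0 \<le> T" and x: "x \<in> {a..b}" "x + c * T \<in> {a..b}"
  shows "(\<lambda>t. f (x + c * t)) integrable_on {0..T}"
    and "integral {0..T} (\<lambda>t. f (x + c * t)) \<le> integral {a..b} f"
proof -
  obtain F where F: "\<And>y. y \<in> {a..b} \<Longrightarrow> (F has_vector_derivative f y) (at y within {a..b})"
    using antiderivative_continuous[OF f(1)] by blast
  have inn: "x + c * t \<in> {a..b}" if "t \<in> {0..T}" for t
  proof (cases "0 \<le> c")
    case True
    have "0 \<le> c * t" using that True by (intro mult_nonneg_nonneg) auto
    moreover have "c * t \<le> c * T" using that True by (intro mult_left_mono) auto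
    ultimately show ?thesis using x unfolding atLeastAtMost_iff by linarith
  next
    case False
    have "c * t \<le> 0" using that False by (intro mult_nonpos_nonneg) auto
    moreover have "c * T \<le> c * t" using that False by (intro mult_left_mono_neg) auto
    ultimately show ?thesis using x unfolding atLeastAtMost_iff by linarith
  qed
  have "((\<lambda>t. f (x + c * t)) has_integral F (x + c * T) / c - F (x + c * 0) / c) {0..T}"
  proof (rule fundamental_theorem_of_calculus[OF T])
    fix t assume t: "t \<in> {0..T}"
    have "((\<lambda>t. x + c * t) has_real_derivative 0 + c * 1) (at t within {0..T})"
      by (intro DERIV_add DERIV_const DERIV_cmult DERIV_ident)
    then have "((\<lambda>t. x + c * t) has_vector_derivative c) (at t within {0..T})"
      by (simp add: has_real_derivative_iff_has_vector_derivative)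
    moreover have "(F has_vector_derivative f (x + c * t)) (at (x + c * t) within (\<lambda>t. x + c * t) ` {0..T})"
      by (rule has_vector_derivative_within_subset[OF F[OF inn[OF t]]]) (use inn in blast)
    ultimately have "(F \<circ> (\<lambda>t. x + c * t) has_vector_derivative c *\<^sub>R f (x + c * t)) (at t within {0..T})"
      by (rule vector_diff_chain_within)
    then have "((\<lambda>t. (1 / c) * F (x + c * t)) has_vector_derivative (1 / c) * (c * f (x + c * t))) (at t within {0..T})"
      by (intro has_vector_derivative_mult_right) (simp add: o_def)
    then show "((\<lambda>t. F (x + c * t) / c) has_vector_derivative f (x + c * t)) (at t within {0..T})"
      using c by simp
  qed
  then have I: "(\<lambda>t. f (x + c * t)) integrable_on {0..T}"
    "integral {0..T} (\<lambda>t. f (x + c * t)) = (F (x + c * T) - F x) / c"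
    by (rule has_integral_integrable, subst integral_unique) (simp_all add: diff_divide_distrib)
  show "(\<lambda>t. f (x + c * t)) integrable_on {0..T}" by (rule I(1))
  have D: "F v - F u \<le> integral {a..b} f" if "u \<le> v" "a \<le> u" "v \<le> b" for u v
  proof -
    have "(f has_integral (F v - F u)) {u..v}"
      by (rule fundamental_theorem_of_calculus[OF that(1)])
         (rule has_vector_derivative_within_subset[OF F], use that in auto)
    then have "F v - F u = integral {u..v} f" by (simp add: integral_unique)
    also have "\<dots> \<le> integral {a..b} f"
      using that f by (intro integral_subset_le integrable_continuous_interval) (auto intro: continuous_on_subset)
    finally show ?thesis .
  qed
  have "(F (x + c * T) - F x) / c \<le> integral {a..b} f"
  proof (cases "0 \<le> c")
    case True
    then have c1: "1 \<le> c" using c by simp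
    have "0 \<le> integral {a..b} f" using f by (intro integral_nonneg integrable_continuous_interval) auto
    moreover have "F (x + c * T) - F x \<le> integral {a..b} f" using True T x by (intro D) auto
    ultimately show ?thesis
      using c1 mult_left_mono[of 1 c "integral {a..b} f"] by (simp add: pos_divide_le_eq)
  next
    case False
    then have c1: "1 \<le> - c" using c by simp
    have "0 \<le> integral {a..b} f" using f by (intro integral_nonneg integrable_continuous_interval) auto
    moreover have "F x - F (x + c * T) \<le> integral {a..b} f"
      using False T x by (intro D) (auto simp: mult_nonpos_nonneg)
    ultimately have "(F x - F (x + c * T)) / (- c) \<le> integral {a..b} f"
      using c1 mult_left_mono[of 1 "- c" "integral {a..b} f"] by (subst pos_divide_le_eq) auto
    moreover have "(F (x + c * T) - F x) / c = (F x - F (x + c * T)) / (- c)"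
      using minus_divide_divide[of "F (x + c * T) - F x" c] by simp
    ultimately show ?thesis by simp
  qed
  then show "integral {0..T} (\<lambda>t. f (x + c * t)) \<le> integral {a..b} f" using I by simp
qed

fun fdiff :: "nat \<Rightarrow> real \<Rightarrow> (real \<Rightarrow> 'a::real_normed_vector) \<Rightarrow> real \<Rightarrow> 'a" where
  "fdiff 0 t f = f"
| "fdiff (Suc j) t f = fdiff j t (\<lambda>y. f (y + t) - f y)"

text \<open>A function bundled with its derivatives of all orders, so that constructions can
  prescribe the derivatives explicitly; \<open>nderiv_dtower\<close> leads back to iterated
  derivatives.\<close>

definition dtower :: "(nat \<Rightarrow> real \<Rightarrow> 'a::real_normed_vector) \<Rightarrow> bool" where
  "dtower g \<longleftrightarrow> (\<forall>n x. (g n has_vector_derivative g (Suc n) x) (at x))"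

lemma dtowerD: "dtower g \<Longrightarrow> (g n has_vector_derivative g (Suc n) x) (at x within S)"
  unfolding dtower_def using has_vector_derivative_at_within by blast

lemma dtower_continuous: "dtower g \<Longrightarrow> continuous_on S (g n)"
  using dtowerD has_vector_derivative_continuous
  by (metis continuous_at_imp_continuous_on)

lemma dtower_borel: "dtower H \<Longrightarrow> (H n :: real \<Rightarrow> 'a::euclidean_space) \<in> borel_measurable borel"
  by (intro borel_measurable_continuous_onI dtower_continuous)

lemma dtower_add: "dtower H1 \<Longrightarrow> dtower H2 \<Longrightarrow> dtower (\<lambda>n x. H1 n x + H2 n x)"
  unfolding dtower_def by (intro allI has_vector_derivative_add; blast)

lemma dtower_diff_bound:
  fixes g :: "nat \<Rightarrow> real \<Rightarrow> 'a::real_normed_vector"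
  assumes g: "dtower g" and b: "\<And>y. y \<in> {a..b} \<Longrightarrow> norm (g (Suc n) y - v) \<le> r"
    and xy: "x \<in> {a..b}" "y \<in> {a..b}"
  shows "norm (g n y - g n x - (y - x) *\<^sub>R v) \<le> r * \<bar>y - x\<bar>"
proof -
  have "norm ((g n y - y *\<^sub>R v) - (g n x - x *\<^sub>R v)) \<le> r * norm (y - x)"
  proof (rule differentiable_bound[of "{a..b}" _ "\<lambda>z h. h *\<^sub>R (g (Suc n) z - v)"])
    fix z assume z: "z \<in> {a..b}"
    have "((\<lambda>z. g n z - z *\<^sub>R v) has_vector_derivative (g (Suc n) z - v)) (at z within {a..b})"
      using dtowerD[OF g] by (intro has_vector_derivative_diff) (auto simp: has_vector_derivative_def intro!: derivative_eq_intros)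
    then show "((\<lambda>z. g n z - z *\<^sub>R v) has_derivative (\<lambda>h. h *\<^sub>R (g (Suc n) z - v))) (at z within {a..b})"
      by (simp add: has_vector_derivative_def)
    show "onorm (\<lambda>h. h *\<^sub>R (g (Suc n) z - v)) \<le> r"
      using b[OF z] by (intro onorm_le) (auto simp: mult.commute[of r] intro: mult_left_mono)
  qed (use xy in auto)
  then show ?thesis by (simp add: algebra_simps)
qed

text \<open>The induction passes to the increment of step \<open>t\<close>, whose derivatives are
  increments of the derivatives of \<open>g\<close>. By the mean value inequality its j-th
  derivative is within \<open>\<bar>t\<bar> * r\<close> of \<open>t *\<^sub>R v\<close> on the
  interval shrunk by \<open>t\<close>.\<close>

lemma fdiff_approx:
  fixes g :: "nat \<Rightarrow> real \<Rightarrow> 'a::real_normed_vector"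
  assumes "dtower g" "\<And>y. y \<in> {a..b} \<Longrightarrow> norm (g j y - v) \<le> r"
    "x \<in> {a..b}" "x + real j * t \<in> {a..b}"
  shows "norm (fdiff j t (g 0) x - t ^ j *\<^sub>R v) \<le> \<bar>t\<bar> ^ j * r"
  using assms
proof (induction j arbitrary: g a b v r)
  case 0
  then show ?case by simp
next
  case (Suc j)
  define h where "h n y = g n (y + t) - g n y" for n y
  have sh: "((\<lambda>y. g n (y + t)) has_vector_derivative g (Suc n) (y + t)) (at y)" for n y
  proof -
    have "((\<lambda>y. y + t) has_vector_derivative 1) (at y)" by (auto intro!: derivative_eq_intros)
    from vector_diff_chain_at[OF this dtowerD[OF Suc.prems(1), of n "y + t" UNIV]]
    show ?thesis by (simp add: o_def)
  qed
  have h: "dtower h"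
    unfolding dtower_def h_def
    by (intro allI has_vector_derivative_diff sh dtowerD[OF Suc.prems(1)])
  let ?a = "max a (a - t)" and ?b = "min b (b - t)"
  have 1: "norm (h j y - t *\<^sub>R v) \<le> \<bar>t\<bar> * r" if "y \<in> {?a..?b}" for y
  proof -
    have "norm (g j (y + t) - g j y - ((y + t) - y) *\<^sub>R v) \<le> r * \<bar>(y + t) - y\<bar>"
      by (rule dtower_diff_bound[OF Suc.prems(1) Suc.prems(2)]) (use that in auto)
    then show ?thesis by (simp add: h_def mult.commute)
  qed
  have tj: "0 \<le> t \<Longrightarrow> 0 \<le> real j * t" "t \<le> 0 \<Longrightarrow> real j * t \<le> 0" by (auto simp: mult_nonneg_nonpos)
  have e: "real (Suc j) * t = real j * t + t" by (simp add: algebra_simps)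
  have inn: "x \<in> {?a..?b}" "x + real j * t \<in> {?a..?b}"
    using Suc.prems(3,4) tj unfolding e atLeastAtMost_iff by (cases "0 \<le> t"; linarith)+
  have "norm (fdiff j t (h 0) x - t ^ j *\<^sub>R (t *\<^sub>R v)) \<le> \<bar>t\<bar> ^ j * (\<bar>t\<bar> * r)"
    by (rule Suc.IH[of h ?a ?b, OF h 1 inn])
  then show ?case by (simp add: h_def[abs_def] mult_ac)
qed

lemma fdiff_powr_le:
  fixes f :: "real \<Rightarrow> 'a::real_normed_vector"
  assumes p: "0 < p" "p \<le> 1"
  shows "norm (fdiff j t f x) powr p \<le> 2 ^ j * (\<Sum>i\<le>j. norm (f (x + real i * t)) powr p)"
proof (induction j arbitrary: f)
  case 0 then show ?case by simp
next
  case (Suc j)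
  let ?N = "\<lambda>i. norm (f (x + real i * t)) powr p"
  have "norm (fdiff (Suc j) t f x) powr p \<le> 2 ^ j * (\<Sum>i\<le>j. norm (f (x + real i * t + t) - f (x + real i * t)) powr p)"
    using Suc[of "\<lambda>y. f (y + t) - f y"] by simp
  also have "\<dots> \<le> 2 ^ j * (\<Sum>i\<le>j. ?N (Suc i) + ?N i)"
  proof (intro mult_left_mono sum_mono)
    fix i
    show "norm (f (x + real i * t + t) - f (x + real i * t)) powr p \<le> ?N (Suc i) + ?N i"
      using norm_powr_subadd[OF p, of "f (x + real i * t + t)" "- f (x + real i * t)"] by (simp add: algebra_simps)
  qed auto
  also have "(\<Sum>i\<le>j. ?N (Suc i) + ?N i) \<le> 2 * (\<Sum>i\<le>Suc j. ?N i)"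
  proof -
    have "(\<Sum>i\<le>j. ?N (Suc i)) \<le> (\<Sum>i\<le>Suc j. ?N i)"
      unfolding sum.atMost_Suc_shift by simp
    moreover have "(\<Sum>i\<le>j. ?N i) \<le> (\<Sum>i\<le>Suc j. ?N i)" by simp
    ultimately show ?thesis by (simp only: sum.distrib)
  qed
  finally show ?case by (simp add: algebra_simps)
qed

text \<open>The value at \<open>x\<close> is recovered from the j-th difference and the values at
  the other nodes. The factor 3 per order pays for the two terms of an increment and for the extra
  summand at \<open>x + t\<close>.\<close>

lemma powr_le_fdiff:
  fixes f :: "real \<Rightarrow> 'a::real_normed_vector"
  assumes p: "0 < p" "p \<le> 1"
  shows "norm (f x) powr p \<le> norm (fdiff j t f x) powr p + 3 ^ j * (\<Sum>i=1..j. norm (f (x + real i * t)) powr p)"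
proof (induction j arbitrary: f)
  case 0 then show ?case by simp
next
  case (Suc j)
  let ?N = "\<lambda>i. norm (f (x + real i * t)) powr p"
  let ?F = "\<lambda>y. f (y + t) - f y"
  have F: "norm (?F y) powr p \<le> norm (f (y + t)) powr p + norm (f y) powr p" for y
    using norm_powr_subadd[OF p, of "f (y + t)" "- f y"] by simp
  have "norm (f x) powr p \<le> norm (f (x + t)) powr p + norm (?F x) powr p"
    using norm_powr_subadd[OF p, of "f (x + t)" "- ?F x"] by (simp add: norm_minus_commute)
  also have "norm (?F x) powr p \<le> norm (fdiff (Suc j) t f x) powr p + 3 ^ j * (\<Sum>i=1..j. norm (?F (x + real i * t)) powr p)"
    using Suc[of ?F] by simp
  also have "(\<Sum>i=1..j. norm (?F (x + real i * t)) powr p) \<le> (\<Sum>i=1..j. ?N (Suc i) + ?N i)"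
    by (intro sum_mono) (use F[of "x + real _ * t"] in \<open>simp add: algebra_simps\<close>)
  also have "\<dots> \<le> 2 * (\<Sum>i=1..Suc j. ?N i) - ?N 1"
  proof -
    have "(\<Sum>i=1..j. ?N (Suc i)) = (\<Sum>i=1..Suc j. ?N i) - ?N 1"
      by (subst (2) sum.atLeast_Suc_atMost) (auto simp: sum.shift_bounds_cl_Suc_ivl simp del: sum.cl_ivl_Suc of_nat_Suc)
    moreover have "(\<Sum>i=1..j. ?N i) \<le> (\<Sum>i=1..Suc j. ?N i)" by simp
    ultimately show ?thesis by (simp only: sum.distrib)
  qed
  finally have 1: "norm (f x) powr p \<le> norm (f (x + t)) powr p + (norm (fdiff (Suc j) t f x) powr p + 3 ^ j * (2 * (\<Sum>i=1..Suc j. ?N i) - ?N 1))"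
    by simp
  have "?N 1 \<le> 3 ^ j * (\<Sum>i=1..Suc j. ?N i) + 3 ^ j * ?N 1"
  proof -
    have "?N 1 \<le> 3 ^ j * ?N 1" using mult_right_mono[of 1 "3 ^ j" "?N 1"] by simp
    moreover have "0 \<le> 3 ^ j * (\<Sum>i=1..Suc j. ?N i)" by (intro mult_nonneg_nonneg sum_nonneg) auto
    ultimately show ?thesis by linarith
  qed
  then show ?case using 1 by (simp add: algebra_simps del: sum.cl_ivl_Suc)
qed

text \<open>Size of the derivatives of \<open>g\<close> on an interval. The derivative of order \<open>j\<close> is called flat if it
  oscillates by at most half of its maximum; there \<open>g\<close> behaves like a polynomial of degree \<open>j\<close>.\<close>

locale tower_on =
  fixes g :: "nat \<Rightarrow> real \<Rightarrow> 'a::euclidean_space" and p a b :: real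
  assumes g: "dtower g" and p: "0 < p" "p < 1" and ab: "a < b"
begin

definition mx :: "nat \<Rightarrow> real" where "mx n = (SUP x\<in>{a..b}. norm (g n x))"
definition Lp :: "nat \<Rightarrow> real" where "Lp n = integral {a..b} (\<lambda>x. norm (g n x) powr p)"
definition L1 :: "nat \<Rightarrow> real" where "L1 n = integral {a..b} (\<lambda>x. norm (g n x))"
definition flat :: "nat \<Rightarrow> bool" where
  "flat n \<longleftrightarrow> (\<forall>x\<in>{a..b}. \<forall>y\<in>{a..b}. norm (g n x - g n y) \<le> mx n / 2)"

lemma cont: "continuous_on S (g n)" by (rule dtower_continuous[OF g])

lemma cont_powr: "continuous_on S (\<lambda>x. norm (g n x) powr p)"
  by (rule cont_powr_norm[OF cont p(1)])

lemma cont_norm: "continuous_on S (\<lambda>x. norm (g n x))"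
  by (intro continuous_on_norm cont)

lemma mx_attained: obtains x where "x \<in> {a..b}" "norm (g n x) = mx n"
proof -
  obtain x where x: "x \<in> {a..b}" "\<And>y. y \<in> {a..b} \<Longrightarrow> norm (g n y) \<le> norm (g n x)"
    using continuous_attains_sup[of "{a..b}" "\<lambda>x. norm (g n x)"] cont_norm[of "{a..b}" n] ab by auto
  have "mx n = norm (g n x)"
    unfolding mx_def by (rule cSup_eq_maximum) (use x in auto)
  then show thesis using that x by metis
qed

lemma mx_ge: "x \<in> {a..b} \<Longrightarrow> norm (g n x) \<le> mx n"
  unfolding mx_def
  by (intro cSUP_upper bounded_imp_bdd_above compact_imp_bounded compact_continuous_image cont_norm) auto

lemma mx_nonneg: "0 \<le> mx n" using order_trans[OF norm_ge_zero mx_ge[of a n]] ab by simp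

lemma Lp_nonneg: "0 \<le> Lp n"
  unfolding Lp_def by (intro integral_nonneg integrable_continuous_interval cont_powr) auto

text \<open>The norm is split into its powers \<open>p\<close> and \<open>1 - p\<close>. The second
  exponent is the ratio \<open>q\<close> of the recursion for the exponents.\<close>

lemma L1_le_Lp: "L1 n \<le> Lp n * mx n powr (1 - p)"
proof -
  have "L1 n \<le> integral {a..b} (\<lambda>x. norm (g n x) powr p * mx n powr (1 - p))"
    unfolding L1_def
  proof (intro integral_le integrable_continuous_interval cont_norm continuous_on_mult_right cont_powr)
    fix x assume x: "x \<in> {a..b}"
    show "norm (g n x) \<le> norm (g n x) powr p * mx n powr (1 - p)"
    proof (cases "g n x = 0")
      case False
      then have "norm (g n x) = norm (g n x) powr p * norm (g n x) powr (1 - p)"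
        by (simp add: powr_add[symmetric])
      also have "\<dots> \<le> norm (g n x) powr p * mx n powr (1 - p)"
        using mx_ge[OF x] p by (intro mult_left_mono powr_mono2) auto
      finally show ?thesis .
    qed simp
  qed
  then show ?thesis by (simp add: Lp_def)
qed

lemma L1_le_mx: "L1 n \<le> (b - a) * mx n"
proof -
  have "L1 n \<le> integral {a..b} (\<lambda>x. mx n)"
    unfolding L1_def by (intro integral_le integrable_continuous_interval cont_norm) (use mx_ge in auto)
  then show ?thesis using ab by simp
qed

lemma diff_le_L1:
  assumes "x \<in> {a..b}" "y \<in> {a..b}" shows "norm (g n x - g n y) \<le> L1 (Suc n)"
proof -
  have *: "norm (g n v - g n u) \<le> L1 (Suc n)" if "u \<le> v" "u \<in> {a..b}" "v \<in> {a..b}" for u v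
  proof -
    have "(g (Suc n) has_integral (g n v - g n u)) {u..v}"
      by (rule fundamental_theorem_of_calculus[OF that(1)]) (rule dtowerD[OF g])
    then have "norm (g n v - g n u) = norm (integral {u..v} (g (Suc n)))" by (simp add: integral_unique)
    also have "\<dots> \<le> integral {u..v} (\<lambda>x. norm (g (Suc n) x))"
      by (intro integral_norm_bound_integral integrable_continuous_interval cont cont_norm) auto
    also have "\<dots> \<le> L1 (Suc n)"
      unfolding L1_def using that by (intro integral_subset_le integrable_continuous_interval cont_norm) auto
    finally show ?thesis .
  qed
  show ?thesis using *[of x y] *[of y x] assms by (cases "x \<le> y") (auto simp: norm_minus_commute)
qed

text \<open>An oscillation above half of the maximum is bounded by the integral of the next
  derivative. In logarithms this is a lower bound for \<open>mx (Suc n)\<close> of the same form as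
  the budget condition on the widths of a bump, which makes the two comparable.\<close>

lemma not_flat_chain:
  assumes "\<not> flat n" shows "mx n \<le> 2 * Lp (Suc n) * mx (Suc n) powr (1 - p)"
proof -
  obtain x y where xy: "x \<in> {a..b}" "y \<in> {a..b}" "mx n / 2 < norm (g n x - g n y)"
    using assms by (auto simp: flat_def not_le)
  then show ?thesis using diff_le_L1[OF xy(1,2), of n] L1_le_Lp[of "Suc n"] by linarith
qed

lemma not_flat_pos:
  assumes "\<not> flat n" shows "0 < mx n" "0 < mx (Suc n)" "mx n \<le> 2 * (b - a) * mx (Suc n)"
proof -
  obtain x y where xy: "x \<in> {a..b}" "y \<in> {a..b}" "mx n / 2 < norm (g n x - g n y)"
    using assms by (auto simp: flat_def not_le)
  have "norm (g n x - g n y) \<le> mx n + mx n"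
    using norm_triangle_ineq4[of "g n x" "g n y"] mx_ge[OF xy(1), of n] mx_ge[OF xy(2), of n] by linarith
  then show 0: "0 < mx n" using xy(3) by linarith
  show 1: "mx n \<le> 2 * (b - a) * mx (Suc n)"
    using xy(3) diff_le_L1[OF xy(1,2), of n] L1_le_mx[of "Suc n"] by linarith
  show "0 < mx (Suc n)"
    using 0 1 mx_nonneg[of "Suc n"] ab by (cases "mx (Suc n) = 0") auto
qed

text \<open>The derivative needs a distance of order \<open>mx n / mx (Suc n)\<close> to move away
  from its largest value. Without flatness, \<open>not_flat_pos\<close> shows that this distance is
  at most half of the interval.\<close>

lemma not_flat_nbhd:
  assumes "\<not> flat n"
  defines "w \<equiv> mx n / (4 * mx (Suc n))"
  obtains x u v where "norm (g n x) = mx n" "a \<le> u" "v \<le> b" "v = u + w" "x \<in> {a..b}"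
    "\<And>y. y \<in> {u..v} \<Longrightarrow> norm (g n y - g n x) \<le> mx n / 4"
proof -
  note pos = not_flat_pos[OF assms(1)]
  obtain x where x: "x \<in> {a..b}" "norm (g n x) = mx n" by (rule mx_attained)
  have w: "0 < w" "w \<le> (b - a) / 2" using pos by (auto simp: w_def field_simps)
  \<comment> \<open>The stretch of length \<open>w\<close> goes to the side of \<open>x\<close> on
    which at least half of the interval lies.\<close>
  define u where "u = (if x \<le> (a + b) / 2 then x else x - w)"
  have near: "norm (g n y - g n x) \<le> mx n / 4" if y: "y \<in> {u..u + w}" for y
  proof -
    have yx: "\<bar>y - x\<bar> \<le> w" "y \<in> {a..b}" using y w x(1) by (auto simp: u_def field_simps split: if_splits)
    have "norm (g n y - g n x - (y - x) *\<^sub>R 0) \<le> mx (Suc n) * \<bar>y - x\<bar>"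
      by (rule dtower_diff_bound[OF g _ x(1) yx(2)]) (use mx_ge in auto)
    also have "\<dots> \<le> mx (Suc n) * w" using yx pos by (intro mult_left_mono) auto
    also have "\<dots> = mx n / 4" using pos by (simp add: w_def)
    finally show ?thesis by simp
  qed
  show thesis
    by (rule that[of x u "u + w"]) (use x w near in \<open>auto simp: u_def field_simps\<close>)
qed

text \<open>The same inequality as \<open>not_flat_convex\<close> one order lower, with
  \<open>L1 0\<close> in place of the maximum of a primitive.\<close>

lemma not_flat_convex_0:
  assumes "\<not> flat 0" shows "(mx 0)\<^sup>2 \<le> 16 * L1 0 * mx 1"
proof -
  note pos = not_flat_pos[OF assms(1)]
  obtain x u v where *: "norm (g 0 x) = mx 0" "a \<le> u" "v \<le> b" "v = u + mx 0 / (4 * mx (Suc 0))" "x \<in> {a..b}"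
    "\<And>y. y \<in> {u..v} \<Longrightarrow> norm (g 0 y - g 0 x) \<le> mx 0 / 4"
    using not_flat_nbhd[OF assms] by blast
  have uv: "u \<le> v" using * pos by simp
  have "mx 0 / 2 * (v - u) = integral {u..v} (\<lambda>_. mx 0 / 2)" using uv by simp
  also have "\<dots> \<le> integral {u..v} (\<lambda>y. norm (g 0 y))"
  proof (intro integral_le integrable_continuous_interval cont_norm)
    fix y assume "y \<in> {u..v}"
    then show "mx 0 / 2 \<le> norm (g 0 y)"
      using *(6)[of y] *(1) norm_triangle_ineq2[of "g 0 x" "g 0 y"] norm_minus_commute[of "g 0 x" "g 0 y"] pos by linarith
  qed auto
  also have "\<dots> \<le> L1 0"
    unfolding L1_def using * by (intro integral_subset_le integrable_continuous_interval cont_norm) auto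
  finally have "mx 0 / 2 * (mx 0 / (4 * mx 1)) \<le> L1 0" using *(4) by simp
  then have "(mx 0)\<^sup>2 \<le> 8 * (L1 0 * mx 1)" using pos by (simp add: field_simps power2_eq_square)
  moreover have "0 \<le> L1 0 * mx 1"
    unfolding L1_def using pos by (intro mult_nonneg_nonneg integral_nonneg integrable_continuous_interval cont_norm) auto
  ultimately show ?thesis by (simp only: mult.assoc)
qed

text \<open>An inequality of Landau-Kolmogorov type: order \<open>Suc n\<close> is nearly constant
  on a stretch of length \<open>mx (Suc n) / (4 * mx (Suc (Suc n)))\<close>, and order
  \<open>n\<close> changes there by about this length times \<open>mx (Suc n)\<close>. In logarithms
  the increments of the maxima drop by at most \<open>ln 16\<close> per order, the counterpart of
  the halving of the widths.\<close>

lemma not_flat_convex: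
  assumes "\<not> flat (Suc n)" shows "(mx (Suc n))\<^sup>2 \<le> 16 * mx n * mx (Suc (Suc n))"
proof -
  let ?m = "mx (Suc n)"
  note pos = not_flat_pos[OF assms(1)]
  obtain x u v where *: "norm (g (Suc n) x) = ?m" "a \<le> u" "v \<le> b" "v = u + ?m / (4 * mx (Suc (Suc n)))" "x \<in> {a..b}"
    "\<And>y. y \<in> {u..v} \<Longrightarrow> norm (g (Suc n) y - g (Suc n) x) \<le> ?m / 4"
    using not_flat_nbhd[OF assms] by blast
  have uv: "u \<le> v" using * pos by simp
  have 1: "norm (g n v - g n u - (v - u) *\<^sub>R g (Suc n) x) \<le> ?m / 4 * \<bar>v - u\<bar>"
    by (rule dtower_diff_bound[OF g *(6)]) (use uv in auto)
  have "norm ((v - u) *\<^sub>R g (Suc n) x) = (v - u) * ?m" using uv *(1) by simp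
  moreover have "norm ((v - u) *\<^sub>R g (Suc n) x) \<le> norm (g n v - g n u) + norm (g n v - g n u - (v - u) *\<^sub>R g (Suc n) x)"
    using norm_triangle_ineq4[of "g n v - g n u" "g n v - g n u - (v - u) *\<^sub>R g (Suc n) x"] by simp
  moreover have "norm (g n v - g n u) \<le> mx n + mx n"
    using norm_triangle_ineq4[of "g n v" "g n u"] mx_ge[of v n] mx_ge[of u n] * uv by auto
  ultimately have "(v - u) * ?m \<le> 2 * mx n + ?m / 4 * (v - u)" using 1 uv by (simp only: abs_of_nonneg diff_ge_0_iff_ge)
  then have "3 / 4 * ?m * (?m / (4 * mx (Suc (Suc n)))) \<le> 2 * mx n" using *(4) by (simp add: algebra_simps)
  then have "3 * ?m\<^sup>2 \<le> 32 * (mx n * mx (Suc (Suc n)))" using pos by (simp add: field_simps power2_eq_square)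
  moreover have "0 \<le> mx n * mx (Suc (Suc n))" using mx_nonneg by simp
  ultimately show ?thesis by (simp only: mult.assoc)
qed

text \<open>A nearly constant derivative integrates to at least half of
  \<open>(b - a) * mx (Suc n)\<close> over the interval. This controls the last increment of the
  logarithms of the maxima, where the comparison with the greedy exponents ends.\<close>

lemma flat_prev:
  assumes "flat (Suc n)" shows "(b - a) * mx (Suc n) \<le> 4 * mx n"
proof -
  obtain x where x: "x \<in> {a..b}" "norm (g (Suc n) x) = mx (Suc n)" by (rule mx_attained)
  have 1: "norm (g n b - g n a - (b - a) *\<^sub>R g (Suc n) x) \<le> mx (Suc n) / 2 * \<bar>b - a\<bar>"
    by (rule dtower_diff_bound[OF g, of a b]) (use assms x ab in \<open>auto simp: flat_def\<close>)
  have "norm ((b - a) *\<^sub>R g (Suc n) x) = (b - a) * mx (Suc n)" using ab x by simp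
  moreover have "norm ((b - a) *\<^sub>R g (Suc n) x) \<le> norm (g n b - g n a) + norm (g n b - g n a - (b - a) *\<^sub>R g (Suc n) x)"
    using norm_triangle_ineq4[of "g n b - g n a" "g n b - g n a - (b - a) *\<^sub>R g (Suc n) x"] by simp
  moreover have "norm (g n b - g n a) \<le> mx n + mx n"
    using norm_triangle_ineq4[of "g n b" "g n a"] mx_ge[of b n] mx_ge[of a n] ab by auto
  ultimately have "(b - a) * mx (Suc n) \<le> 2 * mx n + mx (Suc n) / 2 * (b - a)" using 1 ab by simp
  then have "(b - a) * mx (Suc n) \<le> 2 * mx n + ((b - a) * mx (Suc n)) / 2" by (simp only: times_divide_eq_left mult.commute)
  then show ?thesis by linarith
qed

text \<open>\<open>j\<close> steps cover at most half of the interval, and the summand 1 keeps the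
  denominator positive for \<open>j = 0\<close>.\<close>

definition stp :: "nat \<Rightarrow> real" where "stp j = (b - a) / (2 * (real j + 1))"

lemma stp: "0 < stp j" "real j * stp j \<le> (b - a) / 2" "stp j \<le> b - a"
proof -
  show "0 < stp j" using ab by (simp add: stp_def)
  have "real j * (b - a) \<le> (real j + 1) * (b - a)" "0 \<le> real j * (b - a)" using ab by (auto intro: mult_right_mono)
  then show "real j * stp j \<le> (b - a) / 2" "stp j \<le> b - a"
    using ab by (simp_all add: stp_def field_simps)
qed

text \<open>For a flat derivative the j-th difference has norm at least
  \<open>stp j ^ j * mx j / 2\<close> from every starting point in the left half, while it is
  composed of values of \<open>g 0\<close>. Integrating over the starting points brings in
  \<open>Lp 0\<close>.\<close>

lemma flat_deriv_bound:
  assumes fl: "flat j"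
  shows "(stp j ^ j * mx j) powr p \<le> 2 ^ (j + 2) * (real j + 1) * Lp 0 / (b - a)"
proof -
  let ?t = "stp j" and ?m = "(a + b) / 2"
  obtain x0 where x0: "x0 \<in> {a..b}" "norm (g j x0) = mx j" by (rule mx_attained)
  have inn: "y + real i * ?t \<in> {a..b}" if "y \<in> {a..?m}" "i \<le> j" for y i
  proof -
    have "0 \<le> real i * ?t" using stp[of j] by simp
    moreover have "real i * ?t \<le> real j * ?t" using that stp[of j] by (intro mult_right_mono) auto
    ultimately show ?thesis using that stp(2)[of j] by (auto simp: field_simps)
  qed
  have low: "(?t ^ j * mx j / 2) powr p \<le> 2 ^ j * (\<Sum>i\<le>j. norm (g 0 (y + real i * ?t)) powr p)" if y: "y \<in> {a..?m}" for y
  proof -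
    have "norm (fdiff j ?t (g 0) y - ?t ^ j *\<^sub>R g j x0) \<le> \<bar>?t\<bar> ^ j * (mx j / 2)"
      by (rule fdiff_approx[OF g, of a b]) (use fl x0 y inn[OF y, of j] ab in \<open>auto simp: flat_def\<close>)
    moreover have "norm (?t ^ j *\<^sub>R g j x0) = ?t ^ j * mx j" using stp(1)[of j] x0 by simp
    ultimately have "?t ^ j * mx j / 2 \<le> norm (fdiff j ?t (g 0) y)"
      using norm_triangle_ineq2[of "?t ^ j *\<^sub>R g j x0" "fdiff j ?t (g 0) y"]
        norm_minus_commute[of "?t ^ j *\<^sub>R g j x0" "fdiff j ?t (g 0) y"] stp(1)[of j] by simp
    then have "(?t ^ j * mx j / 2) powr p \<le> norm (fdiff j ?t (g 0) y) powr p"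
      using p stp(1)[of j] mx_nonneg[of j] by (intro powr_mono2) auto
    also have "\<dots> \<le> 2 ^ j * (\<Sum>i\<le>j. norm (g 0 (y + real i * ?t)) powr p)"
      using p by (intro fdiff_powr_le) auto
    finally show ?thesis .
  qed
  have af: "(\<lambda>s. norm (g 0 ((a + real i * ?t) + 1 * s)) powr p) integrable_on {0..(b - a) / 2}"
    "integral {0..(b - a) / 2} (\<lambda>s. norm (g 0 ((a + real i * ?t) + 1 * s)) powr p) \<le> Lp 0" if "i \<le> j" for i
    unfolding Lp_def
    using integral_affine_le[OF cont_powr, of a b 0 1 "(b - a) / 2" "a + real i * ?t"] inn[of a i] inn[of ?m i] that ab
    by (auto simp: algebra_simps field_simps)
  have "(?t ^ j * mx j / 2) powr p * ((b - a) / 2) = integral {0..(b - a) / 2} (\<lambda>s. (?t ^ j * mx j / 2) powr p)"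
    using ab by simp
  also have "\<dots> \<le> integral {0..(b - a) / 2} (\<lambda>s. 2 ^ j * (\<Sum>i\<le>j. norm (g 0 ((a + real i * ?t) + 1 * s)) powr p))"
  proof (intro integral_le)
    show "(\<lambda>s. 2 ^ j * (\<Sum>i\<le>j. norm (g 0 ((a + real i * ?t) + 1 * s)) powr p)) integrable_on {0..(b - a) / 2}"
      by (intro integrable_on_mult_right integrable_sum af(1)) auto
    fix s assume "s \<in> {0..(b - a) / 2}"
    then show "(?t ^ j * mx j / 2) powr p \<le> 2 ^ j * (\<Sum>i\<le>j. norm (g 0 ((a + real i * ?t) + 1 * s)) powr p)"
      using low[of "a + s"] by (simp add: field_simps)
  qed auto
  also have "\<dots> = 2 ^ j * (\<Sum>i\<le>j. integral {0..(b - a) / 2} (\<lambda>s. norm (g 0 ((a + real i * ?t) + 1 * s)) powr p))"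
    by (subst integral_mult_right, subst integral_sum) (use af(1) in auto)
  also have "\<dots> \<le> 2 ^ j * (\<Sum>i\<le>j. Lp 0)"
    by (intro mult_left_mono sum_mono af(2)) auto
  finally have 1: "(?t ^ j * mx j / 2) powr p * (b - a) \<le> 2 ^ (j + 1) * (real j + 1) * Lp 0" by (simp add: algebra_simps)
  have "(?t ^ j * mx j) powr p = 2 powr p * (?t ^ j * mx j / 2) powr p"
    using stp(1)[of j] mx_nonneg[of j] by (simp add: powr_divide)
  also have "\<dots> \<le> 2 * (?t ^ j * mx j / 2) powr p"
    using p powr_mono[of p 1 "2::real"] by (intro mult_right_mono) auto
  finally have "(?t ^ j * mx j) powr p * (b - a) \<le> 2 * (?t ^ j * mx j / 2) powr p * (b - a)"
    using ab by (intro mult_right_mono) auto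
  also have "\<dots> \<le> 2 * (2 ^ (j + 1) * (real j + 1) * Lp 0)" using 1 by (simp only: mult.assoc)
  also have "\<dots> = 2 ^ (j + 2) * (real j + 1) * Lp 0" by simp
  finally show ?thesis using ab by (simp add: field_simps)
qed

text \<open>An inequality of Nikolskii type, as for polynomials of degree \<open>j\<close>. The
  value at the maximum point is expressed through the j-th difference and the other nodes, and then
  averaged over the step: every node sweeps an interval, which produces \<open>Lp 0\<close>.\<close>

lemma flat_sup_bound:
  assumes fl: "flat j"
  shows "mx 0 powr p \<le> (2 ^ (j + 2) * (real j + 1) + 3 ^ j * (real j * (2 * (real j + 1)))) * Lp 0 / (b - a)"
proof -
  let ?T = "stp j"
  obtain x where x: "x \<in> {a..b}" "norm (g 0 x) = mx 0" by (rule mx_attained)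
  \<comment> \<open>The direction in which at least half of the interval lies, so that all nodes
    stay inside.\<close>
  define c :: real where "c = (if x \<le> (a + b) / 2 then 1 else -1)"
  have inn: "x + real i * (c * t) \<in> {a..b}" if "i \<le> j" "t \<in> {0..?T}" for i t
  proof -
    have "0 \<le> real i * t" using that by simp
    moreover have "real i * t \<le> real j * ?T" using that by (intro mult_mono) auto
    ultimately show ?thesis using x(1) stp(2)[of j] by (auto simp: c_def field_simps split: if_splits)
  qed
  have up: "mx 0 powr p \<le> (?T ^ j * mx j) powr p + 3 ^ j * (\<Sum>i=1..j. norm (g 0 (x + (real i * c) * t)) powr p)"
    if t: "t \<in> {0..?T}" for t
  proof -
    have "norm (fdiff j (c * t) (g 0) x - (c * t) ^ j *\<^sub>R 0) \<le> \<bar>c * t\<bar> ^ j * mx j"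
      by (rule fdiff_approx[OF g, of a b]) (use x inn[OF order_refl t] mx_ge in auto)
    also have "\<dots> = t ^ j * mx j" using t by (simp add: c_def abs_mult)
    also have "\<dots> \<le> ?T ^ j * mx j" using t mx_nonneg by (intro mult_right_mono power_mono) auto
    finally have "norm (fdiff j (c * t) (g 0) x) powr p \<le> (?T ^ j * mx j) powr p"
      using p by (intro powr_mono2) auto
    then show ?thesis using powr_le_fdiff[of p "g 0" x j "c * t"] p x(2) by (simp add: mult_ac)
  qed
  have af: "(\<lambda>t. norm (g 0 (x + (real i * c) * t)) powr p) integrable_on {0..?T}"
    "integral {0..?T} (\<lambda>t. norm (g 0 (x + (real i * c) * t)) powr p) \<le> Lp 0" if "i \<in> {1..j}" for i
    unfolding Lp_def
    using integral_affine_le[OF cont_powr, of a b 0 "real i * c" ?T x] inn[of i ?T] that x stp(1)[of j]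
    by (auto simp: c_def abs_mult mult_ac)
  have "mx 0 powr p * ?T = integral {0..?T} (\<lambda>t. mx 0 powr p)" using stp(1)[of j] by simp
  also have "\<dots> \<le> integral {0..?T} (\<lambda>t. (?T ^ j * mx j) powr p + 3 ^ j * (\<Sum>i=1..j. norm (g 0 (x + (real i * c) * t)) powr p))"
    by (intro integral_le up integrable_add integrable_on_mult_right integrable_sum af(1)) auto
  also have "\<dots> = (?T ^ j * mx j) powr p * ?T + 3 ^ j * (\<Sum>i=1..j. integral {0..?T} (\<lambda>t. norm (g 0 (x + (real i * c) * t)) powr p))"
  proof -
    let ?f = "\<lambda>i t. norm (g 0 (x + (real i * c) * t)) powr p"
    have s: "(\<lambda>t. \<Sum>i=1..j. ?f i t) integrable_on {0..?T}" by (intro integrable_sum af(1)) auto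
    have "integral {0..?T} (\<lambda>t. (?T ^ j * mx j) powr p + 3 ^ j * (\<Sum>i=1..j. ?f i t))
      = integral {0..?T} (\<lambda>t. (?T ^ j * mx j) powr p) + integral {0..?T} (\<lambda>t. 3 ^ j * (\<Sum>i=1..j. ?f i t))"
      by (rule integral_add) (use s in \<open>auto intro!: integrable_on_mult_right\<close>)
    also have "integral {0..?T} (\<lambda>t. 3 ^ j * (\<Sum>i=1..j. ?f i t)) = 3 ^ j * integral {0..?T} (\<lambda>t. (\<Sum>i=1..j. ?f i t))"
      by (rule integral_mult_right)
    also have "integral {0..?T} (\<lambda>t. (\<Sum>i=1..j. ?f i t)) = (\<Sum>i=1..j. integral {0..?T} (?f i))"
      by (rule integral_sum) (use af(1) in auto)
    finally show ?thesis using stp(1)[of j] by simp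
  qed
  also have "\<dots> \<le> (2 ^ (j + 2) * (real j + 1) * Lp 0 / (b - a)) * ?T + 3 ^ j * (\<Sum>i=1..j. Lp 0)"
    using stp(1)[of j] by (intro add_mono mult_right_mono mult_left_mono sum_mono af(2) flat_deriv_bound[OF fl]) auto
  finally have "mx 0 powr p * ?T \<le> (2 ^ (j + 2) * (real j + 1) * Lp 0 / (b - a)) * ?T + 3 ^ j * (real j * Lp 0)" by simp
  then have "mx 0 powr p \<le> (2 ^ (j + 2) * (real j + 1) * Lp 0 / (b - a)) + 3 ^ j * (real j * Lp 0) / ?T"
    using stp(1)[of j] by (simp add: field_simps)
  also have "\<dots> = (2 ^ (j + 2) * (real j + 1) + 3 ^ j * (real j * (2 * (real j + 1)))) * Lp 0 / (b - a)"
  proof -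
    have "3 ^ j * (real j * Lp 0) / ?T = 3 ^ j * (real j * (2 * (real j + 1))) * Lp 0 / (b - a)"
      by (simp add: stp_def mult_ac)
    then show ?thesis by (simp only: distrib_right add_divide_distrib)
  qed
  finally show ?thesis .
qed

end

section \<open>Bumps with prescribed $L^p$ norms of the derivatives\<close>

text \<open>\<open>exp R\<close> is an inverse width and \<open>exp X\<close> is \<open>D\<close>
  times the product of the inverse widths chosen so far. The second entry of the maximum is the
  value at which the bound for the L^p norm becomes equal to \<open>a k\<close>. The start of
  \<open>R\<close> is lowered by \<open>ln 2\<close> because the first width used is the one at
  index 1, which has to be at most \<open>l\<close>.\<close>

fun greedy_XR :: "real \<Rightarrow> real \<Rightarrow> real \<Rightarrow> (nat \<Rightarrow> real) \<Rightarrow> nat \<Rightarrow> real \<times> real" where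
  "greedy_XR p D l a 0 = (ln D, ln (1 / l) - ln 2)"
| "greedy_XR p D l a (Suc k) =
    (let X = fst (greedy_XR p D l a k);
         R = max (snd (greedy_XR p D l a k) + ln 2) ((p * X - ln (a k) + (real k + 1) * ln 4) / (1 - p))
     in (X + R, R))"

definition "greedy_X p D l a k = fst (greedy_XR p D l a k)"
definition "greedy_R p D l a k = snd (greedy_XR p D l a k)"

lemma greedy_simps:
  "greedy_X p D l a 0 = ln D" "greedy_R p D l a 0 = ln (1 / l) - ln 2"
  "greedy_X p D l a (Suc k) = greedy_X p D l a k + greedy_R p D l a (Suc k)"
  "greedy_R p D l a (Suc k) = max (greedy_R p D l a k + ln 2)
     ((p * greedy_X p D l a k - ln (a k) + (real k + 1) * ln 4) / (1 - p))"
  by (simp_all add: greedy_X_def greedy_R_def Let_def)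

text \<open>A multiple of \<open>cdf\<close> whose tail widths are \<open>exp (- R)\<close>. The
  parameter \<open>D\<close> may exceed \<open>norm c\<close>: it sets the starting value of the
  recursion and remains positive when the increment vanishes.\<close>

lemma greedy_bump:
  fixes c :: "'a::euclidean_space"
  assumes p: "0 < p" "p < 1" and D: "0 < D" "norm c \<le> D" and l: "0 < l" and a: "\<And>k. 0 < a k"
  obtains H :: "nat \<Rightarrow> real \<Rightarrow> 'a" where "dtower H"
    "\<And>x. x \<le> x0 \<Longrightarrow> H 0 x = 0" "\<And>x. x0 + l \<le> x \<Longrightarrow> H 0 x = c" "\<And>x. norm (H 0 x) \<le> norm c"
    "\<And>n x. x \<le> x0 \<or> x0 + l \<le> x \<Longrightarrow> H (Suc n) x = 0"
    "\<And>n x. norm (H (Suc n) x) \<le> 4 ^ Suc n * exp (greedy_X p D l a (Suc n))"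
    "\<And>n. (\<integral>\<^sup>+x. ennreal (norm (H (Suc n) x) powr p) \<partial>lborel) \<le> ennreal (a n)"
proof -
  let ?X = "greedy_X p D l a" and ?R = "greedy_R p D l a"
  define r where "r n = exp (- ?R (Suc n))" for n
  have "shrinking r"
  proof
    fix n
    have "- ?R (Suc (Suc n)) \<le> - ?R (Suc n) - ln 2" by (simp add: greedy_simps(4)[of p D l a "Suc n"])
    then have "r (Suc n) \<le> exp (- ?R (Suc n) - ln 2)" unfolding r_def by simp
    also have "\<dots> = r n / 2" by (simp add: r_def exp_diff)
    finally show "r (Suc n) \<le> r n / 2" .
  qed (simp add: r_def)
  then interpret shrinking r .
  have "ln (1 / l) \<le> ?R (Suc 0)" by (simp add: greedy_simps)
  then have "r 0 \<le> exp (- ln (1 / l))" unfolding r_def by simp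
  also have "\<dots> = l" using l by (simp add: ln_div)
  finally have r0: "r 0 \<le> l" .
  have X: "D * (\<Prod>i<k. 1 / r i) = exp (?X k)" for k
  proof (induction k)
    case (Suc k)
    then show ?case by (simp add: greedy_simps(3) exp_add r_def exp_minus field_simps)
  qed (use D in \<open>simp add: greedy_simps\<close>)
  have rX: "(\<Prod>i<k. r i powr (-p)) = exp (p * ?X k) / D powr p" for k
  proof -
    have "(\<Prod>i<k. r i powr (-p)) = (\<Prod>i<k. (1 / r i) powr p)"
      using r_pos by (intro prod.cong refl) (simp add: powr_divide powr_minus_divide)
    also have "\<dots> = (\<Prod>i<k. 1 / r i) powr p" by (rule prod_powr_distrib[symmetric])
    also have "(\<Prod>i<k. 1 / r i) = exp (?X k) / D" using X[of k] D by (simp add: field_simps)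
    finally show ?thesis using D by (simp add: powr_divide exp_powr_real mult.commute)
  qed
  define H where "H n x = cdf_deriv n 0 (x - x0) *\<^sub>R c" for n x
  show thesis
  proof (rule that[of H])
    show "dtower H"
      unfolding dtower_def
    proof (intro allI)
      fix n x
      have "((\<lambda>x. cdf_deriv n 0 (x - x0)) has_real_derivative cdf_deriv (Suc n) 0 (x - x0) * (1 - 0)) (at x)"
        by (intro DERIV_chain2[OF cdf_deriv_derivative] DERIV_diff DERIV_ident DERIV_const)
      then have "((\<lambda>x. cdf_deriv n 0 (x - x0)) has_real_derivative cdf_deriv (Suc n) 0 (x - x0)) (at x)"
        by (simp only: diff_0_right mult_1_right)
      from has_vector_derivative_scaleR[OF this has_vector_derivative_const[of c]]
      show "(H n has_vector_derivative H (Suc n) x) (at x)"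
        by (simp add: H_def[abs_def] del: cdf_deriv.simps)
    qed
    show "H 0 x = 0" if "x \<le> x0" for x using cdf_ramp[of 0] that by (simp add: H_def ramp_like_def)
    show "H 0 x = c" if "x0 + l \<le> x" for x using cdf_ramp[of 0] that r0 by (simp add: H_def ramp_like_def)
    show "norm (H 0 x) \<le> norm c" for x
      using ramp_like_bounds[OF cdf_ramp, of 0 "x - x0"] by (simp add: H_def mult_left_le_one_le)
    show "H (Suc n) x = 0" if "x \<le> x0 \<or> x0 + l \<le> x" for n x
    proof -
      have "cdf_deriv (Suc n) 0 (x - x0) = 0" by (rule cdf_deriv_support) (use that r0 in auto)
      then show ?thesis by (simp only: H_def scaleR_zero_left)
    qed
    show "norm (H (Suc n) x) \<le> 4 ^ Suc n * exp (?X (Suc n))" for n x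
    proof -
      have "norm (H (Suc n) x) = \<bar>cdf_deriv (Suc n) 0 (x - x0)\<bar> * norm c" by (simp only: H_def norm_scaleR)
      also have "\<dots> \<le> (\<Prod>i<Suc n. 4 / r (0 + i)) * D"
        using D by (intro mult_mono cdf_deriv_bound prod_nonneg) (auto intro: less_imp_le[OF r_pos])
      also have "(\<Prod>i<Suc n. 4 / r (0 + i)) = 4 ^ Suc n * (\<Prod>i<Suc n. 1 / r i)"
      proof -
        have "(\<Prod>i<Suc n. 4 / r (0 + i)) = (\<Prod>i<Suc n. 4 * (1 / r i))" by simp
        also have "\<dots> = (\<Prod>i<Suc n. 4) * (\<Prod>i<Suc n. 1 / r i)" by (rule prod.distrib)
        finally show ?thesis by (simp only: prod_constant card_lessThan)
      qed
      also have "\<dots> * D = 4 ^ Suc n * exp (?X (Suc n))" 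
        by (simp only: X[of "Suc n", symmetric] mult.assoc mult.commute[of D])
      finally show ?thesis .
    qed
    show "(\<integral>\<^sup>+x. ennreal (norm (H (Suc n) x) powr p) \<partial>lborel) \<le> ennreal (a n)" for n
    proof -
      let ?B = "4 ^ Suc n * (\<Prod>i<n. r (0 + i) powr (-p)) * r (0 + n) powr (1 - p)"
      have "(\<integral>\<^sup>+x. ennreal (norm (H (Suc n) x) powr p) \<partial>lborel)
        \<le> (\<integral>\<^sup>+x. ennreal (D powr p) * ennreal (\<bar>cdf_deriv (Suc n) 0 (x - x0)\<bar> powr p) \<partial>lborel)"
      proof (intro nn_integral_mono)
        fix x
        have "norm (H (Suc n) x) powr p = norm c powr p * \<bar>cdf_deriv (Suc n) 0 (x - x0)\<bar> powr p"
          by (simp only: H_def norm_scaleR powr_mult abs_ge_zero norm_ge_zero mult.commute)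
        also have "\<dots> \<le> D powr p * \<bar>cdf_deriv (Suc n) 0 (x - x0)\<bar> powr p"
          using D p by (intro mult_right_mono powr_mono2) auto
        finally show "ennreal (norm (H (Suc n) x) powr p) \<le> ennreal (D powr p) * ennreal (\<bar>cdf_deriv (Suc n) 0 (x - x0)\<bar> powr p)"
          by (simp only: ennreal_mult[symmetric] powr_ge_zero ennreal_leI)
      qed
      also have "\<dots> = ennreal (D powr p) * (\<integral>\<^sup>+x. ennreal (\<bar>cdf_deriv (Suc n) 0 (x - x0)\<bar> powr p) \<partial>lborel)"
        by (rule nn_integral_cmult) measurable
      also have "(\<integral>\<^sup>+x. ennreal (\<bar>cdf_deriv (Suc n) 0 (x - x0)\<bar> powr p) \<partial>lborel)
         = (\<integral>\<^sup>+x. ennreal (\<bar>cdf_deriv (Suc n) 0 x\<bar> powr p) \<partial>lborel)"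
        using nn_integral_real_affine[of "\<lambda>x. ennreal (\<bar>cdf_deriv (Suc n) 0 (x - x0)\<bar> powr p)" 1 x0] by (simp del: cdf_deriv.simps)
      also have "ennreal (D powr p) * \<dots> \<le> ennreal (D powr p) * ennreal ?B"
        by (intro mult_left_mono cdf_deriv_Lp p) auto
      also have "\<dots> = ennreal (D powr p * ?B)"
        by (rule ennreal_mult[symmetric]) (auto intro!: mult_nonneg_nonneg prod_nonneg)
      also have "D powr p * ?B = exp ((real n + 1) * ln 4) * exp (p * ?X n) * exp (- (1 - p) * ?R (Suc n))"
      proof -
        have "(4::real) ^ Suc n = exp ((real n + 1) * ln 4)"
          using exp_of_nat_mult[of "Suc n" "ln (4::real)"] by (simp add: add.commute)
        moreover have "r n powr (1 - p) = exp (- (1 - p) * ?R (Suc n))"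
        proof -
          have "- ?R (Suc n) * (1 - p) = - (1 - p) * ?R (Suc n)" by algebra
          then show ?thesis by (simp only: r_def exp_powr_real)
        qed
        moreover have "D powr p * (\<Prod>i<n. r (0 + i) powr (-p)) = exp (p * ?X n)" using rX[of n] D by simp
        ultimately show ?thesis by (simp add: mult_ac)
      qed
      also have "\<dots> = exp ((real n + 1) * ln 4 + p * ?X n - (1 - p) * ?R (Suc n))"
      proof -
        have "(real n + 1) * ln 4 + p * ?X n - (1 - p) * ?R (Suc n) = (real n + 1) * ln 4 + p * ?X n + (- (1 - p) * ?R (Suc n))"
          by algebra
        then show ?thesis by (simp only: exp_add)
      qed
      also have "\<dots> \<le> exp (ln (a n))"
      proof -
        have "(p * ?X n - ln (a n) + (real n + 1) * ln 4) / (1 - p) \<le> ?R (Suc n)" by (simp add: greedy_simps)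
        then have "p * ?X n - ln (a n) + (real n + 1) * ln 4 \<le> ?R (Suc n) * (1 - p)"
          using p by (simp add: pos_divide_le_eq)
        then show ?thesis by (simp add: mult.commute)
      qed
      also have "\<dots> = a n" using a by simp
      finally show ?thesis by (simp add: ennreal_leI)
    qed
  qed
qed

section \<open>Growth of the greedy exponents\<close>

lemma sq_power_tendsto_0:
  fixes q :: real assumes "0 < q" "q < 1"
  shows "(\<lambda>n. (real n + 1)\<^sup>2 * q ^ n) \<longlonglongrightarrow> 0"
proof -
  have s: "0 < sqrt q" "sqrt q < 1" using assms by auto
  have "(\<lambda>n. real n * sqrt q ^ n + sqrt q ^ n) \<longlonglongrightarrow> 0 + 0"
    using s powser_times_n_limit_0[of "sqrt q"] by (intro tendsto_add LIMSEQ_realpow_zero) auto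
  then have "(\<lambda>n. (real n * sqrt q ^ n + sqrt q ^ n)\<^sup>2) \<longlonglongrightarrow> (0 + 0)\<^sup>2" by (intro tendsto_power)
  moreover have "(real n * sqrt q ^ n + sqrt q ^ n)\<^sup>2 = (real n + 1)\<^sup>2 * q ^ n" for n
  proof -
    have "(sqrt q ^ n)\<^sup>2 = q ^ n" using assms by (simp add: power2_eq_square power_mult_distrib[symmetric])
    moreover have "real n * sqrt q ^ n + sqrt q ^ n = (real n + 1) * sqrt q ^ n" by (simp add: algebra_simps)
    ultimately show ?thesis by (simp add: power_mult_distrib)
  qed
  ultimately show ?thesis by simp
qed

lemma quadratic_le_eventually:
  fixes p e C :: real assumes p: "0 < p" "p < 1" and e: "0 < e"
  shows "eventually (\<lambda>n. C * (real n + 1)\<^sup>2 \<le> e / (1 - p) ^ n) sequentially"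
proof -
  have "(\<lambda>n. C * ((real n + 1)\<^sup>2 * (1 - p) ^ n)) \<longlonglongrightarrow> C * 0"
    by (intro tendsto_mult sq_power_tendsto_0 tendsto_const) (use p in auto)
  then have "eventually (\<lambda>n. C * ((real n + 1)\<^sup>2 * (1 - p) ^ n) < e) sequentially"
    using e by (intro order_tendstoD(2)) auto
  then show ?thesis by eventually_elim (use p in \<open>simp add: field_simps\<close>)
qed

text \<open>With the price \<open>w * N k powr p\<close> the surplus is \<open>p * ln (N k)\<close>,
  whose weighted sum diverges; \<open>ln w\<close> and the factors 4 are part of the noise.\<close>

lemma greedy_single_slow:
  fixes N :: "nat \<Rightarrow> real"
  assumes p: "0 < p" "p < 1" and w: "0 < w" and N: "\<And>n. 1 \<le> N n"
    and ns: "\<not> summable (\<lambda>n. (1 - p) ^ n * ln (N n))" and e: "0 < e"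
  shows "eventually (\<lambda>k. greedy_X p D l (\<lambda>k. w * N k powr p) k \<le> e / (1 - p) ^ k) sequentially"
proof (rule greedy_rec_limit[where c = "ln 4 + \<bar>ln w\<bar>" and de = "\<lambda>k. p * ln (N k)"
      and ga = "greedy_R p D l (\<lambda>k. w * N k powr p)"])
  show "\<not> summable (\<lambda>k. (1 - p) ^ k * (p * ln (N k)))"
  proof
    assume "summable (\<lambda>k. (1 - p) ^ k * (p * ln (N k)))"
    then have "summable (\<lambda>k. (1 / p) * ((1 - p) ^ k * (p * ln (N k))))" by (rule summable_mult)
    then show False using ns p by (simp add: mult.left_commute)
  qed
  show "greedy_rec p (1 - p) (ln 4 + \<bar>ln w\<bar>) (greedy_X p D l (\<lambda>k. w * N k powr p))
    (greedy_R p D l (\<lambda>k. w * N k powr p)) (\<lambda>k. p * ln (N k)) 0 K" for K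
  proof
    fix k
    let ?X = "greedy_X p D l (\<lambda>k. w * N k powr p)"
    have Nk: "0 < N k" using N[of k] by simp
    have "ln (w * N k powr p) = ln w + p * ln (N k)" using w Nk by (simp add: ln_mult ln_powr)
    moreover have "- ln w \<le> \<bar>ln w\<bar> * (real k + 1)" "ln 2 \<le> ln (4::real)"
      by (auto simp: algebra_simps intro: add_increasing2)
    ultimately have *: "(p * ?X k - ln (w * N k powr p) + (real k + 1) * ln 4) / (1 - p)
      \<le> (p * ?X k + (ln 4 + \<bar>ln w\<bar>) * (real k + 1) - p * ln (N k)) / (1 - p)"
      using p by (intro divide_right_mono) (auto simp: algebra_simps)
    have l24: "ln 2 \<le> ln 4 + \<bar>ln w\<bar>" using \<open>ln 2 \<le> ln (4::real)\<close> abs_ge_zero[of "ln w"] by linarith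
    show "greedy_R p D l (\<lambda>k. w * N k powr p) (Suc k)
      \<le> max (greedy_R p D l (\<lambda>k. w * N k powr p) k + (ln 4 + \<bar>ln w\<bar>))
         ((p * ?X k + (ln 4 + \<bar>ln w\<bar>) * (real k + 1) - p * ln (N k)) / (1 - p))"
      unfolding greedy_simps(4) using * l24 by (intro max.mono add_mono order_refl)
  qed (use p N in \<open>auto simp: greedy_simps(3)\<close>)
qed (rule e)

text \<open>The limsup condition of the test class in logarithmic form, see
  \<open>limsup_le_1_iff\<close>.\<close>

definition slow :: "real \<Rightarrow> (nat \<Rightarrow> real \<Rightarrow> 'a::real_normed_vector) \<Rightarrow> bool" where
  "slow p g \<longleftrightarrow> (\<forall>e>0. eventually (\<lambda>n. \<forall>x. norm (g n x) \<le> exp (e / (1 - p) ^ n)) sequentially)"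

text \<open>Subtracting \<open>ln (\<beta> * w) / p\<close> normalises the starting value to 0. One
  factor of \<open>\<beta>\<^sup>2\<close> in the price is consumed by this normalisation; the other
  one remains as the surplus \<open>ln \<beta>\<close> of every step, and
  \<open>greedy_rec_uniform\<close> applies. Since \<open>\<beta> * w \<le> 1\<close>, the
  subtracted term is not positive.\<close>

lemma greedy_good_uniform:
  fixes N :: "nat \<Rightarrow> real"
  assumes p: "0 < p" "p < 1" and N: "\<And>n. 1 \<le> N n" and e: "0 < e"
  obtains B n0 where "1 \<le> B"
    "\<And>\<beta> w k. B \<le> \<beta> \<Longrightarrow> 0 < w \<Longrightarrow> \<beta> * w \<le> 1 \<Longrightarrow> n0 \<le> k \<Longrightarrow>
      greedy_X p ((\<beta> * w) powr (1 / p)) 1 (\<lambda>k. \<beta>\<^sup>2 * w * N k powr p) k \<le> e / (1 - p) ^ k"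
proof -
  have l4: "(0::real) \<le> ln 4" by simp
  obtain La k0 where La: "0 \<le> La" and U: "\<And>al ga de K k. greedy_rec p (1 - p) (ln 4) al ga de 0 K \<Longrightarrow> (\<And>k. La \<le> de k) \<Longrightarrow>
      al 0 \<le> 0 \<Longrightarrow> ga 0 \<le> p * 0 \<Longrightarrow> k0 \<le> k \<Longrightarrow> k \<le> K \<Longrightarrow>
      al k \<le> e / (1 - p) ^ k \<and> ga k \<le> p * e / (1 - p) ^ k"
    using greedy_rec_uniform[OF p l4 order_refl e] by blast
  show thesis
  proof (rule that[of "exp La" k0])
    show "1 \<le> exp La" using La by simp
    fix \<beta> w k assume \<beta>: "exp La \<le> \<beta>" and w: "0 < w" "\<beta> * w \<le> 1" and k: "k0 \<le> k"
    have \<beta>1: "1 \<le> \<beta>" using \<beta> La by (smt (verit) one_le_exp_iff)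
    then have \<beta>0: "0 < \<beta>" by simp
    have Lb: "La \<le> ln \<beta>" using \<beta> \<beta>0 by (simp add: ln_ge_iff)
    let ?D = "(\<beta> * w) powr (1 / p)" and ?a = "\<lambda>k. \<beta>\<^sup>2 * w * N k powr p"
    let ?X = "greedy_X p ?D 1 ?a" and ?R = "greedy_R p ?D 1 ?a"
    let ?c = "(1 / p) * ln (\<beta> * w)"
    have lnD: "ln ?D = ?c" using \<beta>0 w by (simp add: ln_powr)
    have "greedy_rec p (1 - p) (ln 4) (\<lambda>k. ?X k - ?c) ?R (\<lambda>_. ln \<beta>) 0 k"
    proof
      fix i
      have Ni: "0 < N i" "0 \<le> ln (N i)" using N[of i] by auto
      have "ln (?a i) = 2 * ln \<beta> + ln w + p * ln (N i)"
        using \<beta>0 w Ni by (simp add: ln_mult ln_powr power2_eq_square)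
      moreover have "ln (\<beta> * w) = ln \<beta> + ln w" using \<beta>0 w by (simp add: ln_mult)
      moreover have "0 \<le> p * ln (N i)" using p Ni by simp
      moreover have "p * (?X i - ?c) = p * ?X i - ln (\<beta> * w)" using p by (simp add: algebra_simps)
      ultimately have "p * ?X i - ln (?a i) + (real i + 1) * ln 4 \<le> p * (?X i - ?c) + ln 4 * (real i + 1) - ln \<beta>"
        by (simp add: mult.commute)
      then show "?R (Suc i) \<le> max (?R i + ln 4) ((p * (?X i - ?c) + ln 4 * (real i + 1) - ln \<beta>) / (1 - p))"
        unfolding greedy_simps(4) using p by (intro max.mono add_mono divide_right_mono) auto
    qed (use p \<beta>1 in \<open>auto simp: greedy_simps(3)\<close>)
    from U[OF this Lb _ _ k order_refl] lnD
    have "?X k - ?c \<le> e / (1 - p) ^ k" by (simp add: greedy_simps)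
    moreover have "?c \<le> 0"
    proof (rule mult_nonneg_nonpos)
      show "ln (\<beta> * w) \<le> 0" using mult_pos_pos[OF \<beta>0 w(1)] w(2) by (subst ln_le_zero_iff)
    qed (use p in simp)
    ultimately show "?X k \<le> e / (1 - p) ^ k" by linarith
  qed
qed

text \<open>The factor of \<open>flat_sup_bound\<close>, which also dominates the one of
  \<open>flat_deriv_bound\<close>. What matters is that its logarithm is at most linear in
  \<open>j\<close>.\<close>

definition flat_const :: "nat \<Rightarrow> real" where
  "flat_const j = 2 ^ (j + 2) * (real j + 1) + 3 ^ j * (real j * (2 * (real j + 1)))"

lemma flat_const_pos: "0 < flat_const j"
  unfolding flat_const_def by (rule add_pos_nonneg) auto

lemma ln_flat_const: "ln (flat_const j) \<le> 4 * (real j + 1)"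
proof -
  have j: "real j + 1 \<le> 2 ^ j" by (induction j) auto
  have j2: "real j * (real j + 1) \<le> 2 ^ j * 2 ^ j" using j by (intro mult_mono) auto
  have "flat_const j \<le> 2 ^ (j + 2) * 2 ^ j + 3 ^ j * (2 * (2 ^ j * 2 ^ j))"
  proof -
    have e: "real j * (2 * (real j + 1)) = 2 * (real j * (real j + 1))" by simp
    show ?thesis unfolding flat_const_def e using j j2 by (intro add_mono mult_left_mono) auto
  qed
  also have "\<dots> = 4 * 4 ^ j + 2 * 12 ^ j"
    using power_mult_distrib[of "2::real" 2 j] power_mult_distrib[of "3::real" 4 j] by (simp add: mult_ac)
  also have "\<dots> \<le> 6 * 16 ^ j"
    using power_mono[of "4::real" 16 j] power_mono[of "12::real" 16 j] by simp
  also have "\<dots> \<le> 16 ^ Suc j" by simp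
  also have "16 ^ Suc j \<le> exp (4::real) ^ Suc j"
  proof (rule power_mono)
    have "(2::real) ^ 4 \<le> exp 1 ^ 4" by (rule power_mono) (use exp_ge_add_one_self[of 1] in auto)
    then show "16 \<le> exp (4::real)" by (simp add: exp_of_nat_mult[symmetric])
  qed auto
  also have "\<dots> = exp (4 * (real j + 1))"
    using exp_of_nat_mult[of "Suc j" "4::real"] by (simp add: mult.commute add.commute)
  finally show ?thesis using flat_const_pos[of j] by (metis exp_gt_zero ln_exp ln_le_cancel_iff)
qed

text \<open>The bump is compared with \<open>g\<close> rescaled by
  \<open>(2 * v / w) powr (1 / p)\<close>, where \<open>w\<close> is the weight of the interval and
  \<open>v\<close> that of a half. While no derivative is flat, the maxima of \<open>g\<close>
  satisfy the greedy recursion in reverse, and the surplus \<open>ln \<beta>\<close> makes the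
  difference of the exponents negligible. At the first flat order \<open>j\<close> the sup bound and
  the badness of the interval force \<open>\<beta>\<close> below a quantity exponential in
  \<open>j\<close>. Hence \<open>j\<close> is large, the interval is at least exponentially long in
  \<open>-j\<close>, and the maxima of \<open>g\<close> are governed by the weight up to errors
  quadratic in \<open>j\<close>. From there the recursion continues without
  \<open>g\<close>.\<close>

lemma greedy_bad_uniform:
  fixes N :: "nat \<Rightarrow> real" and g :: "nat \<Rightarrow> real \<Rightarrow> 'a::euclidean_space"
  assumes p: "0 < p" "p < 1" and N: "\<And>n. 1 \<le> N n" and g: "dtower g" "slow p g" and e: "0 < e"
  obtains B n0 where "1 \<le> B"
    "\<And>\<beta> a b w v k. B \<le> \<beta> \<Longrightarrow> a < b \<Longrightarrow> b - a \<le> 1 \<Longrightarrow>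
      (\<And>n. integral {a..b} (\<lambda>x. norm (g n x) powr p) \<le> 2 ^ n * N n powr p * w) \<Longrightarrow>
      0 < v \<Longrightarrow> v \<le> w \<Longrightarrow> v \<le> 1 \<Longrightarrow>
      \<beta> * w < (b - a) * integral {a..b} (\<lambda>x. norm (g 0 x)) powr p \<Longrightarrow> n0 \<le> k \<Longrightarrow>
      greedy_X p ((2 * v / w) powr (1 / p) * integral {a..b} (\<lambda>x. norm (g 0 x))) ((b - a) / 2)
        (\<lambda>k. \<beta>\<^sup>2 * v * N k powr p) k \<le> e / (1 - p) ^ k"
proof -
  define q where "q = 1 - p"
  have q: "0 < q" "q < 1" using p by (auto simp: q_def)
  \<comment> \<open>The comparison with \<open>g\<close> ends with the bound \<open>2 * e'\<close>,
    and the restarted recursion doubles it.\<close>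
  define e' where "e' = e / 4"
  have e': "0 < e'" "0 < 2 * e'" using e by (auto simp: e'_def)
  \<comment> \<open>\<open>ln 16\<close> from the convexity of the maxima and \<open>ln 2\<close>
    from the halving of the widths.\<close>
  define c where "c = 5 * ln (2::real)"
  have c: "0 \<le> c" by (simp add: c_def)
  have ln4: "ln 4 = 2 * ln (2::real)" using ln_realpow[of 2 2] by simp
  have ln16: "ln 16 = 4 * ln (2::real)" using ln_realpow[of 2 4] by simp
  obtain La k0 where La: "0 \<le> La" and U: "\<And>al ga de K k. greedy_rec p (1 - p) c al ga de 0 K \<Longrightarrow> (\<And>k. La \<le> de k) \<Longrightarrow>
      al 0 \<le> 0 \<Longrightarrow> ga 0 \<le> p * 0 \<Longrightarrow> k0 \<le> k \<Longrightarrow> k \<le> K \<Longrightarrow>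
      al k \<le> e' / (1 - p) ^ k \<and> ga k \<le> p * e' / (1 - p) ^ k"
    using greedy_rec_uniform[OF p c order_refl e'(1)] by blast
  obtain m where P: "\<And>al ga de j K k. greedy_rec p (1 - p) c al ga de j K \<Longrightarrow> j \<ge> m \<Longrightarrow>
      al j \<le> 2 * e' / (1 - p) ^ j \<Longrightarrow> ga j \<le> p * (2 * e') / (1 - p) ^ j \<Longrightarrow> j \<le> k \<Longrightarrow> k \<le> K \<Longrightarrow>
      al k \<le> 2 * (2 * e') / (1 - p) ^ k"
    using greedy_rec_persist[OF p c e'(2)] by blast
  obtain n1 where n1: "\<And>n x. n1 \<le> n \<Longrightarrow> norm (g n x) \<le> exp (e' / (1 - p) ^ n)"
    using g(2) e'(1) unfolding slow_def eventually_sequentially by blast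
  \<comment> \<open>\<open>Z * (real j + 1)\<close> will bound the logarithm of
    \<open>flat_const j * N 0 powr p\<close>.\<close>
  define Z where "Z = 4 + p * ln (N 0)"
  have Z: "4 \<le> Z" using p N[of 0] by (simp add: Z_def)
  \<comment> \<open>\<open>K1\<close> and \<open>K2\<close> are the coefficients of
    \<open>(real j + 1)\<^sup>2\<close> in the bounds for \<open>ln (mx j)\<close> and for the last
    increment \<open>dS (Suc j)\<close>.\<close>
  define K1 where "K1 = 2 * Z / p + Z / p\<^sup>2 + 2 + ln 2 / p"
  define K2 where "K2 = 2 + Z / p"
  have K12: "0 \<le> K1" "0 \<le> K2" "ln 2 / p \<le> K1" using p Z by (auto simp: K1_def K2_def)
  obtain n2 where n2: "\<And>j. n2 \<le> j \<Longrightarrow> ((K1 + K2) / p) * (real j + 1)\<^sup>2 \<le> e' / (1 - p) ^ j"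
    using quadratic_le_eventually[OF p e'(1), of "(K1 + K2) / p"] unfolding eventually_sequentially by blast
  define j0 where "j0 = Suc (max (max k0 m) (max n1 n2))"
  \<comment> \<open>The sum dominates \<open>flat_const j * N 0 powr p\<close> for every
    \<open>j < j0\<close>; on a bad interval with \<open>\<beta> \<ge> B\<close> this rules out a
    first flat derivative of order below \<open>j0\<close>.\<close>
  define B where "B = max (exp La) (\<Sum>j<j0. flat_const j * N 0 powr p)"
  have B1: "1 \<le> B" using La by (simp add: B_def le_max_iff_disj)
  show thesis
  proof (rule that[of B j0, OF B1])
    fix \<beta> a b w v k
    assume \<beta>: "B \<le> \<beta>" and ab: "a < b" "b - a \<le> 1"
      and w: "\<And>n. integral {a..b} (\<lambda>x. norm (g n x) powr p) \<le> 2 ^ n * N n powr p * w"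
      and v: "0 < v" "v \<le> w" "v \<le> 1"
      and bad: "\<beta> * w < (b - a) * integral {a..b} (\<lambda>x. norm (g 0 x)) powr p" and k: "j0 \<le> k"
    define l where "l = b - a"
    have l: "0 < l" "l \<le> 1" using ab by (auto simp: l_def)
    interpret tower_on g p a b by standard (use g p ab in auto)
    have w0: "0 < w" using v by simp
    have \<beta>0: "1 \<le> \<beta>" "0 < \<beta>" using \<beta> B1 by auto
    have Lb: "La \<le> ln \<beta>"
    proof -
      have "exp La \<le> \<beta>" using \<beta> by (simp add: B_def)
      then show ?thesis using \<beta>0 by (simp add: ln_ge_iff)
    qed
    have LpN: "Lp n \<le> 2 ^ n * N n powr p * w" for n using w by (simp add: Lp_def)
    define d where "d = L1 0"
    have bad': "\<beta> * w < l * d powr p" using bad by (simp add: d_def L1_def l_def)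
    have d0: "0 < d"
    proof -
      have "0 \<le> d" unfolding d_def L1_def by (intro integral_nonneg integrable_continuous_interval cont_norm) auto
      moreover have "d \<noteq> 0" using bad' mult_pos_pos[OF \<beta>0(2) w0] by auto
      ultimately show ?thesis by simp
    qed
    have Lp0: "0 < Lp 0" and mx0: "0 < mx 0"
    proof -
      have "0 < Lp 0 * mx 0 powr (1 - p)" using L1_le_Lp[of 0] d0 by (simp add: d_def)
      then show "0 < Lp 0" "0 < mx 0" using Lp_nonneg[of 0] mx_nonneg[of 0]
        by (auto simp: zero_less_mult_iff order_less_le)
    qed
    define D where "D = (2 * v / w) powr (1 / p) * d"
    define aa where "aa = (\<lambda>k. \<beta>\<^sup>2 * v * N k powr p)"
    define X where "X = greedy_X p D (l / 2) aa"
    define R where "R = greedy_R p D (l / 2) aa"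
    define ka where "ka = ln (2 * v / w) / p"
    have lnaa: "ln (aa i) = 2 * ln \<beta> + ln v + p * ln (N i)" for i
    proof -
      have "0 < N i" using N[of i] by simp
      then show ?thesis using \<beta>0 v unfolding aa_def by (simp add: ln_mult ln_powr power2_eq_square)
    qed
    have Ni: "0 \<le> ln (N i)" "0 < N i" for i using N[of i] by auto
    have lnD: "ln D = ka + ln d"
      using d0 v w0 by (simp add: D_def ka_def ln_mult ln_powr)
    have X_simps: "X 0 = ka + ln d" "X (Suc i) = X i + R (Suc i)" "R 0 = ln (1 / l)"
      "R (Suc i) = max (R i + ln 2) ((p * X i - ln (aa i) + (real i + 1) * ln 4) / (1 - p))" for i
      using l by (simp_all add: X_def R_def greedy_simps lnD ln_div ln_mult)
    \<comment> \<open>Orders are shifted by one: \<open>S 0\<close> belongs to the increment of the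
      primitive, represented by the mass \<open>d\<close>, and \<open>S (Suc n)\<close> to the
      derivative of order \<open>n\<close> of \<open>g\<close>. The summand \<open>ka\<close> is the
      logarithm of the rescaling factor.\<close>
    define S where "S i = (case i of 0 \<Rightarrow> ka + ln d | Suc n \<Rightarrow> ka + ln (mx n))" for i
    define dS where "dS i = (case i of 0 \<Rightarrow> ln (1 / l) | Suc n \<Rightarrow> S (Suc n) - S n)" for i
    have ka: "ka \<le> ln 2 / p"
    proof -
      have "2 * v / w \<le> 2" using v w0 by (simp add: field_simps)
      then have "ln (2 * v / w) \<le> ln 2" using v w0 by (subst ln_le_cancel_iff) auto
      then show ?thesis unfolding ka_def using p by (intro divide_right_mono) auto
    qed
    \<comment> \<open>Up to the first flat derivative the greedy exponents stay close to the logarithms of the maxima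
      of the derivatives of the rescaled \<open>g\<close>.\<close>
    have main: "X i \<le> S i + e' / (1 - p) ^ i" "R i \<le> dS i + p * e' / (1 - p) ^ i"
      if nf: "\<And>n. Suc n < K \<Longrightarrow> \<not> flat n" and i: "k0 \<le> i" "i \<le> K" for K i
    proof -
      have mxp: "0 < mx n" if "n < K" for n
      proof (cases n)
        case (Suc n')
        then show ?thesis using not_flat_pos(2)[OF nf[of n']] that by simp
      qed (use mx0 in simp)
      have "greedy_rec p (1 - p) c (\<lambda>i. X i - S i) (\<lambda>i. R i - dS i) (\<lambda>_. ln \<beta>) 0 K"
      proof
        fix i assume i: "i < K"
        show "X (Suc i) - S (Suc i) \<le> X i - S i + (R (Suc i) - dS (Suc i))"
          by (simp add: X_simps(2) dS_def)
        \<comment> \<open>This is the halving rule for \<open>g\<close>. At the two lowest indices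
          the interval length and \<open>L1 0\<close> replace maxima.\<close>
        have conv: "dS i - dS (Suc i) \<le> ln 16"
        proof (cases i)
          case 0
          have "ln d \<le> ln (l * mx 0)" using L1_le_mx[of 0] d0 mx0 l by (subst ln_le_cancel_iff) (auto simp: d_def l_def)
          also have "\<dots> = ln l + ln (mx 0)" using mx0 l by (simp add: ln_mult)
          finally have "dS i - dS (Suc i) \<le> 0" using 0 l by (simp add: dS_def S_def ln_div)
          then show ?thesis using ln16 by (smt (verit) ln_ge_zero)
        next
          case (Suc n)
          note n = Suc
          have mn: "0 < mx n" "0 < mx (Suc n)" and nfn: "\<not> flat n" using mxp nf i n by auto
          show ?thesis
          proof (cases n)
            case 0
            have "ln ((mx 0)\<^sup>2) \<le> ln (16 * d * mx 1)"
              using not_flat_convex_0 nfn mn d0 0 by (subst ln_le_cancel_iff) (auto simp: d_def)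
            then have "2 * ln (mx 0) \<le> ln 16 + ln d + ln (mx 1)"
              using mn d0 0 by (simp add: ln_mult ln_realpow)
            then show ?thesis using n 0 by (simp add: dS_def S_def)
          next
            case (Suc n')
            have m': "0 < mx n'" using mxp i n Suc by auto
            have "ln ((mx n)\<^sup>2) \<le> ln (16 * mx n' * mx (Suc n))"
              using not_flat_convex[of n'] nfn mn m' Suc by (subst ln_le_cancel_iff) auto
            then have "2 * ln (mx n) \<le> ln 16 + ln (mx n') + ln (mx (Suc n))"
              using mn m' Suc by (simp add: ln_mult ln_realpow)
            then show ?thesis using n Suc by (simp add: dS_def S_def)
          qed
        qed
        \<comment> \<open>The budget inequality in reverse. The factor \<open>2 * v / w\<close> in
          the rescaling exchanges the weight \<open>w\<close> of the interval for \<open>v\<close>,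
          so that the price \<open>aa i\<close> appears, reduced by
          \<open>2 * ln \<beta>\<close>.\<close>
        have chain: "S i \<le> ln (aa i) - 2 * ln \<beta> + (real i + 2) * ln 2 + (1 - p) * S (Suc i)"
        proof -
          define t where "t = (case i of 0 \<Rightarrow> d | Suc n \<Rightarrow> mx n)"
          have Si: "S i = ka + ln t" by (simp add: S_def t_def split: nat.split)
          have mi: "0 < mx i" using mxp i by simp
          have t0: "0 < t" using d0 mxp i by (simp add: t_def split: nat.split)
          have tle: "t \<le> 2 * Lp i * mx i powr (1 - p)"
          proof (cases i)
            case 0
            then show ?thesis using L1_le_Lp[of 0] d0 by (simp add: t_def d_def)
          next
            case (Suc n)
            then show ?thesis using not_flat_chain[OF nf[of n]] i by (simp add: t_def)
          qed
          also have "\<dots> \<le> 2 * (2 ^ i * N i powr p * w) * mx i powr (1 - p)"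
            using LpN[of i] by (intro mult_right_mono mult_left_mono) auto
          finally have "ln t \<le> ln (2 * (2 ^ i * N i powr p * w) * mx i powr (1 - p))"
          proof (subst ln_le_cancel_iff[OF t0])
            have "0 < N i powr p" "0 < mx i powr (1 - p)" using Ni(2)[of i] mi by simp_all
            then show "0 < 2 * (2 ^ i * N i powr p * w) * mx i powr (1 - p)" using w0 by (intro mult_pos_pos) auto
          qed
          also have "\<dots> = ln 2 + (real i * ln 2 + p * ln (N i) + ln w) + (1 - p) * ln (mx i)"
            using Ni[of i] w0 mi by (simp add: ln_mult ln_powr ln_realpow)
          finally have "ln t \<le> ln 2 + (real i * ln 2 + p * ln (N i) + ln w) + (1 - p) * ln (mx i)" .
          moreover have "S (Suc i) = ka + ln (mx i)" by (simp add: S_def)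
          moreover have "p * ka = ln 2 + ln v - ln w"
            using p v w0 by (simp add: ka_def ln_mult ln_div)
          ultimately show ?thesis unfolding Si lnaa by (simp add: algebra_simps)
        qed
        have b1: "R i + ln 2 - dS (Suc i) \<le> R i - dS i + c" using conv ln16 by (simp add: c_def)
        have b2: "(p * X i - ln (aa i) + (real i + 1) * ln 4) / (1 - p) - dS (Suc i)
            \<le> (p * (X i - S i) + c * (real i + 1) - ln \<beta>) / (1 - p)"
        proof -
          have dSi: "dS (Suc i) = S (Suc i) - S i" by (simp add: dS_def)
          have "p * X i - ln (aa i) + (real i + 1) * ln 4 - dS (Suc i) * (1 - p)
            = p * (X i - S i) + (S i - ln (aa i) - (1 - p) * S (Suc i)) + (real i + 1) * ln 4"
            unfolding dSi by (simp add: algebra_simps)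
          also have "\<dots> \<le> p * (X i - S i) + (- 2 * ln \<beta> + (real i + 2) * ln 2) + (real i + 1) * ln 4"
            using chain by simp
          also have "\<dots> \<le> p * (X i - S i) + c * (real i + 1) - ln \<beta>"
          proof -
            have "0 \<le> ln \<beta>" using \<beta>0 by simp
            moreover have "0 \<le> ln (2::real)" "0 \<le> real i * ln 2" by auto
            ultimately show ?thesis unfolding c_def ln4 by (simp add: algebra_simps)
          qed
          finally have "p * X i - ln (aa i) + (real i + 1) * ln 4 - dS (Suc i) * (1 - p)
            \<le> p * (X i - S i) + c * (real i + 1) - ln \<beta>" .
          then have "(p * X i - ln (aa i) + (real i + 1) * ln 4 - dS (Suc i) * (1 - p)) / (1 - p)
            \<le> (p * (X i - S i) + c * (real i + 1) - ln \<beta>) / (1 - p)"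
            using p by (intro divide_right_mono) auto
          then show ?thesis using p by (simp add: diff_divide_distrib)
        qed
        show "R (Suc i) - dS (Suc i) \<le> max (R i - dS i + c) ((p * (X i - S i) + c * (real i + 1) - ln \<beta>) / (1 - p))"
          unfolding X_simps(4) using b1 b2 by linarith
      qed (use p c \<beta>0 in auto)
      from U[OF this Lb _ _ i] show "X i \<le> S i + e' / (1 - p) ^ i" "R i \<le> dS i + p * e' / (1 - p) ^ i"
        by (simp_all add: X_simps S_def dS_def)
    qed
    have qm: "1 / q ^ n \<le> 1 / q ^ n'" if "n \<le> n'" for n n'
      using q that by (intro divide_left_mono power_decreasing) auto
    have qm': "t / (1 - p) ^ n \<le> t / (1 - p) ^ n'" if "n \<le> n'" "0 \<le> t" for n n' t
      using mult_left_mono[OF qm[OF that(1)] that(2)] by (simp add: q_def)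
    have quad: "K1 * (real j + 1)\<^sup>2 \<le> e' / (1 - p) ^ j" "K2 * (real j + 1)\<^sup>2 \<le> p * e' / (1 - p) ^ j" if "n2 \<le> j" for j
    proof -
      have a: "((K1 + K2) / p) * (real j + 1)\<^sup>2 \<le> e' / (1 - p) ^ j" by (rule n2[OF that])
      have "K2 \<le> K1 + K2" using K12 by simp
      then have "K2 * (real j + 1)\<^sup>2 \<le> (K1 + K2) * (real j + 1)\<^sup>2" by (intro mult_right_mono) auto
      also have "\<dots> = p * (((K1 + K2) / p) * (real j + 1)\<^sup>2)" using p by simp
      also have "\<dots> \<le> p * (e' / (1 - p) ^ j)" using a p by (intro mult_left_mono) auto
      finally show "K2 * (real j + 1)\<^sup>2 \<le> p * e' / (1 - p) ^ j" by simp
      have "K1 * p \<le> K1 + K2" using K12 p by (simp add: mult_left_le add_increasing2)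
      then have "K1 \<le> (K1 + K2) / p" using p by (simp add: pos_le_divide_eq)
      then have "K1 * (real j + 1)\<^sup>2 \<le> ((K1 + K2) / p) * (real j + 1)\<^sup>2" by (intro mult_right_mono) auto
      then show "K1 * (real j + 1)\<^sup>2 \<le> e' / (1 - p) ^ j" using a by simp
    qed
    \<comment> \<open>The slow growth of \<open>g\<close> bounds \<open>mx n\<close>, and
      \<open>ka\<close> is at most \<open>ln 2 / p\<close> because \<open>v \<le> w\<close>.\<close>
    have Sle: "S (Suc n) \<le> 2 * e' / (1 - p) ^ Suc n" if n: "n1 \<le> n" "n2 \<le> n" and mxn: "0 < mx n" for n
    proof -
      obtain x where "x \<in> {a..b}" "norm (g n x) = mx n" by (rule mx_attained)
      then have "mx n \<le> exp (e' / (1 - p) ^ n)" using n1[OF n(1), of x] by simp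
      then have "ln (mx n) \<le> e' / (1 - p) ^ n" using mxn by (metis ln_exp ln_le_cancel_iff exp_gt_zero)
      moreover have "ka \<le> e' / (1 - p) ^ n"
      proof -
        have "ka \<le> K1 * 1" using ka K12 by simp
        also have "\<dots> \<le> K1 * (real n + 1)\<^sup>2" using K12 by (intro mult_left_mono one_le_power) auto
        finally show ?thesis using quad(1)[OF n(2)] by simp
      qed
      moreover have "e' / (1 - p) ^ n \<le> e' / (1 - p) ^ Suc n" using e' by (intro qm') auto
      ultimately show ?thesis by (simp add: S_def)
    qed
    have "X k \<le> 4 * e' / (1 - p) ^ k"
    proof (cases "\<exists>n. Suc n < k \<and> flat n")
      \<comment> \<open>The comparison with \<open>g\<close> reaches order \<open>k\<close>, and the
        slow growth of \<open>g\<close> finishes the estimate.\<close>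
      case False
      have kk: "k = Suc (k - 1)" "k0 \<le> k" "n1 \<le> k - 1" "n2 \<le> k - 1" using k by (auto simp: j0_def)
      have mxk: "0 < mx (k - 1)"
      proof (cases "k - 1")
        case (Suc n')
        then have "\<not> flat n'" using False kk(1) by auto
        then show ?thesis using not_flat_pos(2) Suc by simp
      qed (use mx0 in simp)
      have "X k \<le> S k + e' / (1 - p) ^ k" by (rule main(1)[of k]) (use False kk in auto)
      moreover have "S k \<le> 2 * e' / (1 - p) ^ k" using Sle[OF kk(3,4) mxk] kk(1) by simp
      moreover have "0 \<le> e' / (1 - p) ^ k" using e' p by simp
      ultimately show ?thesis by (simp add: add_divide_distrib) 
    next
      case True
      then obtain n where n: "Suc n < k" "flat n" by blast
      define j where "j = (LEAST n. flat n)"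
      have j: "flat j" "\<And>i. i < j \<Longrightarrow> \<not> flat i" "j \<le> n"
        unfolding j_def by (rule LeastI[of flat, OF n(2)], erule not_less_Least, rule Least_le[of flat, OF n(2)])
      have mxj: "0 < mx j"
      proof (cases j)
        case (Suc j')
        then show ?thesis using not_flat_pos(2)[OF j(2)[of j']] by simp
      qed (use mx0 in simp)
      define C where "C = flat_const j * N 0 powr p"
      have C0: "0 < C" using flat_const_pos[of j] Ni(2)[of 0] by (simp add: C_def)
      have CLp: "flat_const j * Lp 0 / l \<le> C * w / l"
        using LpN[of 0] flat_const_pos[of j] l by (intro divide_right_mono) (auto simp: C_def mult.assoc)
      have lnC: "ln C \<le> Z * (real j + 1)"
      proof -
        have "ln C = ln (flat_const j) + p * ln (N 0)"
          using flat_const_pos[of j] Ni(2)[of 0] by (simp add: C_def ln_mult ln_powr)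
        also have "\<dots> \<le> 4 * (real j + 1) + p * ln (N 0) * (real j + 1)"
          using ln_flat_const[of j] p Ni(1)[of 0] by (intro add_mono) (auto simp: algebra_simps)
        finally show ?thesis by (simp add: Z_def algebra_simps)
      qed
      have "mx 0 powr p \<le> C * w / l"
        using flat_sup_bound[OF j(1)] CLp by (simp add: flat_const_def l_def)
      moreover have "d powr p \<le> l powr p * mx 0 powr p"
        using L1_le_mx[of 0] d0 p l mx0 by (simp add: d_def l_def powr_mult[symmetric] powr_mono2)
      moreover have "l powr p * mx 0 powr p \<le> l powr p * (C * w / l)"
        using calculation(1) by (intro mult_left_mono) auto
      ultimately have "d powr p \<le> l powr p * (C * w / l)" by linarith
      then have "l * d powr p \<le> l powr p * (C * w)" using l by (simp add: field_simps)
      with bad' have "\<beta> * w < l powr p * C * w" by (simp add: mult_ac)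
      \<comment> \<open>Badness against the sup bound at the flat order. Both consequences are used:
        \<open>\<beta> < C\<close> makes \<open>j\<close> large, and the factor
        \<open>l powr p\<close> keeps the interval from being too short.\<close>
      then have bC: "\<beta> < l powr p * C" using w0 by simp
      have "l powr p \<le> 1" using l p by (simp add: powr_le_one_le powr_le1)
      then have "\<beta> < C" using bC less_imp_le[OF C0] mult_right_mono[of "l powr p" 1 C] by linarith
      have jj0: "j0 \<le> j"
      proof (rule ccontr)
        assume "\<not> j0 \<le> j"
        then have "flat_const j * N 0 powr p \<le> (\<Sum>j<j0. flat_const j * N 0 powr p)"
          by (intro member_le_sum) (auto intro!: mult_nonneg_nonneg less_imp_le[OF flat_const_pos])
        then show False using \<open>\<beta> < C\<close> \<beta> by (simp add: B_def C_def)
      qed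
      have lam: "ln (1 / l) \<le> Z * (real j + 1) / p"
      proof -
        have "ln \<beta> < ln (l powr p * C)" using bC \<beta>0 by (subst ln_less_cancel_iff) auto
        also have "\<dots> = p * ln l + ln C" using l C0 by (simp add: ln_mult ln_powr)
        finally have "- (p * ln l) \<le> ln C" using \<beta>0 ln_ge_zero[of \<beta>] by linarith
        then have "p * ln (1 / l) \<le> Z * (real j + 1)" using lnC l by (simp add: ln_div)
        then show ?thesis using p by (simp add: pos_le_divide_eq mult.commute)
      qed
      \<comment> \<open>The logarithm of \<open>flat_deriv_bound\<close>. The power
        \<open>stp j ^ j\<close> contributes \<open>j\<close> times
        \<open>ln (2 * (real j + 1) / l)\<close>, which is where the quadratic term arises.\<close>
      have lnmxj: "ln (mx j) \<le> ln w / p + (K1 - ln 2 / p) * (real j + 1)\<^sup>2"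
      proof -
        let ?t = "real j + 1"
        have "(stp j ^ j * mx j) powr p \<le> 2 ^ (j + 2) * (real j + 1) * Lp 0 / l"
          using flat_deriv_bound[OF j(1)] by (simp add: l_def)
        also have "\<dots> \<le> flat_const j * Lp 0 / l"
          using Lp0 l by (intro divide_right_mono mult_right_mono) (auto simp: flat_const_def)
        finally have "(stp j ^ j * mx j) powr p \<le> C * w / l" using CLp by linarith
        then have "ln ((stp j ^ j * mx j) powr p) \<le> ln (C * w / l)"
          using stp(1)[of j] mxj C0 w0 l by (subst ln_le_cancel_iff) auto
        then have "p * (real j * ln (stp j) + ln (mx j)) \<le> ln C + ln w + ln (1 / l)"
          using stp(1)[of j] mxj C0 w0 l by (simp add: ln_powr ln_mult ln_div ln_realpow)
        also have "\<dots> \<le> Z * ?t + ln w + Z * ?t / p" using lnC lam by linarith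
        finally have "real j * ln (stp j) + ln (mx j) \<le> (Z * ?t + ln w + Z * ?t / p) / p"
          using p by (simp add: pos_le_divide_eq mult.commute)
        moreover have "- (real j * ln (stp j)) \<le> real j * (2 * ?t + Z * ?t / p)"
        proof -
          have "ln (2 * ?t) \<le> 2 * ?t" using ln_le_minus_one[of "2 * ?t"] by simp
          moreover have "- ln (stp j) = ln (2 * ?t) + ln (1 / l)"
            using l by (simp add: stp_def l_def[symmetric] ln_div)
          ultimately have "- ln (stp j) \<le> 2 * ?t + Z * ?t / p" using lam by linarith
          then have "real j * (- ln (stp j)) \<le> real j * (2 * ?t + Z * ?t / p)" by (intro mult_left_mono) auto
          then show ?thesis by simp
        qed
        ultimately have "ln (mx j) \<le> (Z * ?t + ln w + Z * ?t / p) / p + real j * (2 * ?t + Z * ?t / p)" by linarith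
        also have "\<dots> \<le> (Z * ?t\<^sup>2 + ln w + Z * ?t\<^sup>2 / p) / p + (2 * ?t\<^sup>2 + Z * ?t\<^sup>2 / p)"
        proof (intro add_mono divide_right_mono)
          have t: "?t \<le> ?t\<^sup>2" by (simp add: power2_eq_square)
          show "Z * ?t \<le> Z * ?t\<^sup>2" "Z * ?t \<le> Z * ?t\<^sup>2" using t Z by (auto intro: mult_left_mono)
          have "real j * (2 * ?t + Z * ?t / p) \<le> ?t * (2 * ?t + Z * ?t / p)"
            using Z p by (intro mult_right_mono) auto
          then show "real j * (2 * ?t + Z * ?t / p) \<le> 2 * ?t\<^sup>2 + Z * ?t\<^sup>2 / p"
            by (simp add: algebra_simps power2_eq_square)
        qed (use p in auto)
        also have "\<dots> = ln w / p + (K1 - ln 2 / p) * ?t\<^sup>2"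
          using p by (simp add: K1_def field_simps power2_eq_square)
        finally show ?thesis .
      qed
      have K: "k0 \<le> Suc j" "m \<le> Suc j" "n2 \<le> j" "Suc j \<le> k" "1 \<le> j" using jj0 n j by (auto simp: j0_def)
      have XK: "X (Suc j) \<le> S (Suc j) + e' / (1 - p) ^ Suc j" "R (Suc j) \<le> dS (Suc j) + p * e' / (1 - p) ^ Suc j"
        using main[of "Suc j" "Suc j"] j(2) K(1) by auto
      have g1: "X (Suc j) - ln v / p \<le> 2 * e' / (1 - p) ^ Suc j"
      proof -
        have "S (Suc j) = ln 2 / p + ln v / p - ln w / p + ln (mx j)"
          using v w0 by (simp add: S_def ka_def ln_mult ln_div add_divide_distrib diff_divide_distrib)
        moreover have "ln 2 / p \<le> ln 2 / p * (real j + 1)\<^sup>2"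
        proof -
          have "1 \<le> (real j + 1)\<^sup>2" "0 \<le> ln 2 / p" using p by (auto intro: one_le_power)
          from mult_left_mono[OF this] show ?thesis by (simp only: mult_1_right)
        qed
        ultimately have "S (Suc j) - ln v / p \<le> K1 * (real j + 1)\<^sup>2"
          using lnmxj by (simp add: algebra_simps)
        also have "\<dots> \<le> e' / (1 - p) ^ j" by (rule quad(1)[OF K(3)])
        also have "\<dots> \<le> e' / (1 - p) ^ Suc j" using e' by (intro qm') auto
        finally show ?thesis using XK(1) by (simp add: add_divide_distrib)
      qed
      \<comment> \<open>A restart needs a bound for the last width as well; \<open>flat_prev\<close>
        limits the corresponding increment for \<open>g\<close> to
        \<open>ln 4 + ln (1 / l)\<close>.\<close>
      have g2: "R (Suc j) \<le> p * (2 * e') / (1 - p) ^ Suc j"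
      proof -
        obtain j' where j': "j = Suc j'" using K(5) by (cases j) auto
        have mj': "0 < mx j'" using not_flat_pos(1)[OF j(2)[of j']] j' by simp
        have "l * mx j \<le> 4 * mx j'" using flat_prev[of j'] j(1) j' by (simp add: l_def)
        then have "ln (l * mx j) \<le> ln (4 * mx j')" using l mxj mj' by (subst ln_le_cancel_iff) auto
        then have "dS (Suc j) \<le> ln 4 + ln (1 / l)"
          using l mxj mj' by (simp add: dS_def S_def j' ln_mult ln_div)
        also have "\<dots> \<le> 2 * (real j + 1) + Z * (real j + 1) / p"
        proof (rule add_mono[OF _ lam])
          have "ln 4 = 2 * ln (2::real)" by (rule ln4)
          also have "\<dots> \<le> 2" using ln_le_minus_one[of "2::real"] by simp
          finally show "ln 4 \<le> 2 * (real j + 1)" by simp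
        qed
        also have "\<dots> = K2 * (real j + 1)" by (simp add: K2_def algebra_simps add_divide_distrib)
        also have "\<dots> \<le> K2 * (real j + 1)\<^sup>2" using K12 by (intro mult_left_mono) (auto simp: power2_eq_square)
        also have "\<dots> \<le> p * e' / (1 - p) ^ j" by (rule quad(2)[OF K(3)])
        also have "\<dots> \<le> p * e' / (1 - p) ^ Suc j" using e' p by (intro qm') auto
        finally have "dS (Suc j) \<le> p * e' / (1 - p) ^ Suc j" .
        then have "dS (Suc j) + p * e' / (1 - p) ^ Suc j \<le> p * e' / (1 - p) ^ Suc j + p * e' / (1 - p) ^ Suc j"
          by (rule add_right_mono)
        with XK(2) have "R (Suc j) \<le> p * e' / (1 - p) ^ Suc j + p * e' / (1 - p) ^ Suc j" by (rule order_trans)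
        moreover have "p * (2 * e') / (1 - p) ^ Suc j = p * e' / (1 - p) ^ Suc j + p * e' / (1 - p) ^ Suc j"
          unfolding add_divide_distrib[symmetric] by (simp del: power_Suc)
        ultimately show ?thesis by (simp only:)
      qed
      \<comment> \<open>Beyond the flat order the recursion runs on its own with the surplus
        discarded; subtracting \<open>ln v / p\<close> removes \<open>v\<close> from the
        price.\<close>
      have "greedy_rec p (1 - p) c (\<lambda>i. X i - ln v / p) R (\<lambda>_. 0) (Suc j) k"
      proof
        fix i
        have "0 \<le> ln \<beta>" "0 \<le> p * ln (N i)" using \<beta>0 p Ni(1)[of i] by auto
        moreover have "p * (X i - ln v / p) = p * X i - ln v" using p by (simp add: algebra_simps)
        moreover have "(real i + 1) * ln 4 \<le> c * (real i + 1)" unfolding c_def ln4 by (simp add: algebra_simps)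
        ultimately have "p * X i - ln (aa i) + (real i + 1) * ln 4 \<le> p * (X i - ln v / p) + c * (real i + 1) - 0"
          unfolding lnaa by linarith
        then show "R (Suc i) \<le> max (R i + c) ((p * (X i - ln v / p) + c * (real i + 1) - 0) / (1 - p))"
          unfolding X_simps(4) using p by (intro max.mono add_mono divide_right_mono) (auto simp: c_def)
      qed (use p c in \<open>auto simp: X_simps\<close>)
      from P[OF this K(2) g1 g2 K(4) order_refl]
      have "X k - ln v / p \<le> 4 * e' / (1 - p) ^ k" by simp
      moreover have "ln v / p \<le> 0" using v p by (simp add: divide_nonpos_pos)
      ultimately show ?thesis by linarith
    qed
    then show "greedy_X p ((2 * v / w) powr (1 / p) * integral {a..b} (\<lambda>x. norm (g 0 x))) ((b - a) / 2)
        (\<lambda>k. \<beta>\<^sup>2 * v * N k powr p) k \<le> e / (1 - p) ^ k"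
      by (simp add: X_def D_def d_def L1_def aa_def l_def e'_def)
  qed
qed

section \<open>Replacing a primitive by bumps\<close>

text \<open>The function to be treated is \<open>F (Suc 0)\<close>, with the primitive
  \<open>F 0\<close>, and \<open>w a b\<close> is the measure of an interval. \<open>w_low\<close>
  makes short intervals good, which stops the bisection.\<close>

locale weighted_tower =
  fixes p :: real and N :: "nat \<Rightarrow> real" and F :: "nat \<Rightarrow> real \<Rightarrow> 'a::euclidean_space"
    and w :: "real \<Rightarrow> real \<Rightarrow> real"
  assumes p: "0 < p" "p < 1" and N: "\<And>n. 1 \<le> N n" and F: "dtower F"
    and Fslow: "slow p (\<lambda>n. F (Suc n))"
    and ns: "\<not> summable (\<lambda>n. (1 - p) ^ n * ln (N n))"
    and w_add: "\<And>a m b. a \<le> m \<Longrightarrow> m \<le> b \<Longrightarrow> w a b = w a m + w m b"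
    and w_pos: "\<And>a b. a < b \<Longrightarrow> 0 < w a b"
    and w_int: "\<And>n a b. a < b \<Longrightarrow> integral {a..b} (\<lambda>x. norm (F (Suc n) x) powr p) \<le> 2 ^ n * N n powr p * w a b"
    and w_low: "\<And>K. \<exists>c>0. \<forall>a b. - K \<le> a \<longrightarrow> a < b \<longrightarrow> b \<le> K \<longrightarrow> c * (b - a) \<le> w a b"
begin

definition mass :: "real \<Rightarrow> real \<Rightarrow> real" where
  "mass a b = integral {a..b} (\<lambda>x. norm (F (Suc 0) x))"

text \<open>Up to a constant the left side bounds the integral over \<open>{a..b}\<close> of the
  p-th power of the error made by putting a bump in place of the primitive.\<close>

definition good :: "real \<Rightarrow> real \<Rightarrow> real \<Rightarrow> bool" where
  "good \<beta> a b \<longleftrightarrow> (b - a) * mass a b powr p \<le> \<beta> * w a b"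

lemma g: "dtower (\<lambda>n. F (Suc n))"
  using F by (simp add: dtower_def)

lemma F_cont: "continuous_on S (F n)" by (rule dtower_continuous[OF F])

lemma mass_nonneg: "0 \<le> mass a b"
  unfolding mass_def by (intro integral_nonneg integrable_continuous_interval continuous_on_norm F_cont) auto

lemma mass_mono: "a' \<le> a \<Longrightarrow> b \<le> b' \<Longrightarrow> mass a b \<le> mass a' b'"
  unfolding mass_def
  by (intro integral_subset_le integrable_continuous_interval continuous_on_norm F_cont) auto

lemma F_diff_le: "u \<le> v \<Longrightarrow> norm (F 0 v - F 0 u) \<le> mass u v"
proof -
  assume uv: "u \<le> v"
  have "(F (Suc 0) has_integral (F 0 v - F 0 u)) {u..v}"
    by (rule fundamental_theorem_of_calculus[OF uv]) (rule dtowerD[OF F])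
  then have "norm (F 0 v - F 0 u) = norm (integral {u..v} (F (Suc 0)))" by (simp add: integral_unique)
  also have "\<dots> \<le> mass u v"
    unfolding mass_def by (intro integral_norm_bound_integral integrable_continuous_interval continuous_on_norm F_cont) auto
  finally show ?thesis .
qed

text \<open>\<open>B\<close> and \<open>n0\<close> are meant to depend on \<open>e\<close> only and
  to serve all intervals and all \<open>\<beta> \<ge> B\<close>. The first clause is for good unit
  intervals, the second for the halves of bad intervals, with \<open>v\<close> the weight of the
  half.\<close>

definition thr :: "real \<Rightarrow> real \<Rightarrow> nat \<Rightarrow> bool" where
  "thr e B n0 \<longleftrightarrow> 1 \<le> B \<and>
    (\<forall>\<beta> v k. B \<le> \<beta> \<longrightarrow> 0 < v \<longrightarrow> \<beta> * v \<le> 1 \<longrightarrow> n0 \<le> k \<longrightarrow>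
      greedy_X p ((\<beta> * v) powr (1 / p)) 1 (\<lambda>k. \<beta>\<^sup>2 * v * N k powr p) k \<le> e / (1 - p) ^ k) \<and>
    (\<forall>\<beta> a b v k. B \<le> \<beta> \<longrightarrow> a < b \<longrightarrow> b - a \<le> 1 \<longrightarrow> 0 < v \<longrightarrow> v \<le> w a b \<longrightarrow> v \<le> 1 \<longrightarrow>
      \<not> good \<beta> a b \<longrightarrow> n0 \<le> k \<longrightarrow>
      greedy_X p ((2 * v / w a b) powr (1 / p) * mass a b) ((b - a) / 2)
        (\<lambda>k. \<beta>\<^sup>2 * v * N k powr p) k \<le> e / (1 - p) ^ k)"

lemma thr_exists:
  assumes e: "0 < e" shows "\<exists>B n0. thr e B n0"
proof -
  obtain B1 n1 where 1: "1 \<le> B1"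
    "\<And>\<beta> v k. B1 \<le> \<beta> \<Longrightarrow> 0 < v \<Longrightarrow> \<beta> * v \<le> 1 \<Longrightarrow> n1 \<le> k \<Longrightarrow>
      greedy_X p ((\<beta> * v) powr (1 / p)) 1 (\<lambda>k. \<beta>\<^sup>2 * v * N k powr p) k \<le> e / (1 - p) ^ k"
    using greedy_good_uniform[where N = N, OF p N e] by blast
  obtain B2 n2 where 2: "1 \<le> B2"
    "\<And>\<beta> a b w v k. B2 \<le> \<beta> \<Longrightarrow> a < b \<Longrightarrow> b - a \<le> 1 \<Longrightarrow>
      (\<And>n. integral {a..b} (\<lambda>x. norm (F (Suc n) x) powr p) \<le> 2 ^ n * N n powr p * w) \<Longrightarrow>
      0 < v \<Longrightarrow> v \<le> w \<Longrightarrow> v \<le> 1 \<Longrightarrow>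
      \<beta> * w < (b - a) * integral {a..b} (\<lambda>x. norm (F (Suc 0) x)) powr p \<Longrightarrow> n2 \<le> k \<Longrightarrow>
      greedy_X p ((2 * v / w) powr (1 / p) * integral {a..b} (\<lambda>x. norm (F (Suc 0) x))) ((b - a) / 2)
        (\<lambda>k. \<beta>\<^sup>2 * v * N k powr p) k \<le> e / (1 - p) ^ k"
    using greedy_bad_uniform[where N = N and g = "\<lambda>n. F (Suc n)", OF p N g Fslow e] by blast
  have "thr e (max B1 B2) (max n1 n2)"
    unfolding thr_def
  proof (intro conjI allI impI)
    fix \<beta> a b v k
    assume h: "max B1 B2 \<le> \<beta>" "a < b" "b - a \<le> 1" "0 < v" "v \<le> w a b" "v \<le> 1" "\<not> good \<beta> a b" "max n1 n2 \<le> k"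
    show "greedy_X p ((2 * v / w a b) powr (1 / p) * mass a b) ((b - a) / 2)
        (\<lambda>k. \<beta>\<^sup>2 * v * N k powr p) k \<le> e / (1 - p) ^ k"
      unfolding mass_def
      by (rule 2(2)[where w = "w a b"]) (use h w_int in \<open>auto simp: good_def mass_def not_le\<close>)
  qed (use 1 in auto)
  then show ?thesis by blast
qed

text \<open>The function \<open>H 0\<close> replaces the primitive \<open>F 0\<close> on \<open>[a, b]\<close>: it has the same increment and lives at
  the price \<open>\<beta>\<^sup>2 w a b\<close>.\<close>

definition piece :: "real \<Rightarrow> real \<Rightarrow> real \<Rightarrow> (nat \<Rightarrow> real \<Rightarrow> 'a) \<Rightarrow> bool" where
  "piece \<beta> a b H \<longleftrightarrow> dtower H \<and> (\<forall>x\<le>a. H 0 x = 0) \<and> (\<forall>x\<ge>b. H 0 x = F 0 b - F 0 a) \<and>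
    (\<forall>n x. x \<le> a \<or> b \<le> x \<longrightarrow> H (Suc n) x = 0) \<and>
    (\<forall>n. (\<integral>\<^sup>+x. ennreal (norm (H (Suc n) x) powr p) \<partial>lborel) \<le> ennreal (\<beta>\<^sup>2 * w a b * N n powr p)) \<and>
    (\<forall>e B n0. thr e B n0 \<longrightarrow> B \<le> \<beta> \<longrightarrow> (\<forall>n x. n0 \<le> Suc n \<longrightarrow> norm (H (Suc n) x) \<le> 4 ^ Suc n * exp (e / (1 - p) ^ Suc n))) \<and>
    (\<forall>e>0. eventually (\<lambda>n. \<forall>x. norm (H (Suc n) x) \<le> 4 ^ Suc n * exp (e / (1 - p) ^ Suc n)) sequentially) \<and>
    (\<integral>\<^sup>+x. ennreal (norm (F 0 x - F 0 a - H 0 x) powr p) * indicator {a..b} x \<partial>lborel) \<le> ennreal (2 * \<beta> * w a b)"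

text \<open>\<open>D\<close> and \<open>l\<close> are left free because the starting values may come
  from the interval itself or from its bad parent.\<close>

lemma piece_single:
  assumes ab: "a < b" and good: "good \<beta> a b" and \<beta>: "0 < \<beta>" and D: "0 < D" "mass a b \<le> D"
    and l: "0 < l" "l \<le> b - a"
    and X: "\<And>e B n0 k. thr e B n0 \<Longrightarrow> B \<le> \<beta> \<Longrightarrow> n0 \<le> k \<Longrightarrow>
      greedy_X p D l (\<lambda>k. \<beta>\<^sup>2 * w a b * N k powr p) k \<le> e / (1 - p) ^ k"
  shows "\<exists>H. piece \<beta> a b H"
proof -
  let ?c = "F 0 b - F 0 a" and ?a = "\<lambda>k. \<beta>\<^sup>2 * w a b * N k powr p"
  have cm: "norm ?c \<le> mass a b" using F_diff_le[of a b] ab by simp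
  have a0: "0 < ?a k" for k
  proof -
    have "N k \<noteq> 0" using N[of k] by simp
    then show ?thesis using \<beta> w_pos[OF ab] by simp
  qed
  have cD: "norm ?c \<le> D" using cm D by simp
  have ex: thesis
    if "\<And>H :: nat \<Rightarrow> real \<Rightarrow> 'a. dtower H \<Longrightarrow> \<forall>x\<le>a. H 0 x = 0 \<Longrightarrow> \<forall>x\<ge>a + l. H 0 x = ?c \<Longrightarrow>
      \<forall>x. norm (H 0 x) \<le> norm ?c \<Longrightarrow> \<forall>n x. x \<le> a \<or> a + l \<le> x \<longrightarrow> H (Suc n) x = 0 \<Longrightarrow>
      \<forall>n x. norm (H (Suc n) x) \<le> 4 ^ Suc n * exp (greedy_X p D l ?a (Suc n)) \<Longrightarrow>
      \<forall>n. (\<integral>\<^sup>+x. ennreal (norm (H (Suc n) x) powr p) \<partial>lborel) \<le> ennreal (?a n) \<Longrightarrow> thesis" for thesis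
    by (rule greedy_bump[where a = ?a and ?x0.0 = a, OF p D(1) cD l(1) a0], rule that) (assumption, blast+)
  show ?thesis
  proof (rule ex)
    fix H :: "nat \<Rightarrow> real \<Rightarrow> 'a"
    assume H0: "dtower H" "\<forall>x\<le>a. H 0 x = 0" "\<forall>x\<ge>a + l. H 0 x = ?c" "\<forall>x. norm (H 0 x) \<le> norm ?c"
      "\<forall>n x. x \<le> a \<or> a + l \<le> x \<longrightarrow> H (Suc n) x = 0"
      "\<forall>n x. norm (H (Suc n) x) \<le> 4 ^ Suc n * exp (greedy_X p D l ?a (Suc n))"
      "\<forall>n. (\<integral>\<^sup>+x. ennreal (norm (H (Suc n) x) powr p) \<partial>lborel) \<le> ennreal (?a n)"
    note H = H0(1) H0(2)[rule_format] H0(3)[rule_format] H0(4)[rule_format] H0(5)[rule_format] H0(6)[rule_format] H0(7)[rule_format]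
  have bd: "norm (H (Suc n) x) \<le> 4 ^ Suc n * exp t" if "greedy_X p D l ?a (Suc n) \<le> t" for n x t
  proof -
    have "4 ^ Suc n * exp (greedy_X p D l ?a (Suc n)) \<le> 4 ^ Suc n * exp t" using that by (intro mult_left_mono) auto
    then show ?thesis using H(6)[of n x] by linarith
  qed
  have "piece \<beta> a b H"
    unfolding piece_def
  proof (intro conjI allI impI)
    show "dtower H" by (rule H)
    show "H 0 x = 0" if "x \<le> a" for x using that by (rule H)
    show "(\<integral>\<^sup>+x. ennreal (norm (H (Suc n) x) powr p) \<partial>lborel) \<le> ennreal (\<beta>\<^sup>2 * w a b * N n powr p)" for n
      by (rule H(7))
  next
    fix e :: real assume e: "0 < e"
    have bw: "0 < \<beta>\<^sup>2 * w a b" using \<beta> w_pos[OF ab] by simp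
    have "eventually (\<lambda>k. greedy_X p D l ?a k \<le> e / (1 - p) ^ k) sequentially"
      using greedy_single_slow[OF p bw N ns e] .
    then have "eventually (\<lambda>n. greedy_X p D l ?a (Suc n) \<le> e / (1 - p) ^ Suc n) sequentially"
      by (rule eventually_compose_filterlim[OF _ filterlim_Suc])
    then show "eventually (\<lambda>n. \<forall>x. norm (H (Suc n) x) \<le> 4 ^ Suc n * exp (e / (1 - p) ^ Suc n)) sequentially"
      by eventually_elim (use bd in blast)
  next
    fix x assume "b \<le> x" then show "H 0 x = ?c" using l by (intro H(3)) auto
  next
    fix n x assume "x \<le> a \<or> b \<le> x" then show "H (Suc n) x = 0" using l by (intro H(5)) auto
  next
    fix e B n0 n x assume "thr e B n0" "B \<le> \<beta>" "n0 \<le> Suc n"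
    then show "norm (H (Suc n) x) \<le> 4 ^ Suc n * exp (e / (1 - p) ^ Suc n)" by (intro bd X)
  next
    let ?m = "mass a b"
    have "(\<integral>\<^sup>+x. ennreal (norm (F 0 x - F 0 a - H 0 x) powr p) * indicator {a..b} x \<partial>lborel)
      \<le> (\<integral>\<^sup>+x. ennreal ((2 * ?m) powr p) * indicator {a..b} x \<partial>lborel)"
    proof (intro nn_integral_mono)
      fix x
      show "ennreal (norm (F 0 x - F 0 a - H 0 x) powr p) * indicator {a..b} x \<le> ennreal ((2 * ?m) powr p) * indicator {a..b} x"
      proof (cases "x \<in> {a..b}")
        case True
        have "norm (F 0 x - F 0 a - H 0 x) \<le> norm (F 0 x - F 0 a) + norm (H 0 x)" by (rule norm_triangle_ineq4)
        also have "\<dots> \<le> ?m + ?m"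
          using F_diff_le[of a x] mass_mono[of a a x b] True H(4)[of x] cm by (intro add_mono) auto
        finally have "norm (F 0 x - F 0 a - H 0 x) powr p \<le> (2 * ?m) powr p" using p by (intro powr_mono2) auto
        then show ?thesis using True by (simp add: ennreal_leI)
      qed simp
    qed
    also have "\<dots> = ennreal ((2 * ?m) powr p * (b - a))"
      using ab by (simp add: nn_integral_cmult_indicator ennreal_mult)
    also have "\<dots> \<le> ennreal (2 * \<beta> * w a b)"
    proof (rule ennreal_leI)
      have "(2 * ?m) powr p * (b - a) = 2 powr p * ((b - a) * ?m powr p)"
        using mass_nonneg by (simp add: powr_mult)
      also have "\<dots> \<le> 2 * (\<beta> * w a b)"
      proof (rule mult_mono)
        show "2 powr p \<le> (2::real)" using p powr_mono[of p 1 "2::real"] by simp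
        show "(b - a) * ?m powr p \<le> \<beta> * w a b" using good by (simp add: good_def)
      qed (use ab in auto)
      finally show "(2 * ?m) powr p * (b - a) \<le> 2 * \<beta> * w a b" by simp
    qed
    finally show "(\<integral>\<^sup>+x. ennreal (norm (F 0 x - F 0 a - H 0 x) powr p) * indicator {a..b} x \<partial>lborel) \<le> ennreal (2 * \<beta> * w a b)" .
  qed
  then show ?thesis by blast
  qed
qed

text \<open>At every point the derivatives of one of the two summands vanish. Suprema are therefore
  not added, and the thresholds survive any number of concatenations.\<close>

lemma piece_concat:
  assumes am: "a < m" "m < b" and \<beta>: "0 < \<beta>" and P: "piece \<beta> a m H1" "piece \<beta> m b H2"
  shows "piece \<beta> a b (\<lambda>n x. H1 n x + H2 n x)"
proof -
  have P1: "dtower H1" "\<And>x. x \<le> a \<Longrightarrow> H1 0 x = 0" "\<And>x. x \<ge> m \<Longrightarrow> H1 0 x = F 0 m - F 0 a"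
    "\<And>n x. x \<le> a \<or> m \<le> x \<Longrightarrow> H1 (Suc n) x = 0"
    "\<And>n. (\<integral>\<^sup>+x. ennreal (norm (H1 (Suc n) x) powr p) \<partial>lborel) \<le> ennreal (\<beta>\<^sup>2 * w a m * N n powr p)"
    "\<And>e B n0 n x. thr e B n0 \<Longrightarrow> B \<le> \<beta> \<Longrightarrow> n0 \<le> Suc n \<Longrightarrow> norm (H1 (Suc n) x) \<le> 4 ^ Suc n * exp (e / (1 - p) ^ Suc n)"
    "\<And>e. 0 < e \<Longrightarrow> eventually (\<lambda>n. \<forall>x. norm (H1 (Suc n) x) \<le> 4 ^ Suc n * exp (e / (1 - p) ^ Suc n)) sequentially"
    "(\<integral>\<^sup>+x. ennreal (norm (F 0 x - F 0 a - H1 0 x) powr p) * indicator {a..m} x \<partial>lborel) \<le> ennreal (2 * \<beta> * w a m)"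
    using P(1) unfolding piece_def by blast+
  have P2: "dtower H2" "\<And>x. x \<le> m \<Longrightarrow> H2 0 x = 0" "\<And>x. x \<ge> b \<Longrightarrow> H2 0 x = F 0 b - F 0 m"
    "\<And>n x. x \<le> m \<or> b \<le> x \<Longrightarrow> H2 (Suc n) x = 0"
    "\<And>n. (\<integral>\<^sup>+x. ennreal (norm (H2 (Suc n) x) powr p) \<partial>lborel) \<le> ennreal (\<beta>\<^sup>2 * w m b * N n powr p)"
    "\<And>e B n0 n x. thr e B n0 \<Longrightarrow> B \<le> \<beta> \<Longrightarrow> n0 \<le> Suc n \<Longrightarrow> norm (H2 (Suc n) x) \<le> 4 ^ Suc n * exp (e / (1 - p) ^ Suc n)"
    "\<And>e. 0 < e \<Longrightarrow> eventually (\<lambda>n. \<forall>x. norm (H2 (Suc n) x) \<le> 4 ^ Suc n * exp (e / (1 - p) ^ Suc n)) sequentially"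
    "(\<integral>\<^sup>+x. ennreal (norm (F 0 x - F 0 m - H2 0 x) powr p) * indicator {m..b} x \<partial>lborel) \<le> ennreal (2 * \<beta> * w m b)"
    using P(2) unfolding piece_def by blast+
  note [measurable] = dtower_borel[OF P1(1)] dtower_borel[OF P2(1)] dtower_borel[OF F]
  have z: "H1 (Suc n) x = 0 \<or> H2 (Suc n) x = 0" for n x
    using P1(4)[of x n] P2(4)[of x n] by (cases "x \<le> m") auto
  have zn: "norm (H1 (Suc n) x + H2 (Suc n) x) \<le> T" if "norm (H1 (Suc n) x) \<le> T" "norm (H2 (Suc n) x) \<le> T" for n x T
    using z[of n x] that by auto
  have wab: "w a b = w a m + w m b" using w_add[of a m b] am by simp
  have w0: "0 < w a m" "0 < w m b" using w_pos am by auto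
  show ?thesis
    unfolding piece_def
  proof (intro conjI allI impI)
    show "dtower (\<lambda>n x. H1 n x + H2 n x)" by (rule dtower_add[OF P1(1) P2(1)])
    show "H1 0 x + H2 0 x = 0" if "x \<le> a" for x using P1(2)[of x] P2(2)[of x] that am by simp
    show "H1 0 x + H2 0 x = F 0 b - F 0 a" if "b \<le> x" for x using P1(3)[of x] P2(3)[of x] that am by simp
    show "H1 (Suc n) x + H2 (Suc n) x = 0" if "x \<le> a \<or> b \<le> x" for n x
      using P1(4)[of x n] P2(4)[of x n] that am by auto
    show "norm (H1 (Suc n) x + H2 (Suc n) x) \<le> 4 ^ Suc n * exp (e / (1 - p) ^ Suc n)"
      if "thr e B n0" "B \<le> \<beta>" "n0 \<le> Suc n" for e B n0 n x
      by (rule zn[OF P1(6)[OF that] P2(6)[OF that]])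
    show "eventually (\<lambda>n. \<forall>x. norm (H1 (Suc n) x + H2 (Suc n) x) \<le> 4 ^ Suc n * exp (e / (1 - p) ^ Suc n)) sequentially"
      if "0 < e" for e
      using P1(7)[OF that] P2(7)[OF that] by eventually_elim (use zn in blast)
    show "(\<integral>\<^sup>+x. ennreal (norm (H1 (Suc n) x + H2 (Suc n) x) powr p) \<partial>lborel) \<le> ennreal (\<beta>\<^sup>2 * w a b * N n powr p)" for n
    proof -
      have "(\<integral>\<^sup>+x. ennreal (norm (H1 (Suc n) x + H2 (Suc n) x) powr p) \<partial>lborel)
        \<le> (\<integral>\<^sup>+x. ennreal (norm (H1 (Suc n) x) powr p) + ennreal (norm (H2 (Suc n) x) powr p) \<partial>lborel)"
        using p by (intro nn_integral_mono) (auto simp: ennreal_plus[symmetric] simp del: ennreal_plus intro!: ennreal_leI norm_powr_subadd)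
      also have "\<dots> = (\<integral>\<^sup>+x. ennreal (norm (H1 (Suc n) x) powr p) \<partial>lborel) + (\<integral>\<^sup>+x. ennreal (norm (H2 (Suc n) x) powr p) \<partial>lborel)"
        by (rule nn_integral_add) measurable
      also have "\<dots> \<le> ennreal (\<beta>\<^sup>2 * w a m * N n powr p) + ennreal (\<beta>\<^sup>2 * w m b * N n powr p)"
        by (rule add_mono[OF P1(5) P2(5)])
      also have "\<dots> = ennreal (\<beta>\<^sup>2 * w a b * N n powr p)"
        using w0 \<beta> by (subst ennreal_plus[symmetric]) (auto simp: wab algebra_simps)
      finally show ?thesis .
    qed
    have "(\<integral>\<^sup>+x. ennreal (norm (F 0 x - F 0 a - (H1 0 x + H2 0 x)) powr p) * indicator {a..b} x \<partial>lborel)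
      \<le> (\<integral>\<^sup>+x. ennreal (norm (F 0 x - F 0 a - H1 0 x) powr p) * indicator {a..m} x
           + ennreal (norm (F 0 x - F 0 m - H2 0 x) powr p) * indicator {m..b} x \<partial>lborel)"
    proof (intro nn_integral_mono)
      fix x
      show "ennreal (norm (F 0 x - F 0 a - (H1 0 x + H2 0 x)) powr p) * indicator {a..b} x
        \<le> ennreal (norm (F 0 x - F 0 a - H1 0 x) powr p) * indicator {a..m} x
           + ennreal (norm (F 0 x - F 0 m - H2 0 x) powr p) * indicator {m..b} x"
      proof (cases "x \<le> m")
        case True
        then show ?thesis using P2(2)[of x] am by (auto simp: indicator_def)
      next
        case False
        then have eq: "F 0 x - F 0 a - (H1 0 x + H2 0 x) = F 0 x - F 0 m - H2 0 x" using P1(3)[of x] by simp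
        show ?thesis unfolding eq using False am by (auto simp: indicator_def)
      qed
    qed
    also have "\<dots> = (\<integral>\<^sup>+x. ennreal (norm (F 0 x - F 0 a - H1 0 x) powr p) * indicator {a..m} x \<partial>lborel)
           + (\<integral>\<^sup>+x. ennreal (norm (F 0 x - F 0 m - H2 0 x) powr p) * indicator {m..b} x \<partial>lborel)"
      by (rule nn_integral_add) measurable
    also have "\<dots> \<le> ennreal (2 * \<beta> * w a m) + ennreal (2 * \<beta> * w m b)" by (rule add_mono[OF P1(8) P2(8)])
    also have "\<dots> = ennreal (2 * \<beta> * w a b)"
      using w0 \<beta> by (subst ennreal_plus[symmetric]) (auto simp: wab algebra_simps)
    finally show "(\<integral>\<^sup>+x. ennreal (norm (F 0 x - F 0 a - (H1 0 x + H2 0 x)) powr p) * indicator {a..b} x \<partial>lborel) \<le> ennreal (2 * \<beta> * w a b)" .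
  qed
qed

text \<open>Dividing the inequality of the good half by that of the bad parent bounds
  \<open>mass u v\<close> by the rescaled mass of the parent; the factor 2 is the quotient of the
  lengths. So the recursion may start from the data of the parent, for which the second clause of
  \<open>thr\<close> is made.\<close>

lemma piece_half:
  assumes ab: "a < b" "b - a \<le> 1" "w a b \<le> 1" and \<beta>: "0 < \<beta>" and bad: "\<not> good \<beta> a b"
    and I: "a \<le> u" "v \<le> b" "v - u = (b - a) / 2" and good: "good \<beta> u v"
  shows "\<exists>H. piece \<beta> u v H"
proof -
  let ?D = "(2 * w u v / w a b) powr (1 / p) * mass a b"
  have uv: "u < v" using I ab by simp
  have w0: "0 < w u v" "0 < w a b" using w_pos uv ab by auto
  have "w a b = w a u + (w u v + w v b)" using w_add[of a u b] w_add[of u v b] I uv by simp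
  moreover have "0 \<le> w a u" "0 \<le> w v b"
    using w_pos[of a u] w_pos[of v b] I w_add[of a a a] w_add[of b b b] by (cases "a = u"; cases "v = b"; simp)+
  ultimately have wle: "w u v \<le> w a b" by linarith
  have m0: "0 < mass a b"
  proof -
    have "mass a b \<noteq> 0" using bad w0 \<beta> by (auto simp: good_def)
    then show ?thesis using mass_nonneg[of a b] by simp
  qed
  have "(v - u) * mass u v powr p \<le> \<beta> * w u v" using good by (simp add: good_def)
  then have 1: "(b - a) * mass u v powr p \<le> 2 * \<beta> * w u v" using I(3) by (simp add: field_simps)
  have 2: "\<beta> * w a b < (b - a) * mass a b powr p" using bad by (simp add: good_def)
  have "mass u v powr p \<le> 2 * w u v / w a b * mass a b powr p"
  proof -
    have "(b - a) * (mass u v powr p * w a b) \<le> 2 * w u v * (\<beta> * w a b)"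
      using mult_right_mono[OF 1, of "w a b"] w0 by (simp add: mult_ac)
    also have "\<dots> \<le> 2 * w u v * ((b - a) * mass a b powr p)" using 2 w0 by (intro mult_left_mono) auto
    finally have "(b - a) * (mass u v powr p * w a b) \<le> (b - a) * (2 * w u v * mass a b powr p)" by (simp add: mult_ac)
    then have "mass u v powr p * w a b \<le> 2 * w u v * mass a b powr p" using ab by simp
    then show ?thesis using w0 by (simp add: field_simps)
  qed
  then have "(mass u v powr p) powr (1 / p) \<le> (2 * w u v / w a b * mass a b powr p) powr (1 / p)"
    using p by (intro powr_mono2) auto
  also have "\<dots> = ?D" using p w0 m0 by (subst powr_mult) (simp add: powr_powr)
  finally have mD: "mass u v \<le> ?D" using p mass_nonneg[of u v] by (simp add: powr_powr)
  show ?thesis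
  proof (rule piece_single[OF uv good \<beta> _ mD, of "(b - a) / 2"])
    show "0 < ?D" using m0 w0 by simp
    show "0 < (b - a) / 2" "(b - a) / 2 \<le> v - u" using ab I by auto
    fix e B n0 k assume "thr e B n0" "B \<le> \<beta>" "n0 \<le> k"
    then show "greedy_X p ?D ((b - a) / 2) (\<lambda>k. \<beta>\<^sup>2 * w u v * N k powr p) k \<le> e / (1 - p) ^ k"
      using ab bad w0 wle unfolding thr_def by auto
  qed
qed

text \<open>Bisection of bad intervals: a good half is served with its bad parent at hand, a bad
  half is bisected again. For \<open>m = 0\<close> the length is at most \<open>\<delta>\<close>,
  where bad intervals do not exist.\<close>

lemma piece_rec:
  assumes \<beta>: "0 < \<beta>" and K: "\<And>a b. - K \<le> a \<Longrightarrow> a < b \<Longrightarrow> b \<le> K \<Longrightarrow> b - a \<le> \<delta> \<Longrightarrow> good \<beta> a b"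
  shows "- K \<le> a \<Longrightarrow> a < b \<Longrightarrow> b \<le> K \<Longrightarrow> b - a \<le> 1 \<Longrightarrow> b - a \<le> 2 ^ m * \<delta> \<Longrightarrow> w a b \<le> 1 \<Longrightarrow>
    \<not> good \<beta> a b \<Longrightarrow> \<exists>H. piece \<beta> a b H"
proof (induction m arbitrary: a b)
  case 0
  then show ?case using K[of a b] by simp
next
  case (Suc m)
  define c where "c = (a + b) / 2"
  have c: "a < c" "c < b" "c - a = (b - a) / 2" "b - c = (b - a) / 2" using Suc.prems by (auto simp: c_def field_simps)
  have w: "w a b = w a c + w c b" "0 < w a c" "0 < w c b" using w_add[of a c b] w_pos c by auto
  have half: "\<exists>H. piece \<beta> u v H" if uv: "u < v" "a \<le> u" "v \<le> b" "v - u = (b - a) / 2" "w u v \<le> 1" for u v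
  proof (cases "good \<beta> u v")
    case True
    show ?thesis by (rule piece_half[of a b]) (use Suc.prems uv True \<beta> in auto)
  next
    case False
    show ?thesis by (rule Suc.IH) (use Suc.prems uv False in auto)
  qed
  obtain H1 where "piece \<beta> a c H1" using half[of a c] c w Suc.prems by auto
  moreover obtain H2 where "piece \<beta> c b H2" using half[of c b] c w Suc.prems by auto
  ultimately show ?case using piece_concat[OF c(1,2) \<beta>] by blast
qed

text \<open>A good interval of length 1 has an increment of at most
  \<open>(\<beta> * w a b) powr (1 / p)\<close>, which is at most 1, and a bump of full width: the
  starting values are bounded. A bad one is left to the bisection.\<close>

lemma piece_exists:
  assumes \<beta>: "1 \<le> \<beta>" and b: "b = a + 1" and w1: "\<beta> * w a b \<le> 1"
  shows "\<exists>H. piece \<beta> a b H"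
proof (cases "good \<beta> a b")
  case True
  let ?D = "(\<beta> * w a b) powr (1 / p)"
  have ab: "a < b" using b by simp
  have w0: "0 < w a b" using w_pos ab by simp
  have \<beta>0: "0 < \<beta>" using \<beta> by simp
  have "mass a b powr p \<le> \<beta> * w a b" using True b by (simp add: good_def)
  then have "(mass a b powr p) powr (1 / p) \<le> ?D" using p by (intro powr_mono2) auto
  then have mD: "mass a b \<le> ?D" using p mass_nonneg[of a b] by (simp add: powr_powr)
  show ?thesis
  proof (rule piece_single[OF ab True \<beta>0 _ mD, of 1])
    show "0 < ?D" using \<beta>0 w0 by simp
    show "(0::real) < 1" "1 \<le> b - a" using b by auto
    fix e B n0 k assume "thr e B n0" "B \<le> \<beta>" "n0 \<le> k"
    then show "greedy_X p ?D 1 (\<lambda>k. \<beta>\<^sup>2 * w a b * N k powr p) k \<le> e / (1 - p) ^ k"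
      using w1 w0 unfolding thr_def by auto
  qed
next
  case False
  have ab: "a < b" using b by simp
  have \<beta>0: "0 < \<beta>" using \<beta> by simp
  define K where "K = max \<bar>a\<bar> \<bar>b\<bar>"
  have K: "- K \<le> a" "b \<le> K" unfolding K_def by auto
  obtain c where c: "0 < c" "\<And>a b. - K \<le> a \<Longrightarrow> a < b \<Longrightarrow> b \<le> K \<Longrightarrow> c * (b - a) \<le> w a b"
    using w_low[of K] by blast
  have "compact (F (Suc 0) ` {- K..K})" by (intro compact_continuous_image F_cont) simp
  then obtain M where M: "0 < M" "\<And>x. x \<in> {- K..K} \<Longrightarrow> norm (F (Suc 0) x) \<le> M"
    using compact_imp_bounded bounded_pos by (metis imageI)
  \<comment> \<open>With \<open>M\<close> a bound for the function on the compact interval,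
    \<open>(\<delta> * M) powr p\<close> equals \<open>\<beta> * c\<close>, so that
    \<open>w_low\<close> yields goodness.\<close>
  define \<delta> where "\<delta> = (\<beta> * c) powr (1 / p) / M"
  have \<delta>: "0 < \<delta>" using \<beta>0 c(1) M by (simp add: \<delta>_def)
  have small: "good \<beta> u v" if uv: "- K \<le> u" "u < v" "v \<le> K" "v - u \<le> \<delta>" for u v
  proof -
    have "mass u v \<le> integral {u..v} (\<lambda>_. M)"
      unfolding mass_def by (intro integral_le integrable_continuous_interval continuous_on_norm F_cont) (use uv M in auto)
    also have "\<dots> \<le> \<delta> * M" using uv M by simp
    also have "\<dots> = (\<beta> * c) powr (1 / p)" using M by (simp add: \<delta>_def)
    finally have "mass u v powr p \<le> ((\<beta> * c) powr (1 / p)) powr p" using p mass_nonneg by (intro powr_mono2) auto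
    also have "\<dots> = \<beta> * c" using p \<beta>0 c(1) by (simp add: powr_powr)
    finally have "(v - u) * mass u v powr p \<le> (v - u) * (\<beta> * c)" using uv by (intro mult_left_mono) auto
    also have "\<dots> = \<beta> * (c * (v - u))" by simp
    also have "\<dots> \<le> \<beta> * w u v" using c(2)[OF uv(1-3)] \<beta>0 by (intro mult_left_mono) auto
    finally show ?thesis by (simp add: good_def)
  qed
  obtain m where "1 / \<delta> < 2 ^ m" using real_arch_pow[of 2 "1 / \<delta>"] by auto
  then have m: "b - a \<le> 2 ^ m * \<delta>" using \<delta> b by (simp add: field_simps)
  have "w a b \<le> 1" using w1 \<beta> w_pos[OF ab] mult_right_mono[OF \<beta>, of "w a b"] by linarith
  then show ?thesis
    using piece_rec[OF \<beta>0 small K(1) ab K(2) _ m _ False] b by simp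
qed

end

text \<open>A summable sequence stays summable after multiplication by a suitable sequence tending to
  infinity: the inverse square roots of its tails.\<close>

lemma summable_gain:
  fixes f :: "nat \<Rightarrow> real"
  assumes f: "\<And>k. 0 < f k" "summable f" and e: "0 < e"
  obtains \<beta> K where "filterlim \<beta> at_top sequentially"
    "\<And>k. K \<le> k \<Longrightarrow> 1 \<le> \<beta> k" "\<And>k. K \<le> k \<Longrightarrow> \<beta> k * f k \<le> 1"
    "\<And>n. (\<Sum>k=K..<n. (\<beta> k)\<^sup>2 * f k) \<le> e"
proof -
  define r where "r k = (\<Sum>i. f (i + k))" for k
  have sm: "summable (\<lambda>i. f (i + k))" for k using f(2) by (rule summable_ignore_initial_segment)
  have r0: "0 < r k" for k unfolding r_def by (rule suminf_pos[OF sm f(1)])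
  have rS: "r k = f k + r (Suc k)" for k
    using suminf_split_head[OF sm[of k]] by (simp add: r_def)
  have rlim: "r \<longlonglongrightarrow> 0"
    unfolding r_def by (rule suminf_exist_split2[OF f(2)])
  \<comment> \<open>A fourth root because the gain enters squared: the sum of
    \<open>(\<beta> k)\<^sup>2 * f k\<close> telescopes, and \<open>\<beta> k * f k\<close> is at
    most the power 3/4 of the tail.\<close>
  define \<beta> where "\<beta> k = 1 / sqrt (sqrt (r k))" for k
  have b2: "(\<beta> k)\<^sup>2 = 1 / sqrt (r k)" for k
    using r0[of k] by (simp add: \<beta>_def power_divide)
  have step: "(\<beta> k)\<^sup>2 * f k \<le> 2 * (sqrt (r k) - sqrt (r (Suc k)))" for k
  proof -
    have le: "sqrt (r (Suc k)) \<le> sqrt (r k)" using rS[of k] f(1)[of k] by simp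
    have "f k = (sqrt (r k) - sqrt (r (Suc k))) * (sqrt (r k) + sqrt (r (Suc k)))"
      using rS[of k] r0[of k] r0[of "Suc k"] by (simp add: algebra_simps)
    also have "\<dots> \<le> (sqrt (r k) - sqrt (r (Suc k))) * (2 * sqrt (r k))"
      using le by (intro mult_left_mono) auto
    finally have "f k / sqrt (r k) \<le> (sqrt (r k) - sqrt (r (Suc k))) * (2 * sqrt (r k)) / sqrt (r k)"
      using r0[of k] by (intro divide_right_mono) auto
    then show ?thesis using r0[of k] by (simp add: b2 mult.commute)
  qed
  have "eventually (\<lambda>k. r k < min 1 ((e / 2)\<^sup>2)) sequentially"
    using rlim e by (intro order_tendstoD(2)) auto
  then obtain K where K: "\<And>k. K \<le> k \<Longrightarrow> r k < min 1 ((e / 2)\<^sup>2)"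
    by (auto simp: eventually_sequentially)
  have b1: "1 \<le> \<beta> k" if "K \<le> k" for k
  proof -
    have "sqrt (sqrt (r k)) \<le> 1" using K[OF that] by simp
    then show ?thesis using r0[of k] by (simp add: \<beta>_def)
  qed
  show thesis
  proof (rule that[of \<beta> K])
    have "filterlim (\<lambda>k. sqrt (sqrt (r k))) (at_right 0) sequentially"
      unfolding filterlim_at
    proof
      show "eventually (\<lambda>k. sqrt (sqrt (r k)) \<in> {0<..} \<and> sqrt (sqrt (r k)) \<noteq> 0) sequentially"
        using r0 by (intro always_eventually) (simp add: order_less_imp_not_eq2)
      have "(\<lambda>k. sqrt (sqrt (r k))) \<longlonglongrightarrow> sqrt (sqrt 0)" by (intro tendsto_real_sqrt rlim)
      then show "(\<lambda>k. sqrt (sqrt (r k))) \<longlonglongrightarrow> 0" by simp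
    qed
    from filterlim_compose[OF filterlim_inverse_at_top_right this]
    show "filterlim \<beta> at_top sequentially" unfolding \<beta>_def by (simp add: inverse_eq_divide)
    show "1 \<le> \<beta> k" if "K \<le> k" for k by (rule b1[OF that])
    show "\<beta> k * f k \<le> 1" if "K \<le> k" for k
    proof -
      have "f k \<le> r k" using rS[of k] r0[of "Suc k"] by simp
      also have "\<dots> = sqrt (r k) * sqrt (r k)" using r0[of k] by simp
      also have "\<dots> \<le> sqrt (r k) * 1" using K[OF that] r0[of k] by (intro mult_left_mono) auto
      also have "\<dots> = sqrt (sqrt (r k)) * sqrt (sqrt (r k))" using r0[of k] by simp
      also have "\<dots> \<le> sqrt (sqrt (r k)) * 1" using K[OF that] r0[of k] by (intro mult_left_mono) auto
      finally show ?thesis using r0[of k] by (simp add: \<beta>_def field_simps)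
    qed
    show "(\<Sum>k=K..<n. (\<beta> k)\<^sup>2 * f k) \<le> e" for n
    proof (cases "K \<le> n")
      case True
      have "(\<Sum>k=K..<n. (\<beta> k)\<^sup>2 * f k) \<le> (\<Sum>k=K..<n. 2 * (sqrt (r k) - sqrt (r (Suc k))))"
        by (intro sum_mono step)
      also have "\<dots> = 2 * (sqrt (r K) - sqrt (r n))"
        using sum_Suc_diff'[OF True, of "\<lambda>k. - sqrt (r k)"] unfolding sum_distrib_left[symmetric] by simp
      also have "\<dots> \<le> 2 * sqrt (r K)" using r0[of n] by simp
      also have "\<dots> \<le> 2 * (e / 2)"
        using K[of K] e by (intro mult_left_mono real_le_lsqrt) auto
      finally show ?thesis by simp
    qed (use e in simp)
  qed
qed

section \<open>Gluing the pieces along the whole line\<close>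

context weighted_tower begin

text \<open>The part of \<open>piece\<close> that is independent of the thresholds, with price and
  error as separate parameters. It also covers the finitely many central intervals, whose error has
  to be finite only.\<close>

definition upiece :: "real \<Rightarrow> real \<Rightarrow> real \<Rightarrow> real \<Rightarrow> (nat \<Rightarrow> real \<Rightarrow> 'a) \<Rightarrow> bool" where
  "upiece \<tau> C a b H \<longleftrightarrow> dtower H \<and> (\<forall>x\<le>a. H 0 x = 0) \<and> (\<forall>x\<ge>b. H 0 x = F 0 b - F 0 a) \<and>
    (\<forall>n x. x \<le> a \<or> b \<le> x \<longrightarrow> H (Suc n) x = 0) \<and>
    (\<forall>n. (\<integral>\<^sup>+x. ennreal (norm (H (Suc n) x) powr p) \<partial>lborel) \<le> ennreal (\<tau> * N n powr p)) \<and>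
    (\<forall>e>0. eventually (\<lambda>n. \<forall>x. norm (H (Suc n) x) \<le> 4 ^ Suc n * exp (e / (1 - p) ^ Suc n)) sequentially) \<and>
    (\<integral>\<^sup>+x. ennreal (norm (F 0 x - F 0 a - H 0 x) powr p) * indicator {a..b} x \<partial>lborel) \<le> ennreal C"

lemma piece_upiece: "piece \<beta> a b H \<Longrightarrow> upiece (\<beta>\<^sup>2 * w a b) (2 * \<beta> * w a b) a b H"
  unfolding piece_def upiece_def by (elim conjE) (intro conjI; assumption)

lemma piece_thr: "piece \<beta> a b H \<Longrightarrow> thr e B n0 \<Longrightarrow> B \<le> \<beta> \<Longrightarrow> n0 \<le> Suc n \<Longrightarrow>
    norm (H (Suc n) x) \<le> 4 ^ Suc n * exp (e / (1 - p) ^ Suc n)"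
  unfolding piece_def by (elim conjE) blast

lemma upiece_center:
  assumes ab: "a < b" and t: "0 < \<tau>"
  shows "\<exists>C H. 0 \<le> C \<and> upiece \<tau> C a b H"
proof -
  let ?c = "F 0 b - F 0 a" and ?a = "\<lambda>k. \<tau> * N k powr p"
  let ?D = "mass a b + 1" and ?l = "b - a"
  have cm: "norm ?c \<le> mass a b" using F_diff_le[of a b] ab by simp
  have a0: "0 < ?a k" for k
  proof -
    have "N k \<noteq> 0" using N[of k] by simp
    then show ?thesis using t by simp
  qed
  have D: "0 < ?D" "norm ?c \<le> ?D" using cm mass_nonneg[of a b] by auto
  have l: "0 < ?l" using ab by simp
  have ex: thesis
    if "\<And>H :: nat \<Rightarrow> real \<Rightarrow> 'a. dtower H \<Longrightarrow> \<forall>x\<le>a. H 0 x = 0 \<Longrightarrow> \<forall>x\<ge>a + ?l. H 0 x = ?c \<Longrightarrow>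
      \<forall>x. norm (H 0 x) \<le> norm ?c \<Longrightarrow> \<forall>n x. x \<le> a \<or> a + ?l \<le> x \<longrightarrow> H (Suc n) x = 0 \<Longrightarrow>
      \<forall>n x. norm (H (Suc n) x) \<le> 4 ^ Suc n * exp (greedy_X p ?D ?l ?a (Suc n)) \<Longrightarrow>
      \<forall>n. (\<integral>\<^sup>+x. ennreal (norm (H (Suc n) x) powr p) \<partial>lborel) \<le> ennreal (?a n) \<Longrightarrow> thesis" for thesis
    by (rule greedy_bump[where a = ?a and ?x0.0 = a, OF p D l a0], rule that) (assumption, blast+)
  show ?thesis
  proof (rule ex)
    fix H :: "nat \<Rightarrow> real \<Rightarrow> 'a"
    assume H0: "dtower H" "\<forall>x\<le>a. H 0 x = 0" "\<forall>x\<ge>a + ?l. H 0 x = ?c" "\<forall>x. norm (H 0 x) \<le> norm ?c"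
      "\<forall>n x. x \<le> a \<or> a + ?l \<le> x \<longrightarrow> H (Suc n) x = 0"
      "\<forall>n x. norm (H (Suc n) x) \<le> 4 ^ Suc n * exp (greedy_X p ?D ?l ?a (Suc n))"
      "\<forall>n. (\<integral>\<^sup>+x. ennreal (norm (H (Suc n) x) powr p) \<partial>lborel) \<le> ennreal (?a n)"
    let ?m = "mass a b"
    let ?C = "(2 * ?m) powr p * (b - a)"
    have "upiece \<tau> ?C a b H"
      unfolding upiece_def
    proof (intro conjI)
      show "dtower H" "\<forall>x\<le>a. H 0 x = 0" by (rule H0)+
      show "\<forall>x\<ge>b. H 0 x = ?c" "\<forall>n x. x \<le> a \<or> b \<le> x \<longrightarrow> H (Suc n) x = 0" using H0(3,5) by simp_all
      show "\<forall>n. (\<integral>\<^sup>+x. ennreal (norm (H (Suc n) x) powr p) \<partial>lborel) \<le> ennreal (?a n)" by (rule H0)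
      show "\<forall>e>0. eventually (\<lambda>n. \<forall>x. norm (H (Suc n) x) \<le> 4 ^ Suc n * exp (e / (1 - p) ^ Suc n)) sequentially"
      proof (intro allI impI)
        fix e :: real assume e: "0 < e"
        have "eventually (\<lambda>k. greedy_X p ?D ?l ?a k \<le> e / (1 - p) ^ k) sequentially"
          using greedy_single_slow[OF p t N ns e] .
        then have "eventually (\<lambda>n. greedy_X p ?D ?l ?a (Suc n) \<le> e / (1 - p) ^ Suc n) sequentially"
          by (rule eventually_compose_filterlim[OF _ filterlim_Suc])
        then show "eventually (\<lambda>n. \<forall>x. norm (H (Suc n) x) \<le> 4 ^ Suc n * exp (e / (1 - p) ^ Suc n)) sequentially"
        proof eventually_elim
          case (elim n)
          show ?case
          proof
            fix x
            have "4 ^ Suc n * exp (greedy_X p ?D ?l ?a (Suc n)) \<le> 4 ^ Suc n * exp (e / (1 - p) ^ Suc n)"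
              using elim by (intro mult_left_mono) auto
            then show "norm (H (Suc n) x) \<le> 4 ^ Suc n * exp (e / (1 - p) ^ Suc n)"
              using H0(6)[rule_format, of n x] by linarith
          qed
        qed
      qed
      have "(\<integral>\<^sup>+x. ennreal (norm (F 0 x - F 0 a - H 0 x) powr p) * indicator {a..b} x \<partial>lborel)
        \<le> (\<integral>\<^sup>+x. ennreal ((2 * ?m) powr p) * indicator {a..b} x \<partial>lborel)"
      proof (intro nn_integral_mono)
        fix x
        show "ennreal (norm (F 0 x - F 0 a - H 0 x) powr p) * indicator {a..b} x \<le> ennreal ((2 * ?m) powr p) * indicator {a..b} x"
        proof (cases "x \<in> {a..b}")
          case True
          have "norm (F 0 x - F 0 a - H 0 x) \<le> norm (F 0 x - F 0 a) + norm (H 0 x)" by (rule norm_triangle_ineq4)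
          also have "\<dots> \<le> ?m + ?m"
            using F_diff_le[of a x] mass_mono[of a a x b] True H0(4)[rule_format, of x] cm by (intro add_mono) auto
          finally have "norm (F 0 x - F 0 a - H 0 x) powr p \<le> (2 * ?m) powr p" using p by (intro powr_mono2) auto
          then show ?thesis using True by (simp add: ennreal_leI)
        qed simp
      qed
      also have "\<dots> = ennreal ?C" using ab by (simp add: nn_integral_cmult_indicator ennreal_mult)
      finally show "(\<integral>\<^sup>+x. ennreal (norm (F 0 x - F 0 a - H 0 x) powr p) * indicator {a..b} x \<partial>lborel) \<le> ennreal ?C" .
    qed
    moreover have "0 \<le> ?C" using ab by simp
    ultimately show ?thesis by blast
  qed
qed

text \<open>The unit intervals at distance \<open>k\<close> from the origin get the gain
  \<open>\<beta> k\<close> of \<open>summable_gain\<close>. For each \<open>e\<close> a threshold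
  covers all but finitely many of them, since \<open>\<beta>\<close> tends to infinity, and the
  remaining ones satisfy the supremum bound eventually. The L^p error is finite because
  \<open>\<beta> k * om k \<le> (\<beta> k)\<^sup>2 * om k\<close> far out.\<close>

lemma replace_primitive:
  assumes W: "\<And>K. 0 < K \<Longrightarrow> w (- K) K \<le> W" and e: "0 < e"
  shows "\<exists>H. dtower H \<and> (\<forall>n. (\<integral>\<^sup>+x. ennreal (norm (H (Suc n) x) powr p) \<partial>lborel) \<le> ennreal (e * N n powr p)) \<and>
    slow p (\<lambda>n. H (Suc n)) \<and> (\<integral>\<^sup>+x. ennreal (norm (F 0 x - F 0 0 - H 0 x) powr p) \<partial>lborel) < \<infinity>"
proof -
  \<comment> \<open>Left end point of the k-th unit interval on the right (\<open>True\<close>) or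
    left (\<open>False\<close>) of the origin. The two sides are paired so that all sums run over
    natural numbers.\<close>
  define lo where "lo s k = (if s then real k else - real k - 1)" for s :: bool and k :: nat
  define om where "om k = w (lo True k) (lo True k + 1) + w (lo False k) (lo False k + 1)" for k
  have ompos: "0 < om k" for k unfolding om_def by (intro add_pos_pos w_pos) auto
  have ompart: "(\<Sum>k<m. om k) = (if m = 0 then 0 else w (- real m) (real m))" for m
  proof (induction m)
    case (Suc m)
    have "w (- real (Suc m)) (real (Suc m)) = w (- real m - 1) (- real m) + (w (- real m) (real m) + w (real m) (real m + 1))"
    proof -
      have e: "- real (Suc m) = - real m - 1" "real (Suc m) = real m + 1" by simp_all
      show ?thesis unfolding e
        using w_add[of "- real m - 1" "- real m" "real m + 1"] w_add[of "- real m" "real m" "real m + 1"] by simp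
    qed
    moreover have "w (- real m) (real m) = (if m = 0 then 0 else w (- real m) (real m))" using w_add[of 0 0 0] by auto
    ultimately show ?case using Suc by (simp add: om_def lo_def)
  qed simp
  have omsum: "summable om"
  proof (rule bounded_imp_summable)
    show "0 \<le> om k" for k using ompos[of k] by simp
    show "(\<Sum>k\<le>n. om k) \<le> W" for n
      using ompart[of "Suc n"] W[of "real (Suc n)"] by (simp add: lessThan_Suc_atMost)
  qed
  obtain \<beta> K where \<beta>: "filterlim \<beta> at_top sequentially"
    "\<And>k. K \<le> k \<Longrightarrow> 1 \<le> \<beta> k" "\<And>k. K \<le> k \<Longrightarrow> \<beta> k * om k \<le> 1"
    "\<And>n. (\<Sum>k=K..<n. (\<beta> k)\<^sup>2 * om k) \<le> e / 2"
    using summable_gain[OF ompos omsum, of "e / 2"] e by auto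
  have omw: "w (lo s k) (lo s k + 1) \<le> om k" for s k
    using w_pos[of "lo True k" "lo True k + 1"] w_pos[of "lo False k" "lo False k + 1"] by (cases s) (auto simp: om_def)
  \<comment> \<open>The \<open>2 * K\<close> central intervals together then cost at most
    \<open>e / 2\<close>.\<close>
  define cen where "cen = e / (4 * (real K + 1))"
  have cen: "0 < cen" using e by (simp add: cen_def)
  define tau where "tau s k = (if k < K then cen else (\<beta> k)\<^sup>2 * w (lo s k) (lo s k + 1))" for s k
  have "\<forall>s k. \<exists>CH. 0 \<le> fst CH \<and> upiece (tau s k) (fst CH) (lo s k) (lo s k + 1) (snd CH) \<and>
     (K \<le> k \<longrightarrow> fst CH = 2 * \<beta> k * w (lo s k) (lo s k + 1) \<and> piece (\<beta> k) (lo s k) (lo s k + 1) (snd CH))"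
  proof (intro allI)
    fix s k
    show "\<exists>CH. 0 \<le> fst CH \<and> upiece (tau s k) (fst CH) (lo s k) (lo s k + 1) (snd CH) \<and>
     (K \<le> k \<longrightarrow> fst CH = 2 * \<beta> k * w (lo s k) (lo s k + 1) \<and> piece (\<beta> k) (lo s k) (lo s k + 1) (snd CH))"
    proof (cases "k < K")
      case True
      obtain C H where "0 \<le> C" "upiece cen C (lo s k) (lo s k + 1) H"
        using upiece_center[of "lo s k" "lo s k + 1", OF _ cen] by auto
      then show ?thesis using True by (intro exI[of _ "(C, H)"]) (simp add: tau_def)
    next
      case False
      then have k: "K \<le> k" by simp
      have "\<beta> k * w (lo s k) (lo s k + 1) \<le> \<beta> k * om k" using omw \<beta>(2)[OF k] by (intro mult_left_mono) auto
      then have "\<beta> k * w (lo s k) (lo s k + 1) \<le> 1" using \<beta>(3)[OF k] by linarith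
      then obtain H where H: "piece (\<beta> k) (lo s k) (lo s k + 1) H"
        using piece_exists[OF \<beta>(2)[OF k], of "lo s k + 1" "lo s k"] by auto
      have "0 \<le> 2 * \<beta> k * w (lo s k) (lo s k + 1)" using \<beta>(2)[OF k] w_pos[of "lo s k" "lo s k + 1"] by simp
      then show ?thesis using False H piece_upiece[OF H]
        by (intro exI[of _ "(2 * \<beta> k * w (lo s k) (lo s k + 1), H)"]) (simp add: tau_def)
    qed
  qed
  then obtain CH where CH: "\<And>s k. 0 \<le> fst (CH s k)"
    "\<And>s k. upiece (tau s k) (fst (CH s k)) (lo s k) (lo s k + 1) (snd (CH s k))"
    "\<And>s k. K \<le> k \<Longrightarrow> fst (CH s k) = 2 * \<beta> k * w (lo s k) (lo s k + 1)"
    "\<And>s k. K \<le> k \<Longrightarrow> piece (\<beta> k) (lo s k) (lo s k + 1) (snd (CH s k))"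
    by metis
  define C where "C s k = fst (CH s k)" for s k
  define P where "P s k = snd (CH s k)" for s k
  have C0: "0 \<le> C s k" for s k using CH(1) by (simp add: C_def)
  have up: "upiece (tau s k) (C s k) (lo s k) (lo s k + 1) (P s k)" for s k using CH(2) by (simp add: C_def P_def)
  have P1: "dtower (P s k)" and P2: "x \<le> lo s k \<Longrightarrow> P s k 0 x = 0"
    and P3: "lo s k + 1 \<le> x \<Longrightarrow> P s k 0 x = F 0 (lo s k + 1) - F 0 (lo s k)"
    and P4: "x \<le> lo s k \<or> lo s k + 1 \<le> x \<Longrightarrow> P s k (Suc n) x = 0"
    and P5: "(\<integral>\<^sup>+x. ennreal (norm (P s k (Suc n) x) powr p) \<partial>lborel) \<le> ennreal (tau s k * N n powr p)"
    and P6: "0 < e' \<Longrightarrow> eventually (\<lambda>n. \<forall>x. norm (P s k (Suc n) x) \<le> 4 ^ Suc n * exp (e' / (1 - p) ^ Suc n)) sequentially"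
    and P7: "(\<integral>\<^sup>+x. ennreal (norm (F 0 x - F 0 (lo s k) - P s k 0 x) powr p) * indicator {lo s k..lo s k + 1} x \<partial>lborel) \<le> ennreal (C s k)"
    for s k x n e'
    using up[of s k] unfolding upiece_def by (elim conjE; blast)+
  have P8: "norm (P s k (Suc n) x) \<le> 4 ^ Suc n * exp (e' / (1 - p) ^ Suc n)"
    if "thr e' B n0" "B \<le> \<beta> k" "K \<le> k" "n0 \<le> Suc n" for s k x n e' B n0
    using piece_thr[OF CH(4)[OF that(3)] that(1,2,4)] by (simp add: P_def)
  \<comment> \<open>On the negative half line the primitives are normalised to vanish at the right end point.\<close>
  define T where "T k n x = P True k n x + (P False k n x - (if n = 0 then F 0 (- real k) - F 0 (- real k - 1) else 0))" for k n x
  have T_zero: "T k n x = 0" if "\<bar>x\<bar> \<le> real k" for k n x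
  proof (cases n)
    case 0
    then show ?thesis using P2[of x True k] P3[of False k x] that by (simp add: T_def lo_def)
  next
    case (Suc n')
    have "P True k (Suc n') x = 0" "P False k (Suc n') x = 0"
      by (rule P4; use that in \<open>force simp: lo_def\<close>)+
    then show ?thesis using Suc by (simp add: T_def)
  qed
  have T_Suc: "T k (Suc n) x = P True k (Suc n) x + P False k (Suc n) x" for k n x by (simp add: T_def)
  have T_tower: "dtower (T k)" for k
    unfolding dtower_def
  proof (intro allI)
    fix n x
    have "((\<lambda>x. P True k n x + (P False k n x - (if n = 0 then F 0 (- real k) - F 0 (- real k - 1) else 0)))
      has_vector_derivative P True k (Suc n) x + (P False k (Suc n) x - 0)) (at x)"
      by (intro has_vector_derivative_add has_vector_derivative_diff has_vector_derivative_const dtowerD P1)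
    then show "(T k n has_vector_derivative T k (Suc n) x) (at x)" by (simp add: T_def[abs_def])
  qed
  \<comment> \<open>A locally finite sum: \<open>T k\<close> vanishes for
    \<open>\<bar>x\<bar> \<le> real k\<close>, so every larger cut-off gives the same value, and the
    sum may be differentiated termwise with a cut-off common to a neighbourhood.\<close>
  define H where "H n x = (\<Sum>k<nat \<lceil>\<bar>x\<bar>\<rceil>. T k n x)" for n x
  have H_eq: "H n x = (\<Sum>k<m. T k n x)" if "\<bar>x\<bar> \<le> real m" for n x m
    unfolding H_def
  proof (rule sum.mono_neutral_left)
    have "\<lceil>\<bar>x\<bar>\<rceil> \<le> int m" using that by (intro ceiling_le) (simp only: of_int_of_nat_eq)
    then show "{..<nat \<lceil>\<bar>x\<bar>\<rceil>} \<subseteq> {..<m}" by (simp only: lessThan_subset_iff nat_le_iff)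
    show "\<forall>i\<in>{..<m} - {..<nat \<lceil>\<bar>x\<bar>\<rceil>}. T i n x = 0"
    proof
      fix i assume "i \<in> {..<m} - {..<nat \<lceil>\<bar>x\<bar>\<rceil>}"
      then have "nat \<lceil>\<bar>x\<bar>\<rceil> \<le> i" by (simp only: Diff_iff lessThan_iff not_less)
      then have "\<lceil>\<bar>x\<bar>\<rceil> \<le> int i" by (simp only: nat_le_iff)
      then have "\<bar>x\<bar> \<le> real i" by linarith
      then show "T i n x = 0" by (rule T_zero)
    qed
  qed simp
  have H_tower: "dtower H"
    unfolding dtower_def
  proof (intro allI)
    fix n x
    obtain m where m: "\<bar>x\<bar> + 1 \<le> real m" using real_arch_simple by blast
    have "((\<lambda>y. \<Sum>k<m. T k n y) has_vector_derivative (\<Sum>k<m. T k (Suc n) x)) (at x)"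
      by (intro has_vector_derivative_sum dtowerD T_tower)
    then have "(H n has_vector_derivative (\<Sum>k<m. T k (Suc n) x)) (at x)"
      by (rule has_vector_derivative_transform_within_open[where S = "{x - 1<..<x + 1}"]) (use m in \<open>auto intro!: H_eq[symmetric]\<close>)
    then show "(H n has_vector_derivative H (Suc n) x) (at x)" using H_eq[of x m "Suc n"] m by simp
  qed
  note meas [measurable] = dtower_borel[OF P1] dtower_borel[OF F] dtower_borel[OF H_tower]
  \<comment> \<open>At each point at most one piece has nonzero derivatives; suprema over the pieces
    are thus suprema of \<open>H\<close>, without summation.\<close>
  have H_one: "\<exists>s k. H (Suc n) x = P s k (Suc n) x" for n x
  proof -
    define s where "s \<longleftrightarrow> 0 \<le> x"
    define k where "k = nat \<lfloor>\<bar>x\<bar>\<rfloor>"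
    have k: "real k \<le> \<bar>x\<bar>" "\<bar>x\<bar> < real k + 1" unfolding k_def by linarith+
    have zero: "P t i (Suc n) x = 0" if "t \<noteq> s \<or> i \<noteq> k" for t i
    proof (cases "t = s")
      case False
      then show ?thesis by (intro P4) (auto simp: s_def lo_def)
    next
      case True
      then have ik: "i < k \<or> k < i" using that by auto
      then have "real i + 1 \<le> real k \<or> real k + 1 \<le> real i" by linarith
      then show ?thesis using True k by (intro P4) (auto simp: s_def lo_def)
    qed
    have "H (Suc n) x = (\<Sum>i<Suc k. T i (Suc n) x)" by (rule H_eq) (use k in simp)
    also have "\<dots> = (\<Sum>i<Suc k. if i = k then P s k (Suc n) x else 0)"
    proof (intro sum.cong refl)
      fix i
      show "T i (Suc n) x = (if i = k then P s k (Suc n) x else 0)"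
        unfolding T_Suc using zero[of True i] zero[of False i] by (cases s) auto
    qed
    also have "\<dots> = P s k (Suc n) x" by simp
    finally show ?thesis by blast
  qed
  have H_slow: "slow p (\<lambda>n. H (Suc n))"
    unfolding slow_def
  proof (intro allI impI)
    fix e1 :: real assume e1: "0 < e1"
    \<comment> \<open>Half of \<open>e1\<close> is reserved for the factor \<open>4 ^ Suc n\<close>,
      and \<open>1 - p\<close> compensates the shift from order \<open>Suc n\<close> to
      \<open>n\<close>.\<close>
    define e2 where "e2 = e1 / 2 * (1 - p)"
    have e2: "0 < e2" using e1 p by (simp add: e2_def)
    obtain B n0 where B: "thr e2 B n0" using thr_exists[OF e2] by blast
    have "eventually (\<lambda>k. B \<le> \<beta> k) sequentially" using \<beta>(1) by (simp add: filterlim_at_top)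
    then obtain k1 where k1: "\<And>k. k1 \<le> k \<Longrightarrow> B \<le> \<beta> k" by (auto simp: eventually_sequentially)
    let ?ok = "\<lambda>n s k. \<forall>x. norm (P s k (Suc n) x) \<le> 4 ^ Suc n * exp (e2 / (1 - p) ^ Suc n)"
    have "eventually (\<lambda>n. \<forall>k\<in>{..<max k1 K}. \<forall>s\<in>{True, False}. ?ok n s k) sequentially"
      by (intro eventually_ball_finite ballI P6 e2) auto
    moreover have "eventually (\<lambda>n. ln 4 * (real n + 1)\<^sup>2 \<le> (e1 / 2) / (1 - p) ^ n) sequentially"
      using quadratic_le_eventually[OF p, of "e1 / 2" "ln 4"] e1 by simp
    moreover have "eventually (\<lambda>n. n0 \<le> n) sequentially" by (rule eventually_ge_at_top)
    ultimately show "eventually (\<lambda>n. \<forall>x. norm (H (Suc n) x) \<le> exp (e1 / (1 - p) ^ n)) sequentially"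
    proof eventually_elim
      case (elim n)
      show ?case
      proof
        fix x
        obtain s k where sk: "H (Suc n) x = P s k (Suc n) x" using H_one by blast
        have "norm (P s k (Suc n) x) \<le> 4 ^ Suc n * exp (e2 / (1 - p) ^ Suc n)"
        proof (cases "k < max k1 K")
          case True
          then show ?thesis using elim(1) by (cases s) auto
        next
          case False
          show ?thesis by (rule P8[OF B k1]) (use False elim(3) in auto)
        qed
        also have "\<dots> = exp ((real n + 1) * ln 4 + (e1 / 2) / (1 - p) ^ n)"
        proof -
          have "(4::real) ^ Suc n = exp ((real n + 1) * ln 4)"
            using exp_of_nat_mult[of "Suc n" "ln (4::real)"] by (simp add: add.commute)
          moreover have "e2 / (1 - p) ^ Suc n = (e1 / 2) / (1 - p) ^ n" using p by (simp add: e2_def)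
          ultimately show ?thesis by (simp only: exp_add)
        qed
        also have "\<dots> \<le> exp (e1 / (1 - p) ^ n)"
        proof -
          have "(real n + 1) * ln 4 \<le> ln 4 * (real n + 1)\<^sup>2"
            by (simp add: power2_eq_square mult_le_cancel_left1 mult.commute)
          then have "(real n + 1) * ln 4 \<le> (e1 / 2) / (1 - p) ^ n" using elim(2) by linarith
          moreover have "e1 / (1 - p) ^ n = (e1 / 2) / (1 - p) ^ n + (e1 / 2) / (1 - p) ^ n"
            unfolding add_divide_distrib[symmetric] by simp
          ultimately show ?thesis by (subst exp_le_cancel_iff) linarith
        qed
        finally show "norm (H (Suc n) x) \<le> exp (e1 / (1 - p) ^ n)" using sk by simp
      qed
    qed
  qed
  have H_Lp: "(\<integral>\<^sup>+x. ennreal (norm (H (Suc n) x) powr p) \<partial>lborel) \<le> ennreal (e * N n powr p)" for n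
  proof -
    have "(\<integral>\<^sup>+x. ennreal (norm (H (Suc n) x) powr p) \<partial>lborel)
      \<le> (\<integral>\<^sup>+x. (\<Sum>k. ennreal (norm (P True k (Suc n) x) powr p) + ennreal (norm (P False k (Suc n) x) powr p)) \<partial>lborel)"
    proof (intro nn_integral_mono)
      fix x
      let ?f = "\<lambda>k. ennreal (norm (P True k (Suc n) x) powr p) + ennreal (norm (P False k (Suc n) x) powr p)"
      obtain s k where sk: "H (Suc n) x = P s k (Suc n) x" using H_one by blast
      have "ennreal (norm (H (Suc n) x) powr p) \<le> ?f k" unfolding sk by (cases s) auto
      also have "?f k = sum ?f {k}" by simp
      also have "\<dots> \<le> suminf ?f" by (rule sum_le_suminf) auto
      finally show "ennreal (norm (H (Suc n) x) powr p) \<le> suminf ?f" .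
    qed
    also have "\<dots> = (\<Sum>k. \<integral>\<^sup>+x. ennreal (norm (P True k (Suc n) x) powr p) + ennreal (norm (P False k (Suc n) x) powr p) \<partial>lborel)"
      by (rule nn_integral_suminf) measurable
    also have "\<dots> \<le> ennreal (e * N n powr p)"
    proof (rule suminf_le_const)
      fix m
      have t0: "0 \<le> tau s k" for s k
        using cen w_pos[of "lo s k" "lo s k + 1"] by (simp add: tau_def)
      have "(\<Sum>k<m. \<integral>\<^sup>+x. ennreal (norm (P True k (Suc n) x) powr p) + ennreal (norm (P False k (Suc n) x) powr p) \<partial>lborel)
        \<le> (\<Sum>k<m. ennreal (tau True k * N n powr p) + ennreal (tau False k * N n powr p))"
        by (intro sum_mono, subst nn_integral_add, measurable) (intro add_mono P5)
      also have "\<dots> = ennreal (\<Sum>k<m. (tau True k + tau False k) * N n powr p)"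
        using t0 by (simp add: ennreal_plus[symmetric] distrib_right sum_ennreal del: ennreal_plus)
      also have "\<dots> \<le> ennreal (e * N n powr p)"
      proof (intro ennreal_leI)
        have "(\<Sum>k<m. tau True k + tau False k) \<le> (\<Sum>k<max m K. tau True k + tau False k)"
          using t0 by (intro sum_mono2) auto
        also have "\<dots> = (\<Sum>k<K. tau True k + tau False k) + (\<Sum>k=K..<max m K. tau True k + tau False k)"
          by (metis atLeast0LessThan max.cobounded2 sum.atLeastLessThan_concat zero_le)
        also have "(\<Sum>k<K. tau True k + tau False k) = real K * (2 * cen)" by (simp add: tau_def)
        also have "\<dots> \<le> e / 2" using e by (simp add: cen_def field_simps)
        also have "(\<Sum>k=K..<max m K. tau True k + tau False k) = (\<Sum>k=K..<max m K. (\<beta> k)\<^sup>2 * om k)"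
          by (intro sum.cong refl) (simp add: tau_def om_def distrib_left)
        also have "\<dots> \<le> e / 2" by (rule \<beta>(4))
        finally have "(\<Sum>k<m. tau True k + tau False k) \<le> e" by simp
        then show "(\<Sum>k<m. (tau True k + tau False k) * N n powr p) \<le> e * N n powr p"
          unfolding sum_distrib_right[symmetric] by (intro mult_right_mono) auto
      qed
      finally show "(\<Sum>k<m. \<integral>\<^sup>+x. ennreal (norm (P True k (Suc n) x) powr p) + ennreal (norm (P False k (Suc n) x) powr p) \<partial>lborel) \<le> ennreal (e * N n powr p)" .
    qed simp
    finally show ?thesis .
  qed
  let ?g = "\<lambda>s k x. ennreal (norm (F 0 x - F 0 (lo s k) - P s k 0 x) powr p) * indicator {lo s k..lo s k + 1} x"
  \<comment> \<open>The pieces between the origin and \<open>x\<close> have completed their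
    increments, which telescope to an increment of \<open>F 0\<close>. What remains is the error of
    the one piece around \<open>x\<close>.\<close>
  have H_0: "\<exists>s k. F 0 x - F 0 0 - H 0 x = F 0 x - F 0 (lo s k) - P s k 0 x \<and> x \<in> {lo s k..lo s k + 1}" for x
  proof -
    define k where "k = nat \<lfloor>\<bar>x\<bar>\<rfloor>"
    have k: "real k \<le> \<bar>x\<bar>" "\<bar>x\<bar> < real k + 1" unfolding k_def by linarith+
    have "H 0 x = (\<Sum>i<Suc k. T i 0 x)" by (rule H_eq) (use k in simp)
    then have Hx: "H 0 x = (\<Sum>i<k. T i 0 x) + T k 0 x" by simp
    show ?thesis
    proof (cases "0 \<le> x")
      case True
      have T1: "T i 0 x = P True i 0 x" for i using P3[of False i x] True by (simp add: T_def lo_def)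
      have "(\<Sum>i<k. T i 0 x) = (\<Sum>i<k. F 0 (real (Suc i)) - F 0 (real i))"
      proof (intro sum.cong refl)
        fix i assume "i \<in> {..<k}"
        then have "real i + 1 \<le> real k" by auto
        then show "T i 0 x = F 0 (real (Suc i)) - F 0 (real i)"
          using T1 P3[of True i x] k True by (simp add: lo_def add.commute)
      qed
      also have "\<dots> = F 0 (real k) - F 0 0" using sum_lessThan_telescope[of "\<lambda>i. F 0 (real i)" k] by simp
      finally show ?thesis using Hx T1 True k by (intro exI[of _ True] exI[of _ k]) (simp add: lo_def)
    next
      case False
      have T1: "T i 0 x = P False i 0 x - (F 0 (- real i) - F 0 (- real i - 1))" for i
        using P2[of x True i] False by (simp add: T_def lo_def)
      have "(\<Sum>i<k. T i 0 x) = (\<Sum>i<k. F 0 (- real (Suc i)) - F 0 (- real i))"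
      proof (intro sum.cong refl)
        fix i assume "i \<in> {..<k}"
        then have "real i + 1 \<le> real k" by auto
        then have "x \<le> lo False i" using k False by (simp add: lo_def)
        then have "P False i 0 x = 0" by (rule P2)
        moreover have "- real (Suc i) = - real i - 1" by simp
        ultimately show "T i 0 x = F 0 (- real (Suc i)) - F 0 (- real i)" using T1[of i] by (simp only:) simp
      qed
      also have "\<dots> = F 0 (- real k) - F 0 0" using sum_lessThan_telescope[of "\<lambda>i. F 0 (- real i)" k] by simp
      finally show ?thesis using Hx T1[of k] False k by (intro exI[of _ False] exI[of _ k]) (simp add: lo_def)
    qed
  qed
  have "(\<integral>\<^sup>+x. ennreal (norm (F 0 x - F 0 0 - H 0 x) powr p) \<partial>lborel) \<le> (\<integral>\<^sup>+x. (\<Sum>k. ?g True k x + ?g False k x) \<partial>lborel)"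
  proof (intro nn_integral_mono)
    fix x
    obtain s k where sk: "F 0 x - F 0 0 - H 0 x = F 0 x - F 0 (lo s k) - P s k 0 x" "x \<in> {lo s k..lo s k + 1}"
      using H_0[of x] by blast
    have "ennreal (norm (F 0 x - F 0 0 - H 0 x) powr p) = ?g s k x" unfolding sk(1) using sk(2) by simp
    also have "\<dots> \<le> ?g True k x + ?g False k x" by (cases s) auto
    also have "\<dots> = (\<Sum>k\<in>{k}. ?g True k x + ?g False k x)" by simp
    also have "\<dots> \<le> (\<Sum>k. ?g True k x + ?g False k x)" by (rule sum_le_suminf) auto
    finally show "ennreal (norm (F 0 x - F 0 0 - H 0 x) powr p) \<le> (\<Sum>k. ?g True k x + ?g False k x)" .
  qed
  also have "\<dots> = (\<Sum>k. \<integral>\<^sup>+x. ?g True k x + ?g False k x \<partial>lborel)" by (rule nn_integral_suminf) measurable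
  also have "\<dots> \<le> ennreal ((\<Sum>k<K. C True k + C False k) + e)"
  proof (rule suminf_le_const)
    fix m
    have "(\<Sum>k<m. \<integral>\<^sup>+x. ?g True k x + ?g False k x \<partial>lborel) \<le> (\<Sum>k<m. ennreal (C True k) + ennreal (C False k))"
      by (intro sum_mono, subst nn_integral_add, measurable) (intro add_mono P7)
    also have "\<dots> = ennreal (\<Sum>k<m. C True k + C False k)"
      using C0 by (simp add: ennreal_plus[symmetric] sum_ennreal del: ennreal_plus)
    also have "\<dots> \<le> ennreal ((\<Sum>k<K. C True k + C False k) + e)"
    proof (intro ennreal_leI)
      have "(\<Sum>k<m. C True k + C False k) \<le> (\<Sum>k<max m K. C True k + C False k)"
        using C0 by (intro sum_mono2) auto
      also have "\<dots> = (\<Sum>k<K. C True k + C False k) + (\<Sum>k=K..<max m K. C True k + C False k)"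
        by (metis atLeast0LessThan max.cobounded2 sum.atLeastLessThan_concat zero_le)
      also have "(\<Sum>k=K..<max m K. C True k + C False k) \<le> (\<Sum>k=K..<max m K. 2 * ((\<beta> k)\<^sup>2 * om k))"
      proof (intro sum_mono)
        fix k assume "k \<in> {K..<max m K}"
        then have k: "K \<le> k" by simp
        have "C True k + C False k = 2 * (\<beta> k * om k)" using CH(3)[OF k] by (simp add: C_def om_def algebra_simps)
        also have "\<dots> \<le> 2 * ((\<beta> k)\<^sup>2 * om k)"
          using \<beta>(2)[OF k] ompos[of k] by (intro mult_left_mono mult_right_mono) (auto simp: power2_eq_square)
        finally show "C True k + C False k \<le> 2 * ((\<beta> k)\<^sup>2 * om k)" .
      qed
      also have "\<dots> \<le> e" using \<beta>(4)[of "max m K"] by (simp add: sum_distrib_left[symmetric])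
      finally show "(\<Sum>k<m. C True k + C False k) \<le> (\<Sum>k<K. C True k + C False k) + e" by simp
    qed
    finally show "(\<Sum>k<m. \<integral>\<^sup>+x. ?g True k x + ?g False k x \<partial>lborel) \<le> ennreal ((\<Sum>k<K. C True k + C False k) + e)" .
  qed simp
  also have "\<dots> < \<infinity>" by simp
  finally show ?thesis using H_tower H_slow H_Lp by blast
qed

end

section \<open>Classes in $L^p$\<close>

lemma ennpowr_ennreal: "0 \<le> r \<Longrightarrow> ennpowr (ennreal r) a = ennreal (r powr a)"
  by (simp add: ennpowr_def)

lemma ennpowr_less_top: "ennpowr x a < \<infinity> \<longleftrightarrow> x < \<infinity>"
  by (cases x) (auto simp: ennpowr_def)

text \<open>The integral before the root is taken, which is subadditive for
  \<open>p < 1\<close>.\<close>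

definition Jp :: "real \<Rightarrow> (real \<Rightarrow> 'a::real_normed_vector) \<Rightarrow> ennreal" where
  "Jp p f = (\<integral>\<^sup>+x. ennreal (norm (f x) powr p) \<partial>lebesgue)"

lemma lp_norm_Jp: "lp_norm p f = ennpowr (Jp p f) (1 / p)" by (simp add: lp_norm_def Jp_def)

lemma lp_funs_iff: "f \<in> lp_funs p \<longleftrightarrow> f \<in> borel_measurable lebesgue \<and> Jp p f < \<infinity>"
  unfolding lp_funs_def lp_norm_Jp mem_Collect_eq ennpowr_less_top ..

lemma Jp_lborel:
  "Jp p f = (\<integral>\<^sup>+x. ennreal (norm (f x) powr p) \<partial>lborel)"
  unfolding Jp_def by (rule nn_integral_completion)

lemma Jp_add:
  fixes f g :: "real \<Rightarrow> 'a::euclidean_space"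
  assumes p: "0 < p" "p < 1" and f: "f \<in> borel_measurable lebesgue" and g: "g \<in> borel_measurable lebesgue"
  shows "Jp p (\<lambda>x. f x + g x) \<le> Jp p f + Jp p g"
proof -
  note [measurable] = f g
  have "Jp p (\<lambda>x. f x + g x) \<le> (\<integral>\<^sup>+x. ennreal (norm (f x) powr p) + ennreal (norm (g x) powr p) \<partial>lebesgue)"
    unfolding Jp_def using p
    by (intro nn_integral_mono) (auto simp: ennreal_plus[symmetric] simp del: ennreal_plus intro!: ennreal_leI norm_powr_subadd)
  also have "\<dots> = Jp p f + Jp p g" unfolding Jp_def by (rule nn_integral_add) measurable
  finally show ?thesis .
qed

lemma Jp_scale:
  fixes f :: "real \<Rightarrow> 'a::{real_normed_field, euclidean_space}"
  assumes f: "f \<in> borel_measurable lebesgue"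
  shows "Jp p (\<lambda>x. c * f x) = ennreal (norm c powr p) * Jp p f"
proof -
  note [measurable] = f
  have "Jp p (\<lambda>x. c * f x) = (\<integral>\<^sup>+x. ennreal (norm c powr p) * ennreal (norm (f x) powr p) \<partial>lebesgue)"
    unfolding Jp_def by (simp add: norm_mult powr_mult ennreal_mult)
  also have "\<dots> = ennreal (norm c powr p) * Jp p f" unfolding Jp_def by (rule nn_integral_cmult) measurable
  finally show ?thesis .
qed

lemma Jp_minus_commute: "Jp p (\<lambda>x. f x - g x) = Jp p (\<lambda>x. g x - f x)"
  by (simp add: Jp_def norm_minus_commute)

lemma Jp_eq_0_iff:
  fixes f :: "real \<Rightarrow> 'a::euclidean_space"
  assumes f: "f \<in> borel_measurable lebesgue"
  shows "Jp p f = 0 \<longleftrightarrow> (AE x in lebesgue. f x = 0)"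
proof -
  note [measurable] = f
  show ?thesis unfolding Jp_def by (subst nn_integral_0_iff_AE) (auto simp: not_less)
qed

lemma Jp_cong_AE: "AE x in lebesgue. f x = g x \<Longrightarrow> Jp p f = Jp p g"
  unfolding Jp_def by (rule nn_integral_cong_AE) auto

definition mL :: "real \<Rightarrow> (real \<Rightarrow> 'a::real_normed_vector) \<Rightarrow> real" where "mL p f = enn2real (Jp p f)"

lemma Jp_mL: "f \<in> lp_funs p \<Longrightarrow> Jp p f = ennreal (mL p f)"
  by (simp add: mL_def lp_funs_iff)

lemma mL_nonneg: "0 \<le> mL p f" by (simp add: mL_def)

lemma lp_norm_mL: "f \<in> lp_funs p \<Longrightarrow> lp_norm p f = ennreal (mL p f powr (1 / p))"
  by (simp add: lp_norm_Jp Jp_mL ennpowr_ennreal mL_nonneg)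

lemma lp_funs_add:
  fixes f g :: "real \<Rightarrow> 'a::euclidean_space"
  assumes p: "0 < p" "p < 1" and f: "f \<in> lp_funs p" and g: "g \<in> lp_funs p"
  shows "(\<lambda>x. f x + g x) \<in> lp_funs p" "mL p (\<lambda>x. f x + g x) \<le> mL p f + mL p g"
proof -
  have m: "f \<in> borel_measurable lebesgue" "g \<in> borel_measurable lebesgue" using f g by (auto simp: lp_funs_iff)
  note J = Jp_add[OF p m]
  have fin: "Jp p f + Jp p g < \<infinity>" using f g by (simp add: lp_funs_iff)
  show *: "(\<lambda>x. f x + g x) \<in> lp_funs p"
    unfolding lp_funs_iff using m J fin by (auto intro: borel_measurable_add le_less_trans)
  have "ennreal (mL p (\<lambda>x. f x + g x)) \<le> ennreal (mL p f + mL p g)"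
    using J by (simp add: Jp_mL[OF *] Jp_mL[OF f] Jp_mL[OF g] mL_nonneg)
  moreover have "0 \<le> mL p f + mL p g" by (intro add_nonneg_nonneg mL_nonneg)
  ultimately show "mL p (\<lambda>x. f x + g x) \<le> mL p f + mL p g" by (simp only: ennreal_le_iff)
qed

lemma lp_funs_scale:
  fixes f :: "real \<Rightarrow> 'a::{real_normed_field, euclidean_space}"
  assumes f: "f \<in> lp_funs p"
  shows "(\<lambda>x. c * f x) \<in> lp_funs p" "mL p (\<lambda>x. c * f x) = norm c powr p * mL p f"
proof -
  have m: "f \<in> borel_measurable lebesgue" using f by (auto simp: lp_funs_iff)
  note J = Jp_scale[OF m, of p c]
  have "(\<lambda>x. c * f x) \<in> borel_measurable lebesgue"
    using m by (intro borel_measurable_times borel_measurable_const)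
  then show "(\<lambda>x. c * f x) \<in> lp_funs p"
    unfolding lp_funs_iff using J f by (auto simp: lp_funs_iff ennreal_mult_less_top)
  show "mL p (\<lambda>x. c * f x) = norm c powr p * mL p f" using J by (simp add: mL_def enn2real_mult)
qed

lemma lp_funs_diff:
  fixes f g :: "real \<Rightarrow> 'a::{real_normed_field, euclidean_space}"
  assumes p: "0 < p" "p < 1" and f: "f \<in> lp_funs p" and g: "g \<in> lp_funs p"
  shows "(\<lambda>x. f x - g x) \<in> lp_funs p"
  using lp_funs_add(1)[OF p f lp_funs_scale(1)[OF g, of "-1"]] by simp

lemma mL_triangle:
  fixes f g h :: "real \<Rightarrow> 'a::{real_normed_field, euclidean_space}"
  assumes p: "0 < p" "p < 1" and "f \<in> lp_funs p" "g \<in> lp_funs p" "h \<in> lp_funs p"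
  shows "mL p (\<lambda>x. f x - h x) \<le> mL p (\<lambda>x. f x - g x) + mL p (\<lambda>x. g x - h x)"
  using lp_funs_add(2)[OF p lp_funs_diff[OF p assms(3,4)] lp_funs_diff[OF p assms(4,5)]] by simp

lemma mL_minus_commute: "mL p (\<lambda>x. f x - g x) = mL p (\<lambda>x. g x - f x)"
  by (simp add: mL_def Jp_minus_commute[of p f g])

definition lcls :: "real \<Rightarrow> (real \<Rightarrow> 'a::real_normed_vector) \<Rightarrow> (real \<Rightarrow> 'a) set" where
  "lcls p f = ae_rel p `` {f}"

lemma ae_rel_equiv: "equiv (lp_funs p) (ae_rel p)"
proof (rule equivI)
  show "ae_rel p \<subseteq> lp_funs p \<times> lp_funs p" by (auto simp: ae_rel_def)
  show "refl_on (lp_funs p) (ae_rel p)" by (rule refl_onI) (simp add: ae_rel_def)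
  show "sym (ae_rel p)" by (rule symI) (auto simp: ae_rel_def eq_commute)
  show "trans (ae_rel p)"
  proof (rule transI)
    fix f g h assume a: "(f, g) \<in> ae_rel p" "(g, h) \<in> ae_rel p"
    then have "AE x in lebesgue. f x = g x" "AE x in lebesgue. g x = h x" by (auto simp: ae_rel_def)
    then have "AE x in lebesgue. f x = h x" by eventually_elim simp
    then show "(f, h) \<in> ae_rel p" using a by (simp add: ae_rel_def)
  qed
qed

lemma lcls_eq_iff: "f \<in> lp_funs p \<Longrightarrow> g \<in> lp_funs p \<Longrightarrow> lcls p f = lcls p g \<longleftrightarrow> (AE x in lebesgue. f x = g x)"
  unfolding lcls_def using eq_equiv_class_iff[OF ae_rel_equiv, of f p g] by (simp add: ae_rel_def)

lemma in_lcls: "g \<in> lcls p f \<longleftrightarrow> f \<in> lp_funs p \<and> g \<in> lp_funs p \<and> (AE x in lebesgue. f x = g x)"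
  by (simp add: lcls_def ae_rel_def)

lemma lp_carrier: "qcarrier (lp_space p) = lcls p ` lp_funs p"
  by (auto simp: lp_space_def lcls_def quotient_def)

lemma lp_space_add:
  fixes f g :: "real \<Rightarrow> 'a::{real_normed_field, euclidean_space}"
  assumes p: "0 < p" "p < 1" and f: "f \<in> lp_funs p" and g: "g \<in> lp_funs p"
  shows "qadd (lp_space p) (lcls p f) (lcls p g) = lcls p (\<lambda>x. f x + g x)"
proof -
  have *: "lcls p (\<lambda>x. f' x + g' x) = lcls p (\<lambda>x. f x + g x)" if "f' \<in> lcls p f" "g' \<in> lcls p g" for f' g'
  proof (rule iffD2[OF lcls_eq_iff])
    have a: "f' \<in> lp_funs p" "g' \<in> lp_funs p" "AE x in lebesgue. f x = f' x" "AE x in lebesgue. g x = g' x"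
      using that by (auto simp: in_lcls)
    show "(\<lambda>x. f' x + g' x) \<in> lp_funs p" "(\<lambda>x. f x + g x) \<in> lp_funs p"
      using lp_funs_add(1)[OF p a(1,2)] lp_funs_add(1)[OF p f g] by auto
    show "AE x in lebesgue. f' x + g' x = f x + g x" using a(3,4) by eventually_elim simp
  qed
  have "qadd (lp_space p) (lcls p f) (lcls p g) = (\<Union>f'\<in>lcls p f. \<Union>g'\<in>lcls p g. lcls p (\<lambda>x. f' x + g' x))"
    by (simp add: lp_space_def lcls_def)
  also have "\<dots> = (\<Union>f'\<in>lcls p f. \<Union>g'\<in>lcls p g. lcls p (\<lambda>x. f x + g x))" by (intro SUP_cong refl *)
  also have "\<dots> = lcls p (\<lambda>x. f x + g x)"
  proof -
    have "f \<in> lcls p f" "g \<in> lcls p g" using f g by (simp_all add: in_lcls)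
    then have "lcls p f \<noteq> {}" "lcls p g \<noteq> {}" by blast+
    then show ?thesis by simp
  qed
  finally show ?thesis .
qed

lemma lp_space_scale:
  fixes f :: "real \<Rightarrow> 'a::{real_normed_field, euclidean_space}"
  assumes f: "f \<in> lp_funs p"
  shows "qscale (lp_space p) c (lcls p f) = lcls p (\<lambda>x. c * f x)"
proof -
  have *: "lcls p (\<lambda>x. c * f' x) = lcls p (\<lambda>x. c * f x)" if "f' \<in> lcls p f" for f'
  proof (rule iffD2[OF lcls_eq_iff])
    have a: "f' \<in> lp_funs p" "AE x in lebesgue. f x = f' x" using that by (auto simp: in_lcls)
    show "(\<lambda>x. c * f' x) \<in> lp_funs p" "(\<lambda>x. c * f x) \<in> lp_funs p" by (intro lp_funs_scale a f)+
    show "AE x in lebesgue. c * f' x = c * f x" using a(2) by eventually_elim simp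
  qed
  have "qscale (lp_space p) c (lcls p f) = (\<Union>f'\<in>lcls p f. lcls p (\<lambda>x. c * f' x))"
    by (simp add: lp_space_def lcls_def)
  also have "\<dots> = (\<Union>f'\<in>lcls p f. lcls p (\<lambda>x. c * f x))" by (intro SUP_cong refl *)
  also have "\<dots> = lcls p (\<lambda>x. c * f x)"
  proof -
    have "f \<in> lcls p f" using f by (simp add: in_lcls)
    then have "lcls p f \<noteq> {}" by blast
    then show ?thesis by simp
  qed
  finally show ?thesis .
qed

lemma lp_space_norm:
  fixes f :: "real \<Rightarrow> 'a::{real_normed_field, euclidean_space}"
  assumes f: "f \<in> lp_funs p"
  shows "qnorm (lp_space p) (lcls p f) = ennreal (mL p f powr (1 / p))"
proof -
  have *: "lp_norm p g = ennreal (mL p f powr (1 / p))" if "g \<in> lcls p f" for g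
    using that lp_norm_mL[OF f] Jp_cong_AE[of f g p] by (simp add: in_lcls lp_norm_Jp)
  have "f \<in> lcls p f" using f by (simp add: in_lcls)
  then show ?thesis using * unfolding lp_space_def by (auto intro!: the_equality)
qed

definition lrep :: "real \<Rightarrow> (real \<Rightarrow> 'a::real_normed_vector) set \<Rightarrow> real \<Rightarrow> 'a" where
  "lrep p A = (SOME f. f \<in> lp_funs p \<and> A = lcls p f)"

lemma lrep:
  fixes A :: "(real \<Rightarrow> 'a::{real_normed_field, euclidean_space}) set"
  assumes "A \<in> qcarrier (lp_space p)" shows "lrep p A \<in> lp_funs p \<and> lcls p (lrep p A) = A"
proof -
  have "\<exists>f. f \<in> lp_funs p \<and> A = lcls p f" using assms unfolding lp_carrier by blast
  then have "lrep p A \<in> lp_funs p \<and> A = lcls p (lrep p A)" unfolding lrep_def by (rule someI_ex)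
  then show ?thesis by simp
qed

definition DL :: "real \<Rightarrow> (real \<Rightarrow> 'a::real_normed_vector) set \<Rightarrow> (real \<Rightarrow> 'a) set \<Rightarrow> real" where
  "DL p A B = mL p (\<lambda>x. lrep p A x - lrep p B x)"

lemma DL_lcls:
  fixes f g :: "real \<Rightarrow> 'a::{real_normed_field, euclidean_space}"
  assumes f: "f \<in> lp_funs p" and g: "g \<in> lp_funs p"
  shows "DL p (lcls p f) (lcls p g) = mL p (\<lambda>x. f x - g x)"
proof -
  have c: "lcls p f \<in> qcarrier (lp_space p)" "lcls p g \<in> qcarrier (lp_space p)" using f g by (auto simp: lp_carrier)
  have "AE x in lebesgue. lrep p (lcls p f) x = f x" "AE x in lebesgue. lrep p (lcls p g) x = g x"
    using lrep[OF c(1)] lrep[OF c(2)] lcls_eq_iff[of "lrep p (lcls p f)" p f] lcls_eq_iff[of "lrep p (lcls p g)" p g] f g by auto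
  then have "AE x in lebesgue. lrep p (lcls p f) x - lrep p (lcls p g) x = f x - g x" by eventually_elim simp
  then show ?thesis unfolding DL_def mL_def by (simp add: Jp_cong_AE)
qed

lemma DL_power_dist:
  assumes p: "0 < p" "p < 1"
  shows "power_dist p (lp_space p :: ('a::{real_normed_field, euclidean_space}, _) qn_space) (DL p)"
  unfolding power_dist_def
proof (intro conjI ballI p)
  fix A B :: "(real \<Rightarrow> 'a) set" assume AB: "A \<in> qcarrier (lp_space p)" "B \<in> qcarrier (lp_space p)"
  show "0 \<le> DL p A B" by (simp add: DL_def mL_nonneg)
  obtain f g where fg: "f \<in> lp_funs p" "g \<in> lp_funs p" "A = lcls p f" "B = lcls p g" using AB by (auto simp: lp_carrier)
  have d: "(\<lambda>x. f x + -1 * g x) \<in> lp_funs p" using lp_funs_diff[OF p fg(1,2)] by simp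
  show "qdist (lp_space p) A B = ennreal (DL p A B powr (1 / p))"
    unfolding qdist_def fg lp_space_scale[OF fg(2)] lp_space_add[OF p fg(1) lp_funs_scale(1)[OF fg(2)]]
      lp_space_norm[OF d] DL_lcls[OF fg(1,2)] by simp
qed

lemma DL_triangle:
  fixes A :: "(real \<Rightarrow> 'a::{real_normed_field, euclidean_space}) set"
  assumes p: "0 < p" "p < 1" and "A \<in> qcarrier (lp_space p)" "B \<in> qcarrier (lp_space p)" "C \<in> qcarrier (lp_space p)"
  shows "DL p A C \<le> DL p A B + DL p B C"
  unfolding DL_def using lrep[OF assms(3)] lrep[OF assms(4)] lrep[OF assms(5)] by (intro mL_triangle p) auto

lemma DL_refl: "DL p A A = 0" by (simp add: DL_def mL_def Jp_def)

text \<open>The norms are eventually at most 1, and there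
  \<open>norm (a i) \<le> norm (a i) powr p\<close>.\<close>

lemma summable_norm_of_powr:
  fixes a :: "nat \<Rightarrow> 'a::real_normed_vector"
  assumes p: "0 < p" "p < 1" and s: "summable (\<lambda>i. norm (a i) powr p)"
  shows "summable (\<lambda>i. norm (a i))"
proof (rule summable_comparison_test_ev[OF _ s])
  have "eventually (\<lambda>i. norm (a i) powr p < 1) sequentially"
    using summable_LIMSEQ_zero[OF s] by (intro order_tendstoD(2)) auto
  then show "eventually (\<lambda>i. norm (norm (a i)) \<le> norm (a i) powr p) sequentially"
  proof eventually_elim
    case (elim i)
    have "norm (a i) \<le> 1"
    proof (rule ccontr)
      assume "\<not> norm (a i) \<le> 1"
      then have "1 powr p \<le> norm (a i) powr p" using p by (intro powr_mono2) auto
      then show False using elim by simp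
    qed
    then show ?case using p powr_mono'[of p 1 "norm (a i)"] by (cases "a i = 0") auto
  qed
qed

text \<open>The Riesz-Fischer argument with p-th powers: a subsequence whose increments have powers
  bounded by a geometric series converges almost everywhere, and the lemma of Fatou turns this into
  convergence in L^p.\<close>

lemma Lp_complete:
  fixes u :: "nat \<Rightarrow> real \<Rightarrow> 'a::{real_normed_field, euclidean_space}"
  assumes p: "0 < p" "p < 1" and u: "\<And>n. u n \<in> lp_funs p"
    and C: "\<And>e. 0 < e \<Longrightarrow> \<exists>N. \<forall>m\<ge>N. \<forall>n\<ge>N. mL p (\<lambda>x. u m x - u n x) < e"
  shows "\<exists>f\<in>lp_funs p. (\<lambda>n. mL p (\<lambda>x. u n x - f x)) \<longlonglongrightarrow> 0"
proof -
  have um [measurable]: "u n \<in> borel_measurable lebesgue" for n using u[of n] by (simp add: lp_funs_iff)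
  have "\<forall>i. \<exists>N. \<forall>m\<ge>N. \<forall>n\<ge>N. mL p (\<lambda>x. u m x - u n x) < (1/2) ^ i" using C by simp
  then obtain K where K: "\<And>i m n. m \<ge> K i \<Longrightarrow> n \<ge> K i \<Longrightarrow> mL p (\<lambda>x. u m x - u n x) < (1/2) ^ i" by metis
  \<comment> \<open>Monotone, at least \<open>K i\<close>, and unbounded because of the summand
    \<open>i\<close>.\<close>
  define k where "k i = (\<Sum>j\<le>i. K j) + i" for i
  have kK: "K i \<le> k i" for i unfolding k_def by (simp add: member_le_sum trans_le_add1)
  have kmono: "k i \<le> k (Suc i)" "i \<le> k i" for i unfolding k_def by auto
  define d where "d i x = u (k (Suc i)) x - u (k i) x" for i x
  have dl: "d i \<in> lp_funs p" for i unfolding d_def[abs_def] by (intro lp_funs_diff p u)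
  have [measurable]: "d i \<in> borel_measurable lebesgue" for i using dl[of i] by (simp add: lp_funs_iff)
  have dJ: "Jp p (d i) \<le> ennreal ((1/2) ^ i)" for i
    using K[of i "k (Suc i)" "k i"] kK[of i] kmono[of i] unfolding Jp_mL[OF dl] by (simp add: d_def[abs_def] ennreal_leI)
  have "(\<integral>\<^sup>+x. (\<Sum>i. ennreal (norm (d i x) powr p)) \<partial>lebesgue) = (\<Sum>i. Jp p (d i))"
    unfolding Jp_def by (rule nn_integral_suminf) measurable
  also have "\<dots> \<le> (\<Sum>i. ennreal ((1/2) ^ i))" by (intro suminf_le dJ) auto
  also have "\<dots> = ennreal (\<Sum>i. (1/2) ^ i)" by (rule suminf_ennreal2) (auto intro: summable_geometric)
  also have "\<dots> < \<infinity>" by simp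
  finally have "AE x in lebesgue. (\<Sum>i. ennreal (norm (d i x) powr p)) \<noteq> \<infinity>"
    by (intro nn_integral_PInf_AE) auto
  then have conv: "AE x in lebesgue. (\<lambda>i. u (k i) x) \<longlonglongrightarrow> lim (\<lambda>i. u (k i) x)"
  proof eventually_elim
    case (elim x)
    have "summable (\<lambda>i. norm (d i x) powr p)"
      using elim by (intro summable_suminf_not_top) auto
    then have "summable (\<lambda>i. d i x)" by (rule summable_norm_cancel[OF summable_norm_of_powr[OF p]])
    then have "convergent (\<lambda>n. u (k 0) x + (\<Sum>i<n. d i x))"
      by (intro convergent_add convergent_const) (simp add: summable_iff_convergent)
    moreover have "u (k 0) x + (\<Sum>i<n. d i x) = u (k n) x" for n
      using sum_lessThan_telescope[of "\<lambda>i. u (k i) x" n] by (simp add: d_def)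
    ultimately show ?case by (simp add: convergent_LIMSEQ_iff)
  qed
  define f where "f x = lim (\<lambda>i. u (k i) x)" for x
  have fm [measurable]: "f \<in> borel_measurable lebesgue" unfolding f_def[abs_def] by (rule borel_measurable_lim_metric) measurable
  have bound: "Jp p (\<lambda>x. u n x - f x) \<le> ennreal e" if e: "0 < e" and n: "\<And>m m'. n0 \<le> m \<Longrightarrow> n0 \<le> m' \<Longrightarrow> mL p (\<lambda>x. u m x - u m' x) < e" "n0 \<le> n" for e n n0
  proof -
    have "Jp p (\<lambda>x. u n x - f x) = (\<integral>\<^sup>+x. liminf (\<lambda>i. ennreal (norm (u n x - u (k i) x) powr p)) \<partial>lebesgue)"
      unfolding Jp_def
    proof (rule nn_integral_cong_AE)
      show "AE x in lebesgue. ennreal (norm (u n x - f x) powr p) = liminf (\<lambda>i. ennreal (norm (u n x - u (k i) x) powr p))"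
        using conv
      proof eventually_elim
        case (elim x)
        have "(\<lambda>i. ennreal (norm (u n x - u (k i) x) powr p)) \<longlonglongrightarrow> ennreal (norm (u n x - f x) powr p)"
          using elim p unfolding f_def
          by (intro tendsto_ennrealI tendsto_powr' tendsto_norm tendsto_diff tendsto_const) (auto intro: always_eventually)
        then show ?case using lim_imp_Liminf[OF sequentially_bot] by metis
      qed
    qed
    also have "\<dots> \<le> liminf (\<lambda>i. Jp p (\<lambda>x. u n x - u (k i) x))"
      unfolding Jp_def by (rule nn_integral_liminf) measurable
    also have "\<dots> \<le> ennreal e"
    proof (rule Liminf_le)
      show "eventually (\<lambda>i. Jp p (\<lambda>x. u n x - u (k i) x) \<le> ennreal e) sequentially"
        using eventually_ge_at_top[of n0]
      proof eventually_elim
        case (elim i)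
        have "mL p (\<lambda>x. u n x - u (k i) x) < e" using n elim kmono(2)[of i] by auto
        then show ?case using Jp_mL[OF lp_funs_diff[OF p u u], of n "k i"] by (simp add: ennreal_leI)
      qed
    qed simp
    finally show ?thesis .
  qed
  obtain n1 where n1: "\<And>m n. m \<ge> n1 \<Longrightarrow> n \<ge> n1 \<Longrightarrow> mL p (\<lambda>x. u m x - u n x) < 1" using C[of 1] by auto
  have "(\<lambda>x. u n1 x - f x) \<in> lp_funs p"
    unfolding lp_funs_iff
  proof
    show "Jp p (\<lambda>x. u n1 x - f x) < \<infinity>" using bound[OF zero_less_one, of n1 n1] n1 by (simp add: le_less_trans)
  qed measurable
  from lp_funs_diff[OF p u this, of n1] have fl: "f \<in> lp_funs p" by simp
  have "(\<lambda>n. mL p (\<lambda>x. u n x - f x)) \<longlonglongrightarrow> 0"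
  proof (rule LIMSEQ_I)
    fix r :: real assume r: "0 < r"
    obtain n0 where n0: "\<And>m n. m \<ge> n0 \<Longrightarrow> n \<ge> n0 \<Longrightarrow> mL p (\<lambda>x. u m x - u n x) < r / 2" using C[of "r / 2"] r by auto
    show "\<exists>no. \<forall>n\<ge>no. norm (mL p (\<lambda>x. u n x - f x) - 0) < r"
    proof (intro exI allI impI)
      fix n assume n: "n0 \<le> n"
      have "Jp p (\<lambda>x. u n x - f x) \<le> ennreal (r / 2)" by (rule bound[OF _ n0 n]) (use r in auto)
      then have "mL p (\<lambda>x. u n x - f x) \<le> r / 2"
        using Jp_mL[OF lp_funs_diff[OF p u fl], of n] r by (simp add: ennreal_le_iff)
      then show "norm (mL p (\<lambda>x. u n x - f x) - 0) < r" using r mL_nonneg[of p "\<lambda>x. u n x - f x"] by simp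
    qed
  qed
  then show ?thesis using fl by blast
qed

section \<open>Approximation in $L^p$\<close>

lemma borel_lebesgue: "f \<in> borel_measurable borel \<Longrightarrow> f \<in> borel_measurable lebesgue"
  by (rule measurable_completion) simp

text \<open>Sums, constants and factors \<open>4 ^ n\<close> grow far less than
  \<open>exp (e / (1 - p) ^ n)\<close>; they are absorbed by giving up half of
  \<open>e\<close>.\<close>

lemma slow_dominated:
  fixes g1 :: "nat \<Rightarrow> real \<Rightarrow> 'a::real_normed_vector" and g2 :: "nat \<Rightarrow> real \<Rightarrow> 'b::real_normed_vector"
    and h :: "nat \<Rightarrow> real \<Rightarrow> 'c::real_normed_vector"
  assumes p: "0 < p" "p < 1" and g: "slow p g1" "slow p g2"
    and h: "\<And>n x. norm (h n x) \<le> C * 4 ^ n * (norm (g1 n x) + norm (g2 n x))"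
  shows "slow p h"
  unfolding slow_def
proof (intro allI impI)
  fix e :: real assume e: "0 < e"
  let ?B = "\<bar>C\<bar> + 1"
  have "eventually (\<lambda>n. \<forall>x. norm (g1 n x) \<le> exp ((e / 2) / (1 - p) ^ n)) sequentially"
    "eventually (\<lambda>n. \<forall>x. norm (g2 n x) \<le> exp ((e / 2) / (1 - p) ^ n)) sequentially"
    by (rule g(1)[unfolded slow_def, rule_format, OF half_gt_zero[OF e]], rule g(2)[unfolded slow_def, rule_format, OF half_gt_zero[OF e]])
  moreover have "eventually (\<lambda>n. (ln (2 * ?B) + 2) * (real n + 1)\<^sup>2 \<le> (e / 2) / (1 - p) ^ n) sequentially"
    using quadratic_le_eventually[OF p, of "e / 2" "ln (2 * ?B) + 2"] e by simp
  ultimately show "eventually (\<lambda>n. \<forall>x. norm (h n x) \<le> exp (e / (1 - p) ^ n)) sequentially"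
  proof eventually_elim
    case (elim n)
    show ?case
    proof
      fix x
      let ?E = "exp ((e / 2) / (1 - p) ^ n)"
      have B: "1 \<le> 2 * ?B" by simp
      have "4 ^ n = exp (real n * ln 4)" by (simp add: exp_of_nat_mult)
      moreover have "ln (4::real) \<le> 2" using ln_le_minus_one[of "2::real"] ln_realpow[of 2 2] by simp
      then have "real n * ln 4 \<le> real n * 2" by (intro mult_left_mono) auto
      ultimately have n4: "4 ^ n \<le> exp (2 * real n)" by (simp add: mult.commute)
      have l0: "0 \<le> ln (2 * ?B)" using B by (rule ln_ge_zero)
      have "2 * ?B * 4 ^ n \<le> exp (ln (2 * ?B)) * exp (2 * real n)"
        using n4 by (intro mult_mono) auto
      also have "\<dots> = exp (ln (2 * ?B) + 2 * real n)" by (rule exp_add[symmetric])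
      also have "\<dots> \<le> exp ((ln (2 * ?B) + 2) * (real n + 1)\<^sup>2)"
      proof -
        have "1 \<le> (real n + 1)\<^sup>2" "real n \<le> (real n + 1)\<^sup>2" by (simp_all add: power2_eq_square algebra_simps)
        then have "ln (2 * ?B) * 1 \<le> ln (2 * ?B) * (real n + 1)\<^sup>2" "2 * real n \<le> 2 * (real n + 1)\<^sup>2"
          using l0 by (intro mult_left_mono; simp)+
        then show ?thesis by (simp add: distrib_right)
      qed
      also have "\<dots> \<le> ?E" using elim(3) by simp
      finally have C4: "2 * ?B * 4 ^ n \<le> ?E" .
      have "norm (h n x) \<le> C * 4 ^ n * (norm (g1 n x) + norm (g2 n x))" by (rule h)
      also have "\<dots> \<le> ?B * 4 ^ n * (?E + ?E)"
        using elim(1,2) by (intro mult_mono add_mono) auto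
      also have "\<dots> = (2 * ?B * 4 ^ n) * ?E" by (simp add: algebra_simps)
      also have "\<dots> \<le> ?E * ?E" using C4 by (intro mult_right_mono) auto
      also have "\<dots> = exp (e / (1 - p) ^ n)" by (simp flip: exp_add)
      finally show "norm (h n x) \<le> exp (e / (1 - p) ^ n)" .
    qed
  qed
qed

text \<open>Radial retraction onto the ball of radius \<open>R\<close>. The quotient with
  \<open>max\<close> avoids a case distinction, so continuity is immediate.\<close>

definition clip :: "real \<Rightarrow> 'a::real_normed_vector \<Rightarrow> 'a" where
  "clip R y = (R / max R (norm y)) *\<^sub>R y"

lemma clip:
  assumes "0 < R"
  shows "norm (clip R y) \<le> R" "norm (clip R y) \<le> norm y" "norm y \<le> R \<Longrightarrow> clip R y = y"
proof -
  have m: "0 < max R (norm z)" for z :: 'a using assms by simp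
  have n: "norm (clip R y) = R / max R (norm y) * norm y" unfolding clip_def using assms by simp
  have "R / max R (norm y) * norm y = R * (norm y / max R (norm y))" by simp
  also have "\<dots> \<le> R * 1" using assms m[of y] by (intro mult_left_mono) (auto simp: pos_divide_le_eq)
  finally show "norm (clip R y) \<le> R" unfolding n by simp
  have "R / max R (norm y) * norm y \<le> 1 * norm y" using m[of y] by (intro mult_right_mono) (auto simp: pos_divide_le_eq)
  then show "norm (clip R y) \<le> norm y" unfolding n by simp
  show "clip R y = y" if "norm y \<le> R" unfolding clip_def max_absorb1[OF that] using assms by simp
qed

lemma continuous_on_clip:
  fixes S :: "'a::real_normed_vector set"
  assumes "0 < R" shows "continuous_on S (clip R)"
proof -
  have m: "0 < max R (norm z)" for z :: 'a using assms by simp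
  have m': "\<forall>z\<in>S. max R (norm z) \<noteq> 0" by (rule ballI, rule less_imp_neq[OF m, symmetric])
  have "continuous_on S (\<lambda>z. max R (norm z))"
    by (rule continuous_on_max[OF continuous_on_const continuous_on_norm[OF continuous_on_id]])
  then have "continuous_on S (\<lambda>z. (R / max R (norm z)) *\<^sub>R z)"
    by (rule continuous_on_scaleR[OF continuous_on_divide[OF continuous_on_const _ m'] continuous_on_id])
  then show "continuous_on S (clip R)" unfolding clip_def[abs_def] .
qed

text \<open>Half-open, so that adjacent windows add up exactly.\<close>

definition window :: "real \<Rightarrow> real \<Rightarrow> (real \<Rightarrow> 'a::zero) \<Rightarrow> real \<Rightarrow> 'a" where
  "window a b f x = (if a \<le> x \<and> x < b then f x else 0)"

lemma window_measurable:
  fixes f :: "real \<Rightarrow> 'a::euclidean_space"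
  assumes f: "f \<in> borel_measurable lebesgue" shows "window a b f \<in> borel_measurable lebesgue"
proof -
  note [measurable] = f
  have "window a b f = (\<lambda>x. indicator {a..<b} x *\<^sub>R f x)" by (auto simp: window_def indicator_def)
  moreover have "(\<lambda>x. indicator {a..<b} x *\<^sub>R f x) \<in> borel_measurable lebesgue"
    by (intro borel_measurable_scaleR borel_measurable_indicator f) simp
  ultimately show ?thesis by simp
qed

locale weights =
  fixes p :: real and N :: "nat \<Rightarrow> real"
  assumes p: "0 < p" "p < 1" and N: "\<And>n. 1 \<le> N n"
    and ns: "\<not> summable (\<lambda>n. (1 - p) ^ n * ln (N n))"
begin

text \<open>Orders from 1 on are charged against \<open>N\<close>, as in the shifted class; order 0
  has to match \<open>f\<close> in L^p only.\<close>

definition approximable :: "(real \<Rightarrow> 'a::euclidean_space) \<Rightarrow> bool" where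
  "approximable f \<longleftrightarrow> f \<in> borel_measurable lebesgue \<and>
    (\<forall>e>0. \<exists>H. dtower H \<and> slow p (\<lambda>n. H (Suc n)) \<and> (\<forall>n. Jp p (H (Suc n)) \<le> ennreal (e * N n powr p)) \<and>
      Jp p (\<lambda>x. H 0 x - f x) \<le> ennreal e)"

lemma approximable_measurable: "approximable f \<Longrightarrow> f \<in> borel_measurable lebesgue"
  by (simp add: approximable_def)

lemma approximableE:
  assumes "approximable f" "0 < e"
  obtains H where "dtower H" "slow p (\<lambda>n. H (Suc n))" "\<And>n. Jp p (H (Suc n)) \<le> ennreal (e * N n powr p)"
    "Jp p (\<lambda>x. H 0 x - f x) \<le> ennreal e"
  using assms unfolding approximable_def by blast

lemma approximable_add:
  assumes f: "approximable f" and g: "approximable g"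
  shows "approximable (\<lambda>x. f x + g x)"
  unfolding approximable_def
proof (intro conjI allI impI)
  note [measurable] = approximable_measurable[OF f] approximable_measurable[OF g]
  show "(\<lambda>x. f x + g x) \<in> borel_measurable lebesgue" by measurable
  fix e :: real assume e: "0 < e"
  obtain H where H: "dtower H" "slow p (\<lambda>n. H (Suc n))" "\<And>n. Jp p (H (Suc n)) \<le> ennreal (e / 2 * N n powr p)"
    "Jp p (\<lambda>x. H 0 x - f x) \<le> ennreal (e / 2)" using approximableE[OF f, of "e / 2"] e by auto
  obtain G where G: "dtower G" "slow p (\<lambda>n. G (Suc n))" "\<And>n. Jp p (G (Suc n)) \<le> ennreal (e / 2 * N n powr p)"
    "Jp p (\<lambda>x. G 0 x - g x) \<le> ennreal (e / 2)" using approximableE[OF g, of "e / 2"] e by auto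
  note [measurable] = borel_lebesgue[OF dtower_borel[OF H(1)]] borel_lebesgue[OF dtower_borel[OF G(1)]]
  show "\<exists>H. dtower H \<and> slow p (\<lambda>n. H (Suc n)) \<and> (\<forall>n. Jp p (H (Suc n)) \<le> ennreal (e * N n powr p)) \<and>
      Jp p (\<lambda>x. H 0 x - (f x + g x)) \<le> ennreal e"
  proof (intro exI conjI allI)
    show "dtower (\<lambda>n x. H n x + G n x)" by (rule dtower_add[OF H(1) G(1)])
    show "slow p (\<lambda>n x. H (Suc n) x + G (Suc n) x)"
    proof (rule slow_dominated[OF p H(2) G(2), of _ 1])
      fix n x
      have "norm (H (Suc n) x + G (Suc n) x) \<le> 1 * (norm (H (Suc n) x) + norm (G (Suc n) x))"
        using norm_triangle_ineq by simp
      also have "\<dots> \<le> (1 * 4 ^ n) * (norm (H (Suc n) x) + norm (G (Suc n) x))" by (intro mult_right_mono) auto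
      finally show "norm (H (Suc n) x + G (Suc n) x) \<le> 1 * 4 ^ n * (norm (H (Suc n) x) + norm (G (Suc n) x))" .
    qed
    have half: "ennreal (r / 2) + ennreal (r / 2) = ennreal r" if "0 \<le> r" for r
      using that by (simp flip: ennreal_plus)
    show "Jp p (\<lambda>x. H (Suc n) x + G (Suc n) x) \<le> ennreal (e * N n powr p)" for n
    proof -
      have "Jp p (\<lambda>x. H (Suc n) x + G (Suc n) x) \<le> Jp p (H (Suc n)) + Jp p (G (Suc n))"
        by (rule Jp_add[OF p]) measurable
      also have "\<dots> \<le> ennreal (e * N n powr p / 2) + ennreal (e * N n powr p / 2)"
        using H(3)[of n] G(3)[of n] by (intro add_mono) simp_all
      finally show ?thesis using e half[of "e * N n powr p"] by simp
    qed
    have "Jp p (\<lambda>x. H 0 x + G 0 x - (f x + g x)) = Jp p (\<lambda>x. (H 0 x - f x) + (G 0 x - g x))"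
      by (simp add: algebra_simps)
    also have "\<dots> \<le> Jp p (\<lambda>x. H 0 x - f x) + Jp p (\<lambda>x. G 0 x - g x)" by (rule Jp_add[OF p]) measurable
    also have "\<dots> \<le> ennreal (e / 2) + ennreal (e / 2)" by (intro add_mono H(4) G(4))
    also have "\<dots> = ennreal e" using e by (intro half) simp
    finally show "Jp p (\<lambda>x. H 0 x + G 0 x - (f x + g x)) \<le> ennreal e" .
  qed
qed

lemma approximable_limit:
  assumes f: "f \<in> borel_measurable lebesgue"
    and s: "\<And>e. 0 < e \<Longrightarrow> \<exists>s. approximable s \<and> Jp p (\<lambda>x. s x - f x) \<le> ennreal e"
  shows "approximable f"
  unfolding approximable_def
proof (intro conjI allI impI f)
  fix e :: real assume e: "0 < e"
  obtain s where s: "approximable s" "Jp p (\<lambda>x. s x - f x) \<le> ennreal (e / 2)" using s[of "e / 2"] e by auto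
  obtain H where H: "dtower H" "slow p (\<lambda>n. H (Suc n))" "\<And>n. Jp p (H (Suc n)) \<le> ennreal (e / 2 * N n powr p)"
    "Jp p (\<lambda>x. H 0 x - s x) \<le> ennreal (e / 2)" using approximableE[OF s(1), of "e / 2"] e by auto
  note [measurable] = f borel_lebesgue[OF dtower_borel[OF H(1)]] approximable_measurable[OF s(1)]
  show "\<exists>H. dtower H \<and> slow p (\<lambda>n. H (Suc n)) \<and> (\<forall>n. Jp p (H (Suc n)) \<le> ennreal (e * N n powr p)) \<and>
      Jp p (\<lambda>x. H 0 x - f x) \<le> ennreal e"
  proof (intro exI conjI allI)
    show "dtower H" "slow p (\<lambda>n. H (Suc n))" by (rule H)+
    fix n
    have "e / 2 * N n powr p \<le> e * N n powr p" using e by (intro mult_right_mono) auto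
    then show "Jp p (H (Suc n)) \<le> ennreal (e * N n powr p)" using H(3)[of n] by (meson ennreal_leI order_trans)
  next
    have "Jp p (\<lambda>x. H 0 x - f x) = Jp p (\<lambda>x. (H 0 x - s x) + (s x - f x))" by simp
    also have "\<dots> \<le> Jp p (\<lambda>x. H 0 x - s x) + Jp p (\<lambda>x. s x - f x)" by (rule Jp_add[OF p]) measurable
    also have "\<dots> \<le> ennreal (e / 2) + ennreal (e / 2)" by (intro add_mono H(4) s(2))
    also have "\<dots> = ennreal e" using e by (simp flip: ennreal_plus)
    finally show "Jp p (\<lambda>x. H 0 x - f x) \<le> ennreal e" .
  qed
qed

lemma approximable_dominated:
  fixes f :: "real \<Rightarrow> 'a::euclidean_space"
  assumes s: "\<And>n. approximable (s n)" and f: "f \<in> borel_measurable lebesgue"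
    and g: "g \<in> borel_measurable lebesgue" "Jp p (g :: real \<Rightarrow> real) < \<infinity>"
    and sg: "\<And>n x. norm (s n x) \<le> g x" and fg: "\<And>x. norm (f x) \<le> g x"
    and lim: "AE x in lebesgue. (\<lambda>n. s n x) \<longlonglongrightarrow> f x"
  shows "approximable f"
proof (rule approximable_limit[OF f])
  fix e :: real assume e: "0 < e"
  note [measurable] = f g(1) approximable_measurable[OF s]
  have "(\<lambda>n. \<integral>\<^sup>+x. ennreal (norm (s n x - f x) powr p) \<partial>lebesgue) \<longlonglongrightarrow> (\<integral>\<^sup>+(x::real). 0 \<partial>lebesgue)"
  proof (rule nn_integral_dominated_convergence[of "\<lambda>n x. ennreal (norm (s n x - f x) powr p)" lebesgue "\<lambda>_. 0"
        "\<lambda>x. ennreal (norm (g x) powr p) + ennreal (norm (g x) powr p)"])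
    show "AE x in lebesgue. ennreal (norm (s n x - f x) powr p) \<le> ennreal (norm (g x) powr p) + ennreal (norm (g x) powr p)" for n
    proof (intro AE_I2)
      fix x
      have "norm (s n x - f x) powr p \<le> norm (s n x) powr p + norm (f x) powr p"
        using norm_powr_subadd[OF p(1) less_imp_le[OF p(2)], of "s n x" "- f x"] by simp
      also have "\<dots> \<le> norm (g x) powr p + norm (g x) powr p"
      proof -
        have "norm (s n x) \<le> norm (g x)" "norm (f x) \<le> norm (g x)" using sg[of n x] fg[of x] by auto
        then show ?thesis using p by (intro add_mono powr_mono2) auto
      qed
      finally have "ennreal (norm (s n x - f x) powr p) \<le> ennreal (norm (g x) powr p + norm (g x) powr p)" by (rule ennreal_leI)
      also have "\<dots> = ennreal (norm (g x) powr p) + ennreal (norm (g x) powr p)" by (rule ennreal_plus) simp_all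
      finally show "ennreal (norm (s n x - f x) powr p) \<le> ennreal (norm (g x) powr p) + ennreal (norm (g x) powr p)" .
    qed
    have "(\<integral>\<^sup>+x. ennreal (norm (g x) powr p) + ennreal (norm (g x) powr p) \<partial>lebesgue) = Jp p g + Jp p g"
      unfolding Jp_def by (rule nn_integral_add) measurable
    then show "(\<integral>\<^sup>+x. ennreal (norm (g x) powr p) + ennreal (norm (g x) powr p) \<partial>lebesgue) < \<infinity>" using g(2) by simp
    show "AE x in lebesgue. (\<lambda>n. ennreal (norm (s n x - f x) powr p)) \<longlonglongrightarrow> 0"
      using lim
    proof eventually_elim
      case (elim x)
      then have "(\<lambda>n. norm (s n x - f x)) \<longlonglongrightarrow> 0" by (simp add: LIM_zero_iff tendsto_norm_zero)
      then have "(\<lambda>n. norm (s n x - f x) powr p) \<longlonglongrightarrow> 0 powr p" using p by (intro tendsto_powr') auto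
      then show ?case using p tendsto_ennrealI[of "\<lambda>n. norm (s n x - f x) powr p" "0"] by simp
    qed
  qed measurable
  then have "(\<lambda>n. Jp p (\<lambda>x. s n x - f x)) \<longlonglongrightarrow> 0" by (simp add: Jp_def)
  then have "eventually (\<lambda>n. Jp p (\<lambda>x. s n x - f x) < ennreal e) sequentially" using e by (intro order_tendstoD(2)) auto
  then obtain n where "Jp p (\<lambda>x. s n x - f x) < ennreal e" by (auto simp: eventually_sequentially)
  then show "\<exists>s. approximable s \<and> Jp p (\<lambda>x. s x - f x) \<le> ennreal e" using s[of n] by (intro exI[of _ "s n"]) auto
qed

lemma nn_integral_window: "a \<le> b \<Longrightarrow> 0 \<le> C \<Longrightarrow> (\<integral>\<^sup>+x. ennreal C * indicator {a..b} x \<partial>lborel) = ennreal (C * (b - a))"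
  by (simp add: nn_integral_cmult_indicator ennreal_mult)

text \<open>The jump is smoothed on an interval of length \<open>?l\<close>. The error is at most
  \<open>(2 * norm c) powr p * ?l\<close>, while the price of the derivatives can be prescribed
  however small \<open>?l\<close> is.\<close>

lemma approximable_heaviside:
  fixes c :: "'a::euclidean_space"
  shows "approximable (\<lambda>x. if a \<le> x then c else 0)"
  unfolding approximable_def
proof (intro conjI allI impI)
  let ?f = "\<lambda>x. if a \<le> x then c else 0"
  have "?f \<in> borel_measurable borel" by measurable
  then show "?f \<in> borel_measurable lebesgue" by (rule borel_lebesgue)
  fix e :: real assume e: "0 < e"
  let ?C = "(2 * norm c) powr p" and ?a = "\<lambda>k. e * N k powr p" and ?D = "norm c + 1"
  let ?l = "e / (?C + 1)"
  have C1: "0 < ?C + 1" by (rule add_nonneg_pos) auto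
  have l: "0 < ?l" using e C1 by simp
  have a0: "0 < ?a k" for k
  proof -
    have "N k \<noteq> 0" using N[of k] by simp
    then show ?thesis using e by simp
  qed
  have D: "0 < ?D" "norm c \<le> ?D" by (simp_all add: add_nonneg_pos)
  have ex: thesis
    if "\<And>H :: nat \<Rightarrow> real \<Rightarrow> 'a. dtower H \<Longrightarrow> \<forall>x\<le>a. H 0 x = 0 \<Longrightarrow> \<forall>x\<ge>a + ?l. H 0 x = c \<Longrightarrow>
      \<forall>x. norm (H 0 x) \<le> norm c \<Longrightarrow>
      \<forall>n x. norm (H (Suc n) x) \<le> 4 ^ Suc n * exp (greedy_X p ?D ?l ?a (Suc n)) \<Longrightarrow>
      \<forall>n. (\<integral>\<^sup>+x. ennreal (norm (H (Suc n) x) powr p) \<partial>lborel) \<le> ennreal (?a n) \<Longrightarrow> thesis" for thesis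
    by (rule greedy_bump[where a = ?a and ?x0.0 = a, OF p D l a0], rule that) (assumption, blast+)
  show "\<exists>H. dtower H \<and> slow p (\<lambda>n. H (Suc n)) \<and> (\<forall>n. Jp p (H (Suc n)) \<le> ennreal (e * N n powr p)) \<and>
      Jp p (\<lambda>x. H 0 x - ?f x) \<le> ennreal e"
  proof (rule ex)
    fix H :: "nat \<Rightarrow> real \<Rightarrow> 'a"
    assume H: "dtower H" "\<forall>x\<le>a. H 0 x = 0" "\<forall>x\<ge>a + ?l. H 0 x = c" "\<forall>x. norm (H 0 x) \<le> norm c"
      "\<forall>n x. norm (H (Suc n) x) \<le> 4 ^ Suc n * exp (greedy_X p ?D ?l ?a (Suc n))"
      "\<forall>n. (\<integral>\<^sup>+x. ennreal (norm (H (Suc n) x) powr p) \<partial>lborel) \<le> ennreal (?a n)"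
    let ?g = "\<lambda>(n::nat) (x::real). exp (greedy_X p ?D ?l ?a (Suc n))"
    have "slow p ?g"
      unfolding slow_def
    proof (intro allI impI)
      fix e' :: real assume e': "0 < e'"
      have "0 < e' * (1 - p)" using e' p by simp
      then have "eventually (\<lambda>k. greedy_X p ?D ?l ?a k \<le> (e' * (1 - p)) / (1 - p) ^ k) sequentially"
        by (rule greedy_single_slow[OF p e N ns])
      then have "eventually (\<lambda>n. greedy_X p ?D ?l ?a (Suc n) \<le> (e' * (1 - p)) / (1 - p) ^ Suc n) sequentially"
        by (rule eventually_compose_filterlim[OF _ filterlim_Suc])
      then show "eventually (\<lambda>n. \<forall>x::real. norm (?g n x) \<le> exp (e' / (1 - p) ^ n)) sequentially"
      proof eventually_elim
        case (elim n)
        have "(e' * (1 - p)) / (1 - p) ^ Suc n = e' / (1 - p) ^ n" using p by simp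
        then show ?case using elim by simp
      qed
    qed
    then have sl: "slow p (\<lambda>n. H (Suc n))"
    proof (rule slow_dominated[OF p _ \<open>slow p ?g\<close>, of _ _ 4])
      fix n x
      have "0 \<le> 4 ^ Suc n * exp (greedy_X p ?D ?l ?a (Suc n))" by simp
      then show "norm (H (Suc n) x) \<le> 4 * 4 ^ n * (norm (?g n x) + norm (?g n x))"
        using H(5)[rule_format, of n x] by (simp del: exp_ge_zero)
    qed
    have "Jp p (\<lambda>x. H 0 x - ?f x) \<le> (\<integral>\<^sup>+x. ennreal ?C * indicator {a..a + ?l} x \<partial>lborel)"
      unfolding Jp_lborel
    proof (rule nn_integral_mono)
      fix x
      show "ennreal (norm (H 0 x - ?f x) powr p) \<le> ennreal ?C * indicator {a..a + ?l} x"
      proof (cases "x \<in> {a..a + ?l}")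
        case True
        have "norm (H 0 x - ?f x) \<le> norm (H 0 x) + norm (?f x)" by (rule norm_triangle_ineq4)
        also have "\<dots> \<le> norm c + norm c" using H(4)[rule_format, of x] by (intro add_mono) simp_all
        also have "\<dots> = 2 * norm c" by simp
        finally have "norm (H 0 x - ?f x) powr p \<le> ?C" using p by (intro powr_mono2) auto
        then show ?thesis using True by (simp add: ennreal_leI)
      next
        case False
        then have "x < a \<or> a + ?l < x" unfolding atLeastAtMost_iff by linarith
        then have "H 0 x - ?f x = 0"
        proof
          assume "x < a" then show ?thesis using H(2) by simp
        next
          assume x: "a + ?l < x"
          then have "a \<le> x" using l by linarith
          then show ?thesis using H(3) x by simp
        qed
        then show ?thesis by simp
      qed
    qed
    also have "\<dots> = ennreal (?C * (a + ?l - a))" using l by (intro nn_integral_window) auto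
    also have "\<dots> \<le> ennreal e"
    proof (rule ennreal_leI)
      have "?C * ?l \<le> (?C + 1) * ?l" using l by (intro mult_right_mono) auto
      then show "?C * (a + ?l - a) \<le> e" using C1 by simp
    qed
    finally have "Jp p (\<lambda>x. H 0 x - ?f x) \<le> ennreal e" .
    moreover have "\<forall>n. Jp p (H (Suc n)) \<le> ennreal (e * N n powr p)" unfolding Jp_lborel by (rule H(6))
    ultimately show ?thesis using H(1) sl by blast
  qed
qed

lemma approximable_step: "a \<le> b \<Longrightarrow> approximable (window a b (\<lambda>_. c))"
proof -
  assume "a \<le> b"
  then have "window a b (\<lambda>_. c) = (\<lambda>x. (if a \<le> x then c else 0) + (if b \<le> x then - c else 0))" by (auto simp: window_def)
  then show ?thesis by (simp only:) (intro approximable_add approximable_heaviside)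
qed

text \<open>An error proportional to the length is additive over adjacent windows and holds near
  every point by comparison with a constant; the bisection principle \<open>Bolzano\<close> extends
  it to the whole interval.\<close>

lemma approximable_continuous_window:
  fixes h :: "real \<Rightarrow> 'a::euclidean_space"
  assumes h: "continuous_on UNIV h" and ab: "a \<le> b"
  shows "approximable (window a b h)"
proof (rule approximable_limit)
  have hm: "h \<in> borel_measurable lebesgue" by (intro borel_lebesgue borel_measurable_continuous_onI h)
  show "window a b h \<in> borel_measurable lebesgue" by (rule window_measurable[OF hm])
  fix e0 :: real assume e0: "0 < e0"
  \<comment> \<open>The summand 1 prevents a division by zero for an empty window.\<close>
  define e where "e = e0 / (b - a + 1)"
  have e: "0 < e" "e * (b - a) \<le> e0"
    using e0 ab by (simp_all add: e_def field_simps)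
  define P where "P a b \<longleftrightarrow> a \<le> b \<longrightarrow> (\<exists>s. approximable s \<and> Jp p (\<lambda>x. s x - window a b h x) \<le> ennreal (e * (b - a)))" for a b
  have "P a b"
  proof (rule Bolzano[OF ab])
    fix a b c assume P: "P a b" "P b c" and abc: "a \<le> b" "b \<le> c"
    obtain s where s: "approximable s" "Jp p (\<lambda>x. s x - window a b h x) \<le> ennreal (e * (b - a))" using P(1) abc by (auto simp: P_def)
    obtain t where t: "approximable t" "Jp p (\<lambda>x. t x - window b c h x) \<le> ennreal (e * (c - b))" using P(2) abc by (auto simp: P_def)
    note [measurable] = approximable_measurable[OF s(1)] approximable_measurable[OF t(1)] window_measurable[OF hm]
    have "(\<lambda>x. (s x + t x) - window a c h x) = (\<lambda>x. (s x - window a b h x) + (t x - window b c h x))"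
      using abc by (auto simp: window_def)
    then have "Jp p (\<lambda>x. (s x + t x) - window a c h x) \<le> Jp p (\<lambda>x. s x - window a b h x) + Jp p (\<lambda>x. t x - window b c h x)"
      by (simp only:) (rule Jp_add[OF p], measurable)
    also have "\<dots> \<le> ennreal (e * (b - a)) + ennreal (e * (c - b))" by (intro add_mono s(2) t(2))
    also have "\<dots> = ennreal (e * (b - a) + e * (c - b))" using e abc by (intro ennreal_plus[symmetric]) auto
    also have "e * (b - a) + e * (c - b) = e * (c - a)" by (simp add: algebra_simps)
    finally show "P a c" unfolding P_def using approximable_add[OF s(1) t(1)] by blast
  next
    fix x
    let ?r = "e powr (1 / p)"
    have "0 < ?r" using e by simp
    then obtain d where d: "0 < d" "\<And>y. dist y x < d \<Longrightarrow> dist (h y) (h x) < ?r"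
      using h unfolding continuous_on_iff by (metis UNIV_I)
    show "\<exists>d>0. \<forall>a b. a \<le> x \<and> x \<le> b \<and> b - a < d \<longrightarrow> P a b"
    proof (rule exI[of _ d], intro conjI allI impI)
      show "0 < d" by (rule d(1))
      fix a b assume ab: "a \<le> x \<and> x \<le> b \<and> b - a < d"
      have "Jp p (\<lambda>y. window a b (\<lambda>_. h x) y - window a b h y) \<le> (\<integral>\<^sup>+y. ennreal e * indicator {a..b} y \<partial>lborel)"
        unfolding Jp_lborel
      proof (rule nn_integral_mono)
        fix y
        show "ennreal (norm (window a b (\<lambda>_. h x) y - window a b h y) powr p) \<le> ennreal e * indicator {a..b} y"
        proof (cases "a \<le> y \<and> y < b")
          case True
          then have "dist y x < d" unfolding dist_real_def using ab by linarith
          then have "norm (h x - h y) \<le> ?r" using d(2)[of y] by (simp add: dist_norm norm_minus_commute)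
          then have "norm (h x - h y) powr p \<le> ?r powr p" using p by (intro powr_mono2) auto
          also have "\<dots> = e" using p e by (simp add: powr_powr)
          finally show ?thesis using True by (simp add: window_def ennreal_leI)
        next
          case False
          then have "window a b (\<lambda>_. h x) y = 0" "window a b h y = 0" unfolding window_def by (simp_all only: if_False)
          then show ?thesis by simp
        qed
      qed
      also have "\<dots> = ennreal (e * (b - a))" using ab e by (intro nn_integral_window) auto
      finally have *: "Jp p (\<lambda>y. window a b (\<lambda>_. h x) y - window a b h y) \<le> ennreal (e * (b - a))" .
      have "approximable (window a b (\<lambda>_. h x))" using ab by (intro approximable_step) auto
      then show "P a b" unfolding P_def using * by blast
    qed
  qed
  then obtain s where "approximable s" "Jp p (\<lambda>x. s x - window a b h x) \<le> ennreal (e * (b - a))" using ab by (auto simp: P_def)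
  then show "\<exists>s. approximable s \<and> Jp p (\<lambda>x. s x - window a b h x) \<le> ennreal e0"
    using e(2) by (meson ennreal_leI order_trans)
qed

text \<open>Measurability provides continuous functions converging outside a negligible set; after
  clipping, the constant \<open>R\<close> on the window dominates them all.\<close>

lemma approximable_bounded_window:
  fixes f :: "real \<Rightarrow> 'a::euclidean_space"
  assumes f: "f \<in> borel_measurable lebesgue" and R: "0 < R"
  shows "approximable (window (- R) R (\<lambda>x. clip R (f x)))"
proof -
  have "f measurable_on UNIV" using f by (simp add: measurable_on_iff_borel_measurable lebesgue_on_UNIV_eq)
  then obtain Z h where Z: "negligible Z" "\<And>n. continuous_on UNIV (h n)" "\<And>x. x \<notin> Z \<Longrightarrow> (\<lambda>n::nat. h n x) \<longlonglongrightarrow> f x"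
    unfolding measurable_on_def by auto
  have AEZ: "AE x in lebesgue. x \<notin> Z"
    using Z(1) by (simp add: AE_not_in negligible_iff_null_sets)
  let ?g = "window (- R) R (\<lambda>_. R)"
  have cm: "clip R \<in> borel_measurable (borel :: 'a measure)" by (intro borel_measurable_continuous_onI continuous_on_clip R)
  show ?thesis
  proof (rule approximable_dominated[of "\<lambda>n. window (- R) R (\<lambda>x. clip R (h n x))" _ ?g])
    show "approximable (window (- R) R (\<lambda>x. clip R (h n x)))" for n
    proof (rule approximable_continuous_window)
      show "continuous_on UNIV (\<lambda>x. clip R (h n x))"
        using continuous_on_compose[OF Z(2)[of n] continuous_on_clip[OF R]] by (simp add: o_def)
    qed (use R in simp)
    show "window (- R) R (\<lambda>x. clip R (f x)) \<in> borel_measurable lebesgue"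
      by (intro window_measurable measurable_compose[OF f cm])
    show "?g \<in> borel_measurable lebesgue" by (intro window_measurable) simp
    have "Jp p ?g \<le> (\<integral>\<^sup>+x. ennreal (R powr p) * indicator {- R..R} x \<partial>lborel)"
      unfolding Jp_lborel using R by (intro nn_integral_mono) (auto simp: window_def indicator_def)
    also have "\<dots> = ennreal (R powr p * (R - - R))" using R by (intro nn_integral_window) auto
    also have "\<dots> < \<infinity>" by simp
    finally show "Jp p ?g < \<infinity>" .
    show "norm (window (- R) R (\<lambda>x. clip R (h n x)) x) \<le> ?g x" "norm (window (- R) R (\<lambda>x. clip R (f x)) x) \<le> ?g x" for n x
      using clip(1)[OF R] by (auto simp: window_def)
    show "AE x in lebesgue. (\<lambda>n. window (- R) R (\<lambda>x. clip R (h n x)) x) \<longlonglongrightarrow> window (- R) R (\<lambda>x. clip R (f x)) x"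
      using AEZ
    proof eventually_elim
      case (elim x)
      have "isCont (clip R) (f x)" using continuous_on_clip[OF R, of "UNIV :: 'a set"] by (simp add: continuous_on_eq_continuous_at)
      then have "(\<lambda>n. clip R (h n x)) \<longlonglongrightarrow> clip R (f x)" using Z(3)[OF elim] by (rule isCont_tendsto_compose)
      moreover have "window (- R) R F x = F x" if "- R \<le> x \<and> x < R" for F :: "real \<Rightarrow> 'a"
        unfolding window_def using that by (rule if_P)
      moreover have "window (- R) R F x = 0" if "\<not> (- R \<le> x \<and> x < R)" for F :: "real \<Rightarrow> 'a"
        unfolding window_def using that by (rule if_not_P)
      ultimately show ?case by (cases "- R \<le> x \<and> x < R") simp_all
    qed
  qed
qed

theorem approximable_Lp:
  fixes f :: "real \<Rightarrow> 'a::euclidean_space"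
  assumes f: "f \<in> borel_measurable lebesgue" "Jp p f < \<infinity>"
  shows "approximable f"
proof (rule approximable_dominated[of "\<lambda>n. window (- real (Suc n)) (real (Suc n)) (\<lambda>x. clip (real (Suc n)) (f x))" _ "\<lambda>x. norm (f x)"])
  note [measurable] = f(1)
  show "approximable (window (- real (Suc n)) (real (Suc n)) (\<lambda>x. clip (real (Suc n)) (f x)))" for n
    by (rule approximable_bounded_window[OF f(1)]) simp
  show "f \<in> borel_measurable lebesgue" by (rule f)
  show "(\<lambda>x. norm (f x)) \<in> borel_measurable lebesgue" by measurable
  show "Jp p (\<lambda>x. norm (f x)) < \<infinity>" using f(2) by (simp add: Jp_def)
  have S: "0 < real (Suc n)" for n by simp
  show "norm (window (- real (Suc n)) (real (Suc n)) (\<lambda>x. clip (real (Suc n)) (f x)) x) \<le> norm (f x)" for n x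
    using clip(2)[OF S[of n], of "f x"] by (simp add: window_def)
  show "norm (f x) \<le> norm (f x)" for x by simp
  show "AE x in lebesgue. (\<lambda>n. window (- real (Suc n)) (real (Suc n)) (\<lambda>x. clip (real (Suc n)) (f x)) x) \<longlonglongrightarrow> f x"
  proof (intro AE_I2)
    fix x
    obtain n0 where n0: "\<bar>x\<bar> + norm (f x) \<le> real n0" using real_arch_simple by blast
    have "eventually (\<lambda>n. window (- real (Suc n)) (real (Suc n)) (\<lambda>x. clip (real (Suc n)) (f x)) x = f x) sequentially"
      using eventually_ge_at_top[of n0]
    proof eventually_elim
      case (elim n)
      have "real n0 < real (Suc n)" using elim by simp
      then have "\<bar>x\<bar> < real (Suc n)" "norm (f x) \<le> real (Suc n)" using n0 by (smt (verit) norm_ge_zero)+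
      then show ?case using clip(3)[OF S] by (auto simp: window_def abs_less_iff)
    qed
    then show "(\<lambda>n. window (- real (Suc n)) (real (Suc n)) (\<lambda>x. clip (real (Suc n)) (f x)) x) \<longlonglongrightarrow> f x" by (rule tendsto_eventually)
  qed
qed

end

section \<open>Test classes\<close>

lemma nderiv_0: "nderiv 0 u = u" by (simp add: nderiv_def)

lemma nderiv_Suc: "nderiv (Suc n) u = (\<lambda>x. vector_derivative (nderiv n u) (at x))"
  by (simp add: nderiv_def)

lemma nderiv_nderiv: "nderiv n (nderiv 1 u) = nderiv (Suc n) u"
  unfolding nderiv_def funpow_Suc_right by simp

lemma smooth_iff_dtower: "smooth u \<longleftrightarrow> dtower (\<lambda>n. nderiv n u)"
proof
  assume u: "smooth u"
  show "dtower (\<lambda>n. nderiv n u)"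
    unfolding dtower_def
  proof (intro allI)
    fix n x
    have "nderiv n u differentiable (at x)" using u by (simp add: smooth_def)
    then show "(nderiv n u has_vector_derivative nderiv (Suc n) u x) (at x)"
      unfolding nderiv_Suc using vector_derivative_works by blast
  qed
next
  assume "dtower (\<lambda>n. nderiv n u)"
  then show "smooth u" unfolding smooth_def by (intro allI differentiableI_vector) (rule dtowerD)
qed

lemma nderiv_dtower: "dtower H \<Longrightarrow> nderiv n (H 0) = H n"
proof (induction n)
  case (Suc n)
  show ?case
  proof
    fix x
    have "nderiv (Suc n) (H 0) x = vector_derivative (H n) (at x)" using Suc by (simp add: nderiv_Suc)
    also have "\<dots> = H (Suc n) x" by (rule vector_derivative_at) (rule dtowerD[OF Suc.prems])
    finally show "nderiv (Suc n) (H 0) x = H (Suc n) x" .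
  qed
qed (simp add: nderiv_0)

text \<open>An adjunction: suprema can be compared through their upper bounds, without exchanging
  \<open>SUP\<close> and power. This is how \<open>carleman_norm_eq\<close> is obtained.\<close>

lemma ennpowr_le_iff: "0 < a \<Longrightarrow> ennpowr x a \<le> y \<longleftrightarrow> x \<le> ennpowr y (1 / a)"
proof (cases x; cases y)
  fix r s assume a: "0 < a" and r: "x = ennreal r" "0 \<le> r" and s: "y = ennreal s" "0 \<le> s"
  have "r powr a \<le> s \<longleftrightarrow> r \<le> s powr (1 / a)"
  proof
    assume "r powr a \<le> s"
    then have "(r powr a) powr (1 / a) \<le> s powr (1 / a)" using a by (intro powr_mono2) auto
    then show "r \<le> s powr (1 / a)" using a r by (simp add: powr_powr)
  next
    assume "r \<le> s powr (1 / a)"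
    then have "r powr a \<le> (s powr (1 / a)) powr a" using a r by (intro powr_mono2) auto
    then show "r powr a \<le> s" using a s by (simp add: powr_powr)
  qed
  then show ?thesis using r s by (simp add: ennpowr_ennreal ennreal_le_iff)
qed (auto simp: ennpowr_def top_unique)

lemma ennreal_divide_le: "0 < m \<Longrightarrow> x / ennreal m \<le> y \<longleftrightarrow> x \<le> y * ennreal m"
proof (cases x; cases y)
  fix r s assume m: "0 < m" and r: "x = ennreal r" "0 \<le> r" and s: "y = ennreal s" "0 \<le> s"
  then show ?thesis by (simp add: divide_ennreal ennreal_mult[symmetric] ennreal_le_iff pos_divide_le_eq)
next
  fix s assume m: "0 < m" and x: "x = top" and s: "y = ennreal s" "0 \<le> s"
  have "x / ennreal m = top" using m x by (simp add: divide_ennreal_def ennreal_mult_eq_top_iff ennreal_top_mult inverse_ennreal)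
  then show ?thesis using x s m by (simp add: ennreal_mult[symmetric] top_unique)
qed (auto simp: ennreal_top_mult)

lemma test_space_simps:
  "qcarrier (test_space p M) = test_class p M" "qadd (test_space p M) = (\<lambda>u v x. u x + v x)"
  "qscale (test_space p M) = (\<lambda>c u x. c * u x)" "qnorm (test_space p M) = carleman_norm p M"
  by (simp_all add: test_space_def)

text \<open>On the test class, the p-th power of \<open>carleman_norm\<close> as a real
  number.\<close>

definition mu :: "real \<Rightarrow> (nat \<Rightarrow> real) \<Rightarrow> (real \<Rightarrow> 'a::real_normed_vector) \<Rightarrow> real" where
  "mu p M u = enn2real (SUP n. Jp p (nderiv n u) / ennreal (M n powr p))"

lemma mu_nonneg: "0 \<le> mu p M u" by (simp add: mu_def)

context
  fixes p :: real and M :: "nat \<Rightarrow> real"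
  assumes p: "0 < p" "p < 1" and M: "\<And>n. 1 \<le> M n"
begin

lemma Mp: "0 < M n powr p" using M[of n] by simp

lemma carleman_norm_eq:
  "carleman_norm p M u = ennpowr (SUP n. Jp p (nderiv n u) / ennreal (M n powr p)) (1 / p)"
proof -
  have "carleman_norm p M u \<le> y \<longleftrightarrow> ennpowr (SUP n. Jp p (nderiv n u) / ennreal (M n powr p)) (1 / p) \<le> y" for y
  proof -
    have y: "ennpowr y p * ennreal (M n powr p) = ennpowr (y * ennreal (M n)) p" for n
    proof (cases y)
      case (real r)
      have "0 \<le> M n" using M[of n] by simp
      then show ?thesis using real by (simp add: ennpowr_ennreal ennreal_mult[symmetric] powr_mult)
    next
      case top
      have "0 < M n" using M[of n] by simp
      then show ?thesis using top Mp[of n] by (simp add: ennpowr_def ennreal_top_mult)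
    qed
    have "carleman_norm p M u \<le> y \<longleftrightarrow> (\<forall>n. ennpowr (Jp p (nderiv n u)) (1 / p) \<le> y * ennreal (M n))"
    proof -
      have "0 < M n" for n using M[of n] by simp
      then show ?thesis by (simp add: carleman_norm_def SUP_le_iff lp_norm_Jp ennreal_divide_le)
    qed
    also have "\<dots> \<longleftrightarrow> (\<forall>n. Jp p (nderiv n u) \<le> ennpowr y p * ennreal (M n powr p))"
      using p by (simp add: ennpowr_le_iff y)
    also have "\<dots> \<longleftrightarrow> ennpowr (SUP n. Jp p (nderiv n u) / ennreal (M n powr p)) (1 / p) \<le> y"
      using p Mp by (simp add: ennpowr_le_iff SUP_le_iff ennreal_divide_le)
    finally show ?thesis .
  qed
  then show ?thesis by (intro antisym) auto
qed

text \<open>The power \<open>(1 - p) ^ n\<close> turns the bound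
  \<open>exp (e / (1 - p) ^ n)\<close> into \<open>exp e\<close>, and these numbers approach 1 from
  above as \<open>e\<close> tends to 0.\<close>

lemma limsup_le_1_iff:
  fixes h :: "nat \<Rightarrow> real \<Rightarrow> 'a::real_normed_vector"
  shows "limsup (\<lambda>n. ennpowr (sup_norm (h n)) ((1 - p) ^ n)) \<le> 1 \<longleftrightarrow> slow p h"
proof -
  have q: "0 < (1 - p) ^ n" for n using p by simp
  have exp_q: "ennpowr (ennreal (exp e)) (1 / (1 - p) ^ n) = ennreal (exp (e / (1 - p) ^ n))" for e n
    by (simp add: ennpowr_ennreal powr_def)
  have iff: "ennpowr (sup_norm (h n)) ((1 - p) ^ n) \<le> ennreal (exp e) \<longleftrightarrow> (\<forall>x. norm (h n x) \<le> exp (e / (1 - p) ^ n))" for e n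
    unfolding ennpowr_le_iff[OF q] exp_q sup_norm_def SUP_le_iff by (simp add: ennreal_le_iff)
  show ?thesis
  proof
    assume L: "limsup (\<lambda>n. ennpowr (sup_norm (h n)) ((1 - p) ^ n)) \<le> 1"
    show "slow p h" unfolding slow_def
    proof (intro allI impI)
      fix e :: real assume "0 < e"
      then have "1 < ennreal (exp e)" by simp
      then have "eventually (\<lambda>n. ennpowr (sup_norm (h n)) ((1 - p) ^ n) < ennreal (exp e)) sequentially"
        using L unfolding Limsup_le_iff by blast
      then show "eventually (\<lambda>n. \<forall>x. norm (h n x) \<le> exp (e / (1 - p) ^ n)) sequentially"
        by (rule eventually_mono) (rule iffD1[OF iff less_imp_le])
    qed
  next
    assume L: "slow p h"
    show "limsup (\<lambda>n. ennpowr (sup_norm (h n)) ((1 - p) ^ n)) \<le> 1" unfolding Limsup_le_iff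
    proof (intro allI impI)
      fix y :: ennreal assume y: "1 < y"
      have "\<exists>e>0. ennreal (exp e) < y"
      proof (cases y)
        case (real r)
        then have r: "1 < r" using y by (simp flip: ennreal_1 add: ennreal_less_iff)
        have "0 < ln r" using r by (rule ln_gt_zero)
        then have "ln r / 2 < ln r" by linarith
        then have "exp (ln r / 2) < exp (ln r)" by (simp only: exp_less_cancel_iff)
        also have "\<dots> = r" using r by simp
        finally have "ennreal (exp (ln r / 2)) < y" using real r by (simp add: ennreal_less_iff)
        moreover have "0 < ln r / 2" using r by simp
        ultimately show ?thesis by blast
      next
        case top
        then show ?thesis by (intro exI[of _ 1]) simp
      qed
      then obtain e where e: "0 < e" "ennreal (exp e) < y" by blast
      have "eventually (\<lambda>n. \<forall>x. norm (h n x) \<le> exp (e / (1 - p) ^ n)) sequentially"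
        using L e(1) unfolding slow_def by blast
      then show "eventually (\<lambda>n. ennpowr (sup_norm (h n)) ((1 - p) ^ n) < y) sequentially"
        by (rule eventually_mono) (rule le_less_trans[OF iffD2[OF iff] e(2)])
    qed
  qed
qed

lemma test_class_iff: "u \<in> test_class p M \<longleftrightarrow> dtower (\<lambda>n. nderiv n u) \<and>
    (SUP n. Jp p (nderiv n u) / ennreal (M n powr p)) < \<infinity> \<and> slow p (\<lambda>n. nderiv n u)"
  unfolding test_class_def mem_Collect_eq smooth_iff_dtower carleman_norm_eq ennpowr_less_top limsup_le_1_iff ..

lemma SUP_le: "0 \<le> C \<Longrightarrow> (SUP n. Jp p (nderiv n u) / ennreal (M n powr p)) \<le> ennreal C \<longleftrightarrow>
    (\<forall>n. Jp p (nderiv n u) \<le> ennreal (C * M n powr p))"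
  using Mp by (simp add: SUP_le_iff ennreal_divide_le ennreal_mult)

lemma mu_le_iff:
  assumes "u \<in> test_class p M" "0 \<le> C"
  shows "mu p M u \<le> C \<longleftrightarrow> (\<forall>n. Jp p (nderiv n u) \<le> ennreal (C * M n powr p))"
proof -
  have "(SUP n. Jp p (nderiv n u) / ennreal (M n powr p)) = ennreal (mu p M u)"
    using assms(1) by (simp add: test_class_iff mu_def)
  then show ?thesis unfolding SUP_le[OF assms(2), symmetric] using assms(2) by (simp add: ennreal_le_iff)
qed

lemma test_class_bound: "u \<in> test_class p M \<Longrightarrow> Jp p (nderiv n u) \<le> ennreal (mu p M u * M n powr p)"
  using mu_le_iff[OF _ mu_nonneg[of p M u], of u] by simp

lemma carleman_norm_mu: "u \<in> test_class p M \<Longrightarrow> carleman_norm p M u = ennreal (mu p M u powr (1 / p))"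
proof -
  assume "u \<in> test_class p M"
  then have "(SUP n. Jp p (nderiv n u) / ennreal (M n powr p)) = ennreal (mu p M u)"
    by (simp add: test_class_iff mu_def)
  then show ?thesis by (simp add: carleman_norm_eq ennpowr_ennreal mu_nonneg)
qed

lemma test_classI:
  fixes H :: "nat \<Rightarrow> real \<Rightarrow> 'a::real_normed_vector"
  assumes "dtower H" "slow p H" "0 \<le> C" "\<And>n. Jp p (H n) \<le> ennreal (C * M n powr p)"
  shows "H 0 \<in> test_class p M" "mu p M (H 0) \<le> C"
proof -
  have n: "nderiv n (H 0) = H n" for n by (rule nderiv_dtower[OF assms(1)])
  have "(SUP n. Jp p (nderiv n (H 0)) / ennreal (M n powr p)) \<le> ennreal C"
    by (rule iffD2[OF SUP_le[OF assms(3)]]) (simp only: n assms(4) simp_thms)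
  also have "\<dots> < \<infinity>" by simp
  finally show *: "H 0 \<in> test_class p M" unfolding test_class_iff n using assms(1,2) by (simp add: n)
  show "mu p M (H 0) \<le> C" unfolding mu_le_iff[OF * assms(3)] n using assms(4) by blast
qed

lemma test_tower: "u \<in> test_class p M \<Longrightarrow> dtower (\<lambda>n. nderiv n u)"
  and test_slow: "u \<in> test_class p M \<Longrightarrow> slow p (\<lambda>n. nderiv n u)"
  by (simp_all add: test_class_iff)

lemma test_lebesgue: "u \<in> test_class p M \<Longrightarrow> (nderiv n u :: real \<Rightarrow> 'a::euclidean_space) \<in> borel_measurable lebesgue"
  by (intro borel_lebesgue dtower_borel[OF test_tower])

lemma test_add:
  fixes u v :: "real \<Rightarrow> 'a::euclidean_space"
  assumes u: "u \<in> test_class p M" and v: "v \<in> test_class p M"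
  shows "(\<lambda>x. u x + v x) \<in> test_class p M" "mu p M (\<lambda>x. u x + v x) \<le> mu p M u + mu p M v"
    "nderiv n (\<lambda>x. u x + v x) = (\<lambda>x. nderiv n u x + nderiv n v x)"
proof -
  let ?H = "\<lambda>n x. nderiv n u x + nderiv n v x"
  have t: "dtower ?H" by (intro dtower_add test_tower u v)
  have s: "slow p ?H"
  proof (rule slow_dominated[OF p test_slow[OF u] test_slow[OF v], of _ 1])
    fix n x
    have "norm (?H n x) \<le> 1 * (norm (nderiv n u x) + norm (nderiv n v x))" using norm_triangle_ineq by simp
    also have "\<dots> \<le> (1 * 4 ^ n) * (norm (nderiv n u x) + norm (nderiv n v x))" by (intro mult_right_mono) auto
    finally show "norm (?H n x) \<le> 1 * 4 ^ n * (norm (nderiv n u x) + norm (nderiv n v x))" .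
  qed
  have b: "Jp p (?H n) \<le> ennreal ((mu p M u + mu p M v) * M n powr p)" for n
  proof -
    have "Jp p (?H n) \<le> Jp p (nderiv n u) + Jp p (nderiv n v)" by (intro Jp_add p test_lebesgue u v)
    also have "\<dots> \<le> ennreal (mu p M u * M n powr p) + ennreal (mu p M v * M n powr p)"
      by (intro add_mono test_class_bound u v)
    also have "\<dots> = ennreal (mu p M u * M n powr p + mu p M v * M n powr p)"
      by (intro ennreal_plus[symmetric] mult_nonneg_nonneg mu_nonneg) auto
    finally show ?thesis by (simp add: distrib_right)
  qed
  have c: "0 \<le> mu p M u + mu p M v" by (intro add_nonneg_nonneg mu_nonneg)
  show "(\<lambda>x. u x + v x) \<in> test_class p M" "mu p M (\<lambda>x. u x + v x) \<le> mu p M u + mu p M v"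
    using test_classI[OF t s c b] by (simp_all add: nderiv_0)
  show "nderiv n (\<lambda>x. u x + v x) = ?H n" using nderiv_dtower[OF t, of n] by (simp add: nderiv_0)
qed

lemma test_scale:
  fixes u :: "real \<Rightarrow> 'a::{real_normed_field, euclidean_space}"
  assumes u: "u \<in> test_class p M"
  shows "(\<lambda>x. c * u x) \<in> test_class p M" "mu p M (\<lambda>x. c * u x) \<le> norm c powr p * mu p M u"
    "nderiv n (\<lambda>x. c * u x) = (\<lambda>x. c * nderiv n u x)"
proof -
  let ?H = "\<lambda>n x. c * nderiv n u x"
  have t: "dtower ?H" unfolding dtower_def
    by (intro allI has_vector_derivative_mult_right dtowerD[OF test_tower[OF u]])
  have s: "slow p ?H"
  proof (rule slow_dominated[OF p test_slow[OF u] test_slow[OF u], of _ "norm c"])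
    fix n x
    have "norm (?H n x) = (norm c * 1) * norm (nderiv n u x)" by (simp add: norm_mult)
    also have "\<dots> \<le> (norm c * 4 ^ n) * (norm (nderiv n u x) + norm (nderiv n u x))"
      by (intro mult_mono) auto
    finally show "norm (?H n x) \<le> norm c * 4 ^ n * (norm (nderiv n u x) + norm (nderiv n u x))" .
  qed
  have b: "Jp p (?H n) \<le> ennreal ((norm c powr p * mu p M u) * M n powr p)" for n
  proof -
    have "Jp p (?H n) = ennreal (norm c powr p) * Jp p (nderiv n u)" by (intro Jp_scale test_lebesgue u)
    also have "\<dots> \<le> ennreal (norm c powr p) * ennreal (mu p M u * M n powr p)"
      by (intro mult_left_mono test_class_bound u) simp
    also have "\<dots> = ennreal (norm c powr p * (mu p M u * M n powr p))"
      by (intro ennreal_mult[symmetric] mult_nonneg_nonneg mu_nonneg) auto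
    finally show ?thesis by (simp add: mult.assoc)
  qed
  have c: "0 \<le> norm c powr p * mu p M u" by (intro mult_nonneg_nonneg mu_nonneg) simp
  show "(\<lambda>x. c * u x) \<in> test_class p M" "mu p M (\<lambda>x. c * u x) \<le> norm c powr p * mu p M u"
    using test_classI[OF t s c b] by (simp_all add: nderiv_0)
  show "nderiv n (\<lambda>x. c * u x) = ?H n" using nderiv_dtower[OF t, of n] by (simp add: nderiv_0)
qed

lemma test_zero:
  "(\<lambda>x. 0 :: 'a::real_normed_vector) \<in> test_class p M" "mu p M (\<lambda>x. 0 :: 'a) = 0"
proof -
  let ?H = "\<lambda>(n::nat) (x::real). 0 :: 'a"
  have "dtower ?H" by (simp add: dtower_def)
  moreover have "slow p ?H" by (simp add: slow_def)
  moreover have "Jp p (?H n) \<le> ennreal (0 * M n powr p)" for n by (simp add: Jp_def)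
  ultimately have "?H 0 \<in> test_class p M" "mu p M (?H 0) \<le> 0" by (intro test_classI[of ?H 0]; simp)+
  then show "(\<lambda>x. 0 :: 'a) \<in> test_class p M" "mu p M (\<lambda>x. 0 :: 'a) = 0" using mu_nonneg[of p M "\<lambda>x. 0 :: 'a"] by auto
qed

lemma test_diff:
  fixes u v :: "real \<Rightarrow> 'a::{real_normed_field, euclidean_space}"
  assumes u: "u \<in> test_class p M" and v: "v \<in> test_class p M"
  shows "(\<lambda>x. u x - v x) \<in> test_class p M"
    "nderiv n (\<lambda>x. u x - v x) = (\<lambda>x. nderiv n u x - nderiv n v x)"
  using test_add(1,3)[OF u test_scale(1)[OF v, of "-1"]] test_scale(3)[OF v, of n "-1"] by simp_all

lemma mu_triangle:
  fixes u v w :: "real \<Rightarrow> 'a::{real_normed_field, euclidean_space}"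
  assumes u: "u \<in> test_class p M" and v: "v \<in> test_class p M" and w: "w \<in> test_class p M"
  shows "mu p M (\<lambda>x. u x - w x) \<le> mu p M (\<lambda>x. u x - v x) + mu p M (\<lambda>x. v x - w x)"
  using test_add(2)[OF test_diff(1)[OF u v] test_diff(1)[OF v w]] by simp

lemma mu_minus_commute:
  fixes u v :: "real \<Rightarrow> 'a::{real_normed_field, euclidean_space}"
  assumes u: "u \<in> test_class p M" and v: "v \<in> test_class p M"
  shows "mu p M (\<lambda>x. u x - v x) = mu p M (\<lambda>x. v x - u x)"
  using test_scale(2)[OF test_diff(1)[OF u v], of "-1"] test_scale(2)[OF test_diff(1)[OF v u], of "-1"] by simp

lemma test_space_pnormed:
  "pnormed (test_space p M :: ('a::{real_normed_field, euclidean_space}, _) qn_space) p (mu p M) (\<lambda>c. norm c powr p)"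
proof
  show "0 < p" by (rule p)
  fix x y x' y' :: "real \<Rightarrow> 'a" and c :: 'a
  show "0 \<le> norm c powr p" by simp
  assume x0: "x \<in> qcarrier (test_space p M)"
  then have x: "x \<in> test_class p M" by (simp add: test_space_simps)
  show "qscale (test_space p M) c x \<in> qcarrier (test_space p M)" using test_scale(1)[OF x] by (simp add: test_space_simps)
  show "0 \<le> mu p M x" by (rule mu_nonneg)
  show "qnorm (test_space p M) x = ennreal (mu p M x powr (1 / p))" using carleman_norm_mu[OF x] by (simp add: test_space_simps)
  show "mu p M (qadd (test_space p M) x (qscale (test_space p M) (- 1) x)) = 0" using test_zero(2) by (simp add: test_space_simps)
  assume y0: "y \<in> qcarrier (test_space p M)"
  then have y: "y \<in> test_class p M" by (simp add: test_space_simps)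
  show "qadd (test_space p M) x y \<in> qcarrier (test_space p M)" using test_add(1)[OF x y] by (simp add: test_space_simps)
  show "mu p M (qadd (test_space p M) x (qscale (test_space p M) (- 1) y)) = mu p M (qadd (test_space p M) y (qscale (test_space p M) (- 1) x))"
    using mu_minus_commute[OF x y] by (simp add: test_space_simps)
  show "mu p M x \<le> mu p M y + mu p M (qadd (test_space p M) x (qscale (test_space p M) (- 1) y))"
    using test_add(2)[OF y test_diff(1)[OF x y]] by (simp add: test_space_simps)
  show "mu p M (qadd (test_space p M) (qscale (test_space p M) c x) (qscale (test_space p M) (- 1) (qscale (test_space p M) c y)))
    \<le> norm c powr p * mu p M (qadd (test_space p M) x (qscale (test_space p M) (- 1) y))"
    using test_scale(2)[OF test_diff(1)[OF x y], of c] by (simp add: test_space_simps algebra_simps)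
  assume z0: "x' \<in> qcarrier (test_space p M)"
  then have z: "x' \<in> test_class p M" by (simp add: test_space_simps)
  show "mu p M (qadd (test_space p M) x (qscale (test_space p M) (- 1) x'))
    \<le> mu p M (qadd (test_space p M) x (qscale (test_space p M) (- 1) y)) + mu p M (qadd (test_space p M) y (qscale (test_space p M) (- 1) x'))"
    using mu_triangle[OF x y z] by (simp add: test_space_simps)
  assume w0: "y' \<in> qcarrier (test_space p M)"
  then have w: "y' \<in> test_class p M" by (simp add: test_space_simps)
  show "mu p M (qadd (test_space p M) (qadd (test_space p M) x y) (qscale (test_space p M) (- 1) (qadd (test_space p M) x' y')))
    \<le> mu p M (qadd (test_space p M) x (qscale (test_space p M) (- 1) x')) + mu p M (qadd (test_space p M) y (qscale (test_space p M) (- 1) y'))"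
    using test_add(2)[OF test_diff(1)[OF x z] test_diff(1)[OF y w]] by (simp add: test_space_simps algebra_simps)
qed

end

lemma slow_Suc: "0 < p \<Longrightarrow> p < 1 \<Longrightarrow> slow p h \<longleftrightarrow> slow p (\<lambda>n. h (Suc n))"
proof
  assume p: "0 < p" "p < 1" and h: "slow p h"
  show "slow p (\<lambda>n. h (Suc n))" unfolding slow_def
  proof (intro allI impI)
    fix e :: real assume "0 < e"
    then have "0 < e * (1 - p)" using p by simp
    then have "eventually (\<lambda>n. \<forall>x. norm (h n x) \<le> exp (e * (1 - p) / (1 - p) ^ n)) sequentially"
      using h unfolding slow_def by blast
    then have "eventually (\<lambda>n. \<forall>x. norm (h (Suc n) x) \<le> exp (e * (1 - p) / (1 - p) ^ Suc n)) sequentially"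
      by (rule eventually_compose_filterlim[OF _ filterlim_Suc])
    moreover have "e * (1 - p) / (1 - p) ^ Suc n = e / (1 - p) ^ n" for n using p by simp
    ultimately show "eventually (\<lambda>n. \<forall>x. norm (h (Suc n) x) \<le> exp (e / (1 - p) ^ n)) sequentially" by simp
  qed
next
  assume p: "0 < p" "p < 1" and h: "slow p (\<lambda>n. h (Suc n))"
  show "slow p h" unfolding slow_def
  proof (intro allI impI)
    fix e :: real assume e: "0 < e"
    then have "eventually (\<lambda>n. \<forall>x. norm (h (Suc n) x) \<le> exp (e / (1 - p) ^ n)) sequentially"
      using h unfolding slow_def by blast
    then have "eventually (\<lambda>n. \<forall>x. norm (h (Suc n) x) \<le> exp (e / (1 - p) ^ Suc n)) sequentially"
    proof (rule eventually_mono)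
      fix n assume *: "\<forall>x. norm (h (Suc n) x) \<le> exp (e / (1 - p) ^ n)"
      have "(1 - p) ^ Suc n \<le> (1 - p) ^ n" using p by (intro power_decreasing) auto
      then have "e / (1 - p) ^ n \<le> e / (1 - p) ^ Suc n" using p e by (intro divide_left_mono) auto
      then have "exp (e / (1 - p) ^ n) \<le> exp (e / (1 - p) ^ Suc n)" by simp
      then show "\<forall>x. norm (h (Suc n) x) \<le> exp (e / (1 - p) ^ Suc n)" using * order_trans by blast
    qed
    then show "eventually (\<lambda>n. \<forall>x. norm (h n x) \<le> exp (e / (1 - p) ^ n)) sequentially"
      using eventually_sequentially_Suc[of "\<lambda>n. \<forall>x. norm (h n x) \<le> exp (e / (1 - p) ^ n)"] by blast
  qed
qed

lemma all_nat_split: "(\<forall>n. P n) \<longleftrightarrow> P 0 \<and> (\<forall>n. P (Suc n))"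
proof
  assume *: "P 0 \<and> (\<forall>n. P (Suc n))"
  show "\<forall>n. P n"
  proof
    fix n show "P n" using * by (cases n) auto
  qed
qed blast

text \<open>Order 0 is split off from the supremum defining \<open>mu\<close>. The maximum formula,
  applied to differences, is what \<open>homeomorphic_map_max\<close> needs on test
  functions.\<close>

lemma test_class_deriv:
  fixes u :: "real \<Rightarrow> 'a::euclidean_space"
  assumes p: "0 < p" "p < 1" and M: "\<And>n. 1 \<le> M n" and u: "u \<in> test_class p M"
  shows "nderiv 1 u \<in> test_class p (\<lambda>n. M (Suc n))" "u \<in> lp_funs p"
    "mu p M u = max (mL p u / M 0 powr p) (mu p (\<lambda>n. M (Suc n)) (nderiv 1 u))"
proof -
  let ?M = "\<lambda>n. M (Suc n)"
  have M1: "\<And>n. 1 \<le> ?M n" by (rule M)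
  have t: "dtower (\<lambda>n. nderiv (Suc n) u)" using test_tower[OF p M u] by (simp add: dtower_def)
  have s: "slow p (\<lambda>n. nderiv (Suc n) u)" by (rule iffD1[OF slow_Suc[OF p] test_slow[OF p M u]])
  have b: "Jp p (nderiv (Suc n) u) \<le> ennreal (mu p M u * ?M n powr p)" for n
    by (rule test_class_bound[OF p M u])
  show u1: "nderiv 1 u \<in> test_class p ?M"
    using test_classI(1)[OF p M1 t s mu_nonneg b] by simp
  have J0: "Jp p u \<le> ennreal (mu p M u * M 0 powr p)" using test_class_bound[OF p M u, of 0] by (simp add: nderiv_0)
  then show ul: "u \<in> lp_funs p"
    unfolding lp_funs_iff using test_lebesgue[OF p M u, of 0] by (auto simp: nderiv_0 intro: le_less_trans)
  have M0: "0 < M 0 powr p" by (rule Mp[OF p M])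
  have eq: "mu p M u \<le> C \<longleftrightarrow> mL p u / M 0 powr p \<le> C \<and> mu p ?M (nderiv 1 u) \<le> C" if C: "0 \<le> C" for C
  proof -
    have "mu p M u \<le> C \<longleftrightarrow> Jp p u \<le> ennreal (C * M 0 powr p) \<and> (\<forall>n. Jp p (nderiv (Suc n) u) \<le> ennreal (C * M (Suc n) powr p))"
      unfolding mu_le_iff[OF p M u C]
      using all_nat_split[of "\<lambda>n. Jp p (nderiv n u) \<le> ennreal (C * M n powr p)"] by (simp add: nderiv_0)
    also have "Jp p u \<le> ennreal (C * M 0 powr p) \<longleftrightarrow> mL p u / M 0 powr p \<le> C"
      using C M0 by (simp add: Jp_mL[OF ul] ennreal_le_iff pos_divide_le_eq)
    also have "(\<forall>n. Jp p (nderiv (Suc n) u) \<le> ennreal (C * M (Suc n) powr p)) \<longleftrightarrow> mu p ?M (nderiv 1 u) \<le> C"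
      unfolding mu_le_iff[OF p M1 u1 C] nderiv_nderiv ..
    finally show ?thesis .
  qed
  have "0 \<le> max (mL p u / M 0 powr p) (mu p ?M (nderiv 1 u))"
    using mu_nonneg[of p ?M "nderiv 1 u"] by (simp add: le_max_iff_disj)
  from eq[OF this] eq[OF mu_nonneg[of p M u]]
  show "mu p M u = max (mL p u / M 0 powr p) (mu p ?M (nderiv 1 u))" by (intro antisym) simp_all
qed

text \<open>Convergence of the sum of logarithms would make the product finite, and the shift by one
  order only removes a term and changes the rest by the factor \<open>1 - p\<close>.\<close>

lemma carleman_mu_not_summable:
  assumes p: "0 < p" "p < 1" and M: "\<And>n. 1 \<le> M n" and inf: "carleman_mu p M = \<infinity>"
  shows "\<not> summable (\<lambda>n. (1 - p) ^ n * ln (M (Suc n)))"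
proof
  assume "summable (\<lambda>n. (1 - p) ^ n * ln (M (Suc n)))"
  then have "summable (\<lambda>n. (1 - p) * ((1 - p) ^ n * ln (M (Suc n))))" by (rule summable_mult)
  then have "summable (\<lambda>n. (1 - p) ^ Suc n * ln (M (Suc n)))" by (simp add: mult.assoc)
  then have s: "summable (\<lambda>n. (1 - p) ^ n * ln (M n))" by (rule iffD1[OF summable_Suc_iff])
  have "(\<Prod>n<k. ennreal (M n powr ((1 - p) ^ n))) = ennreal (exp (\<Sum>n<k. (1 - p) ^ n * ln (M n)))" for k
  proof -
    have "M n powr ((1 - p) ^ n) = exp ((1 - p) ^ n * ln (M n))" for n using M[of n] by (simp add: powr_def)
    then show ?thesis by (simp add: exp_sum prod_ennreal)
  qed
  moreover have "(\<lambda>k. ennreal (exp (\<Sum>n<k. (1 - p) ^ n * ln (M n)))) \<longlonglongrightarrow> ennreal (exp (\<Sum>n. (1 - p) ^ n * ln (M n)))"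
    by (intro tendsto_ennrealI tendsto_exp summable_LIMSEQ s)
  ultimately have "carleman_mu p M = ennreal (exp (\<Sum>n. (1 - p) ^ n * ln (M n)))"
    unfolding carleman_mu_def by (simp add: limI)
  then show False using inf by simp
qed

section \<open>A finite measure controlling all derivatives of a test function\<close>

lemma integral_le_nn_integral:
  fixes f :: "real \<Rightarrow> real"
  assumes f: "continuous_on UNIV f" "\<And>x. 0 \<le> f x" and C: "(\<integral>\<^sup>+x. ennreal (f x) \<partial>lborel) \<le> ennreal C" "0 \<le> C"
  shows "integral {a..b} f \<le> C"
proof -
  have ci: "continuous_on {a..b} f" using f(1) by (rule continuous_on_subset) simp
  then have "f integrable_on {a..b}" by (rule integrable_continuous_interval)
  then have "(f has_integral integral {a..b} f) {a..b}" by (rule integrable_integral)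
  then have "((\<lambda>x. if x \<in> {a..b} then f x else 0) has_integral integral {a..b} f) UNIV"
    by (rule iffD2[OF has_integral_restrict_UNIV])
  then have eq: "(\<integral>\<^sup>+x. ennreal (if x \<in> {a..b} then f x else 0) \<partial>lborel) = ennreal (integral {a..b} f)"
  proof (intro nn_integral_has_integral_lborel)
    have "f \<in> borel_measurable borel" by (rule borel_measurable_continuous_onI[OF f(1)])
    then show "(\<lambda>x. if x \<in> {a..b} then f x else 0) \<in> borel_measurable borel" by (intro measurable_If) auto
  qed (use f(2) in auto)
  have "ennreal (integral {a..b} f) \<le> (\<integral>\<^sup>+x. ennreal (f x) \<partial>lborel)"
    unfolding eq[symmetric]
  proof (intro nn_integral_mono ennreal_leI)
    fix x
    show "(if x \<in> {a..b} then f x else 0) \<le> f x" using f(2)[of x] by (cases "x \<in> {a..b}") simp_all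
  qed
  also have "\<dots> \<le> ennreal C" by (rule C(1))
  finally show ?thesis using C(2) by (simp add: ennreal_le_iff)
qed

context
  fixes p :: real and N :: "nat \<Rightarrow> real" and h :: "nat \<Rightarrow> real \<Rightarrow> 'a::euclidean_space" and C :: real
  assumes p: "0 < p" "p < 1" and N: "\<And>n. 1 \<le> N n" and h: "dtower h" and C: "0 \<le> C"
    and hC: "\<And>n. Jp p (h n) \<le> ennreal (C * N n powr p)"
begin

text \<open>The powers of 1/2 make the sum over all orders finite; they reappear as the factor
  \<open>2 ^ n\<close> in \<open>weight_int\<close>.\<close>

definition wt :: "nat \<Rightarrow> real \<Rightarrow> real \<Rightarrow> real" where
  "wt i a b = (1/2) ^ i * (integral {a..b} (\<lambda>x. norm (h i x) powr p) / N i powr p)"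

text \<open>A finite measure dominating all the functions \<open>\<bar>h\<^sub>n\<bar>\<^sup>p / N\<^sub>n\<^sup>p\<close> and, locally, Lebesgue measure.\<close>

definition weight :: "real \<Rightarrow> real \<Rightarrow> real" where
  "weight a b = (\<Sum>i. wt i a b) + (arctan b - arctan a)"

lemma Np: "0 < N i powr p" using N[of i] by simp

lemma cont_h: "continuous_on S (\<lambda>x. norm (h i x) powr p)"
  by (rule cont_powr_norm[OF dtower_continuous[OF h] p(1)])

lemma wt_nonneg: "0 \<le> wt i a b"
  unfolding wt_def using Np[of i]
  by (intro mult_nonneg_nonneg divide_nonneg_nonneg integral_nonneg integrable_continuous_interval cont_h) auto

lemma wt_le: "wt i a b \<le> (1/2) ^ i * C"
proof -
  have "integral {a..b} (\<lambda>x. norm (h i x) powr p) \<le> C * N i powr p"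
    by (rule integral_le_nn_integral[OF cont_h]) (use hC[of i] Np[of i] C in \<open>auto simp: Jp_lborel\<close>)
  then have "integral {a..b} (\<lambda>x. norm (h i x) powr p) / N i powr p \<le> C"
    using Np[of i] by (simp add: pos_divide_le_eq)
  then show ?thesis unfolding wt_def by (intro mult_left_mono) auto
qed

lemma wt_summable: "summable (\<lambda>i. wt i a b)"
proof (rule summable_comparison_test)
  show "\<exists>n0. \<forall>n\<ge>n0. norm (wt n a b) \<le> (1/2) ^ n * C"
    unfolding real_norm_def abs_of_nonneg[OF wt_nonneg] using wt_le by blast
  show "summable (\<lambda>n. (1/2) ^ n * C)" by (intro summable_mult2 summable_geometric) auto
qed

lemma weight_add: assumes "a \<le> m" "m \<le> b" shows "weight a b = weight a m + weight m b"
proof -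
  have "wt i a b = wt i a m + wt i m b" for i
  proof -
    have "integral {a..m} (\<lambda>x. norm (h i x) powr p) + integral {m..b} (\<lambda>x. norm (h i x) powr p) = integral {a..b} (\<lambda>x. norm (h i x) powr p)"
      by (intro Henstock_Kurzweil_Integration.integral_combine assms integrable_continuous_interval cont_h)
    then show ?thesis by (simp add: wt_def distrib_left[symmetric] add_divide_distrib[symmetric])
  qed
  then have "(\<Sum>i. wt i a b) = (\<Sum>i. wt i a m) + (\<Sum>i. wt i m b)"
    using suminf_add[OF wt_summable[of a m] wt_summable[of m b]] by simp
  then show ?thesis by (simp add: weight_def)
qed

lemma arctan_le_weight: "arctan b - arctan a \<le> weight a b"
  unfolding weight_def using suminf_nonneg[OF wt_summable wt_nonneg] by simp

lemma weight_pos: "a < b \<Longrightarrow> 0 < weight a b"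
  using arctan_le_weight[of b a] by (simp add: arctan_less_iff less_le_trans[of 0 "arctan b - arctan a"])

lemma weight_int:
  assumes "a < b" shows "integral {a..b} (\<lambda>x. norm (h n x) powr p) \<le> 2 ^ n * N n powr p * weight a b"
proof -
  have "wt n a b = sum (\<lambda>i. wt i a b) {n}" by simp
  also have "\<dots> \<le> (\<Sum>i. wt i a b)" by (intro sum_le_suminf wt_summable) (auto simp: wt_nonneg)
  also have "\<dots> \<le> weight a b" using assms by (simp add: weight_def arctan_le_iff)
  finally have "2 ^ n * N n powr p * wt n a b \<le> 2 ^ n * N n powr p * weight a b"
    by (intro mult_left_mono) auto
  moreover have "2 ^ n * N n powr p * wt n a b = integral {a..b} (\<lambda>x. norm (h n x) powr p)"
    using Np[of n] by (simp add: wt_def power_one_over field_simps)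
  ultimately show ?thesis by simp
qed

text \<open>The lower bound comes from the \<open>arctan\<close> term, whose derivative is at least
  \<open>inverse (1 + K\<^sup>2)\<close> on \<open>{- K..K}\<close> although its total mass is
  finite.\<close>

lemma weight_low: "\<exists>c>0. \<forall>a b. - K \<le> a \<longrightarrow> a < b \<longrightarrow> b \<le> K \<longrightarrow> c * (b - a) \<le> weight a b"
proof (intro exI conjI allI impI)
  have K1: "0 < 1 + K\<^sup>2" by (rule add_pos_nonneg) auto
  then show "0 < inverse (1 + K\<^sup>2)" by simp
  fix a b assume ab: "- K \<le> a" "a < b" "b \<le> K"
  obtain z where z: "a < z" "z < b" "arctan b - arctan a = (b - a) * inverse (1 + z\<^sup>2)"
    using MVT2[OF ab(2), of arctan "\<lambda>x. inverse (1 + x\<^sup>2)"] DERIV_arctan by blast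
  have "\<bar>z\<bar> \<le> \<bar>K\<bar>" using z ab by linarith
  then have "z\<^sup>2 \<le> K\<^sup>2" by (rule abs_le_square_iff[THEN iffD1])
  then have "inverse (1 + K\<^sup>2) \<le> inverse (1 + z\<^sup>2)" by (intro le_imp_inverse_le add_pos_nonneg) auto
  then have "inverse (1 + K\<^sup>2) * (b - a) \<le> inverse (1 + z\<^sup>2) * (b - a)" using ab by (intro mult_right_mono) auto
  also have "\<dots> = arctan b - arctan a" unfolding z(3) by (rule mult.commute)
  also have "\<dots> \<le> weight a b" by (rule arctan_le_weight)
  finally show "inverse (1 + K\<^sup>2) * (b - a) \<le> weight a b" .
qed

lemma weight_le: "weight a b \<le> 2 * C + pi"
proof -
  have "(\<Sum>i. wt i a b) \<le> (\<Sum>i. (1/2) ^ i * C)"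
    by (intro suminf_le wt_le wt_summable summable_mult2 summable_geometric) auto
  also have "\<dots> = (\<Sum>i. (1/2) ^ i) * C" by (rule suminf_mult2[symmetric]) (auto intro: summable_geometric)
  also have "\<dots> = 2 * C" by (simp add: suminf_geometric)
  finally have "(\<Sum>i. wt i a b) \<le> 2 * C" .
  moreover have "arctan b - arctan a \<le> pi" using arctan_bounded[of a] arctan_bounded[of b] by linarith
  ultimately show ?thesis by (simp add: weight_def)
qed

end

text \<open>\<open>U 0\<close> is a primitive of \<open>g\<close> from which the bumps
  \<open>H 0\<close> have been removed: it lies in L^p, and its derivative is near \<open>g\<close>.
  The missing \<open>f - U 0\<close> is supplied by \<open>K 0\<close>, whose derivatives are small,
  so the derivative of \<open>V = U + K\<close> differs from \<open>g\<close> only by those of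
  \<open>K\<close> and \<open>H\<close>.\<close>

theorem test_class_dense:
  fixes f g :: "real \<Rightarrow> 'a::{real_normed_field, euclidean_space}"
  assumes p: "0 < p" "p < 1" and M: "\<And>n. 1 \<le> M n" and inf: "carleman_mu p M = \<infinity>"
    and f: "f \<in> lp_funs p" and g: "g \<in> test_class p (\<lambda>n. M (Suc n))" and e: "0 < e"
  shows "\<exists>u\<in>test_class p M. mL p (\<lambda>x. u x - f x) < e \<and> mu p (\<lambda>n. M (Suc n)) (\<lambda>x. nderiv 1 u x - g x) < e"
proof -
  let ?N = "\<lambda>n. M (Suc n)"
  have N: "\<And>n. 1 \<le> ?N n" by (rule M)
  note ns = carleman_mu_not_summable[OF p M inf]
  interpret W: weights p ?N by unfold_locales (use p N ns in auto)
  let ?C = "mu p ?N g"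
  have C: "0 \<le> ?C" by (rule mu_nonneg)
  note gt = test_tower[OF p N g] and gC = test_class_bound[OF p N g]
  have "continuous_on UNIV g" using dtower_continuous[OF gt, of UNIV 0] by (simp add: nderiv_0)
  then have "\<And>x. isCont g x" by (simp add: continuous_on_eq_continuous_at)
  then have "\<exists>G. \<forall>x :: real. - \<infinity> < ereal x \<longrightarrow> ereal x < \<infinity> \<longrightarrow> (G has_vector_derivative g x) (at x)"
    by (intro einterval_antiderivative) auto
  then obtain G where G: "\<And>x. (G has_vector_derivative g x) (at x)" by auto
  \<comment> \<open>The primitive is placed in the slot below \<open>g\<close>, so the orders of
    \<open>g\<close> move up by one.\<close>
  define F where "F = case_nat G (\<lambda>n. nderiv n g)"
  have F0: "F 0 = G" and FS: "\<And>n. F (Suc n) = nderiv n g" by (simp_all add: F_def)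
  have Ft: "dtower F" unfolding dtower_def
  proof (intro allI)
    fix n x
    show "(F n has_vector_derivative F (Suc n) x) (at x)"
    proof (cases n)
      case 0 then show ?thesis using G by (simp add: F0 FS nderiv_0)
    next
      case (Suc m) then show ?thesis using dtowerD[OF gt] by (simp add: FS)
    qed
  qed
  note wargs = p N gt C gC
  interpret T: weighted_tower p ?N F "weight p ?N (\<lambda>n. nderiv n g)"
  proof
    show "slow p (\<lambda>n. F (Suc n))" unfolding FS by (rule test_slow[OF p N g])
    show "weight p ?N (\<lambda>n. nderiv n g) a b = weight p ?N (\<lambda>n. nderiv n g) a m + weight p ?N (\<lambda>n. nderiv n g) m b"
      if "a \<le> m" "m \<le> b" for a m b by (rule weight_add[OF wargs that])
    show "0 < weight p ?N (\<lambda>n. nderiv n g) a b" if "a < b" for a b by (rule weight_pos[OF wargs that])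
    show "integral {a..b} (\<lambda>x. norm (F (Suc n) x) powr p) \<le> 2 ^ n * ?N n powr p * weight p ?N (\<lambda>n. nderiv n g) a b"
      if "a < b" for n a b unfolding FS by (rule weight_int[OF wargs that])
    show "\<exists>c>0. \<forall>a b. - K \<le> a \<longrightarrow> a < b \<longrightarrow> b \<le> K \<longrightarrow> c * (b - a) \<le> weight p ?N (\<lambda>n. nderiv n g) a b" for K
      by (rule weight_low[OF wargs])
  qed (fact p N Ft ns)+
  \<comment> \<open>Two errors of size \<open>d\<close> meet in the derivative; the third part
    leaves the strict inequality.\<close>
  define d where "d = e / 3"
  have d: "0 < d" using e by (simp add: d_def)
  have ex1: "\<exists>H. dtower H \<and> (\<forall>n. Jp p (H (Suc n)) \<le> ennreal (d * ?N n powr p)) \<and>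
    slow p (\<lambda>n. H (Suc n)) \<and> Jp p (\<lambda>x. F 0 x - F 0 0 - H 0 x) < \<infinity>"
    unfolding Jp_lborel by (rule T.replace_primitive[OF weight_le[OF wargs] d])
  obtain H where H: "dtower H" "\<And>n. Jp p (H (Suc n)) \<le> ennreal (d * ?N n powr p)" "slow p (\<lambda>n. H (Suc n))"
    "Jp p (\<lambda>x. F 0 x - F 0 0 - H 0 x) < \<infinity>" using ex1 by blast
  define U where "U n x = F n x - (if n = 0 then F 0 0 else 0) - H n x" for n x
  have Ut: "dtower U" unfolding dtower_def U_def
  proof (intro allI)
    fix n x
    have "((\<lambda>x. F n x - (if n = 0 then F 0 0 else 0) - H n x) has_vector_derivative F (Suc n) x - 0 - H (Suc n) x) (at x)"
      by (intro has_vector_derivative_diff has_vector_derivative_const dtowerD Ft H(1))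
    then show "((\<lambda>x. F n x - (if n = 0 then F 0 0 else 0) - H n x) has_vector_derivative
        F (Suc n) x - (if Suc n = 0 then F 0 0 else 0) - H (Suc n) x) (at x)" by simp
  qed
  have Ul: "U 0 \<in> lp_funs p" unfolding lp_funs_iff
  proof
    show "U 0 \<in> borel_measurable lebesgue" by (intro borel_lebesgue dtower_borel Ut)
    show "Jp p (U 0) < \<infinity>" using H(4) by (simp add: U_def[abs_def])
  qed
  note dl = lp_funs_diff[OF p f Ul]
  have "W.approximable (\<lambda>x. f x - U 0 x)" using dl unfolding lp_funs_iff by (intro W.approximable_Lp) auto
  from W.approximableE[OF this d] obtain K where K: "dtower K" "slow p (\<lambda>n. K (Suc n))"
    "\<And>n. Jp p (K (Suc n)) \<le> ennreal (d * ?N n powr p)" "Jp p (\<lambda>x. K 0 x - (f x - U 0 x)) \<le> ennreal d" by blast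
  define V where "V n x = U n x + K n x" for n x
  have Vt: "dtower V" unfolding V_def[abs_def] by (rule dtower_add[OF Ut K(1)])
  have Kb: "K n \<in> borel_measurable lebesgue" "H n \<in> borel_measurable lebesgue" "V n \<in> borel_measurable lebesgue"
    "nderiv n g \<in> borel_measurable lebesgue" for n
    by (intro borel_lebesgue dtower_borel K(1) H(1) Vt gt)+
  note [measurable] = Kb
  have fb [measurable]: "f \<in> borel_measurable lebesgue" using f by (simp add: lp_funs_iff)
  define E where "E n x = K (Suc n) x - H (Suc n) x" for n x
  have VE: "V (Suc n) x = nderiv n g x + E n x" for n x by (simp add: V_def U_def E_def FS)
  have Eb [measurable]: "E n \<in> borel_measurable lebesgue" for n unfolding E_def[abs_def] by measurable
  have Et: "dtower E" unfolding dtower_def E_def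
    by (intro allI has_vector_derivative_diff dtowerD K(1) H(1))
  have Es: "slow p E"
  proof (rule slow_dominated[OF p K(2) H(3), of _ 1])
    fix n x
    have "norm (E n x) \<le> 1 * (norm (K (Suc n) x) + norm (H (Suc n) x))" unfolding E_def using norm_triangle_ineq4 by simp
    also have "\<dots> \<le> (1 * 4 ^ n) * (norm (K (Suc n) x) + norm (H (Suc n) x))" by (intro mult_right_mono) auto
    finally show "norm (E n x) \<le> 1 * 4 ^ n * (norm (K (Suc n) x) + norm (H (Suc n) x))" .
  qed
  have EC: "Jp p (E n) \<le> ennreal ((2 * d) * ?N n powr p)" for n
  proof -
    have "Jp p (E n) = Jp p (\<lambda>x. K (Suc n) x + - 1 * H (Suc n) x)" by (simp add: E_def[abs_def])
    also have "\<dots> \<le> Jp p (K (Suc n)) + Jp p (\<lambda>x. - 1 * H (Suc n) x)" by (rule Jp_add[OF p]) measurable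
    also have "Jp p (\<lambda>x. - 1 * H (Suc n) x) = Jp p (H (Suc n))" by (simp add: Jp_def)
    also have "Jp p (K (Suc n)) + Jp p (H (Suc n)) \<le> ennreal (d * ?N n powr p) + ennreal (d * ?N n powr p)"
      by (intro add_mono K(3) H(2))
    also have "\<dots> = ennreal (d * ?N n powr p + d * ?N n powr p)" using d by (intro ennreal_plus[symmetric]) auto
    finally show ?thesis by (simp add: mult.assoc)
  qed
  have V0: "Jp p (\<lambda>x. V 0 x - f x) \<le> ennreal d"
  proof -
    have "(\<lambda>x. V 0 x - f x) = (\<lambda>x. K 0 x - (f x - U 0 x))" by (simp add: V_def fun_eq_iff)
    then show ?thesis using K(4) by simp
  qed
  have Vfl: "(\<lambda>x. V 0 x - f x) \<in> lp_funs p" unfolding lp_funs_iff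
  proof
    show "Jp p (\<lambda>x. V 0 x - f x) < \<infinity>" using V0 by (rule le_less_trans) simp
  qed measurable
  have Vl: "V 0 \<in> lp_funs p" using lp_funs_add(1)[OF p Vfl f] by simp
  \<comment> \<open>Only membership in the test class is at stake here, so the bound may be
    large.\<close>
  let ?c = "mL p (V 0) + (?C + 2 * d)"
  have c0: "0 \<le> ?c" using mL_nonneg[of p "V 0"] C d by simp
  have Vs: "slow p V" 
  proof (rule iffD2[OF slow_Suc[OF p]], rule slow_dominated[OF p test_slow[OF p N g] Es, of _ 1])
    fix n x
    have "norm (V (Suc n) x) \<le> 1 * (norm (nderiv n g x) + norm (E n x))" unfolding VE using norm_triangle_ineq by simp
    also have "\<dots> \<le> (1 * 4 ^ n) * (norm (nderiv n g x) + norm (E n x))" by (intro mult_right_mono) auto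
    finally show "norm (V (Suc n) x) \<le> 1 * 4 ^ n * (norm (nderiv n g x) + norm (E n x))" .
  qed
  have VC: "Jp p (V n) \<le> ennreal (?c * M n powr p)" for n
  proof (cases n)
    case 0
    have "1 powr p \<le> M 0 powr p" using p M[of 0] by (intro powr_mono2) auto
    then have "1 \<le> M 0 powr p" by simp
    then have "?c * 1 \<le> ?c * M 0 powr p" using c0 by (rule mult_left_mono)
    moreover have "mL p (V 0) \<le> ?c" using C d by simp
    ultimately have "mL p (V 0) \<le> ?c * M 0 powr p" unfolding mult_1_right by (rule order_trans[rotated])
    then show ?thesis using 0 by (simp add: Jp_mL[OF Vl] ennreal_leI)
  next
    case (Suc m)
    have "Jp p (V (Suc m)) = Jp p (\<lambda>x. nderiv m g x + E m x)" by (simp add: VE[abs_def])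
    also have "\<dots> \<le> Jp p (nderiv m g) + Jp p (E m)" by (rule Jp_add[OF p]) measurable
    also have "\<dots> \<le> ennreal (?C * ?N m powr p) + ennreal ((2 * d) * ?N m powr p)" by (intro add_mono gC EC)
    also have "\<dots> = ennreal (?C * ?N m powr p + (2 * d) * ?N m powr p)" using d C by (intro ennreal_plus[symmetric]) auto
    also have "\<dots> \<le> ennreal (?c * ?N m powr p)"
      unfolding distrib_right[symmetric] by (intro ennreal_leI mult_right_mono) (auto simp: mL_nonneg)
    finally show ?thesis using Suc by simp
  qed
  note VT = test_classI(1)[OF p M Vt Vs c0 VC]
  have "mL p (\<lambda>x. V 0 x - f x) \<le> d" using V0 d by (simp add: Jp_mL[OF Vfl] ennreal_le_iff)
  then have 1: "mL p (\<lambda>x. V 0 x - f x) < e" using e by (simp add: d_def)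
  have "nderiv 1 (V 0) = V 1" by (rule nderiv_dtower[OF Vt])
  then have "(\<lambda>x. nderiv 1 (V 0) x - g x) = E 0" using VE[of 0] by (simp add: nderiv_0 fun_eq_iff)
  moreover have "mu p ?N (E 0) \<le> 2 * d" using test_classI(2)[OF p N Et Es _ EC] d by simp
  ultimately have "mu p ?N (\<lambda>x. nderiv 1 (V 0) x - g x) < e" using e by (simp add: d_def)
  then show ?thesis using VT 1 by blast
qed

section \<open>The isomorphism of topological vector spaces\<close>

theorem theorem1:
  fixes p :: real and M :: "nat \<Rightarrow> real"
  assumes "0 < p" and "p < 1"
    and "\<And>n. M n \<ge> 1"
    and "carleman_mu p M = \<infinity>"
    and "p_regular p M"
  shows "tvs_isomorphic
           (tvs_of (carleman_sobolev p M ::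
              ('a::{real_normed_field, euclidean_space}, (nat \<Rightarrow> real \<Rightarrow> 'a) set) qn_space))
           (tvs_sum (tvs_of (lp_space p)) (tvs_of (carleman_sobolev p (\<lambda>n. M (Suc n)))))"
proof -
  note p = assms(1,2) and M = assms(3) and inf = assms(4)
  let ?N = "\<lambda>n. M (Suc n)"
  have N: "\<And>n. 1 \<le> ?N n" by (rule M)
  define V :: "('a, real \<Rightarrow> 'a) qn_space" where "V = test_space p M"
  define V1 :: "('a, real \<Rightarrow> 'a) qn_space" where "V1 = test_space p ?N"
  define L :: "('a, (real \<Rightarrow> 'a) set) qn_space" where "L = lp_space p"
  interpret A: pnormed V p "mu p M" "\<lambda>c. norm c powr p" unfolding V_def by (rule test_space_pnormed[OF p M])
  interpret B: pnormed V1 p "mu p ?N" "\<lambda>c. norm c powr p" unfolding V1_def by (rule test_space_pnormed[OF p N])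
  have Vs: "qcarrier V = test_class p M" "qadd V = (\<lambda>u v x. u x + v x)" "qscale V = (\<lambda>c u x. c * u x)"
    and V1s: "qcarrier V1 = test_class p ?N" "qadd V1 = (\<lambda>u v x. u x + v x)" "qscale V1 = (\<lambda>c u x. c * u x)"
    unfolding V_def V1_def by (rule test_space_simps)+
  have AD: "A.D u v = mu p M (\<lambda>x. u x - v x)" for u v by (simp add: A.D_def Vs)
  have BD: "B.D u v = mu p ?N (\<lambda>x. u x - v x)" for u v by (simp add: B.D_def V1s)
  define c where "c = M 0 powr p"
  have c: "0 < c" unfolding c_def by (rule Mp[OF p M])
  define dv where "dv u n = nderiv 1 (u n)" for u :: "nat \<Rightarrow> real \<Rightarrow> 'a" and n
  have Dmax: "A.D u v = max (mL p (\<lambda>x. u x - v x) / c) (B.D (nderiv 1 u) (nderiv 1 v))"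
    if "u \<in> test_class p M" "v \<in> test_class p M" for u v
    unfolding AD BD c_def test_class_deriv(3)[OF p M test_diff(1)[OF p M that]] test_diff(2)[OF p M that] ..
  have Au: "u n \<in> test_class p M" if "u \<in> cauchy_seqs V" for u n using A.cauchy_carrier[OF that] by (simp add: Vs)
  have Al: "u n \<in> lp_funs p" if "u \<in> cauchy_seqs V" for u n by (rule test_class_deriv(2)[OF p M Au[OF that]])
  have mLD: "mL p (\<lambda>x. u m x - v n x) \<le> c * A.D (u m) (v n)" "B.D (dv u m) (dv v n) \<le> A.D (u m) (v n)"
    if "u \<in> cauchy_seqs V" "v \<in> cauchy_seqs V" for u v m n
  proof -
    note eq = Dmax[OF Au[OF that(1), of m] Au[OF that(2), of n]]
    have "mL p (\<lambda>x. u m x - v n x) / c \<le> A.D (u m) (v n)" unfolding eq by (rule max.cobounded1)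
    then show "mL p (\<lambda>x. u m x - v n x) \<le> c * A.D (u m) (v n)" using c by (simp add: pos_divide_le_eq mult.commute)
    show "B.D (dv u m) (dv v n) \<le> A.D (u m) (v n)" unfolding eq dv_def by (rule max.cobounded2)
  qed
  have dv: "dv u \<in> cauchy_seqs V1" if u: "u \<in> cauchy_seqs V" for u
    unfolding B.cauchy_seqs_iff
  proof (intro conjI allI impI)
    show "dv u n \<in> qcarrier V1" for n unfolding dv_def V1s by (rule test_class_deriv(1)[OF p M Au[OF u]])
    fix e :: real assume "0 < e"
    then obtain n0 where "\<forall>m\<ge>n0. \<forall>n\<ge>n0. A.D (u m) (u n) < e" using u unfolding A.cauchy_seqs_iff by blast
    then show "\<exists>n0. \<forall>m\<ge>n0. \<forall>n\<ge>n0. B.D (dv u m) (dv u n) < e" using mLD(2)[OF u u] le_less_trans by blast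
  qed
  \<comment> \<open>A relation rather than a function, since the limit is unique only up to null
    sets.\<close>
  define lm where "lm u f \<longleftrightarrow> f \<in> lp_funs p \<and> (\<lambda>n. mL p (\<lambda>x. u n x - f x)) \<longlonglongrightarrow> 0" for u :: "nat \<Rightarrow> real \<Rightarrow> 'a" and f
  have lm_ex: "\<exists>f. lm u f" if u: "u \<in> cauchy_seqs V" for u
  proof -
    have "\<exists>f\<in>lp_funs p. (\<lambda>n. mL p (\<lambda>x. u n x - f x)) \<longlonglongrightarrow> 0"
    proof (rule Lp_complete[OF p Al[OF u]])
      fix e :: real assume "0 < e"
      then have "0 < e / c" using c by simp
      then obtain n0 where n0: "\<And>m n. m \<ge> n0 \<Longrightarrow> n \<ge> n0 \<Longrightarrow> A.D (u m) (u n) < e / c"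
        using u unfolding A.cauchy_seqs_iff by blast
      have "mL p (\<lambda>x. u m x - u n x) < e" if "m \<ge> n0" "n \<ge> n0" for m n
        using mLD(1)[OF u u, of m n] n0[OF that] c by (simp add: pos_less_divide_eq mult.commute)
      then show "\<exists>n0. \<forall>m\<ge>n0. \<forall>n\<ge>n0. mL p (\<lambda>x. u m x - u n x) < e" by blast
    qed
    then show ?thesis by (auto simp: lm_def)
  qed
  \<comment> \<open>The maximum formula for distances survives the passage to limits. From it follow
    the independence of \<open>T\<close> from representatives, its injectivity and its
    bicontinuity.\<close>
  have key: "A.Dl u v = max (mL p (\<lambda>x. f x - h x) / c) (B.Dl (dv u) (dv v))"
    if u: "u \<in> cauchy_seqs V" and v: "v \<in> cauchy_seqs V" and f: "lm u f" and h: "lm v h" for u v f h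
  proof -
    have fl: "f \<in> lp_funs p" "(\<lambda>n. mL p (\<lambda>x. u n x - f x)) \<longlonglongrightarrow> 0" and hl: "h \<in> lp_funs p" "(\<lambda>n. mL p (\<lambda>x. v n x - h x)) \<longlonglongrightarrow> 0"
      using f h by (auto simp: lm_def)
    have "(\<lambda>n. mL p (\<lambda>x. u n x - v n x) - mL p (\<lambda>x. f x - h x)) \<longlonglongrightarrow> 0"
    proof (rule Lim_null_comparison[OF always_eventually], intro allI)
      fix n
      have a: "mL p (\<lambda>x. u n x - v n x) \<le> mL p (\<lambda>x. u n x - f x) + mL p (\<lambda>x. f x - v n x)"
        "mL p (\<lambda>x. f x - v n x) \<le> mL p (\<lambda>x. f x - h x) + mL p (\<lambda>x. h x - v n x)"
        "mL p (\<lambda>x. f x - h x) \<le> mL p (\<lambda>x. f x - u n x) + mL p (\<lambda>x. u n x - h x)"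
        "mL p (\<lambda>x. u n x - h x) \<le> mL p (\<lambda>x. u n x - v n x) + mL p (\<lambda>x. v n x - h x)"
        by (intro mL_triangle p Al u v fl(1) hl(1))+
      show "norm (mL p (\<lambda>x. u n x - v n x) - mL p (\<lambda>x. f x - h x)) \<le> mL p (\<lambda>x. u n x - f x) + mL p (\<lambda>x. v n x - h x)"
        using a mL_minus_commute[of p h "v n"] mL_minus_commute[of p f "u n"] unfolding real_norm_def by linarith
      show "(\<lambda>n. mL p (\<lambda>x. u n x - f x) + mL p (\<lambda>x. v n x - h x)) \<longlonglongrightarrow> 0"
        using tendsto_add[OF fl(2) hl(2)] by simp
    qed
    then have "(\<lambda>n. mL p (\<lambda>x. u n x - v n x)) \<longlonglongrightarrow> mL p (\<lambda>x. f x - h x)" by (rule LIM_zero_cancel)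
    then have "(\<lambda>n. max (mL p (\<lambda>x. u n x - v n x) / c) (B.D (dv u n) (dv v n))) \<longlonglongrightarrow> max (mL p (\<lambda>x. f x - h x) / c) (B.Dl (dv u) (dv v))"
      using c by (intro tendsto_max tendsto_divide tendsto_const B.Dl_tendsto dv u v) auto
    moreover have "A.D (u n) (v n) = max (mL p (\<lambda>x. u n x - v n x) / c) (B.D (dv u n) (dv v n))" for n
      unfolding dv_def by (rule Dmax[OF Au[OF u] Au[OF v]])
    ultimately show ?thesis using A.Dl_tendsto[OF u v] LIMSEQ_unique by simp
  qed
  \<comment> \<open>The L^p limit of a representative together with the class of its derivatives;
    \<open>T_cls\<close> removes the dependence on the choices.\<close>
  define T where "T X = (lcls p (SOME f. lm (A.rep X) f), B.cls (dv (A.rep X)))" for X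
  have Dl_nonneg: "0 \<le> B.Dl u v" if "u \<in> cauchy_seqs V1" "v \<in> cauchy_seqs V1" for u v
    using LIMSEQ_le_const[OF B.Dl_tendsto[OF that]] B.D_nonneg[OF B.cauchy_carrier[OF that(1)] B.cauchy_carrier[OF that(2)]] by blast
  have T_cls: "T (A.cls u) = (lcls p f, B.cls (dv u))" if u: "u \<in> cauchy_seqs V" and f: "lm u f" for u f
  proof -
    let ?r = "A.rep (A.cls u)" and ?g = "SOME f. lm (A.rep (A.cls u)) f"
    have "A.cls u \<in> qcarrier (completion V)" unfolding A.completion_carrier using u by (rule imageI)
    then have r: "?r \<in> cauchy_seqs V" "A.cls ?r = A.cls u" using A.rep by simp_all
    have g: "lm ?r ?g" using lm_ex[OF r(1)] by (rule someI_ex)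
    have "A.Dl ?r u = 0" using r(2) unfolding A.cls_eq_iff[OF r(1) u] using A.Dl_tendsto[OF r(1) u] LIMSEQ_unique by blast
    then have m0: "max (mL p (\<lambda>x. ?g x - f x) / c) (B.Dl (dv ?r) (dv u)) = 0" using key[OF r(1) u g f] by simp
    have "mL p (\<lambda>x. ?g x - f x) / c \<le> 0" using max.cobounded1[of "mL p (\<lambda>x. ?g x - f x) / c" "B.Dl (dv ?r) (dv u)"] unfolding m0 .
    then have "mL p (\<lambda>x. ?g x - f x) = 0" using c mL_nonneg[of p "\<lambda>x. ?g x - f x"] by (simp add: divide_le_0_iff)
    moreover have gf: "?g \<in> lp_funs p" "f \<in> lp_funs p" using g f by (simp_all add: lm_def)
    ultimately have "Jp p (\<lambda>x. ?g x - f x) = 0" using Jp_mL[OF lp_funs_diff[OF p gf]] by simp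
    moreover have "(\<lambda>x. ?g x - f x) \<in> borel_measurable lebesgue" using lp_funs_diff[OF p gf] by (simp add: lp_funs_iff)
    ultimately have "AE x in lebesgue. ?g x - f x = 0" by (simp only: Jp_eq_0_iff)
    then have "AE x in lebesgue. ?g x = f x" by (simp only: right_minus_eq)
    then have 1: "lcls p ?g = lcls p f" unfolding lcls_eq_iff[OF gf] .
    have "B.Dl (dv ?r) (dv u) \<le> 0" using max.cobounded2[of "B.Dl (dv ?r) (dv u)" "mL p (\<lambda>x. ?g x - f x) / c"] unfolding m0 .
    then have "B.Dl (dv ?r) (dv u) = 0" using Dl_nonneg[OF dv[OF r(1)] dv[OF u]] by linarith
    then have "B.cls (dv ?r) = B.cls (dv u)"
      unfolding B.cls_eq_iff[OF dv[OF r(1)] dv[OF u]] using B.Dl_tendsto[OF dv[OF r(1)] dv[OF u]] by simp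
    then show ?thesis using 1 by (simp add: T_def)
  qed
  have carA: "\<exists>u f. X = A.cls u \<and> u \<in> cauchy_seqs V \<and> lm u f" if X: "X \<in> qcarrier (completion V)" for X
  proof -
    obtain u where "u \<in> cauchy_seqs V" "X = A.cls u" using X unfolding A.completion_carrier by blast
    then show ?thesis using lm_ex by blast
  qed
  have lmL: "f \<in> lp_funs p" if "lm u f" for u f using that by (simp add: lm_def)
  have DX: "A.DC X Y = max (DL p (fst (T X)) (fst (T Y)) / c) (B.DC (snd (T X)) (snd (T Y)))"
    if XY: "X \<in> qcarrier (completion V)" "Y \<in> qcarrier (completion V)" for X Y
  proof -
    obtain u f where u: "X = A.cls u" "u \<in> cauchy_seqs V" "lm u f" using carA[OF XY(1)] by blast
    obtain v h where v: "Y = A.cls v" "v \<in> cauchy_seqs V" "lm v h" using carA[OF XY(2)] by blast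
    show ?thesis unfolding u(1) v(1) T_cls[OF u(2,3)] T_cls[OF v(2,3)] fst_conv snd_conv
        A.DC_cls[OF u(2) v(2)] B.DC_cls[OF dv[OF u(2)] dv[OF v(2)]] DL_lcls[OF lmL[OF u(3)] lmL[OF v(3)]]
      by (rule key[OF u(2) v(2) u(3) v(3)])
  qed
  have TL: "fst (T X) \<in> qcarrier L" "snd (T X) \<in> qcarrier (completion V1)" if X: "X \<in> qcarrier (completion V)" for X
  proof -
    obtain u f where u: "X = A.cls u" "u \<in> cauchy_seqs V" "lm u f" using carA[OF X] by blast
    show "fst (T X) \<in> qcarrier L" "snd (T X) \<in> qcarrier (completion V1)"
      unfolding u(1) T_cls[OF u(2,3)] fst_conv snd_conv L_def lp_carrier B.completion_carrier
      by (rule imageI[OF lmL[OF u(3)]], rule imageI[OF dv[OF u(2)]])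
  qed
  have inj: "inj_on T (qcarrier (completion V))"
  proof (rule inj_onI)
    fix X Y assume X: "X \<in> qcarrier (completion V)" and Y: "Y \<in> qcarrier (completion V)" and eq: "T X = T Y"
    obtain u f where u: "X = A.cls u" "u \<in> cauchy_seqs V" "lm u f" using carA[OF X] by blast
    obtain v h where v: "Y = A.cls v" "v \<in> cauchy_seqs V" "lm v h" using carA[OF Y] by blast
    have "A.DC X Y = max (DL p (fst (T Y)) (fst (T Y)) / c) (B.DC (snd (T Y)) (snd (T Y)))"
      using DX[OF X Y] unfolding eq .
    then have "A.DC X Y = 0" unfolding DL_refl B.DC_refl[OF TL(2)[OF Y]] by simp
    then have "A.Dl u v = 0" unfolding u(1) v(1) A.DC_cls[OF u(2) v(2)] .
    then show "X = Y" unfolding u(1) v(1) A.cls_eq_iff[OF u(2) v(2)] using A.Dl_tendsto[OF u(2) v(2)] by simp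
  qed
  \<comment> \<open>Density is enough: \<open>u n\<close> is taken within \<open>1 / (n + 1)\<close>
    of the pair \<open>(f, g n)\<close>, and the maximum formula makes the sequence Cauchy.\<close>
  have surj: "Z \<in> T ` qcarrier (completion V)" if Z: "Z \<in> qcarrier L \<times> qcarrier (completion V1)" for Z
  proof -
    obtain f g where f: "f \<in> lp_funs p" and g: "g \<in> cauchy_seqs V1" and Zfg: "Z = (lcls p f, B.cls g)"
      using Z unfolding L_def lp_carrier B.completion_carrier by auto
    have gn: "g n \<in> test_class p ?N" for n using B.cauchy_carrier[OF g] by (simp add: V1s)
    let ?e = "\<lambda>n. inverse (real (Suc n))"
    have "\<forall>n. \<exists>u. u \<in> test_class p M \<and> mL p (\<lambda>x. u x - f x) < ?e n \<and> B.D (nderiv 1 u) (g n) < ?e n"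
    proof
      fix n
      have "0 < ?e n" by simp
      from test_class_dense[OF p M inf f gn this, of n]
      show "\<exists>u. u \<in> test_class p M \<and> mL p (\<lambda>x. u x - f x) < ?e n \<and> B.D (nderiv 1 u) (g n) < ?e n"
        unfolding BD by blast
    qed
    then obtain u where u: "\<And>n. u n \<in> test_class p M" "\<And>n. mL p (\<lambda>x. u n x - f x) < ?e n" "\<And>n. B.D (nderiv 1 (u n)) (g n) < ?e n"
      by metis
    have ul: "u n \<in> lp_funs p" for n by (rule test_class_deriv(2)[OF p M u(1)])
    have u1: "nderiv 1 (u n) \<in> qcarrier V1" for n unfolding V1s by (rule test_class_deriv(1)[OF p M u(1)])
    note g1 = B.cauchy_carrier[OF g]
    have uC: "u \<in> cauchy_seqs V"
      unfolding A.cauchy_seqs_iff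
    proof (intro conjI allI impI)
      show "u n \<in> qcarrier V" for n using u(1) by (simp add: Vs)
      fix e :: real assume e: "0 < e"
      have "0 < e / 3" "0 < c * e / 2" using e c by simp_all
      then have "eventually (\<lambda>n. ?e n < e / 3 \<and> ?e n < c * e / 2) sequentially"
        by (intro eventually_conj order_tendstoD(2)[OF LIMSEQ_inverse_real_of_nat])
      then obtain n1 where n1: "\<And>n. n1 \<le> n \<Longrightarrow> ?e n < e / 3 \<and> ?e n < c * e / 2"
        unfolding eventually_sequentially by blast
      obtain n2 where n2: "\<And>m n. n2 \<le> m \<Longrightarrow> n2 \<le> n \<Longrightarrow> B.D (g m) (g n) < e / 3"
        using g \<open>0 < e / 3\<close> unfolding B.cauchy_seqs_iff by blast
      show "\<exists>n0. \<forall>m\<ge>n0. \<forall>n\<ge>n0. A.D (u m) (u n) < e"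
      proof (intro exI allI impI)
        fix m n assume mn: "max n1 n2 \<le> m" "max n1 n2 \<le> n"
        have "mL p (\<lambda>x. u m x - u n x) \<le> mL p (\<lambda>x. u m x - f x) + mL p (\<lambda>x. f x - u n x)"
          by (intro mL_triangle p ul f)
        then have "mL p (\<lambda>x. u m x - u n x) < c * e"
          using u(2)[of m] u(2)[of n] n1[of m] n1[of n] mn mL_minus_commute[of p f "u n"] by simp
        then have "mL p (\<lambda>x. u m x - u n x) / c < e" using c by (simp add: pos_divide_less_eq mult.commute)
        moreover have "B.D (nderiv 1 (u m)) (nderiv 1 (u n)) < e"
        proof -
          have "B.D (nderiv 1 (u m)) (nderiv 1 (u n)) \<le> B.D (nderiv 1 (u m)) (g m) + B.D (g m) (nderiv 1 (u n))"
            by (intro B.D_triangle u1 g1)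
          moreover have "B.D (g m) (nderiv 1 (u n)) \<le> B.D (g m) (g n) + B.D (g n) (nderiv 1 (u n))"
            by (intro B.D_triangle u1 g1)
          moreover have "B.D (g n) (nderiv 1 (u n)) = B.D (nderiv 1 (u n)) (g n)" by (intro B.D_commute u1 g1)
          ultimately show ?thesis using u(3)[of m] u(3)[of n] n1[of m] n1[of n] n2[of m n] mn by simp
        qed
        ultimately show "A.D (u m) (u n) < e" unfolding Dmax[OF u(1) u(1)] by simp
      qed
    qed
    have "lm u f" unfolding lm_def
    proof (intro conjI f)
      show "(\<lambda>n. mL p (\<lambda>x. u n x - f x)) \<longlonglongrightarrow> 0"
        by (rule squeeze_0[OF mL_nonneg less_imp_le[OF u(2)] LIMSEQ_inverse_real_of_nat])
    qed
    moreover have "B.cls (dv u) = B.cls g" unfolding B.cls_eq_iff[OF dv[OF uC] g] dv_def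
      by (rule squeeze_0[OF B.D_nonneg[OF u1 g1] less_imp_le[OF u(3)] LIMSEQ_inverse_real_of_nat])
    ultimately have "T (A.cls u) = Z" using T_cls[OF uC] Zfg by simp
    moreover have "A.cls u \<in> qcarrier (completion V)" unfolding A.completion_carrier using uC by (rule imageI)
    ultimately show ?thesis by blast
  qed
  have bij: "bij_betw T (qcarrier (completion V)) (qcarrier L \<times> qcarrier (completion V1))"
    unfolding bij_betw_def
  proof
    show "T ` qcarrier (completion V) = qcarrier L \<times> qcarrier (completion V1)"
    proof
      show "T ` qcarrier (completion V) \<subseteq> qcarrier L \<times> qcarrier (completion V1)"
      proof
        fix Z assume "Z \<in> T ` qcarrier (completion V)"
        then obtain X where "X \<in> qcarrier (completion V)" "Z = T X" by blast
        then show "Z \<in> qcarrier L \<times> qcarrier (completion V1)" using TL by (simp add: mem_Times_iff)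
      qed
    qed (use surj in blast)
  qed (rule inj)
  have homeo: "homeomorphic_map (qtopology (completion V)) (prod_topology (qtopology L) (qtopology (completion V1))) T"
  proof (rule homeomorphic_map_max[OF A.DC_power_dist _ B.DC_power_dist _ _ _ _ bij c DX])
    show "power_dist p L (DL p)" unfolding L_def by (rule DL_power_dist[OF p])
    show "DL p x z \<le> DL p x y + DL p y z" if "x \<in> qcarrier L" "y \<in> qcarrier L" "z \<in> qcarrier L" for x y z
      using that unfolding L_def by (rule DL_triangle[OF p])
    show "DL p x x = 0" for x :: "(real \<Rightarrow> 'a) set" by (rule DL_refl)
  qed (assumption | rule B.DC_triangle B.DC_refl)+
  have T_add: "T (qadd (completion V) X Y) = (qadd L (fst (T X)) (fst (T Y)), qadd (completion V1) (snd (T X)) (snd (T Y)))"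
    if XY: "X \<in> qcarrier (completion V)" "Y \<in> qcarrier (completion V)" for X Y
  proof -
    obtain u f where u: "X = A.cls u" "u \<in> cauchy_seqs V" "lm u f" using carA[OF XY(1)] by blast
    obtain v h where v: "Y = A.cls v" "v \<in> cauchy_seqs V" "lm v h" using carA[OF XY(2)] by blast
    let ?w = "\<lambda>n. qadd V (u n) (v n)"
    note w = A.cauchy_add[OF u(2) v(2)]
    have fl: "f \<in> lp_funs p" "h \<in> lp_funs p" using u(3) v(3) by (simp_all add: lm_def)
    have "lm ?w (\<lambda>x. f x + h x)" unfolding lm_def
    proof (intro conjI lp_funs_add(1) p fl)
      have "(\<lambda>n. mL p (\<lambda>x. u n x - f x) + mL p (\<lambda>x. v n x - h x)) \<longlonglongrightarrow> 0 + 0"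
        using u(3) v(3) unfolding lm_def by (intro tendsto_add) simp_all
      then have "(\<lambda>n. mL p (\<lambda>x. u n x - f x) + mL p (\<lambda>x. v n x - h x)) \<longlonglongrightarrow> 0" by simp
      moreover have "mL p (\<lambda>x. ?w n x - (f x + h x)) \<le> mL p (\<lambda>x. u n x - f x) + mL p (\<lambda>x. v n x - h x)" for n
        using lp_funs_add(2)[OF p lp_funs_diff[OF p Al[OF u(2)] fl(1)] lp_funs_diff[OF p Al[OF v(2)] fl(2)], of n n]
        by (simp add: Vs add_diff_add)
      ultimately show "(\<lambda>n. mL p (\<lambda>x. ?w n x - (f x + h x))) \<longlonglongrightarrow> 0" by (intro squeeze_0[OF mL_nonneg])
    qed
    note Tw = T_cls[OF w this]
    have dw: "dv ?w = (\<lambda>n. qadd V1 (dv u n) (dv v n))"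
      unfolding dv_def Vs V1s test_add(3)[OF p M Au[OF u(2)] Au[OF v(2)]] ..
    show ?thesis
      unfolding u(1) v(1) A.completion_add[OF u(2) v(2)] Tw T_cls[OF u(2,3)] T_cls[OF v(2,3)] fst_conv snd_conv dw
        B.completion_add[OF dv[OF u(2)] dv[OF v(2)]] L_def lp_space_add[OF p fl] ..
  qed
  have T_scale: "T (qscale (completion V) k X) = (qscale L k (fst (T X)), qscale (completion V1) k (snd (T X)))"
    if X: "X \<in> qcarrier (completion V)" for k X
  proof -
    obtain u f where u: "X = A.cls u" "u \<in> cauchy_seqs V" "lm u f" using carA[OF X] by blast
    let ?w = "\<lambda>n. qscale V k (u n)"
    note w = A.cauchy_scale[OF u(2), of k]
    have fl: "f \<in> lp_funs p" using u(3) by (simp add: lm_def)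
    have "lm ?w (\<lambda>x. k * f x)" unfolding lm_def
    proof (intro conjI lp_funs_scale(1) fl)
      have "(\<lambda>n. norm k powr p * mL p (\<lambda>x. u n x - f x)) \<longlonglongrightarrow> norm k powr p * 0"
        using u(3) unfolding lm_def by (intro tendsto_mult tendsto_const) simp
      moreover have "mL p (\<lambda>x. ?w n x - k * f x) = norm k powr p * mL p (\<lambda>x. u n x - f x)" for n
        using lp_funs_scale(2)[OF lp_funs_diff[OF p Al[OF u(2)] fl], of k n] by (simp add: Vs right_diff_distrib)
      ultimately show "(\<lambda>n. mL p (\<lambda>x. ?w n x - k * f x)) \<longlonglongrightarrow> 0" by simp
    qed
    note Tw = T_cls[OF w this]
    have dw: "dv ?w = (\<lambda>n. qscale V1 k (dv u n))"
      unfolding dv_def Vs V1s test_scale(3)[OF p M Au[OF u(2)]] ..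
    show ?thesis
      unfolding u(1) A.completion_scale[OF u(2)] Tw T_cls[OF u(2,3)] fst_conv snd_conv dw
        B.completion_scale[OF dv[OF u(2)]] L_def lp_space_scale[OF fl] ..
  qed
  have "tvs_isomorphic (tvs_of (completion V)) (tvs_sum (tvs_of L) (tvs_of (completion V1)))"
    unfolding tvs_isomorphic_def
  proof (rule exI[of _ T], intro conjI ballI allI)
    show "homeomorphic_map (vtop (tvs_of (completion V))) (vtop (tvs_sum (tvs_of L) (tvs_of (completion V1)))) T"
      using homeo by (simp add: tvs_of_def tvs_sum_def)
    have top: "topspace (vtop (tvs_of (completion V))) = qcarrier (completion V)"
      by (simp add: tvs_of_def topspace_qtopology[OF A.DC_power_dist])
    fix X assume "X \<in> topspace (vtop (tvs_of (completion V)))"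
    then have X: "X \<in> qcarrier (completion V)" unfolding top .
    show "T (vscale (tvs_of (completion V)) k X) = vscale (tvs_sum (tvs_of L) (tvs_of (completion V1))) k (T X)" for k
      using T_scale[OF X] by (simp add: tvs_of_def tvs_sum_def)
    fix Y assume "Y \<in> topspace (vtop (tvs_of (completion V)))"
    then have Y: "Y \<in> qcarrier (completion V)" unfolding top .
    show "T (vadd (tvs_of (completion V)) X Y) = vadd (tvs_sum (tvs_of L) (tvs_of (completion V1))) (T X) (T Y)"
      using T_add[OF X Y] by (simp add: tvs_of_def tvs_sum_def)
  qed
  then show ?thesis unfolding V_def V1_def L_def carleman_sobolev_def .
qed

end
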